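(* Let $n\ge2$ and $p\ge1$ be integers. Assume that the operators $C_{i\,i-1}$, $i=2,\dots,n$, satisfy the Coupling hypothesis of order $n$, where the operators $\Pi_i$ satisfy the Coupling observability hypothesis of order $n$; that $C_{i\,j}$ and $C_{i\,j}^{*}$ are in $\mathcal L(H_k)$ for $i\in\{n+1,\dots,n+p\}$, $j\in\{n-1,\dots,i-1\}$ and $k=0,1$; and that $\mathbf{B}_{n+j}^{*}$ satisfies the Admissibility and Observability hypotheses of index $n+j$ for all $j\in\{0,\dots,p\}$. Let $T_{n+p}^{*}>0$ be the observability time defined in the context. (i) Let $\mathbf{B}_{n+k}^{*}(w_{n+k},w_{n+k}')=B_{n+k}^{*}w_{n+k}'$ with $B_{n+k}\in\mathcal L(G_{n+k},H)$ for all $k\in\{0,\dots,p\}$, and set $$M_{-(n+p-1)}^{*}=\Big(\big(\prod_{i=1}^nH_{n-i+1}\big)\times H_1^p\Big)\times\Big(\big(\prod_{i=1}^nH_{n-i}\big)\times H^p\Big).$$ Then for all $T>T_{n+p}^{*}$ and all $Y_0\in M_{-(n+p-1)}^{*}$ there exist control functions $v_{n+k}\in L^2((0,T);G_{n+k})$, $k=0,\dots,p$, such that the solution $Y=(y_1,\dots,y_{n+p},y_1',\dots,y_{n+p}')$ of the control system with initial data $Y_0$ satisfies $Y(T)=0$. (ii) Let $\mathbf{B}_{n+k}^{*}(w_{n+k},w_{n+k}')=B_{n+k}^{*}w_{n+k}$ with $B_{n+k}\in\mathcal L(G_{n+k},H_2')$ for all $k\in\{0,\dots,p\}$, and set $$M_{(n+p-1)}^{*}=\Big(\big(\prod_{i=1}^nH_{n-i}\big)\times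 H^p\Big)\times\Big(\big(\prod_{i=1}^nH_{n-i-1}\big)\times(H_{-1})^p\Big).$$ Then for all $T>T_{n+p}^{*}$ and all $Y_0\in M_{(n+p-1)}^{*}$ there exist control functions $v_{n+k}\in L^2((0,T);G_{n+k})$, $k=0,\dots,p$, such that the solution $Y$ of the control system with initial data $Y_0$ satisfies $Y(T)=0$.
   Context: Abstract setting. $H$ is a Hilbert space with norm $|\cdot|$ and scalar product $\langle\cdot,\cdot\rangle$. $A:D(A)\subset H\to H$ is a positive self-adjoint operator with compact resolvent such that, for some $\omega>0$, $|Au|\ge\omega|u|$ for all $u\in D(A)$. For $k\in\mathbb N$, $H_k=D(A^{k/2})$ with norm $|A^{k/2}\cdot|$ ($H_0=H$), and $H_{-k}=H_k'$ is the dual of $H_k$ with pivot space $H$, with norm $|A^{-k/2}\cdot|$. For $k\in\mathbb Z$ and a pair $W=(w,w')$, $e_k(W)=\frac12\big(|A^{k/2}w|^2+|A^{(k-1)/2}w'|^2\big)$. Coupling hypothesis of order $n$. For all $i\in\{2,\dots,n\}$: $C_{i\,i-1}$ is a bounded operator on $H$; $C_{i\,i-1}^{*}\in\mathcal L(H_k)$ for $k\in\{0,1,\dots,n-i+1\}$; $\|C_{i\,i-1}\|=\beta_i$ and $|C_{i\,i-1}w|^2\le\beta_i\langle C_{i\,i-1}w,w\rangle$ for all $w\in H$; there exists $\alpha_i>0$ such that $\alpha_i|\Pi_iw|^2\le\langle C_{i\,i-1}w,w\rangle$ for all $w\in H$. Coupling observability hypothesis of order $n$. For all $i\in\{2,\dots,n\}$: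 $\Pi_i\in\mathcal L(H)$ and there exists $T_{0,i}>0$ such that for all $T>T_{0,i}$ there exists $\gamma_i(T)>0$ such that all solutions $w$ of $w''+Aw=0$ satisfy $\int_0^T|\Pi_iw'|^2dt\ge\gamma_i(T)e_1(W)(0)$, where $W=(w,w')$. Admissibility hypothesis of index $m$. $G_m$ is a Hilbert space (identified with its dual), $\mathbf{B}_m^{*}\in\mathcal L(H_2\times H;G_m)$, and for all $T>0$ there exists $D_m(T)>0$ such that all solutions $w$ of $w''+Aw=f\in L^2([0,T];H)$ satisfy, with $W=(w,w')$, $$\int_0^T\|\mathbf{B}_m^{*}(w,w')\|_{G_m}^2dt\le D_m(T)\Big(e_1(W)(0)+e_1(W)(T)+\int_0^Te_1(W)(t)\,dt+\int_0^T|f|^2dt\Big).$$ Observations of solutions of lower regularity are understood by extension by density. Observability hypothesis of index $m$. There exists $T_{0,m}>0$ such that for all $T>T_{0,m}$ there exists $R_m(T)>0$ such that all solutions $w$ of $w''+Aw=0$ satisfy $\int_0^T\|\mathbf{B}_m^{*}(w,w')\|_{G_m}^2dt\ge R_m(T)e_1(W)(0)$. Dual mixed cascade system: $w_1''+Aw_1=0$; $w_i''+Aw_i+C_{i\,i-1}w_{i-1}=0$ ($2\le i\le n$); $w_i''+Aw_i+\sum_{k=n-1}^{i-1}C_{i\,k}w_k=0$ ($n+1\le i\le n+p$); $W_i=(w_i,w_i')$. Observability time $T_{n+p}^{*}$: a time $T_{n+p}^{*}>0$ such that for all $T>T_{n+p}^{*}$ there are constants $d_{i,n}(T)>0$, $\rho_{n,k}(T)>0$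 such that every solution of the dual mixed cascade system with initial data in $H_1^{n+p}\times H^{n+p}$ satisfies $e_{1+i-n}(W_i)(0)\le d_{i,n}(T)\int_0^T\|\mathbf{B}_n^{*}(W_n)\|_{G_n}^2dt$ for $i=1,\dots,n$ (with $d_{i,n}(T)\le K/T^3$ for $i\le n-1$, $d_{n,n}(T)\le K/T$, $K$ bounded with respect to $T$), and $e_1(W_{n+k})(0)\le\rho_{n,k}(T)\sum_{l=0}^k\int_0^T\|\mathbf{B}_{n+l}^{*}(W_{n+l})\|_{G_{n+l}}^2dt$ for $k=1,\dots,p$. (Under the hypotheses above such a time exists.) Control system, with $Y_0=(y_1^0,\dots,y_{n+p}^0,y_1^1,\dots,y_{n+p}^1)$: $$\begin{cases}y_i''+Ay_i+C_{i+1\,i}^{*}y_{i+1}=0,&1\le i\le n-2,\\ y_{n-1}''+Ay_{n-1}+\sum_{k=n}^{n+p}C_{k\,n-1}^{*}y_k=0,\\ y_i''+Ay_i+\sum_{k=i+1}^{n+p}C_{k\,i}^{*}y_k=B_iv_i,&n\le i\le n+p-1,\\ y_{n+p}''+Ay_{n+p}=B_{n+p}v_{n+p},\\ (y_i,y_i')(0)=(y_i^0,y_i^1),&1\le i\le n+p,\end{cases}$$ where the first line is absent if $n=2$. Solutions are understood in the sense of transposition: $Y$ is continuous in time with values in the space of $Y_0$ and, for every $t\in[0,T]$ and every solution $(w_1,\dots,w_{n+p})$ of the dual mixed cascade system with data at time $t$ in the dual space ($(\prod_{i=1}^nH_{i-n}\times H^p)\times(\prod_{i=1}^nH_{i-n-1}\times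 H_{-1}^p)$ in case (i), $(\prod_{i=1}^nH_{i-n+1}\times H_1^p)\times(\prod_{i=1}^nH_{i-n}\times H^p)$ in case (ii)), $$\int_0^t\sum_{l=0}^p\langle v_{n+l},B_{n+l}^{*}w_{n+l}\rangle_{G_{n+l}}ds=\sum_{k=1}^{n+p}\big(\langle y_k'(t),w_k(t)\rangle-\langle y_k(t),w_k'(t)\rangle\big)-\sum_{k=1}^{n+p}\big(\langle y_k^1,w_k(0)\rangle-\langle y_k^0,w_k'(0)\rangle\big),$$ with the appropriate duality pairings. *)

theory Defs
  imports "HOL-Analysis.Analysis"
begin

section \<open>Unbounded operators and the scale of spaces\<close>

text \<open>
  An unbounded operator is a partial function whose \<^const>\<open>dom\<close> is its domain; \<open>(\<circ>\<^sub>m)\<close> is then the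
  composition of unbounded operators, with its natural domain.  Scalars are real.
\<close>

type_synonym 'h operator = "'h \<rightharpoonup> 'h"

definition lin_on :: "'a::real_vector set \<Rightarrow> ('a \<Rightarrow> 'b::real_vector) \<Rightarrow> bool" where
  "lin_on S f \<longleftrightarrow> (\<forall>x\<in>S. \<forall>y\<in>S. f (x + y) = f x + f y) \<and> (\<forall>c. \<forall>x\<in>S. f (c *\<^sub>R x) = c *\<^sub>R f x)"

definition op_adjoint :: "'h::real_inner operator \<Rightarrow> 'h operator" where
  "op_adjoint A u =
     (if \<exists>z. \<forall>v\<in>dom A. the (A v) \<bullet> u = v \<bullet> z
      then Some (THE z. \<forall>v\<in>dom A. the (A v) \<bullet> u = v \<bullet> z) else None)"

definition self_adjoint :: "'h::real_inner operator \<Rightarrow> bool" where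
  "self_adjoint A \<longleftrightarrow> subspace (dom A) \<and> lin_on (dom A) (\<lambda>u. the (A u)) \<and>
     closure (dom A) = UNIV \<and> op_adjoint A = A"

definition positive_op :: "'h::real_inner operator \<Rightarrow> bool" where
  "positive_op A \<longleftrightarrow> (\<forall>u\<in>dom A. 0 \<le> the (A u) \<bullet> u)"

definition compact_resolvent :: "'h::real_inner operator \<Rightarrow> bool" where
  "compact_resolvent A \<longleftrightarrow>
     (\<exists>\<mu>::real. bij_betw (\<lambda>u. the (A u) - \<mu> *\<^sub>R u) (dom A) UNIV \<and>
        compact (closure (inv_into (dom A) (\<lambda>u. the (A u) - \<mu> *\<^sub>R u) ` cball 0 1)))"

definition op_sqrt :: "'h::real_inner operator \<Rightarrow> 'h operator" where
  "op_sqrt A = (THE S. self_adjoint S \<and> positive_op S \<and> S \<circ>\<^sub>m S = A)"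

text \<open>The operator \<open>A\<^bsup>k/2\<^esup>\<close>, as the \<open>k\<close>-th power of \<open>A\<^bsup>1/2\<^esup>\<close>; its domain is \<open>H\<^sub>k\<close> for \<open>k \<ge> 0\<close>.\<close>

definition half_power :: "'h::real_inner operator \<Rightarrow> nat \<Rightarrow> 'h operator" where
  "half_power A k = (((\<circ>\<^sub>m) (op_sqrt A)) ^^ k) Some"

definition Hdom :: "'h::real_inner operator \<Rightarrow> nat \<Rightarrow> 'h set" where
  "Hdom A k = dom (half_power A k)"

definition Hdom_norm :: "'h::real_inner operator \<Rightarrow> nat \<Rightarrow> 'h \<Rightarrow> real" where
  "Hdom_norm A k u = norm (the (half_power A k u))"

text \<open>
  To treat \<open>H\<^sub>s\<close> uniformly for all integers \<open>s\<close>, its elements are represented by functionals.  For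
  \<open>s < 0\<close> they are the bounded linear functionals on \<open>H\<^bsub>-s\<^esub>\<close> (set to \<open>0\<close> outside \<open>H\<^bsub>-s\<^esub>\<close>, so that
  functionals are equal when they agree on \<open>H\<^bsub>-s\<^esub>\<close>).  For \<open>s \<ge> 0\<close> a vector \<open>y\<close> is identified with
  the functional \<open>\<langle>y, -\<rangle>\<close>; this is the identification of the pivot space with its dual.
  For \<open>s < 0\<close> the norm is the dual norm, i.e. \<open>|A\<^bsup>s/2\<^esup> u|\<close>.  It only looks at the values of \<open>u\<close> on
  \<open>H\<^bsub>-s\<^esub>\<close>, so it also gives the \<open>H\<^sub>s\<close> norm of an element of a smaller space of the scale.
\<close>

definition pivot :: "'h::real_inner \<Rightarrow> ('h \<Rightarrow> real)" where
  "pivot y = (\<lambda>\<phi>. y \<bullet> \<phi>)"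

abbreviation vec_of :: "('h::real_inner \<Rightarrow> real) \<Rightarrow> 'h" where
  "vec_of u \<equiv> inv pivot u"

definition Hs :: "'h::real_inner operator \<Rightarrow> int \<Rightarrow> ('h \<Rightarrow> real) set" where
  "Hs A s =
     (if 0 \<le> s then pivot ` Hdom A (nat s)
      else {u. lin_on (Hdom A (nat (- s))) u \<and>
               (\<exists>K. \<forall>\<phi>\<in>Hdom A (nat (- s)). \<bar>u \<phi>\<bar> \<le> K * Hdom_norm A (nat (- s)) \<phi>) \<and>
               (\<forall>\<phi>. \<phi> \<notin> Hdom A (nat (- s)) \<longrightarrow> u \<phi> = 0)})"

definition Hs_norm :: "'h::real_inner operator \<Rightarrow> int \<Rightarrow> ('h \<Rightarrow> real) \<Rightarrow> real" where
  "Hs_norm A s u =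
     (if 0 \<le> s then Hdom_norm A (nat s) (vec_of u)
      else (SUP \<phi>\<in>{\<phi> \<in> Hdom A (nat (- s)). Hdom_norm A (nat (- s)) \<phi> \<le> 1}. \<bar>u \<phi>\<bar>))"

text \<open>Duality pairing of \<open>u \<in> H\<^sub>s\<close> with \<open>v \<in> H\<^bsub>-s\<^esub>\<close>.\<close>

definition Hs_pair :: "int \<Rightarrow> ('h::real_inner \<Rightarrow> real) \<Rightarrow> ('h \<Rightarrow> real) \<Rightarrow> real" where
  "Hs_pair s u v = (if 0 \<le> s then v (vec_of u) else u (vec_of v))"

definition energy :: "'h::real_inner operator \<Rightarrow> int \<Rightarrow> ('h \<Rightarrow> real) \<Rightarrow> ('h \<Rightarrow> real) \<Rightarrow> real" where
  "energy A k w w' = ((Hs_norm A k w)\<^sup>2 + (Hs_norm A (k - 1) w')\<^sup>2) / 2"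

section \<open>Function spaces in time\<close>

definition cont_Hs ::
  "'h::real_inner operator \<Rightarrow> int \<Rightarrow> real \<Rightarrow> (real \<Rightarrow> 'h \<Rightarrow> real) \<Rightarrow> bool" where
  "cont_Hs A s T u \<longleftrightarrow> (\<forall>t\<in>{0..T}. u t \<in> Hs A s \<and>
     ((\<lambda>r. Hs_norm A s (\<lambda>\<phi>. u r \<phi> - u t \<phi>)) \<longlongrightarrow> 0) (at t within {0..T}))"

text \<open>
  \<open>L\<^sup>2((0,T);X)\<close> for a closed subspace \<open>X\<close>, with Bochner (strong) measurability, so that no
  separability of the ambient space is needed.
\<close>

definition L2 :: "real \<Rightarrow> 'a::real_normed_vector set \<Rightarrow> (real \<Rightarrow> 'a) \<Rightarrow> bool" where
  "L2 T X f \<longleftrightarrow> (\<forall>t\<in>{0..T}. f t \<in> X) \<and>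
     (\<exists>S. (\<forall>j. simple_function (lebesgue_on {0..T}) (S j)) \<and>
          (AE t in lebesgue_on {0..T}. (\<lambda>j::nat. S j t) \<longlonglongrightarrow> f t)) \<and>
     integrable (lebesgue_on {0..T}) (\<lambda>t. (norm (f t))\<^sup>2)"

abbreviation L2_sq :: "real \<Rightarrow> (real \<Rightarrow> 'a::real_normed_vector) \<Rightarrow> real" where
  "L2_sq T f \<equiv> integral\<^sup>L (lebesgue_on {0..T}) (\<lambda>t. (norm (f t))\<^sup>2)"

section \<open>Solutions of the uncontrolled equations\<close>

text \<open>
  \<open>w'' + A w = f\<close> on \<open>[0,T]\<close> with \<open>w \<in> C(H\<^sub>s) \<inter> C\<^sup>1(H\<^bsub>s-1\<^esub>)\<close>; \<open>w'\<close> is the derivative of \<open>w\<close> in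
  \<open>H\<^bsub>s-1\<^esub>\<close> and the equation is integrated once in time and tested with \<open>\<phi>\<close> in \<open>D(A) \<inter> H\<^bsub>2-s\<^esub>\<close>.
\<close>

definition wave_sol ::
  "'h::real_inner operator \<Rightarrow> int \<Rightarrow> real \<Rightarrow> (real \<Rightarrow> 'h \<Rightarrow> real) \<Rightarrow> (real \<Rightarrow> 'h \<Rightarrow> real) \<Rightarrow>
   (real \<Rightarrow> 'h \<Rightarrow> real) \<Rightarrow> bool" where
  "wave_sol A s T f w w' \<longleftrightarrow>
     cont_Hs A s T w \<and> cont_Hs A (s - 1) T w' \<and>
     (\<forall>t\<in>{0..T}. ((\<lambda>r. Hs_norm A (s - 1) (\<lambda>\<phi>. (w r \<phi> - w t \<phi>) / (r - t) - w' t \<phi>)) \<longlongrightarrow> 0)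
                   (at t within {0..T})) \<and>
     (\<forall>\<phi>\<in>Hdom A (nat (max 2 (2 - s))). \<forall>t\<in>{0..T}.
        ((\<lambda>r. f r \<phi> - w r (the (A \<phi>))) has_integral (w' t \<phi> - w' 0 \<phi>)) {0..t})"

definition finite_energy_sol ::
  "'h::real_inner operator \<Rightarrow> real \<Rightarrow> (real \<Rightarrow> 'h) \<Rightarrow> (real \<Rightarrow> 'h) \<Rightarrow> (real \<Rightarrow> 'h) \<Rightarrow> bool" where
  "finite_energy_sol A T f w w' \<longleftrightarrow> L2 T UNIV f \<and>
     wave_sol A 1 T (\<lambda>t. pivot (f t)) (\<lambda>t. pivot (w t)) (\<lambda>t. pivot (w' t))"

text \<open>Indices \<open>k\<close> for which \<open>C\<^bsub>i k\<^esub> w\<^sub>k\<close> occurs in the \<open>i\<close>-th equation of the dual mixed cascade system.\<close>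

definition coupled :: "nat \<Rightarrow> nat \<Rightarrow> nat set" where
  "coupled n i = (if i \<le> 1 then {} else if i \<le> n then {i - 1} else {n - 1..i - 1})"

text \<open>
  Solutions of the dual mixed cascade system on \<open>[0,T]\<close> with \<open>(w\<^sub>i, w\<^sub>i') \<in> H\<^bsub>\<sigma> i\<^esub> \<times> H\<^bsub>\<sigma> i - 1\<^esub>\<close>.
  On spaces of negative index \<open>C\<^bsub>i k\<^esub>\<close> acts as the transpose of \<open>C\<^bsub>i k\<^esub>\<^sup>*\<close>; on \<open>H\<close> this is \<open>C\<^bsub>i k\<^esub>\<close> itself.
\<close>

definition dual_sol ::
  "'h::real_inner operator \<Rightarrow> (nat \<Rightarrow> nat \<Rightarrow> 'h \<Rightarrow>\<^sub>L 'h) \<Rightarrow> nat \<Rightarrow> nat \<Rightarrow> (nat \<Rightarrow> int) \<Rightarrow> real \<Rightarrow>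
   (nat \<Rightarrow> real \<Rightarrow> 'h \<Rightarrow> real) \<Rightarrow> (nat \<Rightarrow> real \<Rightarrow> 'h \<Rightarrow> real) \<Rightarrow> bool" where
  "dual_sol A C n p \<sigma> T w w' \<longleftrightarrow> (\<forall>i\<in>{1..n + p}.
     wave_sol A (\<sigma> i) T
       (\<lambda>t \<phi>. - (\<Sum>k\<in>coupled n i. w k t (adjoint (blinfun_apply (C i k)) \<phi>))) (w i) (w' i))"

section \<open>Observations\<close>

text \<open>
  \<open>g\<close> is the observation on \<open>[0,T]\<close>, through \<open>\<BB>\<close> in \<open>L(H\<^sub>2 \<times> H; G)\<close>, of the finite energy solution
  \<open>w\<close> of \<open>w'' + A w = f\<close>: the \<open>L\<^sup>2\<close> limit of \<open>\<BB>(w\<^sub>j, w\<^sub>j')\<close> for solutions \<open>w\<^sub>j\<close> in \<open>C(H\<^sub>2)\<close> whose data and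
  right-hand sides converge (extension by density).  Under admissibility \<open>g\<close> exists and is unique
  almost everywhere, so the hypotheses may quantify over all such \<open>g\<close>.
\<close>

definition observation ::
  "'h::real_inner operator \<Rightarrow> 'g::real_inner set \<Rightarrow> ('h \<times> 'h \<Rightarrow> 'g) \<Rightarrow> real \<Rightarrow>
   (real \<Rightarrow> 'h) \<Rightarrow> (real \<Rightarrow> 'h) \<Rightarrow> (real \<Rightarrow> 'h) \<Rightarrow> (real \<Rightarrow> 'g) \<Rightarrow> bool" where
  "observation A G \<BB> T f w w' g \<longleftrightarrow> L2 T G g \<and>
     (\<exists>F W W'. (\<forall>j::nat. finite_energy_sol A T (F j) (W j) (W' j) \<and>
                          cont_Hs A 2 T (\<lambda>t. pivot (W j t))) \<and>
        (\<lambda>j. Hdom_norm A 1 (W j 0 - w 0)) \<longlonglongrightarrow> 0 \<and>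
        (\<lambda>j. norm (W' j 0 - w' 0)) \<longlonglongrightarrow> 0 \<and>
        (\<lambda>j. L2_sq T (\<lambda>t. F j t - f t)) \<longlonglongrightarrow> 0 \<and>
        (\<lambda>j. L2_sq T (\<lambda>t. \<BB> (W j t, W' j t) - g t)) \<longlonglongrightarrow> 0)"

text \<open>Observation of the \<open>i\<close>-th component of a solution of the dual mixed cascade system.\<close>

definition dual_observation ::
  "'h::real_inner operator \<Rightarrow> (nat \<Rightarrow> nat \<Rightarrow> 'h \<Rightarrow>\<^sub>L 'h) \<Rightarrow> nat \<Rightarrow> 'g::real_inner set \<Rightarrow>
   ('h \<times> 'h \<Rightarrow> 'g) \<Rightarrow> real \<Rightarrow> nat \<Rightarrow> (nat \<Rightarrow> real \<Rightarrow> 'h \<Rightarrow> real) \<Rightarrow> (nat \<Rightarrow> real \<Rightarrow> 'h \<Rightarrow> real) \<Rightarrow>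
   (real \<Rightarrow> 'g) \<Rightarrow> bool" where
  "dual_observation A C n G \<BB> T i w w' g \<longleftrightarrow>
     observation A G \<BB> T
       (\<lambda>t. - (\<Sum>k\<in>coupled n i. blinfun_apply (C i k) (vec_of (w k t))))
       (\<lambda>t. vec_of (w i t)) (\<lambda>t. vec_of (w' i t)) g"

section \<open>Hypotheses\<close>

definition abstract_setting :: "'h::real_inner operator \<Rightarrow> bool" where
  "abstract_setting A \<longleftrightarrow> self_adjoint A \<and> positive_op A \<and> compact_resolvent A \<and>
     (\<exists>\<omega>>0. \<forall>u\<in>dom A. norm (the (A u)) \<ge> \<omega> * norm u)"

definition bounded_on_Hk :: "'h::real_inner operator \<Rightarrow> nat \<Rightarrow> ('h \<Rightarrow> 'h) \<Rightarrow> bool" where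
  "bounded_on_Hk A k L \<longleftrightarrow> lin_on (Hdom A k) L \<and> L ` Hdom A k \<subseteq> Hdom A k \<and>
     (\<exists>K. \<forall>u\<in>Hdom A k. Hdom_norm A k (L u) \<le> K * Hdom_norm A k u)"

definition coupling_hyp ::
  "'h::real_inner operator \<Rightarrow> nat \<Rightarrow> (nat \<Rightarrow> nat \<Rightarrow> 'h \<Rightarrow>\<^sub>L 'h) \<Rightarrow> (nat \<Rightarrow> 'h \<Rightarrow>\<^sub>L 'h) \<Rightarrow> bool" where
  "coupling_hyp A n C P \<longleftrightarrow> (\<forall>i\<in>{2..n}.
     (\<forall>k\<in>{0..n - i + 1}. bounded_on_Hk A k (adjoint (blinfun_apply (C i (i - 1))))) \<and>
     (\<forall>w. (norm (C i (i - 1) w))\<^sup>2 \<le> norm (C i (i - 1)) * (C i (i - 1) w \<bullet> w)) \<and>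
     (\<exists>\<alpha>>0. \<forall>w. \<alpha> * (norm (P i w))\<^sup>2 \<le> C i (i - 1) w \<bullet> w))"

definition coupling_observability_hyp ::
  "'h::real_inner operator \<Rightarrow> nat \<Rightarrow> (nat \<Rightarrow> 'h \<Rightarrow>\<^sub>L 'h) \<Rightarrow> bool" where
  "coupling_observability_hyp A n P \<longleftrightarrow> (\<forall>i\<in>{2..n}. \<exists>T0>0. \<forall>T>T0. \<exists>\<gamma>>0. \<forall>w w'.
     finite_energy_sol A T (\<lambda>_. 0) w w' \<longrightarrow>
     L2_sq T (\<lambda>t. P i (w' t)) \<ge> \<gamma> * energy A 1 (pivot (w 0)) (pivot (w' 0)))"

definition admissibility_hyp ::
  "'h::real_inner operator \<Rightarrow> 'g::real_inner set \<Rightarrow> ('h \<times> 'h \<Rightarrow> 'g) \<Rightarrow> bool" where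
  "admissibility_hyp A G \<BB> \<longleftrightarrow>
     subspace G \<and> closed G \<and>
     lin_on (Hdom A 2 \<times> UNIV) \<BB> \<and> \<BB> ` (Hdom A 2 \<times> UNIV) \<subseteq> G \<and>
     (\<exists>K. \<forall>w\<in>Hdom A 2. \<forall>w'. norm (\<BB> (w, w')) \<le> K * (Hdom_norm A 2 w + norm w')) \<and>
     (\<forall>T>0. \<exists>D>0. \<forall>f w w' g.
        finite_energy_sol A T f w w' \<and> observation A G \<BB> T f w w' g \<longrightarrow>
        L2_sq T g \<le> D * (energy A 1 (pivot (w 0)) (pivot (w' 0)) + energy A 1 (pivot (w T)) (pivot (w' T)) +
          integral\<^sup>L (lebesgue_on {0..T}) (\<lambda>t. energy A 1 (pivot (w t)) (pivot (w' t))) + L2_sq T f))"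

definition observability_hyp ::
  "'h::real_inner operator \<Rightarrow> 'g::real_inner set \<Rightarrow> ('h \<times> 'h \<Rightarrow> 'g) \<Rightarrow> bool" where
  "observability_hyp A G \<BB> \<longleftrightarrow> (\<exists>T0>0. \<forall>T>T0. \<exists>R>0. \<forall>w w' g.
     finite_energy_sol A T (\<lambda>_. 0) w w' \<and> observation A G \<BB> T (\<lambda>_. 0) w w' g \<longrightarrow>
     L2_sq T g \<ge> R * energy A 1 (pivot (w 0)) (pivot (w' 0)))"

text \<open>\<open>Ts\<close> is an observability time; the data of the solutions below are in \<open>H\<^sub>1 \<times> H\<close> for each component.\<close>

definition observability_time ::
  "'h::real_inner operator \<Rightarrow> (nat \<Rightarrow> nat \<Rightarrow> 'h \<Rightarrow>\<^sub>L 'h) \<Rightarrow> nat \<Rightarrow> nat \<Rightarrow> (nat \<Rightarrow> 'g::real_inner set) \<Rightarrow>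
   (nat \<Rightarrow> 'h \<times> 'h \<Rightarrow> 'g) \<Rightarrow> real \<Rightarrow> bool" where
  "observability_time A C n p G \<BB> Ts \<longleftrightarrow> Ts > 0 \<and>
     (\<exists>(d :: nat \<Rightarrow> real \<Rightarrow> real) (\<rho> :: nat \<Rightarrow> real \<Rightarrow> real) (K :: real). \<forall>T>Ts.
        (\<forall>i\<in>{1..n}. d i T > 0) \<and> (\<forall>k\<in>{1..p}. \<rho> k T > 0) \<and>
        (\<forall>i\<in>{1..n - 1}. d i T \<le> K / T ^ 3) \<and> d n T \<le> K / T \<and>
        (\<forall>w w' g. dual_sol A C n p (\<lambda>_. 1) T w w' \<and>
             (\<forall>l\<in>{0..p}. dual_observation A C n (G (n + l)) (\<BB> (n + l)) T (n + l) w w' (g l)) \<longrightarrow>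
           (\<forall>i\<in>{1..n}. energy A (1 + int i - int n) (w i 0) (w' i 0) \<le> d i T * L2_sq T (g 0)) \<and>
           (\<forall>k\<in>{1..p}. energy A 1 (w (n + k) 0) (w' (n + k) 0)
                          \<le> \<rho> k T * (\<Sum>l = 0..k. L2_sq T (g l)))))"

section \<open>The control system\<close>

text \<open>Control operators \<open>B \<in> L(G,H)\<close> and \<open>B \<in> L(G,H\<^sub>2')\<close>, and their adjoints \<open>H \<rightarrow> G\<close> and \<open>H\<^sub>2 \<rightarrow> G\<close>.\<close>

definition bounded_control_op :: "'g::real_inner set \<Rightarrow> ('g \<Rightarrow> 'h::real_inner) \<Rightarrow> bool" where
  "bounded_control_op G B \<longleftrightarrow> lin_on G B \<and> (\<exists>K. \<forall>x\<in>G. norm (B x) \<le> K * norm x)"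

definition bounded_control_adj :: "'g::real_inner set \<Rightarrow> ('g \<Rightarrow> 'h::real_inner) \<Rightarrow> 'h \<Rightarrow> 'g" where
  "bounded_control_adj G B w = (THE z. z \<in> G \<and> (\<forall>x\<in>G. z \<bullet> x = w \<bullet> B x))"

definition unbounded_control_op ::
  "'h::real_inner operator \<Rightarrow> 'g::real_inner set \<Rightarrow> ('g \<Rightarrow> 'h \<Rightarrow> real) \<Rightarrow> bool" where
  "unbounded_control_op A G B \<longleftrightarrow> (\<forall>x\<in>G. B x \<in> Hs A (-2)) \<and> (\<forall>\<phi>. lin_on G (\<lambda>x. B x \<phi>)) \<and>
     (\<exists>K. \<forall>x\<in>G. Hs_norm A (-2) (B x) \<le> K * norm x)"

definition unbounded_control_adj :: "'g::real_inner set \<Rightarrow> ('g \<Rightarrow> 'h::real_inner \<Rightarrow> real) \<Rightarrow> 'h \<Rightarrow> 'g" where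
  "unbounded_control_adj G B w = (THE z. z \<in> G \<and> (\<forall>x\<in>G. z \<bullet> x = B x w))"

text \<open>
  \<open>(\<Prod>\<^sub>i H\<^bsub>\<tau> i\<^esub>) \<times> (\<Prod>\<^sub>i H\<^bsub>\<tau>' i\<^esub>)\<close> with \<open>i\<close> ranging over \<open>1, \<dots>, N\<close>; components outside this range are
  irrelevant.
\<close>

definition state_space ::
  "'h::real_inner operator \<Rightarrow> nat \<Rightarrow> (nat \<Rightarrow> int) \<Rightarrow> (nat \<Rightarrow> int) \<Rightarrow>
   ((nat \<Rightarrow> 'h \<Rightarrow> real) \<times> (nat \<Rightarrow> 'h \<Rightarrow> real)) set" where
  "state_space A N \<tau> \<tau>' = {(y0, y1). \<forall>i\<in>{1..N}. y0 i \<in> Hs A (\<tau> i) \<and> y1 i \<in> Hs A (\<tau>' i)}"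

text \<open>
  Solutions by transposition on \<open>[0,T]\<close> of the control system, i.e. (with \<open>B\<^sub>i = 0\<close> for \<open>i < n\<close>)
  \<open>y\<^sub>i'' + A y\<^sub>i + \<Sum>\<^sub>k C\<^bsub>k i\<^esub>\<^sup>* y\<^sub>k = B\<^sub>i v\<^sub>i\<close>, summed over the \<open>k\<close> with \<open>i \<in> coupled n k\<close>, with data
  \<open>(y0, y1)\<close>.  \<open>(y, y')\<close> is continuous with values in the state space of levels \<open>\<tau>\<close>, \<open>\<tau> - 1\<close>; the
  test solutions have levels \<open>1 - \<tau>\<close>, \<open>-\<tau>\<close>, which is the dual space, at every (equivalently, one)
  time.  \<open>obs m w w' g\<close> says that \<open>g\<close> is \<open>B\<^sub>m\<^sup>* w\<^sub>m\<close>.  The identity at \<open>t = 0\<close> contains the initial condition.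
\<close>

definition transposition_sol ::
  "'h::real_inner operator \<Rightarrow> (nat \<Rightarrow> nat \<Rightarrow> 'h \<Rightarrow>\<^sub>L 'h) \<Rightarrow> nat \<Rightarrow> nat \<Rightarrow> (nat \<Rightarrow> int) \<Rightarrow>
   (nat \<Rightarrow> (nat \<Rightarrow> real \<Rightarrow> 'h \<Rightarrow> real) \<Rightarrow> (nat \<Rightarrow> real \<Rightarrow> 'h \<Rightarrow> real) \<Rightarrow> (real \<Rightarrow> 'g::real_inner) \<Rightarrow> bool) \<Rightarrow>
   real \<Rightarrow> (nat \<Rightarrow> real \<Rightarrow> 'g) \<Rightarrow> (nat \<Rightarrow> 'h \<Rightarrow> real) \<times> (nat \<Rightarrow> 'h \<Rightarrow> real) \<Rightarrow>
   (nat \<Rightarrow> real \<Rightarrow> 'h \<Rightarrow> real) \<Rightarrow> (nat \<Rightarrow> real \<Rightarrow> 'h \<Rightarrow> real) \<Rightarrow> bool" where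
  "transposition_sol A C n p \<tau> obs T v Y0 y y' \<longleftrightarrow>
     (\<forall>i\<in>{1..n + p}. cont_Hs A (\<tau> i) T (y i) \<and> cont_Hs A (\<tau> i - 1) T (y' i)) \<and>
     (\<forall>t\<in>{0..T}. \<forall>w w' g. dual_sol A C n p (\<lambda>i. 1 - \<tau> i) T w w' \<and>
          (\<forall>l\<in>{0..p}. obs (n + l) w w' (g (n + l))) \<longrightarrow>
        integral\<^sup>L (lebesgue_on {0..t}) (\<lambda>s. \<Sum>l = 0..p. v (n + l) s \<bullet> g (n + l) s) =
          (\<Sum>k = 1..n + p. Hs_pair (\<tau> k - 1) (y' k t) (w k t) - Hs_pair (\<tau> k) (y k t) (w' k t)) -
          (\<Sum>k = 1..n + p. Hs_pair (\<tau> k - 1) (snd Y0 k) (w k 0) - Hs_pair (\<tau> k) (fst Y0 k) (w' k 0)))"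

text \<open>The solution with data \<open>Y0\<close> exists and vanishes, with its derivative, at time \<open>T\<close>.\<close>

definition steers_to_zero ::
  "'h::real_inner operator \<Rightarrow> (nat \<Rightarrow> nat \<Rightarrow> 'h \<Rightarrow>\<^sub>L 'h) \<Rightarrow> nat \<Rightarrow> nat \<Rightarrow> (nat \<Rightarrow> int) \<Rightarrow>
   (nat \<Rightarrow> (nat \<Rightarrow> real \<Rightarrow> 'h \<Rightarrow> real) \<Rightarrow> (nat \<Rightarrow> real \<Rightarrow> 'h \<Rightarrow> real) \<Rightarrow> (real \<Rightarrow> 'g::real_inner) \<Rightarrow> bool) \<Rightarrow>
   real \<Rightarrow> (nat \<Rightarrow> real \<Rightarrow> 'g) \<Rightarrow> (nat \<Rightarrow> 'h \<Rightarrow> real) \<times> (nat \<Rightarrow> 'h \<Rightarrow> real) \<Rightarrow> bool" where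
  "steers_to_zero A C n p \<tau> obs T v Y0 \<longleftrightarrow>
     (\<exists>y y'. transposition_sol A C n p \<tau> obs T v Y0 y y') \<and>
     (\<forall>y y'. transposition_sol A C n p \<tau> obs T v Y0 y y' \<longrightarrow>
        (\<forall>i\<in>{1..n + p}. y i T = (\<lambda>_. 0) \<and> y' i T = (\<lambda>_. 0)))"

end

theory Submission
  imports Defs
begin

text \<open>
  By compactness of the resolvent \<open>A\<^bsup>1/2\<^esup>\<close> is diagonal in an orthonormal basis. Every \<open>H\<^sub>s\<close> is then an
  isometric copy of \<open>H\<close>, and in these coordinates the equation \<open>w'' + A w = f\<close> is the same first order
  system at all levels, only the couplings changing with the level. The dual cascade system is lower
  triangular, hence well posed and reversible at the levels of either case.

  The theorem follows from the Hilbert uniqueness method. The observability inequality, known for finite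
  energy solutions, is carried to the levels of the dual space for the dense set of data with finitely
  many Fourier coefficients: in case (ii) because such data are those of a finite energy solution, in case
  (i) because such a solution is the velocity of a finite energy solution. It extends to all data by
  density, so the observation defines an equivalent Hilbert norm on the solutions, and the Riesz
  representation of the functional given by \<open>Y\<^sub>0\<close> is a solution whose observation is the control. The
  controlled trajectory is defined by the transposition identity; its continuity follows from the
  absolute continuity of the integral and the weak continuity of the dual flow, and testing with all final data gives \<open>Y(T) = 0\<close>.
\<close>

text \<open>The couplings do not commute with the spectral projections of \<open>A\<close>, so the
  coupled flow cannot be truncated mode by mode. Only data at time 0 are truncated: on finitely many
  modes the negative powers of \<open>A\<close> can be inverted, which is what turns a solution at a
  low level into one of finite energy. The observability inequality measures a finite energy
  solution only in the weaker norms \<open>e_{1+i-n}\<close>; these are the norms of the dual space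
  in case (ii). In case (i) the dual space lies one level lower in every component, and passing from
  \<open>(w, w')\<close> to \<open>(w', w'')\<close> is exactly this shift; the coupling term in
  \<open>w''\<close> is of lower order and is bounded by the same norms. In case (ii) the rows from
  \<open>n\<close> on stay at level 1, so lowering leaves the observed components unchanged. As the
  coordinates hide the level, both cases are instances of one abstract argument, which sees bounded
  couplings, an observation relation, an upper bound for it, and a lower bound on truncated
  data.\<close>

section \<open>Quadratic inequalities and Riesz representation\<close>

lemma nonneg_quadratic_discriminant:
  fixes a h c :: real
  assumes "\<And>t. a + 2 * t * h + t\<^sup>2 * c \<ge> 0" and "c \<ge> 0"
  shows "h\<^sup>2 \<le> a * c"
proof (cases "c = 0")
  case True
  have "h = 0"
  proof (rule ccontr)
    assume "h \<noteq> 0"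
    \<comment> \<open>For \<open>c = 0\<close> the polynomial is affine in \<open>t\<close>; at this
      \<open>t\<close> it equals -1.\<close>
    with assms(1)[of "- (a + 1) / (2 * h)"] True show False by (simp add: field_simps)
  qed
  then show ?thesis using True by simp
next
  case False
  then have "c > 0" using assms(2) by simp
  have "a + 2 * (- h / c) * h + (- h / c)\<^sup>2 * c \<ge> 0" by (rule assms(1))
  then have "a - h\<^sup>2 / c \<ge> 0" using \<open>c > 0\<close> by (simp add: power2_eq_square field_simps)
  then show ?thesis using \<open>c > 0\<close> by (simp add: field_simps)
qed

lemma tendsto_zero_if_square_le:
  fixes a h :: "'b \<Rightarrow> real"
  assumes "\<And>n. (a n)\<^sup>2 \<le> h n" and "(h \<longlongrightarrow> 0) F"
  shows "(a \<longlongrightarrow> 0) F"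
proof -
  have "((\<lambda>n. (a n)\<^sup>2) \<longlongrightarrow> 0) F"
    by (rule tendsto_sandwich[OF _ _ tendsto_const assms(2)]) (simp_all add: assms(1))
  then show ?thesis by simp
qed

text \<open>
  The linear structure enters only through the combinations \<open>lc a x c y = a x + c y\<close>, so that the
  lemma applies to products of varying length, which do not form a type.
\<close>

lemma riesz_form:
  fixes b :: "'a \<Rightarrow> 'a \<Rightarrow> real" and l :: "'a \<Rightarrow> real" and lc :: "real \<Rightarrow> 'a \<Rightarrow> real \<Rightarrow> 'a \<Rightarrow> 'a"
  assumes lcS: "\<And>a x c y. x \<in> S \<Longrightarrow> y \<in> S \<Longrightarrow> lc a x c y \<in> S"
    and blin: "\<And>a x c y z. x \<in> S \<Longrightarrow> y \<in> S \<Longrightarrow> z \<in> S \<Longrightarrow> b (lc a x c y) z = a * b x z + c * b y z"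
    and sym: "\<And>x y. x \<in> S \<Longrightarrow> y \<in> S \<Longrightarrow> b x y = b y x"
    and pos: "\<And>x. x \<in> S \<Longrightarrow> b x x \<ge> 0"
    and llin: "\<And>a x c y. x \<in> S \<Longrightarrow> y \<in> S \<Longrightarrow> l (lc a x c y) = a * l x + c * l y"
    and lb: "\<And>x. x \<in> S \<Longrightarrow> (l x)\<^sup>2 \<le> K * b x x"
    and compl: "\<And>X. (\<And>n::nat. X n \<in> S) \<Longrightarrow>
       (\<And>e. e > 0 \<Longrightarrow> \<exists>M. \<forall>m\<ge>M. \<forall>n\<ge>M. b (lc 1 (X m) (-1) (X n)) (lc 1 (X m) (-1) (X n)) < e) \<Longrightarrow>
       \<exists>x\<in>S. (\<lambda>n. b (lc 1 (X n) (-1) x) (lc 1 (X n) (-1) x)) \<longlonglongrightarrow> 0"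
    and ne: "S \<noteq> {}"
  shows "\<exists>z\<in>S. \<forall>x\<in>S. b z x = l x"
proof -
  have blin2: "b z (lc a x c y) = a * b z x + c * b z y" if "x \<in> S" "y \<in> S" "z \<in> S" for a c x y z
    using that blin lcS sym by metis
  have bq: "b (lc a x c y) (lc a x c y) = a\<^sup>2 * b x x + 2 * a * c * b x y + c\<^sup>2 * b y y"
    if "x \<in> S" "y \<in> S" for a c x y
    using that by (simp add: blin blin2 lcS sym[of y x] power2_eq_square algebra_simps)
  have cs: "(b x y)\<^sup>2 \<le> b x x * b y y" if "x \<in> S" "y \<in> S" for x y
  proof (rule nonneg_quadratic_discriminant)
    fix t show "0 \<le> b x x + 2 * t * b x y + t\<^sup>2 * b y y"
      using bq[OF that, of 1 t] pos[OF lcS[OF that, of 1 t]] by simp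
  qed (use pos that in auto)
  \<comment> \<open>A minimiser of this functional represents \<open>l\<close>. The form may be
    degenerate, so the minimiser is a limit in the seminorm of \<open>b\<close> and need not be
    unique.\<close>
  define J where "J x = b x x - 2 * l x" for x
  define K' where "K' = max K 0"
  \<comment> \<open>The inequality of means turns \<open>(l x)\<^sup>2 \<le> K' * b x x\<close> into
    \<open>2 * l x \<le> K' + b x x\<close>.\<close>
  have Jlow: "J x \<ge> - K'" if "x \<in> S" for x
  proof -
    have "(l x)\<^sup>2 \<le> K' * b x x"
      using lb[OF that] pos[OF that] by (smt (verit) K'_def mult_right_mono max_def)
    moreover have "4 * (K' * b x x) \<le> (K' + b x x)\<^sup>2"
      using zero_le_power2[of "K' - b x x"] by (simp add: power2_eq_square algebra_simps)
    ultimately have "(2 * l x)\<^sup>2 \<le> (K' + b x x)\<^sup>2" by (simp add: power_mult_distrib)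
    moreover have "0 \<le> K' + b x x" using pos[OF that] by (simp add: K'_def)
    ultimately have "2 * l x \<le> K' + b x x" by (metis abs_le_square_iff abs_le_iff abs_of_nonneg)
    then show ?thesis by (simp add: J_def)
  qed
  have Jexp: "J (lc 1 x t y) = J x + 2 * t * (b x y - l y) + t\<^sup>2 * b y y" if "x \<in> S" "y \<in> S" for x y t
    using that by (simp add: J_def bq llin algebra_simps)
  define d where "d = (INF x\<in>S. J x)"
  have bdd: "bdd_below (J ` S)" using Jlow by (auto intro!: bdd_belowI2)
  have dle: "d \<le> J x" if "x \<in> S" for x unfolding d_def by (rule cINF_lower[OF bdd that])
  have "\<exists>x\<in>S. J x < d + e" if "e > 0" for e
    using cINF_less_iff[OF ne bdd, of "d + e"] that by (simp add: d_def)
  then have "\<forall>n. \<exists>x\<in>S. J x < d + 1 / real (Suc n)" by simp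
  then obtain X where XS: "\<And>n. X n \<in> S" and XJ: "\<And>n. J (X n) < d + 1 / real (Suc n)" by metis
  \<comment> \<open>Parallelogram identity for \<open>J\<close>: the linear terms cancel, and since
    the value at the midpoint is at least \<open>d\<close>, minimising sequences are Cauchy.\<close>
  have par: "b (lc 1 x (-1) y) (lc 1 x (-1) y) = 2 * J x + 2 * J y - 4 * J (lc (1/2) x (1/2) y)"
    if "x \<in> S" "y \<in> S" for x y
    using that by (simp add: J_def bq llin power2_eq_square algebra_simps)
  have "\<exists>x\<in>S. (\<lambda>n. b (lc 1 (X n) (-1) x) (lc 1 (X n) (-1) x)) \<longlonglongrightarrow> 0"
  proof (rule compl[OF XS])
    fix e :: real assume "e > 0"
    then obtain M where M: "1 / real (Suc M) < e / 4" using nat_approx_posE[of "e/4"] by auto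
    show "\<exists>M. \<forall>m\<ge>M. \<forall>n\<ge>M. b (lc 1 (X m) (- 1) (X n)) (lc 1 (X m) (- 1) (X n)) < e"
    proof (intro exI[of _ M] allI impI)
      fix m n assume "M \<le> m" "M \<le> n"
      then have "1 / real (Suc m) \<le> 1 / real (Suc M)" "1 / real (Suc n) \<le> 1 / real (Suc M)"
        by (auto intro!: divide_left_mono)
      then have "J (X m) < d + e / 4" "J (X n) < d + e / 4"
        using M XJ[of m] XJ[of n] by linarith+
      moreover have "d \<le> J (lc (1/2) (X m) (1/2) (X n))" by (intro dle lcS XS)
      ultimately show "b (lc 1 (X m) (- 1) (X n)) (lc 1 (X m) (- 1) (X n)) < e"
        using par[OF XS[of m] XS[of n]] by linarith
    qed
  qed
  then obtain z where zS: "z \<in> S" and zlim: "(\<lambda>n. b (lc 1 (X n) (-1) z) (lc 1 (X n) (-1) z)) \<longlonglongrightarrow> 0"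
    by blast
  have "b z y = l y" if yS: "y \<in> S" for y
  proof -
    \<comment> \<open>Moving from the almost minimal \<open>X n\<close> in direction
      \<open>y\<close> lowers \<open>J\<close> by at most \<open>1 / Suc n\<close> for every
      \<open>t\<close>; the discriminant of this quadratic polynomial gives an approximate Euler
      equation.\<close>
    have e1: "(b (X n) y - l y)\<^sup>2 \<le> (1 / real (Suc n)) * b y y" for n
    proof (rule nonneg_quadratic_discriminant)
      fix t
      show "0 \<le> 1 / real (Suc n) + 2 * t * (b (X n) y - l y) + t\<^sup>2 * b y y"
        using dle[OF lcS[OF XS[of n] yS, of 1 t]] Jexp[OF XS[of n] yS, of t] XJ[of n] by linarith
    qed (use pos yS in auto)
    have "(\<lambda>n. (1 / real (Suc n)) * b y y) \<longlonglongrightarrow> 0 * b y y"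
      by (intro tendsto_mult tendsto_const LIMSEQ_Suc[OF lim_1_over_n])
    then have "(\<lambda>n. (1 / real (Suc n)) * b y y) \<longlonglongrightarrow> 0" by simp
    then have l1: "(\<lambda>n. b (X n) y - l y) \<longlonglongrightarrow> 0" by (rule tendsto_zero_if_square_le[OF e1])
    have e2: "(b (X n) y - b z y)\<^sup>2 \<le> b (lc 1 (X n) (-1) z) (lc 1 (X n) (-1) z) * b y y" for n
      using cs[OF lcS[OF XS[of n] zS, of 1 "-1"] yS] by (simp add: blin XS zS yS)
    have "(\<lambda>n. b (lc 1 (X n) (-1) z) (lc 1 (X n) (-1) z) * b y y) \<longlonglongrightarrow> 0 * b y y"
      by (intro tendsto_mult tendsto_const zlim)
    then have "(\<lambda>n. b (lc 1 (X n) (-1) z) (lc 1 (X n) (-1) z) * b y y) \<longlonglongrightarrow> 0" by simp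
    then have l2: "(\<lambda>n. b (X n) y - b z y) \<longlonglongrightarrow> 0" by (rule tendsto_zero_if_square_le[OF e2])
    have "(\<lambda>n. (b (X n) y - l y) - (b (X n) y - b z y)) \<longlonglongrightarrow> 0 - 0"
      by (rule tendsto_diff[OF l1 l2])
    then have "(\<lambda>n::nat. b z y - l y) \<longlonglongrightarrow> 0" by simp
    then show ?thesis by (simp add: LIMSEQ_const_iff)
  qed
  then show ?thesis using zS by blast
qed

lemma riesz_closed_subspace:
  fixes l :: "'a::{real_inner,complete_space} \<Rightarrow> real"
  assumes "subspace G" "closed G" "lin_on G l" and lb: "\<And>x. x \<in> G \<Longrightarrow> \<bar>l x\<bar> \<le> K * norm x"
  shows "\<exists>z\<in>G. \<forall>x\<in>G. z \<bullet> x = l x"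
proof (rule riesz_form[where lc = "\<lambda>a x c y. a *\<^sub>R x + c *\<^sub>R y" and K = "K\<^sup>2"])
  show "l (a *\<^sub>R x + c *\<^sub>R y) = a * l x + c * l y" if "x \<in> G" "y \<in> G" for a x c y
    using assms(3) that by (simp add: lin_on_def subspace_scale[OF assms(1)])
  show "(l x)\<^sup>2 \<le> K\<^sup>2 * (x \<bullet> x)" if "x \<in> G" for x
    using power_mono[OF lb[OF that] abs_ge_zero, of 2] by (simp add: power_mult_distrib power2_norm_eq_inner)
  show "G \<noteq> {}" using subspace_0[OF assms(1)] by auto
  fix X :: "nat \<Rightarrow> 'a"
  assume X: "\<And>n. X n \<in> G"
    and c: "\<And>e. e > 0 \<Longrightarrow> \<exists>M. \<forall>m\<ge>M. \<forall>n\<ge>M. (1 *\<^sub>R X m + - 1 *\<^sub>R X n) \<bullet> (1 *\<^sub>R X m + - 1 *\<^sub>R X n) < e"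
  have "Cauchy X"
  proof (rule CauchyI)
    fix e :: real assume "e > 0"
    then have "e\<^sup>2 > 0" by simp
    then obtain M where M: "\<forall>m\<ge>M. \<forall>n\<ge>M. (norm (X m - X n))\<^sup>2 < e\<^sup>2"
      using c[of "e\<^sup>2"] by (auto simp: power2_norm_eq_inner)
    then show "\<exists>M. \<forall>m\<ge>M. \<forall>n\<ge>M. norm (X m - X n) < e"
      using \<open>e > 0\<close> by (meson power2_less_imp_less less_imp_le)
  qed
  then obtain x where x: "X \<longlonglongrightarrow> x" using Cauchy_convergent convergent_def by blast
  then have "x \<in> G" using closed_sequentially[OF assms(2)] X by blast
  moreover have "(\<lambda>n. (norm (X n - x))\<^sup>2) \<longlonglongrightarrow> 0"
    using x by (simp add: LIM_zero_iff tendsto_norm_zero_iff)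
  ultimately show "\<exists>x\<in>G. (\<lambda>n. (1 *\<^sub>R X n + - 1 *\<^sub>R x) \<bullet> (1 *\<^sub>R X n + - 1 *\<^sub>R x)) \<longlonglongrightarrow> 0"
    by (auto simp: power2_norm_eq_inner)
qed (auto simp: inner_add_left inner_add_right inner_commute intro!: subspace_add[OF assms(1)] subspace_scale[OF assms(1)])

section \<open>Eigenbases of compact symmetric operators\<close>

text \<open>The norm \<open>m\<close> of \<open>R\<close> on the invariant subspace \<open>V\<close>
  is attained: compactness makes the images of a maximising sequence converge, and almost maximality
  then forces the sequence itself to converge, to some \<open>x\<close> with
  \<open>R (R x) = m^2 x\<close>. The subspace \<open>V\<close> is there so that the lemma applies
  to the orthogonal complement of eigenvectors already found.\<close>

lemma compact_symmetric_eigenvector: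
  fixes R :: "'h::real_inner \<Rightarrow> 'h"
  assumes "linear R" and V: "subspace V" "closed V" "R ` V \<subseteq> V"
    and sym: "\<And>x y. R x \<bullet> y = x \<bullet> R y"
    and cpt: "compact (closure (R ` cball 0 1))"
    and nz: "x0 \<in> V" "R x0 \<noteq> 0"
  shows "\<exists>e\<in>V. \<exists>r. norm e = 1 \<and> R e = r *\<^sub>R e"
proof -
  interpret R: linear R by fact
  have "bounded (R ` cball 0 1)" using cpt compact_imp_bounded bounded_closure bounded_subset closure_subset by metis
  then obtain c where "\<forall>x\<in>cball 0 1. norm (R x) \<le> c" by (auto simp: bounded_iff)
  then have c: "\<And>x. norm x \<le> 1 \<Longrightarrow> norm (R x) \<le> c" by simp
  have cR: "norm (R x) \<le> norm x * c" for x
  proof (cases "x = 0")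
    case False
    have "norm (R (x /\<^sub>R norm x)) \<le> c" by (rule c) (use False in auto)
    then show ?thesis using False by (simp add: R.scaleR field_simps)
  qed (simp add: R.zero)
  have bl: "bounded_linear R" by (rule bounded_linear_intro[where K = c]) (auto simp: R.add R.scaleR cR)
  define m where "m = (SUP x\<in>V \<inter> cball 0 1. norm (R x))"
  have bdd: "bdd_above ((\<lambda>x. norm (R x)) ` (V \<inter> cball 0 1))" using c by (auto intro!: bdd_aboveI2[where M = c])
  have m1: "norm (R x) \<le> m" if "x \<in> V" "norm x \<le> 1" for x
    unfolding m_def by (rule cSUP_upper[OF _ bdd]) (use that in auto)
  have mR: "norm (R x) \<le> m * norm x" if "x \<in> V" for x
  proof (cases "x = 0")
    case False
    have "norm (R (x /\<^sub>R norm x)) \<le> m" by (rule m1) (use False that V subspace_scale in auto)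
    then show ?thesis using False by (simp add: R.scaleR field_simps)
  qed (simp add: R.zero)
  have "m > 0"
  proof (rule ccontr)
    assume "\<not> m > 0"
    then have "m * norm x0 \<le> 0" by (simp add: mult_nonpos_nonneg)
    then have "norm (R x0) \<le> 0" using mR[OF nz(1)] by linarith
    then show False using nz(2) by simp
  qed
  have ne: "V \<inter> cball 0 1 \<noteq> {}" using subspace_0[OF V(1)] by auto
  have "\<exists>x\<in>V \<inter> cball 0 1. m - 1 / real (Suc n) < norm (R x)" for n
    using less_cSUP_iff[OF ne bdd, of "m - 1 / real (Suc n)"] by (simp add: m_def)
  then obtain X where X: "\<And>n. X n \<in> V" "\<And>n. norm (X n) \<le> 1" "\<And>n. m - 1 / real (Suc n) < norm (R (X n))"
    by (metis IntE mem_cball_0)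
  have "\<forall>n. R (X n) \<in> closure (R ` cball 0 1)" using X(2) closure_subset by fastforce
  then obtain y r where r: "strict_mono r" and y: "((\<lambda>n. R (X n)) \<circ> r) \<longlonglongrightarrow> y"
    using cpt[unfolded compact_def, rule_format, of "\<lambda>n. R (X n)"] by blast
  define u where "u = X \<circ> r"
  have u: "u n \<in> V" "norm (u n) \<le> 1" "norm (R (u n)) \<le> m" for n
    using X m1 by (auto simp: u_def)
  have Ru: "(\<lambda>n. R (u n)) \<longlonglongrightarrow> y" using y by (simp add: u_def o_def)
  have "(\<lambda>n. norm (R (X n))) \<longlonglongrightarrow> m"
  proof (rule tendsto_sandwich[OF _ _ _ tendsto_const])
    show "\<forall>\<^sub>F n in sequentially. m - 1 / real (Suc n) \<le> norm (R (X n))" using X(3) less_imp_le by (auto intro!: always_eventually)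
    show "\<forall>\<^sub>F n in sequentially. norm (R (X n)) \<le> m" using X m1 by (auto intro!: always_eventually)
    show "(\<lambda>n. m - 1 / real (Suc n)) \<longlonglongrightarrow> m"
      using tendsto_diff[OF tendsto_const LIMSEQ_Suc[OF lim_1_over_n], of m] by simp
  qed
  from LIMSEQ_subseq_LIMSEQ[OF this r] have nRu: "(\<lambda>n. norm (R (u n))) \<longlonglongrightarrow> m" by (simp add: u_def o_def)
  \<comment> \<open>Expand the square; symmetry gives \<open>R (R u) \<bullet> u = |R u|^2\<close>,
    and \<open>R u\<close> in \<open>V\<close> gives \<open>|R (R u)| \<le> m |R u|\<close>. The
    right-hand side tends to 0 along the maximising sequence.\<close>
  have key: "(norm (R (R (u n)) - m\<^sup>2 *\<^sub>R u n))\<^sup>2 \<le> m\<^sup>2 * (m\<^sup>2 - (norm (R (u n)))\<^sup>2)" for n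
  proof -
    have "R (R (u n)) \<bullet> u n = (norm (R (u n)))\<^sup>2" using sym[of "R (u n)" "u n"] by (simp add: power2_norm_eq_inner)
    then have "(norm (R (R (u n)) - m\<^sup>2 *\<^sub>R u n))\<^sup>2
        = (norm (R (R (u n))))\<^sup>2 - 2 * m\<^sup>2 * (norm (R (u n)))\<^sup>2 + m^4 * (norm (u n))\<^sup>2"
      unfolding power2_norm_eq_inner
      by (simp add: inner_diff inner_commute algebra_simps power4_eq_xxxx power2_eq_square)
    moreover have "R (u n) \<in> V" using u V by blast
    then have "(norm (R (R (u n))))\<^sup>2 \<le> (m * norm (R (u n)))\<^sup>2"
      by (intro power_mono mR) auto
    moreover have "m^4 * (norm (u n))\<^sup>2 \<le> m^4 * 1"
      using u(2)[of n] \<open>m > 0\<close> by (intro mult_left_mono) (auto simp: power_le_one)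
    ultimately show ?thesis by (simp add: algebra_simps power2_eq_square power4_eq_xxxx)
  qed
  have "(\<lambda>n. m\<^sup>2 * (m\<^sup>2 - (norm (R (u n)))\<^sup>2)) \<longlonglongrightarrow> m\<^sup>2 * (m\<^sup>2 - m\<^sup>2)"
    by (intro tendsto_intros nRu)
  then have "(\<lambda>n. m\<^sup>2 * (m\<^sup>2 - (norm (R (u n)))\<^sup>2)) \<longlonglongrightarrow> 0" by simp
  from tendsto_zero_if_square_le[OF key this]
  have d0: "(\<lambda>n. R (R (u n)) - m\<^sup>2 *\<^sub>R u n) \<longlonglongrightarrow> 0" by (simp add: tendsto_norm_zero_iff)
  have RRu: "(\<lambda>n. R (R (u n))) \<longlonglongrightarrow> R y" by (rule bounded_linear.tendsto[OF bl Ru])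
  \<comment> \<open>\<open>R (R (u n))\<close> converges to \<open>R y\<close> and differs from
    \<open>m^2 u n\<close> by a null sequence, so this is the limit of \<open>u\<close>.\<close>
  define x where "x = (1 / m\<^sup>2) *\<^sub>R R y"
  have "(\<lambda>n. (1 / m\<^sup>2) *\<^sub>R (R (R (u n)) - (R (R (u n)) - m\<^sup>2 *\<^sub>R u n))) \<longlonglongrightarrow> (1 / m\<^sup>2) *\<^sub>R (R y - 0)"
    by (intro tendsto_intros RRu d0)
  then have ux: "u \<longlonglongrightarrow> x" using \<open>m > 0\<close> by (simp add: x_def)
  have xV: "x \<in> V" using closed_sequentially[OF V(2) _ ux] u by blast
  have "(\<lambda>n. R (u n)) \<longlonglongrightarrow> R x" by (rule bounded_linear.tendsto[OF bl ux])
  then have yx: "y = R x" using Ru LIMSEQ_unique by blast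
  have "R y = m\<^sup>2 *\<^sub>R x" using \<open>m > 0\<close> by (simp add: x_def)
  then have RRx: "R (R x) = m\<^sup>2 *\<^sub>R x" using yx by simp
  have "norm (R x) = m" using tendsto_norm[OF Ru] nRu LIMSEQ_unique yx by blast
  then have "x \<noteq> 0" using \<open>m > 0\<close> by (auto simp: R.zero)
  have *: "\<exists>e\<in>V. \<exists>r. norm e = 1 \<and> R e = r *\<^sub>R e" if "w \<in> V" "w \<noteq> 0" "R w = r *\<^sub>R w" for w r
    by (rule bexI[of _ "w /\<^sub>R norm w"]) (use that V subspace_scale in \<open>auto simp: R.scaleR intro!: exI[of _ r]\<close>)
  show ?thesis
  \<comment> \<open>Since \<open>(R - m) (R + m) x = 0\<close>, either \<open>x\<close> is an
    eigenvector for \<open>-m\<close>, or \<open>(R + m) x\<close> is one for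
    \<open>m\<close>.\<close>
  proof (cases "R x + m *\<^sub>R x = 0")
    case True
    then have "R x = (- m) *\<^sub>R x" by (simp add: add_eq_0_iff2)
    then show ?thesis using * xV \<open>x \<noteq> 0\<close> by blast
  next
    case False
    have "R (R x + m *\<^sub>R x) = m *\<^sub>R (R x + m *\<^sub>R x)"
      by (simp add: R.add R.scaleR RRx power2_eq_square algebra_simps)
    moreover have "R x + m *\<^sub>R x \<in> V" using xV V by (auto intro!: subspace_add subspace_scale)
    ultimately show ?thesis using * False by blast
  qed
qed

text \<open>A basis is a set of vectors without enumeration: sums over \<open>E\<close> are
  unordered and truncations run over its finite subsets. Totality is stated by orthogonality, the
  form in which maximality under inclusion delivers it.\<close>

locale onb =
  fixes E :: "'h::{real_inner,complete_space} set"
  assumes orth: "\<And>e e'. e \<in> E \<Longrightarrow> e' \<in> E \<Longrightarrow> e \<bullet> e' = (if e = e' then 1 else 0)"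
    and total: "\<And>x. (\<And>e. e \<in> E \<Longrightarrow> x \<bullet> e = 0) \<Longrightarrow> x = 0"

text \<open>Zorn's lemma gives a maximal orthonormal set of eigenvectors. Symmetry makes its
  orthogonal complement invariant under \<open>R\<close>, and injectivity makes \<open>R\<close>
  nonzero on any nonzero vector of it; a further eigenvector there would contradict
  maximality.\<close>

lemma compact_symmetric_eigenbasis:
  fixes R :: "'h::{real_inner,complete_space} \<Rightarrow> 'h"
  assumes "linear R" "inj R"
    and sym: "\<And>x y. R x \<bullet> y = x \<bullet> R y"
    and cpt: "compact (closure (R ` cball 0 1))"
  shows "\<exists>E. onb E \<and> (\<forall>e\<in>E. \<exists>r. R e = r *\<^sub>R e)"
proof -
  interpret R: linear R by fact
  define \<P> where "\<P> = {S. (\<forall>e\<in>S. norm e = 1 \<and> (\<exists>r. R e = r *\<^sub>R e)) \<and> pairwise orthogonal S}"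
  have "\<exists>E\<in>\<P>. \<forall>X\<in>\<P>. E \<subseteq> X \<longrightarrow> X = E"
  proof (rule subset_Zorn_nonempty)
    show "\<P> \<noteq> {}" by (auto simp: \<P>_def intro!: exI[of _ "{}"])
    fix \<C> assume "\<C> \<noteq> {}" "subset.chain \<P> \<C>"
    then have "chain\<^sub>\<subseteq> \<C>" "\<C> \<subseteq> \<P>" by (auto simp: subset.chain_def chain_subset_def)
    then show "\<Union>\<C> \<in> \<P>" by (auto simp: \<P>_def intro!: pairwise_chain_Union)
  qed
  then obtain E where EP: "E \<in> \<P>" and Emax: "\<And>X. X \<in> \<P> \<Longrightarrow> E \<subseteq> X \<Longrightarrow> X = E" by blast
  have orth: "e \<bullet> e' = (if e = e' then 1 else 0)" if "e \<in> E" "e' \<in> E" for e e'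
    using EP that by (auto simp: \<P>_def pairwise_def orthogonal_def norm_eq_1)
  define V where "V = {x. \<forall>e\<in>E. e \<bullet> x = 0}"
  have "V = \<Inter> ((\<lambda>e. {x. e \<bullet> x = 0}) ` E)" by (auto simp: V_def)
  then have "closed V" by (auto intro!: closed_INT closed_hyperplane)
  have "subspace V" by (auto simp: V_def subspace_def inner_add_right)
  have "R ` V \<subseteq> V"
  proof safe
    fix x assume x: "x \<in> V"
    show "R x \<in> V" unfolding V_def
    proof safe
      fix e assume e: "e \<in> E"
      then obtain r where "R e = r *\<^sub>R e" using EP by (auto simp: \<P>_def)
      then show "e \<bullet> R x = 0" using sym[of e x] x e by (simp add: V_def)
    qed
  qed
  have "x = 0" if "\<And>e. e \<in> E \<Longrightarrow> x \<bullet> e = 0" for x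
  proof (rule ccontr)
    assume "x \<noteq> 0"
    then have "R x \<noteq> 0" using \<open>inj R\<close> by (metis R.zero injD)
    moreover have "x \<in> V" using that by (auto simp: V_def inner_commute)
    ultimately obtain e r where e: "e \<in> V" "norm e = 1" "R e = r *\<^sub>R e"
      using compact_symmetric_eigenvector[OF assms(1) \<open>subspace V\<close> \<open>closed V\<close> \<open>R ` V \<subseteq> V\<close> sym cpt] by metis
    have "insert e E \<in> \<P>"
      using EP e by (auto simp: \<P>_def pairwise_insert orthogonal_def V_def inner_commute)
    then have "e \<in> E" using Emax by blast
    then show False using e by (auto simp: V_def norm_eq_1)
  qed
  then have "onb E" using orth by unfold_locales auto
  then show ?thesis using EP by (auto simp: \<P>_def)
qed

section \<open>Bessel, Riesz-Fischer and Parseval for an orthonormal basis\<close>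

context onb
begin

definition proj :: "'h set \<Rightarrow> 'h \<Rightarrow> 'h" where
  "proj F x = (\<Sum>e\<in>F. (x \<bullet> e) *\<^sub>R e)"

lemma eqI: "(\<And>e. e \<in> E \<Longrightarrow> x \<bullet> e = y \<bullet> e) \<Longrightarrow> x = y"
  using total[of "x - y"] by (simp add: inner_diff_left)

lemma sum_inner_basis:
  assumes "finite F" "F \<subseteq> E" "e \<in> E"
  shows "(\<Sum>e\<in>F. c e *\<^sub>R e) \<bullet> e = (if e \<in> F then c e else 0)"
proof -
  have "(\<Sum>e\<in>F. c e *\<^sub>R e) \<bullet> e = (\<Sum>e'\<in>F. c e' * (if e' = e then 1 else 0))"
    unfolding inner_sum_left inner_scaleR_left
    by (rule sum.cong) (use assms in \<open>auto simp: orth subsetD\<close>)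
  also have "\<dots> = (\<Sum>e'\<in>F. if e' = e then c e' else 0)" by (rule sum.cong) auto
  finally show ?thesis using assms by simp
qed

lemma norm_sum_basis:
  assumes "finite F" "F \<subseteq> E"
  shows "(norm (\<Sum>e\<in>F. c e *\<^sub>R e))\<^sup>2 = (\<Sum>e\<in>F. (c e)\<^sup>2)"
proof -
  have "(norm (\<Sum>e\<in>F. c e *\<^sub>R e))\<^sup>2 = (\<Sum>e'\<in>F. (\<Sum>e\<in>F. c e *\<^sub>R e) \<bullet> (c e' *\<^sub>R e'))"
    by (simp add: power2_norm_eq_inner inner_sum_right)
  also have "\<dots> = (\<Sum>e'\<in>F. (c e')\<^sup>2)"
    by (rule sum.cong) (use assms in \<open>auto simp: sum_inner_basis subsetD power2_eq_square\<close>)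
  finally show ?thesis .
qed

lemma proj_inner: "finite F \<Longrightarrow> F \<subseteq> E \<Longrightarrow> e \<in> E \<Longrightarrow> proj F x \<bullet> e = (if e \<in> F then x \<bullet> e else 0)"
  by (simp add: proj_def sum_inner_basis)

lemma norm_proj: "finite F \<Longrightarrow> F \<subseteq> E \<Longrightarrow> (norm (proj F x))\<^sup>2 = (\<Sum>e\<in>F. (x \<bullet> e)\<^sup>2)"
  by (simp add: proj_def norm_sum_basis)

lemma norm_diff_proj:
  assumes "finite F" "F \<subseteq> E"
  shows "(norm (x - proj F x))\<^sup>2 = (norm x)\<^sup>2 - (\<Sum>e\<in>F. (x \<bullet> e)\<^sup>2)"
proof -
  have "x \<bullet> proj F x = (\<Sum>e\<in>F. (x \<bullet> e)\<^sup>2)"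
    by (simp add: proj_def inner_sum_right power2_eq_square)
  then show ?thesis using norm_proj[OF assms, of x]
    by (simp add: power2_norm_eq_inner inner_diff inner_commute)
qed

lemma bessel: "finite F \<Longrightarrow> F \<subseteq> E \<Longrightarrow> (\<Sum>e\<in>F. (x \<bullet> e)\<^sup>2) \<le> (norm x)\<^sup>2"
  using norm_diff_proj[of F x] zero_le_power2[of "norm (x - proj F x)"] by linarith

lemma norm_proj_le: "finite F \<Longrightarrow> F \<subseteq> E \<Longrightarrow> norm (proj F x) \<le> norm x"
  by (rule power2_le_imp_le) (simp_all add: bessel norm_proj)

lemma norm_diff_proj_le: "finite F \<Longrightarrow> F \<subseteq> E \<Longrightarrow> norm (x - proj F x) \<le> norm x"
  by (rule power2_le_imp_le) (simp_all add: norm_diff_proj sum_nonneg)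

lemma norm_diff_proj_mono:
  assumes "finite F'" "F \<subseteq> F'" "F' \<subseteq> E"
  shows "norm (x - proj F' x) \<le> norm (x - proj F x)"
proof (rule power2_le_imp_le)
  have "finite F" "F \<subseteq> E" using assms finite_subset by auto
  then show "(norm (x - proj F' x))\<^sup>2 \<le> (norm (x - proj F x))\<^sup>2"
    using assms by (simp add: norm_diff_proj sum_mono2)
qed simp

lemma bounded_linear_proj: "finite F \<Longrightarrow> F \<subseteq> E \<Longrightarrow> bounded_linear (proj F)"
proof (rule bounded_linear_intro[where K = 1])
  fix x y :: 'h and c :: real
  show "proj F (x + y) = proj F x + proj F y"
    by (simp add: proj_def inner_add_left scaleR_add_left sum.distrib)
  show "proj F (c *\<^sub>R x) = c *\<^sub>R proj F x" by (simp add: proj_def scaleR_sum_right)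
qed (simp add: norm_proj_le)

lemma abs_sum_mult_le:
  fixes c d :: "'h \<Rightarrow> real"
  assumes "(\<Sum>e\<in>F. (c e)\<^sup>2) \<le> B" "(\<Sum>e\<in>F. (d e)\<^sup>2) \<le> D"
  shows "(\<Sum>e\<in>F. \<bar>c e * d e\<bar>) \<le> sqrt B * sqrt D"
proof -
  have "(\<Sum>e\<in>F. \<bar>c e\<bar> * \<bar>d e\<bar>) \<le> L2_set c F * L2_set d F" by (rule L2_set_mult_ineq)
  also have "\<dots> \<le> sqrt B * sqrt D"
    unfolding L2_set_def using assms sum_nonneg[of F "\<lambda>e. (c e)\<^sup>2"] sum_nonneg[of F "\<lambda>e. (d e)\<^sup>2"]
    by (intro mult_mono) auto
  finally show ?thesis by (simp add: abs_mult)
qed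

text \<open>The coefficients define the functional sending \<phi> to the unordered sum of
  \<open>c e * (\<phi> \<bullet> e)\<close>, bounded by \<open>sqrt B\<close> through the
  Cauchy-Schwarz inequality on finite sets. Its Riesz vector is \<open>y\<close>, so only scalar
  sums have to converge.\<close>

lemma riesz_fischer:
  assumes B: "\<And>F. finite F \<Longrightarrow> F \<subseteq> E \<Longrightarrow> (\<Sum>e\<in>F. (c e)\<^sup>2) \<le> B"
  obtains y where "\<And>e. e \<in> E \<Longrightarrow> y \<bullet> e = c e" and "\<And>\<phi>. ((\<lambda>e. c e * (\<phi> \<bullet> e)) has_sum y \<bullet> \<phi>) E"
    and "(norm y)\<^sup>2 \<le> B"
proof -
  have fin: "(\<Sum>e\<in>F. \<bar>c e * (\<phi> \<bullet> e)\<bar>) \<le> sqrt B * norm \<phi>" if "finite F" "F \<subseteq> E" for F \<phi>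
    using abs_sum_mult_le[OF B[OF that] bessel[OF that, of \<phi>]] by simp
  have sm: "(\<lambda>e. \<bar>c e * (\<phi> \<bullet> e)\<bar>) summable_on E" for \<phi>
    by (rule nonneg_bdd_above_summable_on) (use fin in \<open>auto intro!: bdd_aboveI2[where M = "sqrt B * norm \<phi>"]\<close>)
  then have sm': "(\<lambda>e. c e * (\<phi> \<bullet> e)) summable_on E" for \<phi>
    using abs_summable_summable[of "\<lambda>e. c e * (\<phi> \<bullet> e)" E] by simp
  define l where "l \<phi> = infsum (\<lambda>e. c e * (\<phi> \<bullet> e)) E" for \<phi>
  have lb: "\<bar>l \<phi>\<bar> \<le> sqrt B * norm \<phi>" for \<phi>
  proof -
    have "\<bar>l \<phi>\<bar> \<le> infsum (\<lambda>e. \<bar>c e * (\<phi> \<bullet> e)\<bar>) E"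
      using norm_infsum_bound[of "\<lambda>e. c e * (\<phi> \<bullet> e)" E] sm[of \<phi>] by (simp add: l_def)
    also have "\<dots> \<le> sqrt B * norm \<phi>" by (rule infsum_le_finite_sums[OF sm fin])
    finally show ?thesis .
  qed
  have "lin_on UNIV l"
    using sm' by (auto simp: lin_on_def l_def inner_add_left distrib_left infsum_add mult.left_commute infsum_cmult_right')
  from riesz_closed_subspace[OF subspace_UNIV closed_UNIV this, of "sqrt B"] lb
  obtain y where y: "\<And>\<phi>. y \<bullet> \<phi> = l \<phi>" by auto
  have hs: "((\<lambda>e. c e * (\<phi> \<bullet> e)) has_sum y \<bullet> \<phi>) E" for \<phi>
    unfolding y l_def using sm' by (rule has_sum_infsum)
  have "y \<bullet> e = c e" if "e \<in> E" for e
  proof -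
    have "((\<lambda>e'. c e' * (e \<bullet> e')) has_sum c e) E"
      by (rule has_sum_finite_neutralI[where B = "{e}"]) (use that in \<open>auto simp: orth\<close>)
    then show ?thesis using hs[of e] has_sum_unique by blast
  qed
  moreover have "(norm y)\<^sup>2 \<le> B"
  proof -
    have "0 \<le> B" using B[of "{}"] by simp
    have "(norm y)\<^sup>2 \<le> sqrt B * norm y" using lb[of y] y[of y] by (simp add: power2_norm_eq_inner)
    then have "norm y \<le> sqrt B" using \<open>0 \<le> B\<close> by (cases "norm y = 0") (auto simp: power2_eq_square)
    then show ?thesis using \<open>0 \<le> B\<close> by (metis norm_ge_zero power_mono real_sqrt_pow2)
  qed
  ultimately show ?thesis using hs that by blast
qed

text \<open>Riesz-Fischer applied to the coefficients of \<open>x\<close> returns a vector with the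
  same coordinates, hence \<open>x\<close> itself by totality, together with the sum
  formula.\<close>

lemma parseval: "((\<lambda>e. (x \<bullet> e) * (y \<bullet> e)) has_sum x \<bullet> y) E"
proof -
  obtain x' where x': "\<And>e. e \<in> E \<Longrightarrow> x' \<bullet> e = x \<bullet> e" "\<And>\<phi>. ((\<lambda>e. (x \<bullet> e) * (\<phi> \<bullet> e)) has_sum x' \<bullet> \<phi>) E"
    by (rule riesz_fischer[of "\<lambda>e. x \<bullet> e" "(norm x)\<^sup>2"]) (use bessel in auto)
  then have "x' = x" by (intro eqI) auto
  then show ?thesis using x'(2) by simp
qed

lemma proj_tendsto: "((\<lambda>F. proj F x) \<longlongrightarrow> x) (finite_subsets_at_top E)"
proof -
  have "((\<lambda>F. (norm x)\<^sup>2 - (\<Sum>e\<in>F. (x \<bullet> e)\<^sup>2)) \<longlongrightarrow> (norm x)\<^sup>2 - (norm x)\<^sup>2) (finite_subsets_at_top E)"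
    using parseval[of x x]
    by (intro tendsto_diff tendsto_const) (simp add: has_sum_def power2_eq_square power2_norm_eq_inner[symmetric])
  then have "((\<lambda>F. (norm x)\<^sup>2 - (\<Sum>e\<in>F. (x \<bullet> e)\<^sup>2)) \<longlongrightarrow> 0) (finite_subsets_at_top E)" by simp
  moreover have "\<forall>\<^sub>F F in finite_subsets_at_top E. (norm x)\<^sup>2 - (\<Sum>e\<in>F. (x \<bullet> e)\<^sup>2) = (norm (x - proj F x))\<^sup>2"
    by (rule eventually_finite_subsets_at_top_weakI) (simp add: norm_diff_proj)
  ultimately have "((\<lambda>F. (norm (x - proj F x))\<^sup>2) \<longlongrightarrow> 0) (finite_subsets_at_top E)"
    using tendsto_cong by force
  then have "((\<lambda>F. norm (x - proj F x)) \<longlongrightarrow> 0) (finite_subsets_at_top E)" by simp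
  from tendsto_diff[OF tendsto_const[of x] tendsto_norm_zero_cancel[OF this]]
  show ?thesis by simp
qed

lemma proj_approx:
  assumes "\<epsilon> > 0"
  shows "\<exists>F. finite F \<and> F \<subseteq> E \<and> norm (x - proj F x) < \<epsilon>"
proof -
  have "\<forall>\<^sub>F F in finite_subsets_at_top E. dist (proj F x) x < \<epsilon>"
    using proj_tendsto assms tendstoD by blast
  then show ?thesis by (auto simp: eventually_finite_subsets_at_top dist_norm norm_minus_commute)
qed

text \<open>Turns estimates on finitely many coordinates, where derivatives and sums can be handled,
  into an estimate of the norm.\<close>

lemma norm_le_if_proj_le:
  assumes "\<And>F. finite F \<Longrightarrow> F \<subseteq> E \<Longrightarrow> (\<Sum>e\<in>F. (x \<bullet> e)\<^sup>2) \<le> B"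
  shows "(norm x)\<^sup>2 \<le> B"
proof -
  obtain y where "\<And>e. e \<in> E \<Longrightarrow> y \<bullet> e = x \<bullet> e" "(norm y)\<^sup>2 \<le> B"
    by (rule riesz_fischer[OF assms]) auto
  then show ?thesis using eqI[of y x] by simp
qed

text \<open>Source of all negative powers of \<open>A\<close>: a bounded multiplier keeps
  coordinates square summable.\<close>

lemma ex_multiplier:
  assumes "\<And>e. e \<in> E \<Longrightarrow> \<bar>m e\<bar> \<le> K"
  shows "\<exists>y. (\<forall>e\<in>E. y \<bullet> e = m e * (x \<bullet> e)) \<and> norm y \<le> \<bar>K\<bar> * norm x"
proof -
  have "(\<Sum>e\<in>F. (m e * (x \<bullet> e))\<^sup>2) \<le> (\<bar>K\<bar> * norm x)\<^sup>2" if "finite F" "F \<subseteq> E" for F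
  proof -
    have "(\<Sum>e\<in>F. (m e * (x \<bullet> e))\<^sup>2) \<le> (\<Sum>e\<in>F. K\<^sup>2 * (x \<bullet> e)\<^sup>2)"
    proof (rule sum_mono)
      fix e assume "e \<in> F"
      then have "\<bar>m e\<bar> \<le> \<bar>K\<bar>" using assms that by fastforce
      then show "(m e * (x \<bullet> e))\<^sup>2 \<le> K\<^sup>2 * (x \<bullet> e)\<^sup>2"
        by (simp add: power_mult_distrib mult_right_mono abs_le_square_iff)
    qed
    also have "\<dots> \<le> K\<^sup>2 * (norm x)\<^sup>2"
      using bessel[OF that, of x] by (simp add: sum_distrib_left[symmetric] mult_left_mono)
    finally show ?thesis by (simp add: power_mult_distrib)
  qed
  then obtain y where y: "\<And>e. e \<in> E \<Longrightarrow> y \<bullet> e = m e * (x \<bullet> e)" "(norm y)\<^sup>2 \<le> (\<bar>K\<bar> * norm x)\<^sup>2"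
    by (rule riesz_fischer[of "\<lambda>e. m e * (x \<bullet> e)" "(\<bar>K\<bar> * norm x)\<^sup>2"]) auto
  from y(2) have "norm y \<le> \<bar>K\<bar> * norm x" by (rule power2_le_imp_le) simp
  then show ?thesis using y(1) by blast
qed

end

section \<open>Spectral representation of the operator\<close>

text \<open>Density of the domain makes the representing vector unique, so that the description
  operator in \<open>op_adjoint\<close> returns it.\<close>

lemma adjoint_eqI:
  assumes d: "closure (dom S) = UNIV" and z: "\<And>v. v \<in> dom S \<Longrightarrow> the (S v) \<bullet> u = v \<bullet> z"
  shows "op_adjoint S u = Some z"
proof -
  have "z' = z" if z': "\<forall>v\<in>dom S. the (S v) \<bullet> u = v \<bullet> z'" for z'
  proof -
    have "dom S \<subseteq> {v. (z' - z) \<bullet> v = 0}" using z z' by (auto simp: inner_diff_right inner_commute[of "z' - z"])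
    then have "closure (dom S) \<subseteq> {v. (z' - z) \<bullet> v = 0}" by (intro closure_minimal closed_hyperplane)
    then have "(z' - z) \<bullet> (z' - z) = 0" using d by blast
    then show ?thesis by simp
  qed
  then have "(THE z. \<forall>v\<in>dom S. the (S v) \<bullet> u = v \<bullet> z) = z"
    by (intro the_equality) (use z in auto)
  moreover have "\<exists>z. \<forall>v\<in>dom S. the (S v) \<bullet> u = v \<bullet> z" using z by blast
  ultimately show ?thesis unfolding op_adjoint_def by simp
qed

lemma self_adjoint_symmetric:
  assumes S: "self_adjoint S" and "v \<in> dom S" "S u = Some w"
  shows "the (S v) \<bullet> u = v \<bullet> w"
proof -
  have d: "closure (dom S) = UNIV" and a: "op_adjoint S u = Some w" using S assms(3) by (auto simp: self_adjoint_def)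
  from a obtain z where z: "\<forall>v\<in>dom S. the (S v) \<bullet> u = v \<bullet> z"
    by (auto simp: op_adjoint_def split: if_splits)
  then have "op_adjoint S u = Some z" by (intro adjoint_eqI[OF d]) auto
  then show ?thesis using a z assms(2) by auto
qed

context onb
begin

text \<open>The direction from right to left identifies the domain: being its own adjoint,
  \<open>S\<close> contains every \<open>x\<close> for which the adjoint relation holds, and
  Parseval verifies that relation whenever the multiplied coordinates are those of some vector
  \<open>y\<close>.\<close>

lemma self_adjoint_diagonal:
  assumes S: "self_adjoint S" and eig: "\<And>e. e \<in> E \<Longrightarrow> S e = Some (s e *\<^sub>R e)"
  shows "S x = Some y \<longleftrightarrow> (\<forall>e\<in>E. y \<bullet> e = s e * (x \<bullet> e))"
proof -
  have coord: "y \<bullet> e = s e * (x \<bullet> e)" if "S x = Some y" "e \<in> E" for x y e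
    using self_adjoint_symmetric[OF S _ eig[OF that(2)], of x] that by (auto simp: inner_commute)
  show ?thesis
  proof
    assume y: "\<forall>e\<in>E. y \<bullet> e = s e * (x \<bullet> e)"
    have "op_adjoint S x = Some y"
    proof (rule adjoint_eqI)
      show "closure (dom S) = UNIV" using S by (simp add: self_adjoint_def)
      fix v assume "v \<in> dom S"
      then obtain w where w: "S v = Some w" by auto
      have "((\<lambda>e. (w \<bullet> e) * (x \<bullet> e)) has_sum w \<bullet> x) E" by (rule parseval)
      moreover have "((\<lambda>e. (w \<bullet> e) * (x \<bullet> e)) has_sum v \<bullet> y) E"
        using parseval[of v y] by (rule has_sum_cong[THEN iffD1, rotated]) (use coord[OF w] y in auto)
      ultimately show "the (S v) \<bullet> x = v \<bullet> y" using w has_sum_unique by fastforce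
    qed
    then show "S x = Some y" using S by (simp add: self_adjoint_def)
  qed (use coord in blast)
qed

text \<open>The multiplication operator by \<open>s\<close> on its maximal domain, the model with
  which \<open>A\<close> and its square root are compared.\<close>

definition diag :: "('h \<Rightarrow> real) \<Rightarrow> 'h operator" where
  "diag s x = (if \<exists>y. \<forall>e\<in>E. y \<bullet> e = s e * (x \<bullet> e) then Some (THE y. \<forall>e\<in>E. y \<bullet> e = s e * (x \<bullet> e)) else None)"

lemma diag_eq: "diag s x = Some y \<longleftrightarrow> (\<forall>e\<in>E. y \<bullet> e = s e * (x \<bullet> e))"
proof -
  have "(THE y. \<forall>e\<in>E. y \<bullet> e = s e * (x \<bullet> e)) = y" if "\<forall>e\<in>E. y \<bullet> e = s e * (x \<bullet> e)" for y
    by (rule the_equality) (use that in \<open>auto intro: eqI\<close>)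
  then show ?thesis unfolding diag_def by auto
qed

lemma diag_dom: "x \<in> dom (diag s) \<longleftrightarrow> (\<exists>y. \<forall>e\<in>E. y \<bullet> e = s e * (x \<bullet> e))"
  by (auto simp: dom_def diag_eq)

text \<open>Truncations of any vector lie in the domain, which is therefore dense. An adjoint value
  is forced by testing with the basis vectors, and Parseval gives the converse.\<close>

lemma diag_self_adjoint: "self_adjoint (diag s)"
proof -
  have the_diag: "the (diag s x) = y" if "\<forall>e\<in>E. y \<bullet> e = s e * (x \<bullet> e)" for x y
    using diag_eq that by (metis option.sel)
  have sub: "subspace (dom (diag s))"
    unfolding subspace_def
  proof (intro conjI ballI allI)
    show "0 \<in> dom (diag s)" by (auto simp: diag_dom intro!: exI[of _ 0])
  next
    fix x y assume "x \<in> dom (diag s)" "y \<in> dom (diag s)"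
    then obtain x' y' where "\<forall>e\<in>E. x' \<bullet> e = s e * (x \<bullet> e)" "\<forall>e\<in>E. y' \<bullet> e = s e * (y \<bullet> e)"
      by (auto simp: diag_dom)
    then show "x + y \<in> dom (diag s)"
      by (auto simp: diag_dom inner_add_left algebra_simps intro!: exI[of _ "x' + y'"])
  next
    fix c x assume "x \<in> dom (diag s)"
    then obtain x' where "\<forall>e\<in>E. x' \<bullet> e = s e * (x \<bullet> e)" by (auto simp: diag_dom)
    then show "c *\<^sub>R x \<in> dom (diag s)" by (auto simp: diag_dom intro!: exI[of _ "c *\<^sub>R x'"])
  qed
  have lin: "lin_on (dom (diag s)) (\<lambda>u. the (diag s u))"
    unfolding lin_on_def
  proof (intro conjI ballI allI)
    fix x y assume "x \<in> dom (diag s)" "y \<in> dom (diag s)"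
    then obtain x' y' where *: "\<forall>e\<in>E. x' \<bullet> e = s e * (x \<bullet> e)" "\<forall>e\<in>E. y' \<bullet> e = s e * (y \<bullet> e)"
      by (auto simp: diag_dom)
    then have "the (diag s (x + y)) = x' + y'" by (intro the_diag) (auto simp: inner_add_left algebra_simps)
    then show "the (diag s (x + y)) = the (diag s x) + the (diag s y)" using * the_diag by metis
  next
    fix c x assume "x \<in> dom (diag s)"
    then obtain x' where *: "\<forall>e\<in>E. x' \<bullet> e = s e * (x \<bullet> e)" by (auto simp: diag_dom)
    then have "the (diag s (c *\<^sub>R x)) = c *\<^sub>R x'" by (intro the_diag) auto
    then show "the (diag s (c *\<^sub>R x)) = c *\<^sub>R the (diag s x)" using * the_diag by metis
  qed
  have dense: "closure (dom (diag s)) = UNIV"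
  proof -
    have "x \<in> closure (dom (diag s))" for x
      unfolding closure_approachable
    proof (intro allI impI)
      fix \<epsilon> :: real assume "\<epsilon> > 0"
      then obtain F where F: "finite F" "F \<subseteq> E" "norm (x - proj F x) < \<epsilon>" using proj_approx by blast
      have "proj F x \<in> dom (diag s)"
        unfolding diag_dom using F(1,2)
        by (intro exI[of _ "\<Sum>e\<in>F. (s e * (x \<bullet> e)) *\<^sub>R e"]) (simp add: sum_inner_basis proj_inner)
      then show "\<exists>y\<in>dom (diag s). dist y x < \<epsilon>" using F(3) by (auto simp: dist_norm norm_minus_commute)
    qed
    then show ?thesis by blast
  qed
  have "op_adjoint (diag s) = diag s"
  proof
    fix u
    have pos: "op_adjoint (diag s) u = Some z" if "diag s u = Some z" for z
    proof (rule adjoint_eqI[OF dense])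
      fix v assume "v \<in> dom (diag s)"
      then obtain w where w: "diag s v = Some w" by auto
      have "((\<lambda>e. (w \<bullet> e) * (u \<bullet> e)) has_sum w \<bullet> u) E" by (rule parseval)
      moreover have "((\<lambda>e. (w \<bullet> e) * (u \<bullet> e)) has_sum v \<bullet> z) E"
        using parseval[of v z] by (rule has_sum_cong[THEN iffD1, rotated]) (use w that in \<open>auto simp: diag_eq\<close>)
      ultimately show "the (diag s v) \<bullet> u = v \<bullet> z" using w has_sum_unique by fastforce
    qed
    have "diag s u = Some z" if "op_adjoint (diag s) u = Some z" for z
    proof -
      obtain z' where z': "\<forall>v\<in>dom (diag s). the (diag s v) \<bullet> u = v \<bullet> z'"
        using \<open>op_adjoint (diag s) u = Some z\<close> by (auto simp: op_adjoint_def split: if_splits)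
      then have "op_adjoint (diag s) u = Some z'" by (intro adjoint_eqI[OF dense]) auto
      then have "z' = z" using that by simp
      have "z \<bullet> e = s e * (u \<bullet> e)" if "e \<in> E" for e
      proof -
        have de: "diag s e = Some (s e *\<^sub>R e)" using that by (auto simp: diag_eq orth)
        then have "the (diag s e) \<bullet> u = e \<bullet> z" using z' \<open>z' = z\<close> by blast
        then show ?thesis using de by (simp add: inner_commute)
      qed
      then show ?thesis by (auto simp: diag_eq)
    qed
    then show "op_adjoint (diag s) u = diag s u" using pos by (metis option.exhaust)
  qed
  then show ?thesis using sub lin dense by (simp add: self_adjoint_def)
qed

lemma diag_positive:
  assumes "\<And>e. e \<in> E \<Longrightarrow> s e \<ge> 0"
  shows "positive_op (diag s)"
  unfolding positive_op_def
proof
  fix u assume "u \<in> dom (diag s)"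
  then obtain w where w: "diag s u = Some w" by auto
  have "0 \<le> w \<bullet> u"
    using parseval[of w u] by (rule has_sum_nonneg) (use w assms in \<open>auto simp: diag_eq mult.assoc\<close>)
  then show "0 \<le> the (diag s u) \<bullet> u" using w by simp
qed

end

text \<open>Here \<open>\<mu> e\<close> is the square root of the eigenvalue of \<open>A\<close> at
  \<open>e\<close>. The half powers and \<open>A\<close> enter by their coordinates, domains
  included, so that the description behind \<open>op_sqrt\<close> never has to be unfolded inside
  the locale; the bound \<open>c\<^sub>0\<close> makes negative powers bounded.\<close>

locale eigenbasis = onb E for E :: "'h::{real_inner,complete_space} set" +
  fixes A :: "'h operator" and \<mu> :: "'h \<Rightarrow> real" and c\<^sub>0 :: real
  assumes c0: "c\<^sub>0 > 0" and mu_ge: "\<And>e. e \<in> E \<Longrightarrow> c\<^sub>0 \<le> \<mu> e"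
    and half_power_eq: "half_power A k x = Some y \<longleftrightarrow> (\<forall>e\<in>E. y \<bullet> e = \<mu> e ^ k * (x \<bullet> e))"
    and A_eq: "A x = Some y \<longleftrightarrow> (\<forall>e\<in>E. y \<bullet> e = (\<mu> e)\<^sup>2 * (x \<bullet> e))"

text \<open>As \<open>op_sqrt\<close> is a definite description, both existence and uniqueness of
  the root have to be shown. Uniqueness reduces to the action of a positive root on each
  \<open>e\<close>, after which self-adjointness fixes it everywhere.\<close>

lemma (in onb) op_sqrt_diagonal:
  assumes A: "A = diag (\<lambda>e. (\<mu> e)\<^sup>2)" and mu: "\<And>e. e \<in> E \<Longrightarrow> \<mu> e \<ge> c" and "c > 0"
  shows "op_sqrt A = diag \<mu>"
  unfolding op_sqrt_def
proof (rule the_equality)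
  have "0 \<le> \<mu> e" if "e \<in> E" for e using mu[OF that] \<open>c > 0\<close> by linarith
  moreover have "diag \<mu> \<circ>\<^sub>m diag \<mu> = A"
  proof
    fix x
    have 1: "A x = Some z" if xy: "diag \<mu> x = Some y" and yz: "diag \<mu> y = Some z" for y z
      using xy yz unfolding A by (auto simp: diag_eq power2_eq_square)
    have 2: "\<exists>y. diag \<mu> x = Some y \<and> diag \<mu> y = Some z" if "A x = Some z" for z
    proof -
      have z: "\<And>e. e \<in> E \<Longrightarrow> z \<bullet> e = (\<mu> e)\<^sup>2 * (x \<bullet> e)" using that by (simp add: A diag_eq)
      \<comment> \<open>The intermediate vector of the composition is recovered by dividing by
        \<mu>, which is bounded below; so the domain of the square is not smaller than that of
        \<open>A\<close>.\<close>
      obtain y where y: "\<forall>e\<in>E. y \<bullet> e = (1 / \<mu> e) * (z \<bullet> e)"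
        using ex_multiplier[of "\<lambda>e. 1 / \<mu> e" "1 / c" z] mu \<open>c > 0\<close> by (force simp: abs_le_iff frac_le)
      have "\<mu> e > 0" if "e \<in> E" for e using mu[OF that] \<open>c > 0\<close> by linarith
      then show ?thesis using y z by (intro exI[of _ y]) (auto simp: diag_eq power2_eq_square)
    qed
    show "(diag \<mu> \<circ>\<^sub>m diag \<mu>) x = A x"
    proof (cases "A x")
      case None
      then have "\<And>y. diag \<mu> x = Some y \<Longrightarrow> diag \<mu> y = None" using 1 by fastforce
      then show ?thesis using None by (auto simp: map_comp_def split: option.split)
    next
      case (Some z)
      then show ?thesis using 2 by (auto simp: map_comp_def)
    qed
  qed
  ultimately show "self_adjoint (diag \<mu>) \<and> positive_op (diag \<mu>) \<and> diag \<mu> \<circ>\<^sub>m diag \<mu> = A"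
    by (simp add: diag_self_adjoint diag_positive)
next
  fix S assume S: "self_adjoint S \<and> positive_op S \<and> S \<circ>\<^sub>m S = A"
  have eig: "S e = Some (\<mu> e *\<^sub>R e)" if e: "e \<in> E" for e
  proof -
    have "A e = Some ((\<mu> e)\<^sup>2 *\<^sub>R e)" using e by (auto simp: A diag_eq orth)
    then have "(S \<circ>\<^sub>m S) e = Some ((\<mu> e)\<^sup>2 *\<^sub>R e)" using S by simp
    then obtain g where g: "S e = Some g" "S g = Some ((\<mu> e)\<^sup>2 *\<^sub>R e)"
      by (auto simp: map_comp_def split: option.splits)
    have sub: "subspace (dom S)" and lin: "lin_on (dom S) (\<lambda>u. the (S u))" using S by (auto simp: self_adjoint_def)
    \<comment> \<open>Since \<open>S (S e) = \<mu>^2 e\<close>, the vector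
      \<open>f = S e - \<mu> e\<close> satisfies \<open>S f = - \<mu> f\<close>; positivity of
      \<open>S\<close> then forces \<open>f = 0\<close>.\<close>
    define f where "f = g + (- \<mu> e) *\<^sub>R e"
    have dS: "e \<in> dom S" "g \<in> dom S" using g by auto
    then have fd: "f \<in> dom S" unfolding f_def using sub by (intro subspace_add subspace_scale)
    have "the (S f) = the (S g) + (- \<mu> e) *\<^sub>R the (S e)"
      using lin dS subspace_scale[OF sub dS(1)] unfolding f_def lin_on_def by metis
    also have "\<dots> = - \<mu> e *\<^sub>R f" by (simp add: g f_def power2_eq_square algebra_simps)
    finally have "0 \<le> (- \<mu> e *\<^sub>R f) \<bullet> f" using S fd unfolding positive_op_def by metis
    moreover have "\<mu> e > 0" using mu[OF e] \<open>c > 0\<close> by linarith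
    ultimately have "f \<bullet> f \<le> 0" by (simp add: mult_le_0_iff)
    then have "f = 0" by (metis inner_eq_zero_iff inner_ge_zero order_antisym)
    then show ?thesis using g by (simp add: f_def)
  qed
  have "S x = diag \<mu> x" for x
    using self_adjoint_diagonal[OF conjunct1[OF S] eig, of x] diag_eq[of \<mu> x] by (metis option.exhaust)
  then show "S = diag \<mu>" by auto
qed

lemma (in onb) half_power_diagonal:
  assumes s: "op_sqrt A = diag \<mu>" and mu: "\<And>e. e \<in> E \<Longrightarrow> \<mu> e \<ge> c" and "c > 0"
  shows "half_power A k x = Some y \<longleftrightarrow> (\<forall>e\<in>E. y \<bullet> e = \<mu> e ^ k * (x \<bullet> e))"
proof (induction k arbitrary: y)
  case 0
  show ?case by (auto simp: half_power_def intro: eqI)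
next
  case (Suc k)
  have pos: "\<mu> e > 0" if "e \<in> E" for e using mu[OF that] \<open>c > 0\<close> by linarith
  have "half_power A (Suc k) x = Some y \<longleftrightarrow> (\<exists>z. half_power A k x = Some z \<and> diag \<mu> z = Some y)"
    by (simp add: half_power_def s map_comp_def split: option.splits)
  also have "\<dots> \<longleftrightarrow> (\<exists>z. (\<forall>e\<in>E. z \<bullet> e = \<mu> e ^ k * (x \<bullet> e)) \<and> (\<forall>e\<in>E. y \<bullet> e = \<mu> e * (z \<bullet> e)))"
    by (simp add: Suc diag_eq)
  also have "\<dots> \<longleftrightarrow> (\<forall>e\<in>E. y \<bullet> e = \<mu> e ^ Suc k * (x \<bullet> e))"
  proof
    assume y: "\<forall>e\<in>E. y \<bullet> e = \<mu> e ^ Suc k * (x \<bullet> e)"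
    obtain z where "\<forall>e\<in>E. z \<bullet> e = (1 / \<mu> e) * (y \<bullet> e)"
      using ex_multiplier[of "\<lambda>e. 1 / \<mu> e" "1 / c" y] mu \<open>c > 0\<close> pos by (force simp: abs_le_iff frac_le)
    then show "\<exists>z. (\<forall>e\<in>E. z \<bullet> e = \<mu> e ^ k * (x \<bullet> e)) \<and> (\<forall>e\<in>E. y \<bullet> e = \<mu> e * (z \<bullet> e))"
      using y pos by (intro exI[of _ z]) (auto simp: less_imp_neq[symmetric])
  qed auto
  finally show ?case .
qed

text \<open>The resolvent \<open>R\<close> at the point \<open>m\<close> is linear, injective and
  symmetric, and compact by hypothesis. Its eigenbasis also diagonalises \<open>A\<close>, with
  eigenvalue \<open>m + 1 / r\<close> where \<open>R e = r e\<close>.\<close>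

lemma abstract_setting_eigenbasis:
  assumes "abstract_setting (A :: 'h::{real_inner,complete_space} operator)"
  shows "\<exists>E \<mu> c. eigenbasis E A \<mu> c"
proof -
  from assms obtain \<omega> where sa: "self_adjoint A" and po: "positive_op A" and cr: "compact_resolvent A"
    and om: "\<omega> > 0" "\<And>u. u \<in> dom A \<Longrightarrow> norm (the (A u)) \<ge> \<omega> * norm u"
    by (auto simp: abstract_setting_def)
  have sub: "subspace (dom A)" and lin: "lin_on (dom A) (\<lambda>u. the (A u))" using sa by (auto simp: self_adjoint_def)
  from cr obtain m where bij: "bij_betw (\<lambda>u. the (A u) - m *\<^sub>R u) (dom A) UNIV"
    and cpt: "compact (closure (inv_into (dom A) (\<lambda>u. the (A u) - m *\<^sub>R u) ` cball 0 1))"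
    by (auto simp: compact_resolvent_def)
  define f where "f u = the (A u) - m *\<^sub>R u" for u
  define R where "R = inv_into (dom A) f"
  have surj: "f ` dom A = UNIV" using bij_betw_imp_surj_on[OF bij] unfolding f_def .
  have fR: "f (R y) = y" "R y \<in> dom A" for y
    using f_inv_into_f[of y f "dom A"] inv_into_into[of y f "dom A"] by (simp_all add: surj R_def)
  have Rf: "R (f u) = u" if "u \<in> dom A" for u
    using bij_betw_inv_into_left[OF bij that] unfolding R_def f_def by simp
  have fadd: "f (u + v) = f u + f v" if "u \<in> dom A" "v \<in> dom A" for u v
    using lin that by (simp add: lin_on_def f_def algebra_simps)
  have fscale: "f (c *\<^sub>R u) = c *\<^sub>R f u" if "u \<in> dom A" for u c
    using lin that by (simp add: lin_on_def f_def algebra_simps)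
  have "linear R"
  proof
    fix x y c
    have "R x + R y = R (f (R x + R y))" using Rf fR subspace_add[OF sub] by simp
    then show "R (x + y) = R x + R y" by (simp add: fadd fR)
    have "c *\<^sub>R R x = R (f (c *\<^sub>R R x))" using Rf fR subspace_scale[OF sub] by simp
    then show "R (c *\<^sub>R x) = c *\<^sub>R R x" by (simp add: fscale fR)
  qed
  have "inj R" by (rule inj_on_inverseI[where g = f]) (rule fR)
  have sym: "R x \<bullet> y = x \<bullet> R y" for x y
  proof -
    have "A (R y) = Some (the (A (R y)))" using fR(2)[of y] by (simp add: domIff)
    from self_adjoint_symmetric[OF sa fR(2) this]
    have "the (A (R x)) \<bullet> R y = R x \<bullet> the (A (R y))" .
    then have "f (R x) \<bullet> R y = R x \<bullet> f (R y)" by (simp add: f_def inner_diff)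
    then show ?thesis by (simp add: fR(1) inner_commute)
  qed
  obtain E where "onb E" and eR: "\<And>e. e \<in> E \<Longrightarrow> \<exists>r. R e = r *\<^sub>R e"
    using compact_symmetric_eigenbasis[OF \<open>linear R\<close> \<open>inj R\<close> sym] cpt unfolding R_def f_def by blast
  interpret onb E by fact
  have "\<exists>l\<ge>\<omega>. A e = Some (l *\<^sub>R e)" if e: "e \<in> E" for e
  proof -
    obtain r where r: "R e = r *\<^sub>R e" using eR e by blast
    have ne: "norm e = 1" using orth[OF e e] by (simp add: norm_eq_1)
    then have "R e \<noteq> 0" using \<open>inj R\<close> linear_0[OF \<open>linear R\<close>] by (metis injD norm_zero zero_neq_one)
    then have "r \<noteq> 0" using r by auto
    have ed: "e \<in> dom A" using subspace_scale[OF sub fR(2)[of e], of "1 / r"] r \<open>r \<noteq> 0\<close> by simp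
    have "e = f (r *\<^sub>R e)" using fR(1)[of e] r by simp
    also have "\<dots> = r *\<^sub>R f e" using fscale[OF ed] .
    finally have "(1 / r) *\<^sub>R e = (1 / r) *\<^sub>R (r *\<^sub>R f e)" by (rule arg_cong)
    then have "(1 / r) *\<^sub>R e = f e" using \<open>r \<noteq> 0\<close> by simp
    then have Ae: "the (A e) = (m + 1 / r) *\<^sub>R e" by (simp add: f_def algebra_simps)
    have "0 \<le> the (A e) \<bullet> e" using po ed by (simp add: positive_op_def)
    then have "0 \<le> m + 1 / r" using orth[OF e e] by (simp add: Ae)
    \<comment> \<open>The lower bound on \<open>A\<close> controls only the modulus; the sign comes
      from positivity.\<close>
    moreover have "\<omega> \<le> \<bar>m + 1 / r\<bar>" using om(2)[OF ed] ne by (simp add: Ae)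
    ultimately show ?thesis using Ae ed by (intro exI[of _ "m + 1 / r"]) (auto simp: domIff)
  qed
  then obtain l where l: "\<And>e. e \<in> E \<Longrightarrow> \<omega> \<le> l e \<and> A e = Some (l e *\<^sub>R e)" by metis
  define \<mu> where "\<mu> e = sqrt (l e)" for e
  have mul: "(\<mu> e)\<^sup>2 = l e" "sqrt \<omega> \<le> \<mu> e" if "e \<in> E" for e
    using l[OF that] om(1) by (auto simp: \<mu>_def)
  have Ad: "A x = Some y \<longleftrightarrow> (\<forall>e\<in>E. y \<bullet> e = (\<mu> e)\<^sup>2 * (x \<bullet> e))" for x y
    using self_adjoint_diagonal[OF sa, of l x y] l mul by simp
  have "A = diag (\<lambda>e. (\<mu> e)\<^sup>2)"
  proof
    fix x show "A x = diag (\<lambda>e. (\<mu> e)\<^sup>2) x"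
      using Ad[of x] diag_eq[of "\<lambda>e. (\<mu> e)\<^sup>2" x] by (metis option.exhaust)
  qed
  then have "op_sqrt A = diag \<mu>" using mul(2) om(1) by (intro op_sqrt_diagonal[where c = "sqrt \<omega>"]) auto
  then have "half_power A k x = Some y \<longleftrightarrow> (\<forall>e\<in>E. y \<bullet> e = \<mu> e ^ k * (x \<bullet> e))" for k x y
    using mul(2) om(1) by (intro half_power_diagonal[where c = "sqrt \<omega>"]) auto
  then have "eigenbasis E A \<mu> (sqrt \<omega>)"
    using mul(2) om(1) Ad by unfold_locales auto
  then show ?thesis by blast
qed

section \<open>The scale of spaces in spectral coordinates\<close>

context eigenbasis
begin

lemma mu_pos: "e \<in> E \<Longrightarrow> \<mu> e > 0"
  using mu_ge[of e] c0 by linarith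

lemma mu_nz: "e \<in> E \<Longrightarrow> \<mu> e \<noteq> 0"
  using mu_pos by force

text \<open>\<open>sc s \<phi> \<psi>\<close> says that \<open>\<phi>\<close> is in the domain of \<open>A\<^bsup>s/2\<^esup>\<close> and \<open>\<psi> = A\<^bsup>s/2\<^esup> \<phi>\<close>.\<close>

definition sc :: "int \<Rightarrow> 'h \<Rightarrow> 'h \<Rightarrow> bool" where
  "sc s \<phi> \<psi> \<longleftrightarrow> (\<forall>e\<in>E. \<psi> \<bullet> e = \<mu> e powi s * (\<phi> \<bullet> e))"

lemma sc_unique: "sc s \<phi> \<psi> \<Longrightarrow> sc s \<phi> \<psi>' \<Longrightarrow> \<psi> = \<psi>'"
  by (rule eqI) (simp add: sc_def)

lemma sc_sym: "sc s \<phi> \<psi> \<Longrightarrow> sc (- s) \<psi> \<phi>"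
  using mu_nz by (auto simp: sc_def power_int_minus field_simps)

lemma sc_trans: "sc s \<phi> \<psi> \<Longrightarrow> sc r \<psi> \<xi> \<Longrightarrow> sc (s + r) \<phi> \<xi>"
  using mu_nz by (auto simp: sc_def power_int_add)

lemma sc_0: "sc 0 \<phi> \<phi>"
  by (simp add: sc_def)

lemma sc_basis: "e \<in> E \<Longrightarrow> sc s e (\<mu> e powi s *\<^sub>R e)"
  by (auto simp: sc_def orth)

lemma sc_lin: "sc s \<phi> \<psi> \<Longrightarrow> sc s \<phi>' \<psi>' \<Longrightarrow> sc s (a *\<^sub>R \<phi> + c *\<^sub>R \<phi>') (a *\<^sub>R \<psi> + c *\<^sub>R \<psi>')"
  by (auto simp: sc_def inner_add_left algebra_simps)

lemma sc_ex:
  assumes "s \<le> 0"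
  shows "\<exists>\<psi>. sc s \<phi> \<psi> \<and> norm \<psi> \<le> c\<^sub>0 powi s * norm \<phi>"
proof -
  have "\<bar>\<mu> e powi s\<bar> \<le> c\<^sub>0 powi s" if "e \<in> E" for e
  proof -
    have "\<mu> e powi s = inverse (\<mu> e) ^ nat (- s)" "c\<^sub>0 powi s = inverse c\<^sub>0 ^ nat (- s)"
      using assms by (auto simp: power_int_def)
    moreover have "inverse (\<mu> e) \<le> inverse c\<^sub>0" using mu_ge[OF that] c0 by (intro le_imp_inverse_le)
    ultimately show ?thesis using mu_pos[OF that] by (simp add: power_mono)
  qed
  from ex_multiplier[of "\<lambda>e. \<mu> e powi s" "c\<^sub>0 powi s" \<phi>, OF this]
  show ?thesis using c0 by (simp add: sc_def)
qed

lemma sc_mono: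
  assumes "sc s \<phi> \<psi>" "r \<le> s"
  shows "\<exists>\<xi>. sc r \<phi> \<xi> \<and> norm \<xi> \<le> c\<^sub>0 powi (r - s) * norm \<psi>"
  using sc_ex[of "r - s" \<psi>] sc_trans[OF assms(1), of "r - s"] assms(2) by auto

lemma sc_diff: "sc s \<phi> \<psi> \<Longrightarrow> sc r \<phi> \<xi> \<Longrightarrow> sc (r - s) \<psi> \<xi>"
  using sc_trans[OF sc_sym, of s \<phi> \<psi> r \<xi>] by simp

text \<open>Symmetry of \<open>A^{s/2}\<close>, read off from Parseval; it moves powers of either
  sign across scalar products.\<close>

lemma sc_adj:
  assumes "sc s a b" "sc s c d"
  shows "b \<bullet> c = a \<bullet> d"
proof -
  have "((\<lambda>e. (b \<bullet> e) * (c \<bullet> e)) has_sum a \<bullet> d) E"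
    using parseval[of a d] by (rule has_sum_cong[THEN iffD1, rotated]) (use assms in \<open>auto simp: sc_def\<close>)
  then show ?thesis using parseval[of b c] has_sum_unique by blast
qed

lemma half_power_sc: "half_power A k \<phi> = Some \<psi> \<longleftrightarrow> sc (int k) \<phi> \<psi>"
  by (simp add: half_power_eq sc_def)

lemma Hdom_iff: "\<phi> \<in> Hdom A k \<longleftrightarrow> (\<exists>\<psi>. sc (int k) \<phi> \<psi>)"
  by (simp add: Hdom_def dom_def half_power_sc)

lemma Hdom_norm_sc: "sc (int k) \<phi> \<psi> \<Longrightarrow> Hdom_norm A k \<phi> = norm \<psi>"
  unfolding Hdom_norm_def by (simp add: half_power_sc[symmetric])

lemma A_sc: "A \<phi> = Some \<psi> \<longleftrightarrow> sc 2 \<phi> \<psi>"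
  by (simp add: A_eq sc_def)

text \<open>A total function standing for \<open>A^{s/2}\<close>; for positive \<open>s\<close> its
  value is meaningful only where \<open>sc\<close> relates the argument to some vector.\<close>

definition pw :: "int \<Rightarrow> 'h \<Rightarrow> 'h" where
  "pw s \<phi> = (THE \<psi>. sc s \<phi> \<psi>)"

lemma pw_eq: "sc s \<phi> \<psi> \<Longrightarrow> pw s \<phi> = \<psi>"
  unfolding pw_def using sc_unique by blast

lemma sc_pw: "s \<le> 0 \<Longrightarrow> sc s \<phi> (pw s \<phi>)"
  using sc_ex pw_eq by metis

lemma pw_inner: "s \<le> 0 \<Longrightarrow> e \<in> E \<Longrightarrow> pw s \<phi> \<bullet> e = \<mu> e powi s * (\<phi> \<bullet> e)"
  using sc_pw by (simp add: sc_def)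

lemma norm_pw_le: "s \<le> 0 \<Longrightarrow> norm (pw s \<phi>) \<le> c\<^sub>0 powi s * norm \<phi>"
  using sc_ex pw_eq by metis

lemma bounded_linear_pw:
  assumes "s \<le> 0" shows "bounded_linear (pw s)"
proof (rule bounded_linear_intro[where K = "c\<^sub>0 powi s"])
  fix x y :: 'h and c :: real
  show "pw s (x + y) = pw s x + pw s y"
    using sc_lin[OF sc_pw[OF assms] sc_pw[OF assms], of 1 x 1 y] by (auto intro: pw_eq)
  show "pw s (c *\<^sub>R x) = c *\<^sub>R pw s x"
    using sc_lin[OF sc_pw[OF assms] sc_pw[OF assms], of c x 0 x] by (auto intro: pw_eq)
qed (use norm_pw_le[OF assms] in \<open>simp add: mult.commute\<close>)

text \<open>\<open>fn s\<close> is the isometry of \<open>H\<close> onto \<open>H\<^sub>s\<close> that inverts \<open>A\<^bsup>s/2\<^esup>\<close>, with the elements of \<open>H\<^sub>s\<close> seen as functionals.\<close>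

definition fn :: "int \<Rightarrow> 'h \<Rightarrow> 'h \<Rightarrow> real" where
  "fn s y \<phi> = (if \<exists>\<psi>. sc (- s) \<phi> \<psi> then y \<bullet> pw (- s) \<phi> else 0)"

lemma fn_eval: "sc (- s) \<phi> \<psi> \<Longrightarrow> fn s y \<phi> = y \<bullet> \<psi>"
  using pw_eq by (auto simp: fn_def)

lemma fn_basis: "e \<in> E \<Longrightarrow> fn s y e = \<mu> e powi (- s) * (y \<bullet> e)"
  using fn_eval[OF sc_basis] by simp

lemma fn_0: "fn s 0 = (\<lambda>_. 0)"
  by (auto simp: fn_def)

lemma fn_inj: "fn s y = fn s z \<Longrightarrow> y = z"
proof (rule eqI)
  fix e assume "fn s y = fn s z" "e \<in> E"
  then have "\<mu> e powi (- s) * (y \<bullet> e) = \<mu> e powi (- s) * (z \<bullet> e)" by (metis fn_basis)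
  then show "y \<bullet> e = z \<bullet> e" using mu_nz[OF \<open>e \<in> E\<close>] by (simp add: power_int_eq_0_iff)
qed

lemma inj_pivot: "inj (pivot :: 'h \<Rightarrow> _)"
proof (rule injI)
  fix x y :: 'h assume "pivot x = pivot y"
  then have "x \<bullet> (x - y) = y \<bullet> (x - y)" by (metis pivot_def)
  then have "(x - y) \<bullet> (x - y) = 0" by (simp add: inner_diff_left)
  then show "x = y" by simp
qed

lemma vec_of_pivot: "vec_of (pivot y) = (y :: 'h)"
  using inj_pivot by simp

lemma fn_pivot: "s \<ge> 0 \<Longrightarrow> fn s y = pivot (pw (- s) y)"
proof
  fix \<phi> assume "s \<ge> 0"
  then have "sc (- s) y (pw (- s) y)" "sc (- s) \<phi> (pw (- s) \<phi>)" by (auto intro: sc_pw)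
  then show "fn s y \<phi> = pivot (pw (- s) y) \<phi>" using sc_adj fn_eval by (simp add: pivot_def)
qed

lemma fn_0_pivot: "fn 0 y = pivot y"
  using fn_pivot[of 0 y] pw_eq[OF sc_0] by simp

lemma vec_of_fn: "s \<ge> 0 \<Longrightarrow> vec_of (fn s y) = pw (- s) y"
  by (simp add: fn_pivot vec_of_pivot)

text \<open>For negative \<open>s\<close> this is Riesz representation: composing a functional on
  \<open>H_{-s}\<close> with \<open>A^{s/2}\<close> gives a bounded functional on \<open>H\<close>,
  whose vector is the coordinate.\<close>

lemma Hs_eq: "Hs A s = range (fn s)"
proof (cases "s \<ge> 0")
  case True
  have "pivot x \<in> range (fn s)" if x: "x \<in> Hdom A (nat s)" for x
  proof -
    from x obtain y where "sc s x y" using True by (auto simp: Hdom_iff)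
    then have "pw (- s) y = x" using sc_sym pw_eq by blast
    then show ?thesis using fn_pivot[OF True, of y] by (metis rangeI)
  qed
  moreover have "fn s y \<in> pivot ` Hdom A (nat s)" for y
  proof -
    have "sc s (pw (- s) y) y" using sc_sym[OF sc_pw[of "- s" y]] True by simp
    then have "pw (- s) y \<in> Hdom A (nat s)" using True by (auto simp: Hdom_iff)
    then show ?thesis using True by (simp add: fn_pivot)
  qed
  ultimately have "pivot ` Hdom A (nat s) = range (fn s)" by blast
  then show ?thesis using True by (simp add: Hs_def)
next
  case False
  define m where "m = nat (- s)"
  have m: "int m = - s" using False by (simp add: m_def)
  have f1: "u \<in> range (fn s)" if lin: "lin_on (Hdom A m) u"
    and K: "\<forall>\<phi>\<in>Hdom A m. \<bar>u \<phi>\<bar> \<le> K * Hdom_norm A m \<phi>" and z: "\<forall>\<phi>. \<phi> \<notin> Hdom A m \<longrightarrow> u \<phi> = 0" for u K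
  proof -
    have s: "sc (- s) (pw s \<psi>) \<psi>" for \<psi> using sc_sym[OF sc_pw[of s \<psi>]] False by simp
    then have inH: "pw s \<psi> \<in> Hdom A m" for \<psi> using m by (auto simp: Hdom_iff)
    have "s \<le> 0" using False by simp
    from bounded_linear.linear[OF bounded_linear_pw[OF this]] have pl: "linear (pw s)" .
    have "lin_on UNIV (\<lambda>\<psi>. u (pw s \<psi>))"
      using lin inH by (auto simp: lin_on_def linear_add[OF pl] linear_scale[OF pl])
    moreover have "\<bar>u (pw s \<psi>)\<bar> \<le> K * norm \<psi>" for \<psi>
      using K inH[of \<psi>] Hdom_norm_sc[of m "pw s \<psi>" \<psi>] s[of \<psi>] m by fastforce
    ultimately obtain y where y: "\<And>\<psi>. y \<bullet> \<psi> = u (pw s \<psi>)"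
      using riesz_closed_subspace[OF subspace_UNIV closed_UNIV, of "\<lambda>\<psi>. u (pw s \<psi>)" K] by blast
    have "u \<phi> = fn s y \<phi>" for \<phi>
    proof (cases "\<phi> \<in> Hdom A m")
      case True
      then obtain \<psi> where p: "sc (- s) \<phi> \<psi>" using m by (auto simp: Hdom_iff)
      then have "pw s \<psi> = \<phi>" using sc_sym[OF p] pw_eq by simp
      then show ?thesis using y[of \<psi>] fn_eval[OF p] by simp
    next
      case False
      then show ?thesis using z m by (auto simp: Hdom_iff fn_def)
    qed
    then show ?thesis by auto
  qed
  have f2: "lin_on (Hdom A m) (fn s y)" for y
    unfolding lin_on_def
  proof (intro conjI ballI allI)
    fix \<phi> \<phi>' c assume "\<phi> \<in> Hdom A m" "\<phi>' \<in> Hdom A m"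
    then obtain \<psi> \<psi>' where *: "sc (- s) \<phi> \<psi>" "sc (- s) \<phi>' \<psi>'" using m by (auto simp: Hdom_iff)
    show "fn s y (\<phi> + \<phi>') = fn s y \<phi> + fn s y \<phi>'"
      using fn_eval[OF sc_lin[OF *, of 1 1]] fn_eval[OF *(1)] fn_eval[OF *(2)] by (simp add: inner_add_right)
  next
    fix \<phi> c assume "\<phi> \<in> Hdom A m"
    then obtain \<psi> where *: "sc (- s) \<phi> \<psi>" using m by (auto simp: Hdom_iff)
    show "fn s y (c *\<^sub>R \<phi>) = c *\<^sub>R fn s y \<phi>"
      using fn_eval[OF sc_lin[OF * *, of c 0]] fn_eval[OF *] by simp
  qed
  have f3: "\<bar>fn s y \<phi>\<bar> \<le> norm y * Hdom_norm A m \<phi>" if p: "\<phi> \<in> Hdom A m" for y \<phi>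
  proof -
    obtain \<psi> where *: "sc (- s) \<phi> \<psi>" using p m by (auto simp: Hdom_iff)
    then show ?thesis using fn_eval[OF *, of y] Hdom_norm_sc[of m \<phi> \<psi>] m by (simp add: Cauchy_Schwarz_ineq2)
  qed
  have f4: "fn s y \<phi> = 0" if "\<phi> \<notin> Hdom A m" for y \<phi>
    using that m by (auto simp: Hdom_iff fn_def)
  have f5: "u \<in> Hs A s \<longleftrightarrow> lin_on (Hdom A m) u \<and>
      (\<exists>K. \<forall>\<phi>\<in>Hdom A m. \<bar>u \<phi>\<bar> \<le> K * Hdom_norm A m \<phi>) \<and> (\<forall>\<phi>. \<phi> \<notin> Hdom A m \<longrightarrow> u \<phi> = 0)" for u
    using False by (simp add: Hs_def m_def)
  show ?thesis
  proof (intro set_eqI iffI)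
    fix u assume "u \<in> Hs A s"
    then show "u \<in> range (fn s)" unfolding f5 using f1 by blast
  next
    fix u assume "u \<in> range (fn s)"
    then obtain y where "u = fn s y" by blast
    then show "u \<in> Hs A s" unfolding f5 using f2[of y] f3[of _ y] f4[of _ y] by blast
  qed
qed

text \<open>The values of \<open>u\<close> are prescribed only on the domain of
  \<open>A^{-s/2}\<close>, since \<open>u\<close> will be a difference quotient or an element of a
  smaller space of the scale.\<close>

lemma Hs_norm_eq:
  assumes u: "\<And>\<phi> \<psi>. sc (- s) \<phi> \<psi> \<Longrightarrow> u \<phi> = y \<bullet> \<psi>"
  shows "Hs_norm A s u = norm y"
proof (cases "s \<ge> 0")
  case True
  have "u = fn s y"
  proof
    fix \<phi> show "u \<phi> = fn s y \<phi>" using u fn_eval sc_pw[of "- s" \<phi>] True by auto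
  qed
  moreover have "sc (int (nat s)) (pw (- s) y) y" using sc_sym[OF sc_pw[of "- s" y]] True by simp
  ultimately show ?thesis using True Hdom_norm_sc by (simp add: Hs_norm_def vec_of_fn)
next
  case False
  define m where "m = nat (- s)"
  have m: "int m = - s" using False by (simp add: m_def)
  define D where "D = {\<phi> \<in> Hdom A m. Hdom_norm A m \<phi> \<le> 1}"
  have s: "sc (- s) (pw s \<psi>) \<psi>" for \<psi> using sc_sym[OF sc_pw[of s \<psi>]] False by simp
  have up: "\<bar>u \<phi>\<bar> \<le> norm y" if p: "\<phi> \<in> D" for \<phi>
  proof -
    obtain \<psi> where *: "sc (- s) \<phi> \<psi>" using p m by (auto simp: Hdom_iff D_def)
    then have "norm \<psi> \<le> 1" using p Hdom_norm_sc[of m \<phi> \<psi>] m by (simp add: D_def)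
    then have "norm y * norm \<psi> \<le> norm y * 1" by (intro mult_left_mono) auto
    then show ?thesis using u[OF *] Cauchy_Schwarz_ineq2[of y \<psi>] by simp
  qed
  have inD: "pw s \<psi> \<in> D" if "norm \<psi> \<le> 1" for \<psi>
    using that s[of \<psi>] m Hdom_norm_sc[of m "pw s \<psi>" \<psi>] by (auto simp: D_def Hdom_iff)
  have "norm y \<le> (SUP \<phi>\<in>D. \<bar>u \<phi>\<bar>)"
  proof (cases "y = 0")
    case True
    have "\<bar>u (pw s 0)\<bar> \<le> (SUP \<phi>\<in>D. \<bar>u \<phi>\<bar>)"
      by (rule cSUP_upper[OF inD]) (use up in \<open>auto intro!: bdd_aboveI2[where M = "norm y"]\<close>)
    then show ?thesis using True by simp
  next
    case False
    have "\<bar>u (pw s (y /\<^sub>R norm y))\<bar> \<le> (SUP \<phi>\<in>D. \<bar>u \<phi>\<bar>)"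
      by (rule cSUP_upper[OF inD]) (use up False in \<open>auto intro!: bdd_aboveI2[where M = "norm y"]\<close>)
    \<comment> \<open>The supremum in the dual norm is attained at \<open>A^{s/2}\<close> of the
      unit vector in the direction of \<open>y\<close>.\<close>
    moreover have "u (pw s (y /\<^sub>R norm y)) = norm y"
      using u[OF s, of "y /\<^sub>R norm y"] False
      by (simp add: power2_norm_eq_inner[symmetric] power2_eq_square field_simps)
    ultimately show ?thesis by simp
  qed
  moreover have "(SUP \<phi>\<in>D. \<bar>u \<phi>\<bar>) \<le> norm y"
    by (rule cSUP_least) (use up inD[of 0] in auto)
  ultimately show ?thesis using False by (simp add: Hs_norm_def D_def m_def)
qed

lemma Hs_norm_fn: "Hs_norm A s (fn s y) = norm y"
  by (rule Hs_norm_eq) (rule fn_eval)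

lemma Hs_pair_fn: "Hs_pair s (fn s a) (fn (- s) b) = a \<bullet> b"
proof (cases "s \<ge> 0")
  case True
  then have "sc s (pw (- s) a) a" using sc_sym[OF sc_pw[of "- s" a]] by simp
  then show ?thesis using True fn_eval[of "- s" "pw (- s) a" a b]
    by (simp add: Hs_pair_def vec_of_fn inner_commute)
next
  case False
  then have "sc (- s) (pw s b) b" using sc_sym[OF sc_pw[of s b]] by simp
  then show ?thesis using False fn_eval[of s "pw s b" b a]
    by (simp add: Hs_pair_def vec_of_fn)
qed

text \<open>An element of \<open>H_s\<close> with coordinate \<open>y\<close> has coordinate
  \<open>A^{(r-s)/2} y\<close> in the larger space \<open>H_r\<close>.\<close>

lemma fn_embed:
  assumes "sc (r - s) y y'" "r \<le> s" "sc (- r) \<phi> \<xi>"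
  shows "fn s y \<phi> = y' \<bullet> \<xi>"
proof -
  obtain \<psi> where p: "sc (- s) \<phi> \<psi>" using sc_mono[OF assms(3), of "- s"] assms(2) by auto
  then have "sc (r - s) \<xi> \<psi>" using sc_diff[OF assms(3) p] by simp
  then show ?thesis using sc_adj[OF assms(1)] fn_eval[OF p] by simp
qed

lemma eventually_within: "eventually (\<lambda>r. r \<in> S) (at t within S)"
  by (auto simp: eventually_at_filter)

lemma cont_Hs_iff:
  "cont_Hs A s T w \<longleftrightarrow> (\<exists>x. continuous_on {0..T} x \<and> (\<forall>t\<in>{0..T}. w t = fn s (x t)))"
proof -
  have *: "((\<lambda>r. Hs_norm A s (\<lambda>\<phi>. w r \<phi> - w t \<phi>)) \<longlongrightarrow> 0) (at t within {0..T})
      \<longleftrightarrow> (x \<longlongrightarrow> x t) (at t within {0..T})"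
    if x: "\<forall>t\<in>{0..T}. w t = fn s (x t)" and t: "t \<in> {0..T}" for x t
  proof -
    have "Hs_norm A s (\<lambda>\<phi>. w r \<phi> - w t \<phi>) = norm (x r - x t)" if "r \<in> {0..T}" for r
      by (rule Hs_norm_eq) (use x t that in \<open>auto simp: fn_eval inner_diff_left\<close>)
    then have "\<forall>\<^sub>F r in at t within {0..T}. Hs_norm A s (\<lambda>\<phi>. w r \<phi> - w t \<phi>) = norm (x r - x t)"
      using eventually_within[of "{0..T}" t] by (rule eventually_mono[rotated])
    from tendsto_cong[OF this] show ?thesis by (simp add: tendsto_norm_zero_iff LIM_zero_iff)
  qed
  have "\<exists>x. \<forall>t\<in>{0..T}. w t = fn s (x t)" if "\<forall>t\<in>{0..T}. w t \<in> Hs A s"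
    using that by (auto simp: Hs_eq intro!: bchoice)
  then show ?thesis unfolding cont_Hs_def continuous_on using * by (fastforce simp: Hs_eq)
qed

section \<open>The wave equation as a first order system\<close>

text \<open>
  With \<open>x = A\<^bsup>s/2\<^esup> w\<close>, \<open>z = A\<^bsup>(s-1)/2\<^esup> w'\<close> and \<open>k = A\<^bsup>(s-1)/2\<^esup> f\<close> the equation \<open>w'' + A w = f\<close> becomes
  \<open>x' = A\<^bsup>1/2\<^esup> z\<close>, \<open>z' = k - A\<^bsup>1/2\<^esup> x\<close>, whatever the level \<open>s\<close>.
\<close>

definition asol :: "real \<Rightarrow> (real \<Rightarrow> 'h) \<Rightarrow> (real \<Rightarrow> 'h) \<Rightarrow> (real \<Rightarrow> 'h) \<Rightarrow> bool" where
  "asol T k x z \<longleftrightarrow> continuous_on {0..T} k \<and> continuous_on {0..T} x \<and> continuous_on {0..T} z \<and>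
     (\<forall>e\<in>E. \<forall>t\<in>{0..T}.
        ((\<lambda>t. x t \<bullet> e) has_real_derivative \<mu> e * (z t \<bullet> e)) (at t within {0..T}) \<and>
        ((\<lambda>t. z t \<bullet> e) has_real_derivative k t \<bullet> e - \<mu> e * (x t \<bullet> e)) (at t within {0..T}))"

text \<open>Differentiability is assumed for the coordinates only. The increment \<open>v\<close> is
  paired with its own truncation \<open>p\<close>, a finite sum with
  \<open>v \<bullet> p = |p|^2\<close>; the scalar mean value inequality then bounds
  \<open>|p|\<close> uniformly in the truncation.\<close>

lemma coord_mvt:
  assumes d: "\<And>e t. e \<in> E \<Longrightarrow> t \<in> {0..T} \<Longrightarrow> ((\<lambda>t. y t \<bullet> e) has_real_derivative y' t \<bullet> e) (at t within {0..T})"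
    and ab: "a \<in> {0..T}" "b \<in> {0..T}" and B: "\<And>t. t \<in> closed_segment a b \<Longrightarrow> norm (y' t) \<le> B"
  shows "norm (y b - y a) \<le> B * \<bar>b - a\<bar>"
proof -
  define v where "v = y b - y a"
  have sub: "closed_segment a b \<subseteq> {0..T}" using ab by (simp add: closed_segment_subset)
  have B0: "B \<ge> 0" using B[of a] norm_ge_zero[of "y' a"] by (simp del: norm_ge_zero)
  have "(\<Sum>e\<in>F. (v \<bullet> e)\<^sup>2) \<le> (B * \<bar>b - a\<bar>)\<^sup>2" if F: "finite F" "F \<subseteq> E" for F
  proof -
    define p where "p = proj F v"
    have dp: "((\<lambda>t. y t \<bullet> p) has_real_derivative y' t \<bullet> p) (at t within closed_segment a b)"
      if t: "t \<in> closed_segment a b" for t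
    proof -
      have "((\<lambda>t. \<Sum>e\<in>F. (v \<bullet> e) * (y t \<bullet> e)) has_real_derivative (\<Sum>e\<in>F. (v \<bullet> e) * (y' t \<bullet> e)))
          (at t within closed_segment a b)"
        using F t sub by (intro DERIV_sum DERIV_cmult DERIV_subset[OF d]) auto
      then show ?thesis by (simp add: p_def proj_def inner_sum_right)
    qed
    have "norm (y b \<bullet> p - y a \<bullet> p) \<le> (B * norm p) * norm (b - a)"
    proof (rule field_differentiable_bound[OF convex_closed_segment dp])
      fix t assume "t \<in> closed_segment a b"
      then show "norm (y' t \<bullet> p) \<le> B * norm p"
        using Cauchy_Schwarz_ineq2[of "y' t" p] B[of t] by (simp add: order_trans[OF _ mult_right_mono])
    qed auto
    moreover have "v \<bullet> p = (norm p)\<^sup>2"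
      using norm_proj[OF F, of v] by (simp add: p_def proj_def inner_sum_right power2_eq_square)
    ultimately have "(norm p)\<^sup>2 \<le> (B * norm p) * \<bar>b - a\<bar>"
      by (simp add: v_def inner_diff_left)
    then have "norm p \<le> B * \<bar>b - a\<bar>"
      using B0 by (cases "norm p = 0") (auto simp: power2_eq_square)
    then have "(norm p)\<^sup>2 \<le> (B * \<bar>b - a\<bar>)\<^sup>2" by (rule power_mono) simp
    then show ?thesis using norm_proj[OF F, of v] by (simp add: p_def)
  qed
  then have "(norm v)\<^sup>2 \<le> (B * \<bar>b - a\<bar>)\<^sup>2" by (rule norm_le_if_proj_le)
  then have "norm v \<le> B * \<bar>b - a\<bar>" by (rule power2_le_imp_le) (use B0 in simp)
  then show ?thesis by (simp add: v_def)
qed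

text \<open>The mean value bound is applied to \<open>y q - q y'(t)\<close>, whose derivative is
  small near \<open>t\<close> by continuity of \<open>y'\<close>; coordinatewise derivatives thus
  become a strong one.\<close>

lemma coord_diff_quotient:
  assumes d: "\<And>e t. e \<in> E \<Longrightarrow> t \<in> {0..T} \<Longrightarrow> ((\<lambda>t. y t \<bullet> e) has_real_derivative y' t \<bullet> e) (at t within {0..T})"
    and c: "continuous_on {0..T} y'" and t: "t \<in> {0..T}"
  shows "((\<lambda>r. (1 / (r - t)) *\<^sub>R (y r - y t)) \<longlongrightarrow> y' t) (at t within {0..T})"
proof (rule tendstoI)
  fix \<epsilon> :: real assume "\<epsilon> > 0"
  then obtain \<delta> where \<delta>: "\<delta> > 0" "\<And>r. r \<in> {0..T} \<Longrightarrow> dist r t < \<delta> \<Longrightarrow> dist (y' r) (y' t) < \<epsilon> / 2"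
    using c t unfolding continuous_on_iff by (metis half_gt_zero)
  have "dist ((1 / (r - t)) *\<^sub>R (y r - y t)) (y' t) < \<epsilon>"
    if r: "r \<in> {0..T}" "dist r t < \<delta>" "r \<noteq> t" for r
  proof -
    have "norm ((y r - r *\<^sub>R y' t) - (y t - t *\<^sub>R y' t)) \<le> (\<epsilon> / 2) * \<bar>r - t\<bar>"
    proof (rule coord_mvt[where T = T and y' = "\<lambda>q. y' q - y' t"])
      fix q assume q: "q \<in> closed_segment t r"
      have "q \<in> {0..T}" using q closed_segment_subset[of t "{0..T}" r] t r by auto
      moreover have "dist q t < \<delta>" using q r by (auto simp: closed_segment_eq_real_ivl dist_real_def split: if_splits)
      ultimately show "norm (y' q - y' t) \<le> \<epsilon> / 2" using \<delta>(2)[of q] by (simp add: dist_norm)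
    next
      fix e q assume eq: "e \<in> E" "q \<in> {0..T}"
      have "((\<lambda>q. y q \<bullet> e - q * (y' t \<bullet> e)) has_real_derivative y' q \<bullet> e - 1 * (y' t \<bullet> e)) (at q within {0..T})"
        by (intro DERIV_diff d eq DERIV_cmult_right DERIV_ident)
      then show "((\<lambda>q. (y q - q *\<^sub>R y' t) \<bullet> e) has_real_derivative (y' q - y' t) \<bullet> e) (at q within {0..T})"
        by (simp add: inner_diff_left)
    qed (use t r in auto)
    then have "norm ((y r - y t) - (r - t) *\<^sub>R y' t) \<le> (\<epsilon> / 2) * \<bar>r - t\<bar>"
      by (simp add: algebra_simps)
    moreover have "(1 / (r - t)) *\<^sub>R (y r - y t) - y' t = (1 / (r - t)) *\<^sub>R ((y r - y t) - (r - t) *\<^sub>R y' t)"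
      using r by (simp add: scaleR_diff_right)
    then have "norm ((1 / (r - t)) *\<^sub>R (y r - y t) - y' t) = norm ((y r - y t) - (r - t) *\<^sub>R y' t) / \<bar>r - t\<bar>"
      by simp
    ultimately have "norm ((1 / (r - t)) *\<^sub>R (y r - y t) - y' t) \<le> \<epsilon> / 2"
      using r by (simp add: pos_divide_le_eq)
    then show ?thesis using \<open>\<epsilon> > 0\<close> by (simp add: dist_norm)
  qed
  then show "\<forall>\<^sub>F r in at t within {0..T}. dist ((1 / (r - t)) *\<^sub>R (y r - y t)) (y' t) < \<epsilon>"
    using \<delta>(1) by (auto simp: eventually_at)
qed

lemma inner_has_derivative:
  assumes "((\<lambda>r. (1 / (r - t)) *\<^sub>R (y r - y t)) \<longlongrightarrow> y't) (at t within S)"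
  shows "((\<lambda>t. y t \<bullet> \<phi>) has_real_derivative y't \<bullet> \<phi>) (at t within S)"
  unfolding has_field_derivative_iff
  using tendsto_inner[OF assms tendsto_const[of \<phi>]] by (simp add: inner_diff_left)

lemma pw_continuous_on: "s \<le> 0 \<Longrightarrow> continuous_on S x \<Longrightarrow> continuous_on S (\<lambda>t. pw s (x t))"
  using bounded_linear.continuous_on[OF bounded_linear_pw] .

lemma asol_D:
  assumes "asol T k x z"
  shows "continuous_on {0..T} k" "continuous_on {0..T} x" "continuous_on {0..T} z"
    and "\<And>e t. e \<in> E \<Longrightarrow> t \<in> {0..T} \<Longrightarrow> ((\<lambda>t. x t \<bullet> e) has_real_derivative \<mu> e * (z t \<bullet> e)) (at t within {0..T})"
    and "\<And>e t. e \<in> E \<Longrightarrow> t \<in> {0..T} \<Longrightarrow> ((\<lambda>t. z t \<bullet> e) has_real_derivative k t \<bullet> e - \<mu> e * (x t \<bullet> e)) (at t within {0..T})"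
  using assms by (auto simp: asol_def)

text \<open>Applying \<open>A^{-1/2}\<close> removes the unbounded factor: the coordinates of
  \<open>A^{-1/2} x\<close> and \<open>A^{-1/2} z\<close> have derivatives that are coordinates of
  continuous functions.\<close>

lemma asol_diff_quotients:
  assumes a: "asol T k x z" and t: "t \<in> {0..T}"
  shows "((\<lambda>r. (1 / (r - t)) *\<^sub>R (pw (-1) (x r) - pw (-1) (x t))) \<longlongrightarrow> z t) (at t within {0..T})"
    and "((\<lambda>r. (1 / (r - t)) *\<^sub>R (pw (-1) (z r) - pw (-1) (z t))) \<longlongrightarrow> pw (-1) (k t) - x t) (at t within {0..T})"
proof -
  have "((\<lambda>t. pw (-1) (x t) \<bullet> e) has_real_derivative z t \<bullet> e) (at t within {0..T})"
    if "e \<in> E" "t \<in> {0..T}" for e t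
    using DERIV_cmult[OF asol_D(4)[OF a that], of "inverse (\<mu> e)"] mu_nz[OF that(1)]
    by (simp add: pw_inner that power_int_minus field_simps)
  from coord_diff_quotient[OF this asol_D(3)[OF a] t]
  show "((\<lambda>r. (1 / (r - t)) *\<^sub>R (pw (-1) (x r) - pw (-1) (x t))) \<longlongrightarrow> z t) (at t within {0..T})" .
  have "((\<lambda>t. pw (-1) (z t) \<bullet> e) has_real_derivative (pw (-1) (k t) - x t) \<bullet> e) (at t within {0..T})"
    if "e \<in> E" "t \<in> {0..T}" for e t
    using DERIV_cmult[OF asol_D(5)[OF a that], of "inverse (\<mu> e)"] mu_nz[OF that(1)]
    by (simp add: pw_inner inner_diff_left that power_int_minus field_simps)
  from coord_diff_quotient[OF this _ t]
  show "((\<lambda>r. (1 / (r - t)) *\<^sub>R (pw (-1) (z r) - pw (-1) (z t))) \<longlongrightarrow> pw (-1) (k t) - x t) (at t within {0..T})"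
    using asol_D(1,2)[OF a] by (simp add: continuous_on_diff pw_continuous_on)
qed

lemma wave_diff_quotient_norm:
  assumes "w r = fn s (x r)" "w t = fn s (x t)" "w't = fn (s - 1) zt"
  shows "Hs_norm A (s - 1) (\<lambda>\<phi>. (w r \<phi> - w t \<phi>) / (r - t) - w't \<phi>)
    = norm ((1 / (r - t)) *\<^sub>R (pw (-1) (x r) - pw (-1) (x t)) - zt)"
proof (rule Hs_norm_eq)
  fix \<phi> \<psi> assume p: "sc (- (s - 1)) \<phi> \<psi>"
  have "fn s y \<phi> = pw (-1) y \<bullet> \<psi>" for y
    using fn_embed[of "s - 1" s y "pw (-1) y", OF _ _ p] sc_pw[of "-1" y] by simp
  then show "(w r \<phi> - w t \<phi>) / (r - t) - w't \<phi> = ((1 / (r - t)) *\<^sub>R (pw (-1) (x r) - pw (-1) (x t)) - zt) \<bullet> \<psi>"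
    using assms fn_eval[OF p] by (simp add: inner_diff_left)
qed

text \<open>The integrated equation is the fundamental theorem of calculus for the scalar product of
  \<open>A^{-1/2} z\<close> with \<open>A^{(2-s)/2} \<phi>\<close>, which equals
  \<open>w' \<phi>\<close>.\<close>

lemma wave_sol_if_asol:
  assumes a: "asol T k x z"
    and f: "\<And>r \<phi> \<phi>'. r \<in> {0..T} \<Longrightarrow> sc (1 - s) \<phi> \<phi>' \<Longrightarrow> \<phi> \<in> Hdom A (nat (max 2 (2 - s))) \<Longrightarrow> f r \<phi> = k r \<bullet> \<phi>'"
    and w: "\<And>t. t \<in> {0..T} \<Longrightarrow> w t = fn s (x t)" "\<And>t. t \<in> {0..T} \<Longrightarrow> w' t = fn (s - 1) (z t)"
  shows "wave_sol A s T f w w'"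
  unfolding wave_sol_def
proof (intro conjI ballI)
  show "cont_Hs A s T w" "cont_Hs A (s - 1) T w'"
    using asol_D(2,3)[OF a] w by (auto simp: cont_Hs_iff)
next
  fix t assume t: "t \<in> {0..T}"
  have "\<forall>\<^sub>F r in at t within {0..T}. Hs_norm A (s - 1) (\<lambda>\<phi>. (w r \<phi> - w t \<phi>) / (r - t) - w' t \<phi>)
      = norm ((1 / (r - t)) *\<^sub>R (pw (-1) (x r) - pw (-1) (x t)) - z t)"
    using eventually_within[of "{0..T}" t]
    by (rule eventually_mono) (rule wave_diff_quotient_norm, use w t in auto)
  from tendsto_cong[OF this] asol_diff_quotients(1)[OF a t]
  show "((\<lambda>r. Hs_norm A (s - 1) (\<lambda>\<phi>. (w r \<phi> - w t \<phi>) / (r - t) - w' t \<phi>)) \<longlongrightarrow> 0) (at t within {0..T})"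
    by (simp add: tendsto_norm_zero_iff LIM_zero_iff)
next
  fix \<phi> t assume p: "\<phi> \<in> Hdom A (nat (max 2 (2 - s)))" and t: "t \<in> {0..T}"
  have "int (nat (max 2 (2 - s))) = max 2 (2 - s)" by simp
  then obtain \<psi> where \<psi>: "sc (max 2 (2 - s)) \<phi> \<psi>" using p unfolding Hdom_iff by metis
  \<comment> \<open>The regularity index of the test functions dominates all three exponents that
    occur: the one pairing with \<open>w'\<close> and \<open>f\<close>, the next higher one, and
    that of \<open>A \<phi>\<close>.\<close>
  have "1 - s \<le> max 2 (2 - s)" "2 - s \<le> max 2 (2 - s)" "2 \<le> max 2 (2 - s)" by auto
  then obtain p1 p2 pA where p1: "sc (1 - s) \<phi> p1" and p2: "sc (2 - s) \<phi> p2" and pA: "sc 2 \<phi> pA"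
    using sc_mono[OF \<psi>] by meson
  have A: "the (A \<phi>) = pA" using pA by (simp add: A_sc[symmetric])
  have pA2: "sc (- s) pA p2" using sc_diff[OF pA p2] by simp
  have p21: "sc (-1) p2 p1" using sc_diff[OF p2 p1] by simp
  have w'p: "w' r \<phi> = pw (-1) (z r) \<bullet> p2" if "r \<in> {0..T}" for r
    using w(2)[OF that] fn_eval[of "s - 1" \<phi> p1] p1 sc_adj[OF sc_pw[of "-1" "z r"] p21] by simp
  have int: "((\<lambda>r. (pw (-1) (k r) - x r) \<bullet> p2) has_integral (pw (-1) (z t) \<bullet> p2 - pw (-1) (z 0) \<bullet> p2)) {0..t}"
  proof (rule fundamental_theorem_of_calculus)
    fix r assume "r \<in> {0..t}"
    then have r: "r \<in> {0..T}" using t by auto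
    have "((\<lambda>r. pw (-1) (z r) \<bullet> p2) has_real_derivative (pw (-1) (k r) - x r) \<bullet> p2) (at r within {0..t})"
      using DERIV_subset[OF inner_has_derivative[OF asol_diff_quotients(2)[OF a r]], of "{0..t}" p2] t by auto
    then show "((\<lambda>r. pw (-1) (z r) \<bullet> p2) has_vector_derivative (pw (-1) (k r) - x r) \<bullet> p2) (at r within {0..t})"
      by (simp add: has_real_derivative_iff_has_vector_derivative)
  qed (use t in auto)
  have eq: "(pw (-1) (k r) - x r) \<bullet> p2 = f r \<phi> - w r (the (A \<phi>))" if "r \<in> {0..t}" for r
  proof -
    have r: "r \<in> {0..T}" using that t by auto
    show ?thesis using f[OF r p1 p] w(1)[OF r] fn_eval[OF pA2] sc_adj[OF sc_pw[of "-1" "k r"] p21]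
      by (simp add: A inner_diff_left)
  qed
  have "w' t \<phi> = pw (-1) (z t) \<bullet> p2" "w' 0 \<phi> = pw (-1) (z 0) \<bullet> p2" using w'p t by auto
  with has_integral_eq[OF eq int]
  show "((\<lambda>r. f r \<phi> - w r (the (A \<phi>))) has_integral w' t \<phi> - w' 0 \<phi>) {0..t}" by simp
qed

text \<open>The equation is tested with basis vectors only: they lie in every domain, and on them
  each power of \<open>A\<close> is a nonzero scalar that can be divided out. This is why
  \<open>f\<close> is prescribed on \<open>E\<close> alone.\<close>

lemma asol_if_wave_sol:
  assumes ws: "wave_sol A s T f w w'" and k: "continuous_on {0..T} k" and T: "T > 0"
    and f: "\<And>r e. r \<in> {0..T} \<Longrightarrow> e \<in> E \<Longrightarrow> f r e = \<mu> e powi (1 - s) * (k r \<bullet> e)"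
    and w: "\<And>t. t \<in> {0..T} \<Longrightarrow> w t = fn s (x t)" "\<And>t. t \<in> {0..T} \<Longrightarrow> w' t = fn (s - 1) (z t)"
  shows "asol T k x z"
proof -
  have cx: "continuous_on {0..T} x"
  proof -
    have "cont_Hs A s T w" using ws by (simp add: wave_sol_def)
    then obtain x' where x': "continuous_on {0..T} x'" "\<And>t. t \<in> {0..T} \<Longrightarrow> w t = fn s (x' t)"
      by (auto simp: cont_Hs_iff)
    then have "x t = x' t" if "t \<in> {0..T}" for t using w(1)[OF that] that fn_inj by metis
    then show ?thesis using x'(1) continuous_on_cong by blast
  qed
  have cz: "continuous_on {0..T} z"
  proof -
    have "cont_Hs A (s - 1) T w'" using ws by (simp add: wave_sol_def)
    then obtain x' where x': "continuous_on {0..T} x'" "\<And>t. t \<in> {0..T} \<Longrightarrow> w' t = fn (s - 1) (x' t)"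
      by (auto simp: cont_Hs_iff)
    then have "z t = x' t" if "t \<in> {0..T}" for t using w(2)[OF that] that fn_inj by metis
    then show ?thesis using x'(1) continuous_on_cong by blast
  qed
  have d1: "((\<lambda>t. x t \<bullet> e) has_real_derivative \<mu> e * (z t \<bullet> e)) (at t within {0..T})"
    if e: "e \<in> E" and t: "t \<in> {0..T}" for e t
  proof -
    have "\<forall>\<^sub>F r in at t within {0..T}. Hs_norm A (s - 1) (\<lambda>\<phi>. (w r \<phi> - w t \<phi>) / (r - t) - w' t \<phi>)
        = norm ((1 / (r - t)) *\<^sub>R (pw (-1) (x r) - pw (-1) (x t)) - z t)"
      using eventually_within[of "{0..T}" t]
      by (rule eventually_mono) (rule wave_diff_quotient_norm, use w t in auto)
    moreover have "((\<lambda>r. Hs_norm A (s - 1) (\<lambda>\<phi>. (w r \<phi> - w t \<phi>) / (r - t) - w' t \<phi>)) \<longlongrightarrow> 0) (at t within {0..T})"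
      using ws t by (simp add: wave_sol_def)
    ultimately have "((\<lambda>r. norm ((1 / (r - t)) *\<^sub>R (pw (-1) (x r) - pw (-1) (x t)) - z t)) \<longlongrightarrow> 0) (at t within {0..T})"
      by (rule tendsto_cong[THEN iffD1])
    then have "((\<lambda>r. (1 / (r - t)) *\<^sub>R (pw (-1) (x r) - pw (-1) (x t))) \<longlongrightarrow> z t) (at t within {0..T})"
      by (simp add: tendsto_norm_zero_iff LIM_zero_iff)
    from DERIV_cmult[OF inner_has_derivative[OF this, of e], of "\<mu> e"]
    show ?thesis using mu_nz[OF e] by (simp add: pw_inner e power_int_minus field_simps)
  qed
  have d2: "((\<lambda>t. z t \<bullet> e) has_real_derivative k t \<bullet> e - \<mu> e * (x t \<bullet> e)) (at t within {0..T})"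
    if e: "e \<in> E" and t: "t \<in> {0..T}" for e t
  proof -
    define g where "g r = k r \<bullet> e - \<mu> e * (x r \<bullet> e)" for r
    define q where "q = \<mu> e powi (1 - s)"
    have q: "q \<noteq> 0" using mu_nz[OF e] by (simp add: q_def power_int_eq_0_iff)
    have eH: "e \<in> Hdom A (nat (max 2 (2 - s)))" using sc_basis[OF e] by (auto simp: Hdom_iff)
    have Ae: "the (A e) = (\<mu> e)\<^sup>2 *\<^sub>R e" using sc_basis[OF e, of 2] by (simp add: A_sc[symmetric])
    have 2: "fn s y ((\<mu> e)\<^sup>2 *\<^sub>R e) = q * \<mu> e * (y \<bullet> e)" for y
    proof -
      have "sc (- s) ((\<mu> e)\<^sup>2 *\<^sub>R e) ((q * \<mu> e) *\<^sub>R e)"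
        using sc_diff[OF sc_basis[OF e, of 2] sc_basis[OF e, of "2 - s"]] mu_nz[OF e]
        by (simp add: q_def power_int_diff power2_eq_square)
      from fn_eval[OF this] show ?thesis by simp
    qed
    have int: "((\<lambda>r. g r) has_integral (z t \<bullet> e - z 0 \<bullet> e)) {0..t}" if t: "t \<in> {0..T}" for t
    proof -
      have "((\<lambda>r. f r e - w r (the (A e))) has_integral w' t e - w' 0 e) {0..t}"
        using ws eH t unfolding wave_sol_def by blast
      moreover have "f r e - w r (the (A e)) = q * g r" if "r \<in> {0..t}" for r
      proof -
        have r: "r \<in> {0..T}" using that t by auto
        show ?thesis using f[OF r e] w(1)[OF r] 2[of "x r"] by (simp add: Ae g_def q_def algebra_simps)
      qed
      moreover have "w' r e = q * (z r \<bullet> e)" if "r \<in> {0..T}" for r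
        using w(2)[OF that] fn_basis[OF e, of "s - 1" "z r"] by (simp add: q_def)
      ultimately have "((\<lambda>r. q * g r) has_integral q * (z t \<bullet> e - z 0 \<bullet> e)) {0..t}"
        using t has_integral_eq[of "{0..t}" "\<lambda>r. f r e - w r (the (A e))" "\<lambda>r. q * g r"] by (simp add: algebra_simps)
      from has_integral_mult_right[OF this, of "1 / q"] show ?thesis using q by simp
    qed
    have "continuous_on {0..T} g" unfolding g_def by (intro continuous_intros k cx)
    from integral_has_real_derivative[OF this t]
    have "((\<lambda>t. z 0 \<bullet> e + integral {0..t} g) has_real_derivative g t) (at t within {0..T})"
      by (auto intro!: derivative_eq_intros)
    then have "((\<lambda>t. z t \<bullet> e) has_real_derivative g t) (at t within {0..T})"
      by (rule has_field_derivative_transform_within[OF _ zero_less_one t])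
         (use integral_unique[OF int] in \<open>simp\<close>)
    then show ?thesis by (simp add: g_def)
  qed
  show ?thesis unfolding asol_def using k cx cz d1 d2 by blast
qed

end

section \<open>Well-posedness\<close>

text \<open>In the derivative of the sum of squares the oscillation terms cancel, leaving
  \<open>2 * b * k\<close>. Hence the root of the sum has slope at most \<open>B\<close>, forward
  and backward in time.\<close>

lemma coord_energy:
  fixes a b k :: "'e \<Rightarrow> real \<Rightarrow> real" and \<mu> :: "'e \<Rightarrow> real"
  assumes F: "finite F"
    and da: "\<And>e t. e \<in> F \<Longrightarrow> t \<in> {0..T} \<Longrightarrow> (a e has_real_derivative \<mu> e * b e t) (at t within {0..T})"
    and db: "\<And>e t. e \<in> F \<Longrightarrow> t \<in> {0..T} \<Longrightarrow> (b e has_real_derivative k e t - \<mu> e * a e t) (at t within {0..T})"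
    and k: "\<And>t. t \<in> {0..T} \<Longrightarrow> (\<Sum>e\<in>F. (k e t)\<^sup>2) \<le> B\<^sup>2" and B: "B \<ge> 0"
    and st: "s \<in> {0..T}" "t \<in> {0..T}"
  shows "sqrt (\<Sum>e\<in>F. (a e t)\<^sup>2 + (b e t)\<^sup>2) \<le> sqrt (\<Sum>e\<in>F. (a e s)\<^sup>2 + (b e s)\<^sup>2) + B * \<bar>t - s\<bar>"
proof -
  define N where "N r = (\<Sum>e\<in>F. (a e r)\<^sup>2 + (b e r)\<^sup>2)" for r
  have N0: "N r \<ge> 0" for r by (simp add: N_def sum_nonneg)
  have "sqrt (N t) \<le> sqrt (N s) + B * \<bar>t - s\<bar> + \<epsilon>" if "\<epsilon> > 0" for \<epsilon>
  proof -
    \<comment> \<open>The square root is not differentiable where the energy vanishes; adding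
      \<delta> regularises it, at the cost of \<open>sqrt \<delta> = \<epsilon>\<close> in the
      estimate.\<close>
    define \<delta> where "\<delta> = \<epsilon>\<^sup>2"
    have \<delta>: "\<delta> > 0" using that by (simp add: \<delta>_def)
    define N' where "N' r = (\<Sum>e\<in>F. 2 * (b e r * k e r))" for r
    have dN: "(N has_real_derivative N' r) (at r within {0..T})" if r: "r \<in> {0..T}" for r
    proof -
      have "((\<lambda>r. (a e r)\<^sup>2 + (b e r)\<^sup>2) has_real_derivative 2 * (b e r * k e r)) (at r within {0..T})"
        if e: "e \<in> F" for e
        using da[OF e r] db[OF e r]
        by (auto intro!: derivative_eq_intros simp: algebra_simps)
      then show ?thesis unfolding N_def N'_def by (rule DERIV_sum)
    qed
    have dg: "((\<lambda>r. sqrt (N r + \<delta>)) has_real_derivative N' r / (2 * sqrt (N r + \<delta>))) (at r within {0..T})"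
      if r: "r \<in> {0..T}" for r
    proof -
      have "N r + \<delta> > 0" using N0[of r] \<delta> by linarith
      then show ?thesis using dN[OF r] by (auto intro!: derivative_eq_intros simp: field_simps)
    qed
    have N'b: "\<bar>N' r / (2 * sqrt (N r + \<delta>))\<bar> \<le> B" if r: "r \<in> {0..T}" for r
    proof -
      have pos: "sqrt (N r + \<delta>) > 0" using N0[of r] \<delta> by simp
      have "\<bar>\<Sum>e\<in>F. b e r * k e r\<bar> \<le> (\<Sum>e\<in>F. \<bar>b e r\<bar> * \<bar>k e r\<bar>)"
        by (rule order_trans[OF sum_abs]) (simp add: abs_mult)
      also have "\<dots> \<le> L2_set (\<lambda>e. b e r) F * L2_set (\<lambda>e. k e r) F" by (rule L2_set_mult_ineq)
      also have "\<dots> \<le> sqrt (N r + \<delta>) * B"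
      proof (rule mult_mono)
        have "(\<Sum>e\<in>F. (b e r)\<^sup>2) \<le> N r" unfolding N_def by (rule sum_mono) simp
        then show "L2_set (\<lambda>e. b e r) F \<le> sqrt (N r + \<delta>)" using \<delta> by (simp add: L2_set_def)
        show "L2_set (\<lambda>e. k e r) F \<le> B" unfolding L2_set_def using k[OF r] B by (rule real_le_lsqrt[OF _ , rotated])
      qed (use N0[of r] \<delta> in \<open>auto simp: L2_set_nonneg\<close>)
      finally have "\<bar>N' r\<bar> \<le> 2 * (sqrt (N r + \<delta>) * B)"
        by (simp add: N'_def sum_distrib_left[symmetric] abs_mult)
      then show ?thesis using pos by (simp add: abs_divide pos_divide_le_eq mult_ac)
    qed
    have "norm (sqrt (N t + \<delta>) - sqrt (N s + \<delta>)) \<le> B * norm (t - s)"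
      by (rule field_differentiable_bound[OF convex_closed_interval dg]) (use N'b st in auto)
    then have "sqrt (N t + \<delta>) \<le> sqrt (N s + \<delta>) + B * \<bar>t - s\<bar>" by (simp add: abs_le_iff)
    moreover have "sqrt (N t) \<le> sqrt (N t + \<delta>)" using \<delta> by simp
    moreover have "sqrt (N s + \<delta>) \<le> sqrt (N s) + \<epsilon>"
      using sqrt_add_le_add_sqrt[of "N s" \<delta>] N0[of s] \<delta> that by (simp add: \<delta>_def)
    ultimately show ?thesis by linarith
  qed
  then show ?thesis unfolding N_def[symmetric] by (rule field_le_epsilon)
qed

text \<open>Duhamel's formula with data at \<open>t0\<close>. The addition theorems split the kernel
  \<open>sin (m * (t - r))\<close>, so that the integrands of \<open>P\<close> and \<open>Q\<close>
  do not involve \<open>t\<close>.\<close>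

lemma scalar_oscillator_exists:
  fixes h :: "real \<Rightarrow> real"
  assumes h: "continuous_on {0..T} h" and t0: "t0 \<in> {0..T}"
  shows "\<exists>u v. u t0 = a \<and> v t0 = b \<and> (\<forall>t\<in>{0..T}. (u has_real_derivative m * v t) (at t within {0..T}) \<and>
     (v has_real_derivative h t - m * u t) (at t within {0..T}))"
proof -
  define P where "P t = integral {0..t} (\<lambda>r. cos (m * r) * h r)" for t
  define Q where "Q t = integral {0..t} (\<lambda>r. sin (m * r) * h r)" for t
  define u where "u t = a * cos (m * (t - t0)) + b * sin (m * (t - t0)) + sin (m * t) * (P t - P t0) - cos (m * t) * (Q t - Q t0)" for t
  define v where "v t = b * cos (m * (t - t0)) - a * sin (m * (t - t0)) + cos (m * t) * (P t - P t0) + sin (m * t) * (Q t - Q t0)" for t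
  have dP: "(P has_real_derivative cos (m * t) * h t) (at t within {0..T})" if "t \<in> {0..T}" for t
    unfolding P_def by (rule integral_has_real_derivative[OF _ that]) (intro continuous_intros h)
  have dQ: "(Q has_real_derivative sin (m * t) * h t) (at t within {0..T})" if "t \<in> {0..T}" for t
    unfolding Q_def by (rule integral_has_real_derivative[OF _ that]) (intro continuous_intros h)
  have "(u has_real_derivative m * v t) (at t within {0..T})" if t: "t \<in> {0..T}" for t
    unfolding u_def[abs_def] v_def using dP[OF t] dQ[OF t]
    by (auto intro!: derivative_eq_intros simp: algebra_simps)
  moreover have "(v has_real_derivative h t - m * u t) (at t within {0..T})" if t: "t \<in> {0..T}" for t
  proof -
    have "h t = h t * ((sin (m * t))\<^sup>2 + (cos (m * t))\<^sup>2)" by simp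
    then have *: "h t = h t * (cos (m * t) * cos (m * t)) + h t * (sin (m * t) * sin (m * t))"
      by (simp only: power2_eq_square distrib_left add.commute)
    show ?thesis
      unfolding v_def[abs_def] u_def using dP[OF t] dQ[OF t]
      by (auto intro!: derivative_eq_intros simp: algebra_simps) (use * in \<open>simp add: algebra_simps\<close>)
  qed
  moreover have "u t0 = a" "v t0 = b" by (auto simp: u_def v_def)
  ultimately show ?thesis by blast
qed

lemma continuous_on_uniform_approx:
  fixes x :: "'t::topological_space \<Rightarrow> 'a::metric_space"
  assumes "\<And>\<epsilon>. \<epsilon> > 0 \<Longrightarrow> \<exists>g. continuous_on S g \<and> (\<forall>t\<in>S. dist (g t) (x t) < \<epsilon>)"
  shows "continuous_on S x"
proof -
  have "\<exists>g. \<forall>n::nat. continuous_on S (g n) \<and> (\<forall>t\<in>S. dist (g n t) (x t) < inverse (real (Suc n)))"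
    using assms by (intro choice allI) simp
  then obtain g where g: "\<And>n::nat. continuous_on S (g n)" "\<And>n t. t \<in> S \<Longrightarrow> dist (g n t) (x t) < inverse (real (Suc n))"
    by blast
  have "uniform_limit S g x sequentially"
  proof (rule uniform_limitI)
    fix e :: real assume "e > 0"
    then have "\<forall>\<^sub>F n in sequentially. inverse (real (Suc n)) < e"
      using LIMSEQ_inverse_real_of_nat order_tendstoD(2) by blast
    then show "\<forall>\<^sub>F n in sequentially. \<forall>t\<in>S. dist (g n t) (x t) < e"
      by (rule eventually_mono) (meson g(2) less_trans)
  qed
  then show ?thesis using g(1) by (intro uniform_limit_theorem[of S g sequentially x]) auto
qed

lemma continuous_on_interval_bounded:
  fixes k :: "real \<Rightarrow> 'a::real_normed_vector"
  assumes "continuous_on {0..T} k"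
  shows "\<exists>B\<ge>0. \<forall>t\<in>{0..T}. norm (k t) \<le> B"
proof -
  have "bounded (k ` {0..T})" using assms by (intro compact_imp_bounded compact_continuous_image) auto
  then obtain B where "\<forall>x\<in>k ` {0..T}. norm x \<le> B" by (auto simp only: bounded_iff)
  then show ?thesis by (intro exI[of _ "max B 0"]) (auto simp: le_max_iff_disj)
qed

context onb
begin

lemma norm_pair_le_if_finite:
  assumes "\<And>F. finite F \<Longrightarrow> F \<subseteq> E \<Longrightarrow> (\<Sum>e\<in>F. (x \<bullet> e)\<^sup>2 + (z \<bullet> e)\<^sup>2) \<le> R"
  shows "(norm x)\<^sup>2 + (norm z)\<^sup>2 \<le> R"
proof -
  have "((\<lambda>e. (x \<bullet> e) * (x \<bullet> e) + (z \<bullet> e) * (z \<bullet> e)) has_sum x \<bullet> x + z \<bullet> z) E"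
    by (intro has_sum_add parseval)
  then have "x \<bullet> x + z \<bullet> z \<le> R"
    by (rule has_sum_le_finite_sums) (use assms in \<open>simp add: power2_eq_square\<close>)
  then show ?thesis by (simp add: power2_norm_eq_inner)
qed

text \<open>The image of a compact interval has a finite net; a finite set of modes that serves the
  net serves all points, because the truncation error is a contraction and decreases when modes are
  added.\<close>

lemma uniform_proj_approx:
  assumes k: "continuous_on {0..T} k" and "\<epsilon> > 0"
  shows "\<exists>F. finite F \<and> F \<subseteq> E \<and> (\<forall>r\<in>{0..T::real}. norm (k r - proj F (k r)) < \<epsilon>)"
proof -
  have cpt: "compact (k ` {0..T})" using k by (intro compact_continuous_image) auto
  have cov: "k ` {0..T} \<subseteq> (\<Union>c\<in>k ` {0..T}. ball c (\<epsilon> / 2))" using \<open>\<epsilon> > 0\<close> by force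
  obtain C where C: "C \<subseteq> k ` {0..T}" "finite C" "k ` {0..T} \<subseteq> (\<Union>c\<in>C. ball c (\<epsilon> / 2))"
    by (rule compactE_image[OF cpt _ cov]) auto
  have "\<forall>c\<in>C. \<exists>F. finite F \<and> F \<subseteq> E \<and> norm (c - proj F c) < \<epsilon> / 2"
    using proj_approx[of "\<epsilon> / 2"] \<open>\<epsilon> > 0\<close> by (meson half_gt_zero)
  then obtain Fc where Fc: "\<And>c. c \<in> C \<Longrightarrow> finite (Fc c) \<and> Fc c \<subseteq> E \<and> norm (c - proj (Fc c) c) < \<epsilon> / 2" by metis
  define F where "F = (\<Union>c\<in>C. Fc c)"
  have F: "finite F" "F \<subseteq> E" using C(2) Fc by (auto simp: F_def)
  have "norm (k r - proj F (k r)) < \<epsilon>" if r: "r \<in> {0..T}" for r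
  proof -
    have "k r \<in> (\<Union>c\<in>C. ball c (\<epsilon> / 2))" using C(3) r by blast
    then obtain c where c: "c \<in> C" "norm (k r - c) < \<epsilon> / 2"
      by (auto simp: dist_norm norm_minus_commute)
    have "norm (c - proj F c) \<le> norm (c - proj (Fc c) c)"
      by (rule norm_diff_proj_mono) (use F c in \<open>auto simp: F_def\<close>)
    then have "norm (c - proj F c) < \<epsilon> / 2" using Fc[OF c(1)] by linarith
    moreover have "norm ((k r - c) - proj F (k r - c)) \<le> norm (k r - c)" by (rule norm_diff_proj_le[OF F])
    moreover have eq: "k r - proj F (k r) = ((k r - c) - proj F (k r - c)) + (c - proj F c)"
      using linear_diff[OF bounded_linear.linear[OF bounded_linear_proj[OF F]], of "k r" c] by simp
    have "norm (k r - proj F (k r)) \<le> norm ((k r - c) - proj F (k r - c)) + norm (c - proj F c)"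
      unfolding eq by (rule norm_triangle_ineq)
    ultimately show ?thesis using c(2) by linarith
  qed
  then show ?thesis using F by blast
qed

end

context eigenbasis
begin

text \<open>The bound on finitely many modes does not depend on their choice, so it passes to the
  norms. It holds in both time directions, whence uniqueness and reversibility.\<close>

lemma asol_estimate:
  assumes a: "asol T k x z" and k: "\<And>r. r \<in> {0..T} \<Longrightarrow> norm (k r) \<le> B" and st: "s \<in> {0..T}" "t \<in> {0..T}"
  shows "norm (x t, z t) \<le> norm (x s, z s) + B * \<bar>t - s\<bar>"
proof -
  have B: "B \<ge> 0" using k[OF st(1)] norm_ge_zero order_trans by blast
  define R where "R = norm (x s, z s) + B * \<bar>t - s\<bar>"
  have R: "R \<ge> 0" using B by (simp add: R_def)
  have "(\<Sum>e\<in>F. (x t \<bullet> e)\<^sup>2 + (z t \<bullet> e)\<^sup>2) \<le> R\<^sup>2" if F: "finite F" "F \<subseteq> E" for F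
  proof -
    have "sqrt (\<Sum>e\<in>F. (x t \<bullet> e)\<^sup>2 + (z t \<bullet> e)\<^sup>2) \<le> sqrt (\<Sum>e\<in>F. (x s \<bullet> e)\<^sup>2 + (z s \<bullet> e)\<^sup>2) + B * \<bar>t - s\<bar>"
    proof (rule coord_energy[OF F(1), where T = T and \<mu> = \<mu> and k = "\<lambda>e t. k t \<bullet> e"])
      fix r assume "r \<in> {0..T}"
      then show "(\<Sum>e\<in>F. (k r \<bullet> e)\<^sup>2) \<le> B\<^sup>2"
        using bessel[OF F, of "k r"] k power_mono[OF k norm_ge_zero, of r 2] by (meson order_trans)
    qed (use asol_D(4,5)[OF a] F B st in auto)
    also have "\<dots> \<le> R"
      using bessel[OF F, of "x s"] bessel[OF F, of "z s"] by (simp add: R_def norm_Pair sum.distrib)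
    finally show ?thesis by (rule sqrt_le_D)
  qed
  then have "(norm (x t))\<^sup>2 + (norm (z t))\<^sup>2 \<le> R\<^sup>2" by (rule norm_pair_le_if_finite)
  then have "norm (x t, z t) \<le> R" using R by (simp add: norm_Pair real_le_lsqrt)
  then show ?thesis by (simp add: R_def)
qed

lemma asol_lin:
  assumes "asol T k x z" "asol T k' x' z'"
  shows "asol T (\<lambda>t. a *\<^sub>R k t + c *\<^sub>R k' t) (\<lambda>t. a *\<^sub>R x t + c *\<^sub>R x' t) (\<lambda>t. a *\<^sub>R z t + c *\<^sub>R z' t)"
proof -
  note A = asol_D[OF assms(1)] and B = asol_D[OF assms(2)]
  show ?thesis
    unfolding asol_def inner_add_left inner_scaleR_left
  proof (intro conjI ballI)
    fix e t assume et: "e \<in> E" "t \<in> {0..T}"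
    show "((\<lambda>t. a * (x t \<bullet> e) + c * (x' t \<bullet> e)) has_real_derivative \<mu> e * (a * (z t \<bullet> e) + c * (z' t \<bullet> e))) (at t within {0..T})"
      using A(4)[OF et] B(4)[OF et] by (auto intro!: derivative_eq_intros simp: algebra_simps)
    show "((\<lambda>t. a * (z t \<bullet> e) + c * (z' t \<bullet> e)) has_real_derivative
        a * (k t \<bullet> e) + c * (k' t \<bullet> e) - \<mu> e * (a * (x t \<bullet> e) + c * (x' t \<bullet> e))) (at t within {0..T})"
      using A(5)[OF et] B(5)[OF et] by (auto intro!: derivative_eq_intros simp: algebra_simps)
  qed (intro continuous_intros A B)+
qed

text \<open>Each mode is solved separately; the energy bound makes the modes square summable at
  every time. Continuity in norm comes from the same bound for the modes outside a fixed finite set,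
  which makes truncations converge uniformly in time.\<close>

lemma asol_exists:
  assumes k: "continuous_on {0..T} k" and t0: "t0 \<in> {0..T}"
  shows "\<exists>x z. asol T k x z \<and> x t0 = a \<and> z t0 = b"
proof -
  have "\<forall>e. \<exists>uv. fst uv t0 = a \<bullet> e \<and> snd uv t0 = b \<bullet> e \<and>
     (\<forall>t\<in>{0..T}. (fst uv has_real_derivative \<mu> e * snd uv t) (at t within {0..T}) \<and>
     (snd uv has_real_derivative k t \<bullet> e - \<mu> e * fst uv t) (at t within {0..T}))"
  proof
    fix e
    have "continuous_on {0..T} (\<lambda>t. k t \<bullet> e)" by (intro continuous_intros k)
    from scalar_oscillator_exists[OF this t0, of "a \<bullet> e" "b \<bullet> e" "\<mu> e"]
    show "\<exists>uv. fst uv t0 = a \<bullet> e \<and> snd uv t0 = b \<bullet> e \<and>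
     (\<forall>t\<in>{0..T}. (fst uv has_real_derivative \<mu> e * snd uv t) (at t within {0..T}) \<and>
     (snd uv has_real_derivative k t \<bullet> e - \<mu> e * fst uv t) (at t within {0..T}))" by simp
  qed
  from choice[OF this] obtain uv where uv: "\<And>e. fst (uv e) t0 = a \<bullet> e \<and> snd (uv e) t0 = b \<bullet> e \<and>
     (\<forall>t\<in>{0..T}. (fst (uv e) has_real_derivative \<mu> e * snd (uv e) t) (at t within {0..T}) \<and>
     (snd (uv e) has_real_derivative k t \<bullet> e - \<mu> e * fst (uv e) t) (at t within {0..T}))" by blast
  define u where "u e = fst (uv e)" for e
  define v where "v e = snd (uv e)" for e
  have ini: "u e t0 = a \<bullet> e" "v e t0 = b \<bullet> e" for e using uv by (auto simp: u_def v_def)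
  have du: "(u e has_real_derivative \<mu> e * v e t) (at t within {0..T})"
    and dv: "(v e has_real_derivative k t \<bullet> e - \<mu> e * u e t) (at t within {0..T})" if "t \<in> {0..T}" for e t
    using uv that by (auto simp: u_def v_def)
  have cu: "continuous_on {0..T} (u e)" for e by (rule DERIV_continuous_on[OF du])
  have cv: "continuous_on {0..T} (v e)" for e by (rule DERIV_continuous_on[OF dv])
  have est: "(\<Sum>e\<in>F. (u e t)\<^sup>2 + (v e t)\<^sup>2) \<le> (sqrt (\<Sum>e\<in>F. (a \<bullet> e)\<^sup>2 + (b \<bullet> e)\<^sup>2) + B * T)\<^sup>2"
    if F: "finite F" and B: "\<And>t. t \<in> {0..T} \<Longrightarrow> (\<Sum>e\<in>F. (k t \<bullet> e)\<^sup>2) \<le> B\<^sup>2" "B \<ge> 0" and t: "t \<in> {0..T}" for F B t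
  proof -
    have "sqrt (\<Sum>e\<in>F. (u e t)\<^sup>2 + (v e t)\<^sup>2) \<le> sqrt (\<Sum>e\<in>F. (u e t0)\<^sup>2 + (v e t0)\<^sup>2) + B * \<bar>t - t0\<bar>"
      by (rule coord_energy[OF F, where T = T and \<mu> = \<mu> and k = "\<lambda>e t. k t \<bullet> e"]) (use du dv B t t0 in auto)
    also have "\<dots> \<le> sqrt (\<Sum>e\<in>F. (a \<bullet> e)\<^sup>2 + (b \<bullet> e)\<^sup>2) + B * T"
      unfolding ini using t t0 B by (intro add_left_mono mult_left_mono) auto
    finally show ?thesis by (rule sqrt_le_D)
  qed
  from continuous_on_interval_bounded[OF k] obtain B where B0: "B \<ge> 0"
    and B: "\<And>t. t \<in> {0..T} \<Longrightarrow> norm (k t) \<le> B" by blast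
  define R where "R = (sqrt ((norm a)\<^sup>2 + (norm b)\<^sup>2) + B * T)\<^sup>2"
  have bnd: "(\<Sum>e\<in>F. (u e t)\<^sup>2 + (v e t)\<^sup>2) \<le> R" if F: "finite F" "F \<subseteq> E" and t: "t \<in> {0..T}" for F t
  proof -
    have "(\<Sum>e\<in>F. (k t \<bullet> e)\<^sup>2) \<le> B\<^sup>2" if "t \<in> {0..T}" for t
      using bessel[OF F, of "k t"] power_mono[OF B[OF that] norm_ge_zero, of 2] by linarith
    from est[OF F(1) this B0 t]
    have "(\<Sum>e\<in>F. (u e t)\<^sup>2 + (v e t)\<^sup>2) \<le> (sqrt (\<Sum>e\<in>F. (a \<bullet> e)\<^sup>2 + (b \<bullet> e)\<^sup>2) + B * T)\<^sup>2" by simp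
    also have "\<dots> \<le> R" unfolding R_def
      by (intro power_mono add_right_mono real_sqrt_le_mono)
         (use bessel[OF F, of a] bessel[OF F, of b] B0 t in \<open>auto simp: sum.distrib sum_nonneg\<close>)
    finally show ?thesis .
  qed
  have "\<exists>y. \<forall>e\<in>E. y \<bullet> e = u e t" if "t \<in> {0..T}" for t
  proof -
    have "(\<Sum>e\<in>F. (u e t)\<^sup>2) \<le> R" if "finite F" "F \<subseteq> E" for F
      by (rule order_trans[OF sum_mono bnd[OF that \<open>t \<in> {0..T}\<close>]]) simp
    then show ?thesis using riesz_fischer[of "\<lambda>e. u e t" R] by metis
  qed
  then obtain x where x: "\<And>t e. t \<in> {0..T} \<Longrightarrow> e \<in> E \<Longrightarrow> x t \<bullet> e = u e t" by metis
  have "\<exists>y. \<forall>e\<in>E. y \<bullet> e = v e t" if "t \<in> {0..T}" for t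
  proof -
    have "(\<Sum>e\<in>F. (v e t)\<^sup>2) \<le> R" if "finite F" "F \<subseteq> E" for F
      by (rule order_trans[OF sum_mono bnd[OF that \<open>t \<in> {0..T}\<close>]]) simp
    then show ?thesis using riesz_fischer[of "\<lambda>e. v e t" R] by metis
  qed
  then obtain z where z: "\<And>t e. t \<in> {0..T} \<Longrightarrow> e \<in> E \<Longrightarrow> z t \<bullet> e = v e t" by metis
  have tail: "\<exists>F. finite F \<and> F \<subseteq> E \<and> (\<forall>t\<in>{0..T}. norm (x t - proj F (x t)) < \<epsilon> \<and> norm (z t - proj F (z t)) < \<epsilon>)"
    if "\<epsilon> > 0" for \<epsilon>
  proof -
    have T0: "T \<ge> 0" using t0 by simp
    \<comment> \<open>Off the chosen modes the data contribute at most \<open>2 * \<eta>\<close> and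
      the forcing at most \<open>T * \<eta>\<close>, in total strictly less than \<epsilon>.\<close>
    define \<eta> where "\<eta> = \<epsilon> / (3 + T)"
    have \<eta>: "\<eta> > 0" using that T0 by (simp add: \<eta>_def)
    obtain F1 F2 F3 where F1: "finite F1" "F1 \<subseteq> E" "norm (a - proj F1 a) < \<eta>"
      and F2: "finite F2" "F2 \<subseteq> E" "norm (b - proj F2 b) < \<eta>"
      and F3: "finite F3" "F3 \<subseteq> E" "\<And>r. r \<in> {0..T} \<Longrightarrow> norm (k r - proj F3 (k r)) < \<eta>"
      using proj_approx[OF \<eta>] uniform_proj_approx[OF k \<eta>] by metis
    define F0 where "F0 = F1 \<union> F2 \<union> F3"
    have F0: "finite F0" "F0 \<subseteq> E" using F1 F2 F3 by (auto simp: F0_def)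
    have off: "(\<Sum>e\<in>F. (y \<bullet> e)\<^sup>2) \<le> \<eta>\<^sup>2" if y: "norm (y - proj F' y) < \<eta>" and F: "finite F" "F \<subseteq> E" "F \<inter> F0 = {}" "F' \<subseteq> F0" for y F F'
    proof -
      have "norm (y - proj F0 y) \<le> norm (y - proj F' y)" using F0 F by (intro norm_diff_proj_mono) auto
      then have "(norm (y - proj F0 y))\<^sup>2 \<le> \<eta>\<^sup>2" using y by (intro power_mono) auto
      moreover have "(\<Sum>e\<in>F. (y \<bullet> e)\<^sup>2) = (\<Sum>e\<in>F. ((y - proj F0 y) \<bullet> e)\<^sup>2)"
        by (rule sum.cong) (use F F0 in \<open>auto simp: inner_diff_left proj_inner subsetD\<close>)
      ultimately show ?thesis using bessel[OF F(1,2), of "y - proj F0 y"] by linarith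
    qed
    have uv_off: "(\<Sum>e\<in>F. (u e t)\<^sup>2 + (v e t)\<^sup>2) \<le> ((2 + T) * \<eta>)\<^sup>2"
      if F: "finite F" "F \<subseteq> E" "F \<inter> F0 = {}" and t: "t \<in> {0..T}" for F t
    proof -
      have kk: "(\<Sum>e\<in>F. (k t \<bullet> e)\<^sup>2) \<le> \<eta>\<^sup>2" if "t \<in> {0..T}" for t
        using off[OF F3(3)[OF that] F] by (simp add: F0_def)
      have sub: "F1 \<subseteq> F0" "F2 \<subseteq> F0" by (auto simp: F0_def)
      have "(\<Sum>e\<in>F. (a \<bullet> e)\<^sup>2 + (b \<bullet> e)\<^sup>2) \<le> \<eta>\<^sup>2 + \<eta>\<^sup>2"
        unfolding sum.distrib by (intro add_mono off[OF F1(3) F sub(1)] off[OF F2(3) F sub(2)])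
      also have "\<dots> \<le> (2 * \<eta>)\<^sup>2" by (simp add: power_mult_distrib)
      finally have "(\<Sum>e\<in>F. (a \<bullet> e)\<^sup>2 + (b \<bullet> e)\<^sup>2) \<le> (2 * \<eta>)\<^sup>2" .
      then have "sqrt (\<Sum>e\<in>F. (a \<bullet> e)\<^sup>2 + (b \<bullet> e)\<^sup>2) \<le> 2 * \<eta>"
        using \<eta> by (simp add: real_le_lsqrt)
      then have "(sqrt (\<Sum>e\<in>F. (a \<bullet> e)\<^sup>2 + (b \<bullet> e)\<^sup>2) + \<eta> * T)\<^sup>2 \<le> ((2 + T) * \<eta>)\<^sup>2"
        using \<eta> T0 by (intro power_mono) (auto simp: algebra_simps sum_nonneg)
      then show ?thesis using est[OF F(1) kk _ t] \<eta> by auto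
    qed
    have fin: "norm (y - proj F0 y) < \<epsilon>"
      if y: "\<And>e. e \<in> E \<Longrightarrow> (y \<bullet> e)\<^sup>2 \<le> (u e t)\<^sup>2 + (v e t)\<^sup>2" and t: "t \<in> {0..T}" for y t
    proof -
      have "(norm (y - proj F0 y))\<^sup>2 \<le> ((2 + T) * \<eta>)\<^sup>2"
      proof (rule norm_le_if_proj_le)
        fix F assume F: "finite F" "F \<subseteq> E"
        have "(\<Sum>e\<in>F. ((y - proj F0 y) \<bullet> e)\<^sup>2) = (\<Sum>e\<in>F - F0. (y \<bullet> e)\<^sup>2)"
          by (rule sum.mono_neutral_cong_right) (use F F0 in \<open>auto simp: inner_diff_left proj_inner subsetD\<close>)
        also have "\<dots> \<le> (\<Sum>e\<in>F - F0. (u e t)\<^sup>2 + (v e t)\<^sup>2)" by (rule sum_mono) (use y F in auto)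
        also have "\<dots> \<le> ((2 + T) * \<eta>)\<^sup>2" by (rule uv_off[OF _ _ _ t]) (use F in auto)
        finally show "(\<Sum>e\<in>F. ((y - proj F0 y) \<bullet> e)\<^sup>2) \<le> ((2 + T) * \<eta>)\<^sup>2" .
      qed
      then have "norm (y - proj F0 y) \<le> (2 + T) * \<eta>" by (rule power2_le_imp_le) (use \<eta> T0 in simp)
      also have "\<dots> < (3 + T) * \<eta>" using \<eta> by simp
      also have "\<dots> = \<epsilon>" using T0 by (simp add: \<eta>_def)
      finally show ?thesis .
    qed
    show ?thesis
    proof (intro exI[of _ F0] conjI F0 ballI)
      fix t assume t: "t \<in> {0..T}"
      show "norm (x t - proj F0 (x t)) < \<epsilon>" by (rule fin[OF _ t]) (simp add: x[OF t])
      show "norm (z t - proj F0 (z t)) < \<epsilon>" by (rule fin[OF _ t]) (simp add: z[OF t])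
    qed
  qed
  have cont: "continuous_on {0..T} y"
    if y: "\<And>t e. t \<in> {0..T} \<Longrightarrow> e \<in> E \<Longrightarrow> y t \<bullet> e = c e t" and c: "\<And>e. continuous_on {0..T} (c e)"
      and yt: "\<And>\<epsilon>. \<epsilon> > 0 \<Longrightarrow> \<exists>F. finite F \<and> F \<subseteq> E \<and> (\<forall>t\<in>{0..T}. norm (y t - proj F (y t)) < \<epsilon>)" for y c
  proof (rule continuous_on_uniform_approx)
    fix \<epsilon> :: real assume "\<epsilon> > 0"
    then obtain F where F: "finite F" "F \<subseteq> E" "\<And>t. t \<in> {0..T} \<Longrightarrow> norm (y t - proj F (y t)) < \<epsilon>" using yt by metis
    have "continuous_on {0..T} (\<lambda>t. \<Sum>e\<in>F. c e t *\<^sub>R e)" by (intro continuous_intros c)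
    moreover have "(\<Sum>e\<in>F. c e t *\<^sub>R e) = proj F (y t)" if "t \<in> {0..T}" for t
      unfolding proj_def by (rule sum.cong) (use y that F in auto)
    ultimately show "\<exists>g. continuous_on {0..T} g \<and> (\<forall>t\<in>{0..T}. dist (g t) (y t) < \<epsilon>)"
      using F(3) by (intro exI[of _ "\<lambda>t. \<Sum>e\<in>F. c e t *\<^sub>R e"]) (auto simp: dist_norm norm_minus_commute)
  qed
  have cx: "continuous_on {0..T} x" and cz: "continuous_on {0..T} z"
    by (rule cont[OF x cu]; use tail in meson) (rule cont[OF z cv]; use tail in meson)
  have "((\<lambda>t. x t \<bullet> e) has_real_derivative \<mu> e * (z t \<bullet> e)) (at t within {0..T}) \<and>
        ((\<lambda>t. z t \<bullet> e) has_real_derivative k t \<bullet> e - \<mu> e * (x t \<bullet> e)) (at t within {0..T})"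
    if e: "e \<in> E" and t: "t \<in> {0..T}" for e t
    using has_field_derivative_transform_within[OF du[OF t, of e] zero_less_one t, of "\<lambda>t. x t \<bullet> e"]
      has_field_derivative_transform_within[OF dv[OF t, of e] zero_less_one t, of "\<lambda>t. z t \<bullet> e"] x z e t by simp
  then have "asol T k x z" using k cx cz by (auto simp: asol_def)
  moreover have "x t0 = a" "z t0 = b" using x[OF t0] z[OF t0] ini by (auto intro: eqI)
  ultimately show ?thesis by blast
qed

end

section \<open>Adjoints of bounded operators\<close>

lemma adjoint_exists:
  fixes Q :: "'h::{real_inner,complete_space} \<Rightarrow> 'h"
  assumes "bounded_linear Q"
  shows "\<exists>K. bounded_linear K \<and> (\<forall>y \<psi>. K y \<bullet> \<psi> = y \<bullet> Q \<psi>)"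
proof -
  interpret Q: bounded_linear Q by fact
  have "\<exists>z. \<forall>\<psi>. z \<bullet> \<psi> = y \<bullet> Q \<psi>" for y
  proof -
    have "lin_on UNIV (\<lambda>\<psi>. y \<bullet> Q \<psi>)" by (auto simp: lin_on_def Q.add Q.scaleR inner_add_right)
    moreover have "\<bar>y \<bullet> Q \<psi>\<bar> \<le> (norm y * onorm Q) * norm \<psi>" for \<psi>
    proof -
      have "\<bar>y \<bullet> Q \<psi>\<bar> \<le> norm y * norm (Q \<psi>)" by (rule Cauchy_Schwarz_ineq2)
      also have "\<dots> \<le> norm y * (onorm Q * norm \<psi>)" by (intro mult_left_mono onorm[OF assms]) auto
      finally show ?thesis by (simp add: mult_ac)
    qed
    ultimately show ?thesis using riesz_closed_subspace[OF subspace_UNIV closed_UNIV] by (metis UNIV_I)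
  qed
  then obtain K where K: "\<And>y \<psi>. K y \<bullet> \<psi> = y \<bullet> Q \<psi>" by metis
  have "bounded_linear K"
  proof (rule bounded_linear_intro[where K = "onorm Q"])
    fix x y :: 'h and c :: real
    show "K (x + y) = K x + K y" by (simp add: vector_eq_rdot[symmetric] K inner_add_left)
    show "K (c *\<^sub>R x) = c *\<^sub>R K x" by (simp add: vector_eq_rdot[symmetric] K)
    show "norm (K x) \<le> norm x * onorm Q"
    proof (cases "K x = 0")
      case False
      have "norm (K x) * norm (K x) = x \<bullet> Q (K x)" by (simp add: K[symmetric] power2_norm_eq_inner[symmetric] power2_eq_square)
      also have "\<dots> \<le> norm x * norm (Q (K x))" by (rule norm_cauchy_schwarz)
      also have "\<dots> \<le> norm x * (onorm Q * norm (K x))" by (intro mult_left_mono onorm[OF assms]) auto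
      finally show ?thesis using False by (simp add: mult.assoc[symmetric])
    qed (simp add: onorm_pos_le[OF assms])
  qed
  then show ?thesis using K by blast
qed

text \<open>\<open>adjoint\<close> is a choice among functions satisfying the adjoint relation;
  existence of one, which rests on completeness, makes the chosen one satisfy it.\<close>

lemma adjoint_inner:
  fixes f :: "'h::{real_inner,complete_space} \<Rightarrow> 'h"
  assumes "bounded_linear f"
  shows "x \<bullet> adjoint f y = f x \<bullet> y"
proof -
  obtain K where "\<forall>y \<psi>. K y \<bullet> \<psi> = y \<bullet> f \<psi>" using adjoint_exists[OF assms] by blast
  then have "\<forall>x y. f x \<bullet> y = x \<bullet> K y" by (simp add: inner_commute)
  then have "\<forall>x y. f x \<bullet> y = x \<bullet> adjoint f y" unfolding adjoint_def
    by (rule someI[of "\<lambda>f'. \<forall>x y. f x \<bullet> y = x \<bullet> f' y"])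
  then show ?thesis by simp
qed

lemma (in eigenbasis) asol_cong:
  assumes a: "asol T k x z"
    and eq: "\<And>t. t \<in> {0..T} \<Longrightarrow> k t = k' t" "\<And>t. t \<in> {0..T} \<Longrightarrow> x t = x' t" "\<And>t. t \<in> {0..T} \<Longrightarrow> z t = z' t"
  shows "asol T k' x' z'"
  unfolding asol_def
proof (intro conjI ballI)
  show "continuous_on {0..T} k'" "continuous_on {0..T} x'" "continuous_on {0..T} z'"
    using asol_D(1-3)[OF a] eq by (metis continuous_on_cong)+
  fix e t assume et: "e \<in> E" "t \<in> {0..T}"
  show "((\<lambda>t. x' t \<bullet> e) has_real_derivative \<mu> e * (z' t \<bullet> e)) (at t within {0..T})"
    using has_field_derivative_transform_within[OF asol_D(4)[OF a et] zero_less_one et(2), of "\<lambda>t. x' t \<bullet> e"] eq et(2) by simp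
  show "((\<lambda>t. z' t \<bullet> e) has_real_derivative k' t \<bullet> e - \<mu> e * (x' t \<bullet> e)) (at t within {0..T})"
    using has_field_derivative_transform_within[OF asol_D(5)[OF a et] zero_less_one et(2), of "\<lambda>t. z' t \<bullet> e"] eq et(2) by simp
qed

section \<open>Cascade systems\<close>

context eigenbasis
begin

definition asys ::
  "real \<Rightarrow> nat \<Rightarrow> (nat \<Rightarrow> nat set) \<Rightarrow> (nat \<Rightarrow> nat \<Rightarrow> 'h \<Rightarrow> 'h) \<Rightarrow> (nat \<Rightarrow> real \<Rightarrow> 'h) \<Rightarrow> (nat \<Rightarrow> real \<Rightarrow> 'h) \<Rightarrow> bool" where
  "asys T N cp K x z \<longleftrightarrow> (\<forall>i\<in>{1..N}. asol T (\<lambda>t. - (\<Sum>k\<in>cp i. K i k (x k t))) (x i) (z i))"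

text \<open>The coupling is strictly lower triangular: row \<open>i\<close> is forced only by rows
  already solved, which is what all inductions on rows use.\<close>

definition cascade :: "nat \<Rightarrow> (nat \<Rightarrow> nat set) \<Rightarrow> (nat \<Rightarrow> nat \<Rightarrow> 'h \<Rightarrow> 'h) \<Rightarrow> bool" where
  "cascade N cp K \<longleftrightarrow> (\<forall>i\<in>{1..N}. cp i \<subseteq> {1..<i} \<and> (\<forall>k\<in>cp i. bounded_linear (K i k)))"

lemma asys_lin:
  assumes "cascade N cp K" "asys T N cp K x z" "asys T N cp K x' z'"
  shows "asys T N cp K (\<lambda>i t. a *\<^sub>R x i t + c *\<^sub>R x' i t) (\<lambda>i t. a *\<^sub>R z i t + c *\<^sub>R z' i t)"
  unfolding asys_def
proof
  fix i assume i: "i \<in> {1..N}"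
  have "asol T (\<lambda>t. a *\<^sub>R (- (\<Sum>k\<in>cp i. K i k (x k t))) + c *\<^sub>R (- (\<Sum>k\<in>cp i. K i k (x' k t))))
     (\<lambda>t. a *\<^sub>R x i t + c *\<^sub>R x' i t) (\<lambda>t. a *\<^sub>R z i t + c *\<^sub>R z' i t)"
    using assms i by (intro asol_lin) (auto simp: asys_def)
  moreover have "a *\<^sub>R (- (\<Sum>k\<in>cp i. K i k (x k t))) + c *\<^sub>R (- (\<Sum>k\<in>cp i. K i k (x' k t)))
      = - (\<Sum>k\<in>cp i. K i k (a *\<^sub>R x k t + c *\<^sub>R x' k t))" for t
  proof -
    have "K i k (a *\<^sub>R x k t + c *\<^sub>R x' k t) = a *\<^sub>R K i k (x k t) + c *\<^sub>R K i k (x' k t)" if "k \<in> cp i" for k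
    proof -
      interpret bounded_linear "K i k" using assms(1) i that by (auto simp: cascade_def)
      show ?thesis by (simp add: add scaleR)
    qed
    then have "(\<Sum>k\<in>cp i. K i k (a *\<^sub>R x k t + c *\<^sub>R x' k t)) = (\<Sum>k\<in>cp i. a *\<^sub>R K i k (x k t) + c *\<^sub>R K i k (x' k t))"
      by (rule sum.cong[OF refl])
    then show ?thesis by (simp add: sum.distrib scaleR_sum_right)
  qed
  ultimately show "asol T (\<lambda>t. - (\<Sum>k\<in>cp i. K i k (a *\<^sub>R x k t + c *\<^sub>R x' k t)))
     (\<lambda>t. a *\<^sub>R x i t + c *\<^sub>R x' i t) (\<lambda>t. a *\<^sub>R z i t + c *\<^sub>R z' i t)" by simp
qed

lemma asys_exists:
  assumes "cascade N cp K" and t0: "t0 \<in> {0..T}"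
  shows "\<exists>x z. asys T N cp K x z \<and> (\<forall>i\<in>{1..N}. x i t0 = a i \<and> z i t0 = b i)"
  using assms(1)
proof (induction N)
  case 0
  show ?case by (auto simp: asys_def)
next
  case (Suc N)
  then have "cascade N cp K" by (auto simp: cascade_def)
  then obtain x z where xz: "asys T N cp K x z" "\<forall>i\<in>{1..N}. x i t0 = a i \<and> z i t0 = b i" using Suc by blast
  have cpN: "cp i \<subseteq> {1..N}" if "i \<in> {1..Suc N}" for i
    using Suc.prems that by (force simp: cascade_def)
  have "continuous_on {0..T} (\<lambda>t. - (\<Sum>k\<in>cp (Suc N). K (Suc N) k (x k t)))"
  proof (intro continuous_on_minus continuous_on_sum)
    fix k assume k: "k \<in> cp (Suc N)"
    then have "bounded_linear (K (Suc N) k)" using Suc.prems by (auto simp: cascade_def)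
    moreover have "k \<in> {1..N}" using k cpN[of "Suc N"] by auto
    then have "continuous_on {0..T} (x k)" using xz(1) unfolding asys_def by (blast dest: asol_D(2))
    ultimately show "continuous_on {0..T} (\<lambda>t. K (Suc N) k (x k t))" by (rule bounded_linear.continuous_on)
  qed
  from asol_exists[OF this t0] obtain x' z' where
    n: "asol T (\<lambda>t. - (\<Sum>k\<in>cp (Suc N). K (Suc N) k (x k t))) x' z'" "x' t0 = a (Suc N)" "z' t0 = b (Suc N)" by blast
  let ?x = "x(Suc N := x')" and ?z = "z(Suc N := z')"
  have "(\<Sum>k\<in>cp i. K i k (?x k t)) = (\<Sum>k\<in>cp i. K i k (x k t))" if "i \<in> {1..Suc N}" for i t
    by (rule sum.cong) (use cpN[OF that] in auto)
  then have "asys T (Suc N) cp K ?x ?z" using xz(1) n(1) by (auto simp: asys_def le_Suc_eq)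
  moreover have "\<forall>i\<in>{1..Suc N}. ?x i t0 = a i \<and> ?z i t0 = b i" using xz(2) n by auto
  ultimately show ?case by blast
qed

text \<open>Induction over the rows, with the rows that feed row \<open>i\<close> treated as
  forcing. Both times are arbitrary, so the states at any two times control each other.\<close>

lemma asys_estimate:
  assumes cas: "cascade N cp K"
  shows "\<exists>c\<ge>0. \<forall>x z s t i. asys T N cp K x z \<longrightarrow> s \<in> {0..T} \<longrightarrow> t \<in> {0..T} \<longrightarrow> i \<in> {1..N} \<longrightarrow>
     norm (x i t, z i t) \<le> c * (\<Sum>j = 1..N. norm (x j s, z j s))"
proof -
  have "i \<in> {1..N} \<Longrightarrow> \<exists>c\<ge>0. \<forall>x z s t. asys T N cp K x z \<longrightarrow> s \<in> {0..T} \<longrightarrow> t \<in> {0..T} \<longrightarrow>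
     norm (x i t, z i t) \<le> c * (\<Sum>j = 1..N. norm (x j s, z j s))" for i
  proof (induction i rule: less_induct)
    case (less i)
    have cpi: "cp i \<subseteq> {1..<i}" and bl: "\<And>k. k \<in> cp i \<Longrightarrow> bounded_linear (K i k)"
      using cas less.prems by (auto simp: cascade_def)
    have "\<forall>k\<in>cp i. \<exists>c\<ge>0. \<forall>x z s t. asys T N cp K x z \<longrightarrow> s \<in> {0..T} \<longrightarrow> t \<in> {0..T} \<longrightarrow>
        norm (x k t, z k t) \<le> c * (\<Sum>j = 1..N. norm (x j s, z j s))"
    proof
      fix k assume "k \<in> cp i"
      then have "k < i" "k \<in> {1..N}" using cpi less.prems by auto
      then show "\<exists>c\<ge>0. \<forall>x z s t. asys T N cp K x z \<longrightarrow> s \<in> {0..T} \<longrightarrow> t \<in> {0..T} \<longrightarrow>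
        norm (x k t, z k t) \<le> c * (\<Sum>j = 1..N. norm (x j s, z j s))" by (rule less.IH)
    qed
    from bchoice[OF this] obtain c where c: "\<And>k. k \<in> cp i \<Longrightarrow> c k \<ge> 0"
      "\<And>k x z s t. k \<in> cp i \<Longrightarrow> asys T N cp K x z \<Longrightarrow> s \<in> {0..T} \<Longrightarrow> t \<in> {0..T} \<Longrightarrow>
         norm (x k t, z k t) \<le> c k * (\<Sum>j = 1..N. norm (x j s, z j s))" by blast
    define M where "M = (\<Sum>k\<in>cp i. onorm (K i k) * c k)"
    have M: "M \<ge> 0" unfolding M_def using c bl by (intro sum_nonneg mult_nonneg_nonneg onorm_pos_le) auto
    show ?case
    proof (intro exI[of _ "1 + M * \<bar>T\<bar>"] conjI allI impI)
      fix x z s t assume a: "asys T N cp K x z" and s: "s \<in> {0..T}" and t: "t \<in> {0..T}"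
      define D where "D = (\<Sum>j = 1..N. norm (x j s, z j s))"
      have D: "D \<ge> 0" by (simp add: D_def sum_nonneg)
      have rhs: "norm (- (\<Sum>k\<in>cp i. K i k (x k r))) \<le> M * D" if r: "r \<in> {0..T}" for r
      proof -
        have "norm (- (\<Sum>k\<in>cp i. K i k (x k r))) \<le> (\<Sum>k\<in>cp i. norm (K i k (x k r)))"
          by (simp add: norm_sum)
        also have "\<dots> \<le> (\<Sum>k\<in>cp i. onorm (K i k) * c k * D)"
        proof (rule sum_mono)
          fix k assume k: "k \<in> cp i"
          have "norm (x k r) \<le> norm (x k r, z k r)" by (simp add: norm_Pair)
          also have "\<dots> \<le> c k * D" using c(2)[OF k a s r] by (simp add: D_def)
          finally have "onorm (K i k) * norm (x k r) \<le> onorm (K i k) * (c k * D)"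
            by (intro mult_left_mono onorm_pos_le bl k)
          then show "norm (K i k (x k r)) \<le> onorm (K i k) * c k * D"
            using onorm[OF bl[OF k], of "x k r"] by (simp add: mult.assoc)
        qed
        finally show ?thesis by (simp add: M_def sum_distrib_right)
      qed
      have "asol T (\<lambda>t. - (\<Sum>k\<in>cp i. K i k (x k t))) (x i) (z i)" using a less.prems by (auto simp: asys_def)
      from asol_estimate[OF this rhs s t]
      have "norm (x i t, z i t) \<le> norm (x i s, z i s) + M * D * \<bar>t - s\<bar>" .
      also have "norm (x i s, z i s) \<le> D"
        unfolding D_def by (rule member_le_sum) (use less.prems in auto)
      also have "M * D * \<bar>t - s\<bar> \<le> M * D * \<bar>T\<bar>" using s t M D by (intro mult_left_mono) auto
      finally show "norm (x i t, z i t) \<le> (1 + M * \<bar>T\<bar>) * (\<Sum>j = 1..N. norm (x j s, z j s))"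
        unfolding D_def[symmetric] by (simp add: algebra_simps)
    qed (use M in simp)
  qed
  then have "\<forall>i\<in>{1..N}. \<exists>c\<ge>0. \<forall>x z s t. asys T N cp K x z \<longrightarrow> s \<in> {0..T} \<longrightarrow> t \<in> {0..T} \<longrightarrow>
     norm (x i t, z i t) \<le> c * (\<Sum>j = 1..N. norm (x j s, z j s))" by blast
  from bchoice[OF this] obtain c where c: "\<And>i. i \<in> {1..N} \<Longrightarrow> c i \<ge> 0"
    "\<And>i x z s t. i \<in> {1..N} \<Longrightarrow> asys T N cp K x z \<Longrightarrow> s \<in> {0..T} \<Longrightarrow> t \<in> {0..T} \<Longrightarrow>
       norm (x i t, z i t) \<le> c i * (\<Sum>j = 1..N. norm (x j s, z j s))" by blast
  show ?thesis
  proof (intro exI[of _ "\<Sum>i = 1..N. c i"] conjI allI impI)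
    show "0 \<le> (\<Sum>i = 1..N. c i)" using c(1) by (auto intro: sum_nonneg)
    fix x z s t i assume *: "asys T N cp K x z" "s \<in> {0..T}" "t \<in> {0..T}" and i: "i \<in> {1..N}"
    have "c i \<le> (\<Sum>i = 1..N. c i)" by (rule member_le_sum) (use i c(1) in auto)
    then have "c i * (\<Sum>j = 1..N. norm (x j s, z j s)) \<le> (\<Sum>i = 1..N. c i) * (\<Sum>j = 1..N. norm (x j s, z j s))"
      by (rule mult_right_mono) (simp add: sum_nonneg)
    then show "norm (x i t, z i t) \<le> (\<Sum>i = 1..N. c i) * (\<Sum>j = 1..N. norm (x j s, z j s))"
      using c(2)[OF i *] by linarith
  qed
qed

text \<open>\<open>Q = A\<^bsup>(s-1)/2\<^esup> L\<^sup>* A\<^bsup>-r/2\<^esup>\<close>: the coupling by the transpose of \<open>L\<close>, from level \<open>r\<close> into level \<open>s\<close>.\<close>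

definition couples :: "int \<Rightarrow> int \<Rightarrow> ('h \<Rightarrow> 'h) \<Rightarrow> ('h \<Rightarrow> 'h) \<Rightarrow> bool" where
  "couples r s L Q \<longleftrightarrow> bounded_linear Q \<and>
     (\<forall>\<phi> \<psi>. sc (1 - s) \<phi> \<psi> \<longrightarrow> (\<exists>\<xi>. sc (- r) (L \<phi>) \<xi>) \<and> (\<forall>y. fn r y (L \<phi>) = Q y \<bullet> \<psi>))"

text \<open>The operator \<open>A^{-r/2} L A^{(s-1)/2}\<close> is bounded on \<open>H\<close>,
  because \<open>L\<close> preserves \<open>H_{1-s}\<close> and \<open>1 - s \<ge> -r\<close> puts
  the result in the domain of \<open>A^{-r/2}\<close>; \<open>Q\<close> is its adjoint.\<close>

lemma couples_exists:
  assumes L: "bounded_on_Hk A m L" and m: "int m = 1 - s" and r: "s \<le> r + 1"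
  shows "\<exists>Q. couples r s L Q"
proof -
  obtain c where lin: "lin_on (Hdom A m) L" and img: "L ` Hdom A m \<subseteq> Hdom A m"
    and c: "\<And>u. u \<in> Hdom A m \<Longrightarrow> Hdom_norm A m (L u) \<le> c * Hdom_norm A m u"
    using L unfolding bounded_on_Hk_def by blast
  define R where "R \<psi> = pw (- r) (L (pw (- int m) \<psi>))" for \<psi>
  have ps: "sc (int m) (pw (- int m) \<psi>) \<psi>" for \<psi> using sc_sym[OF sc_pw[of "- int m" \<psi>]] by simp
  have inH: "pw (- int m) \<psi> \<in> Hdom A m" for \<psi> using ps by (auto simp: Hdom_iff)
  have R: "sc (- r) (L (pw (- int m) \<psi>)) (R \<psi>) \<and> norm (R \<psi>) \<le> c\<^sub>0 powi (- r - int m) * c * norm \<psi>" for \<psi>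
  proof -
    have "L (pw (- int m) \<psi>) \<in> Hdom A m" using img inH by blast
    then obtain \<eta> where \<eta>: "sc (int m) (L (pw (- int m) \<psi>)) \<eta>" by (auto simp: Hdom_iff)
    have "norm \<eta> \<le> c * norm \<psi>" using c[OF inH] Hdom_norm_sc[OF \<eta>] Hdom_norm_sc[OF ps] by metis
    then have "c\<^sub>0 powi (- r - int m) * norm \<eta> \<le> c\<^sub>0 powi (- r - int m) * (c * norm \<psi>)"
      using c0 by (intro mult_left_mono) auto
    moreover obtain \<xi> where "sc (- r) (L (pw (- int m) \<psi>)) \<xi>" "norm \<xi> \<le> c\<^sub>0 powi (- r - int m) * norm \<eta>"
      using sc_mono[OF \<eta>, of "- r"] m r by auto
    ultimately show ?thesis using pw_eq by (auto simp: R_def mult.assoc)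
  qed
  have pl: "linear (pw (- int m))" by (intro bounded_linear.linear bounded_linear_pw) simp
  have Reval: "R \<psi> = \<xi>" if "sc (- r) (L (pw (- int m) \<psi>)) \<xi>" for \<psi> \<xi> using R sc_unique that by blast
  have "bounded_linear R"
  proof (rule bounded_linear_intro[where K = "c\<^sub>0 powi (- r - int m) * c"])
    fix x y :: 'h and d :: real
    have "L (pw (- int m) (x + y)) = L (pw (- int m) x) + L (pw (- int m) y)"
      using lin inH unfolding lin_on_def linear_add[OF pl] by blast
    then show "R (x + y) = R x + R y" using sc_lin[OF conjunct1[OF R[of x]] conjunct1[OF R[of y]], of 1 1] by (intro Reval) simp
    have "L (pw (- int m) (d *\<^sub>R x)) = d *\<^sub>R L (pw (- int m) x)"
      using lin inH unfolding lin_on_def linear_scale[OF pl] by blast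
    then show "R (d *\<^sub>R x) = d *\<^sub>R R x" using sc_lin[OF conjunct1[OF R[of x]] conjunct1[OF R[of x]], of d 0] by (intro Reval) simp
  qed (use R in \<open>simp add: mult.commute\<close>)
  then obtain Q where Q: "bounded_linear Q" "\<And>y \<psi>. Q y \<bullet> \<psi> = y \<bullet> R \<psi>" using adjoint_exists by metis
  have "(\<exists>\<xi>. sc (- r) (L \<phi>) \<xi>) \<and> (\<forall>y. fn r y (L \<phi>) = Q y \<bullet> \<psi>)" if "sc (1 - s) \<phi> \<psi>" for \<phi> \<psi>
  proof -
    have "pw (- int m) \<psi> = \<phi>" using that m sc_sym pw_eq by metis
    then show ?thesis using R[of \<psi>] fn_eval[OF conjunct1[OF R[of \<psi>]]] Q(2) by auto
  qed
  then show ?thesis using Q(1) by (auto simp: couples_def)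
qed

definition coupling_rep ::
  "(nat \<Rightarrow> nat \<Rightarrow> 'h \<Rightarrow>\<^sub>L 'h) \<Rightarrow> nat \<Rightarrow> nat \<Rightarrow> (nat \<Rightarrow> int) \<Rightarrow> (nat \<Rightarrow> nat \<Rightarrow> 'h \<Rightarrow> 'h) \<Rightarrow> bool" where
  "coupling_rep C n p \<sigma> K \<longleftrightarrow> (\<forall>i\<in>{1..n + p}. \<forall>k\<in>coupled n i.
     couples (\<sigma> k) (\<sigma> i) (adjoint (blinfun_apply (C i k))) (K i k))"

lemma coupled_subset: "n \<ge> 2 \<Longrightarrow> coupled n i \<subseteq> {1..<i}"
  by (auto simp: coupled_def)

lemma coupling_rep_cascade: "n \<ge> 2 \<Longrightarrow> coupling_rep C n p \<sigma> K \<Longrightarrow> cascade (n + p) (coupled n) K"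
  using coupled_subset by (auto simp: coupling_rep_def couples_def cascade_def)

text \<open>From here on the dual system is a cascade with bounded couplings on \<open>H\<close>;
  the levels survive only in the choice of \<open>K\<close>.\<close>

lemma dual_sol_iff:
  assumes n: "n \<ge> 2" and rep: "coupling_rep C n p \<sigma> K" and T: "T > 0"
  shows "dual_sol A C n p \<sigma> T w w' \<longleftrightarrow> (\<exists>x z. asys T (n + p) (coupled n) K x z \<and>
     (\<forall>i\<in>{1..n + p}. \<forall>t\<in>{0..T}. w i t = fn (\<sigma> i) (x i t) \<and> w' i t = fn (\<sigma> i - 1) (z i t)))"
proof -
  have cp: "coupled n i \<subseteq> {1..n + p}" if "i \<in> {1..n + p}" for i using coupled_subset[OF n, of i] that by force
  have ev: "fn (\<sigma> k) y (adjoint (blinfun_apply (C i k)) \<phi>) = K i k y \<bullet> \<psi>"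
    if "i \<in> {1..n + p}" "k \<in> coupled n i" "sc (1 - \<sigma> i) \<phi> \<psi>" for i k y \<phi> \<psi>
    using rep that by (auto simp: coupling_rep_def couples_def)
  have rhs: "- (\<Sum>k\<in>coupled n i. w k t (adjoint (blinfun_apply (C i k)) \<phi>)) = (- (\<Sum>k\<in>coupled n i. K i k (x k t))) \<bullet> \<psi>"
    if i: "i \<in> {1..n + p}" and w: "\<And>k. k \<in> {1..n + p} \<Longrightarrow> w k t = fn (\<sigma> k) (x k t)"
      and p: "sc (1 - \<sigma> i) \<phi> \<psi>" for i t x \<phi> \<psi>
    unfolding inner_minus_left inner_sum_left
    by (intro arg_cong[where f = uminus] sum.cong refl) (use cp[OF i] w ev[OF i _ p] in auto)
  show ?thesis
  proof
    assume d: "dual_sol A C n p \<sigma> T w w'"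
    have "\<exists>x. continuous_on {0..T} x \<and> (\<forall>t\<in>{0..T}. w i t = fn (\<sigma> i) (x t))" if "i \<in> {1..n + p}" for i
      using d that unfolding dual_sol_def wave_sol_def cont_Hs_iff by blast
    then obtain x where x: "\<And>i. i \<in> {1..n + p} \<Longrightarrow> continuous_on {0..T} (x i)"
      "\<And>i t. i \<in> {1..n + p} \<Longrightarrow> t \<in> {0..T} \<Longrightarrow> w i t = fn (\<sigma> i) (x i t)" by metis
    have "\<exists>x. \<forall>t\<in>{0..T}. w' i t = fn (\<sigma> i - 1) (x t)" if "i \<in> {1..n + p}" for i
      using d that unfolding dual_sol_def wave_sol_def cont_Hs_iff by blast
    then obtain z where z: "\<And>i t. i \<in> {1..n + p} \<Longrightarrow> t \<in> {0..T} \<Longrightarrow> w' i t = fn (\<sigma> i - 1) (z i t)" by metis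
    have "asol T (\<lambda>t. - (\<Sum>k\<in>coupled n i. K i k (x k t))) (x i) (z i)" if i: "i \<in> {1..n + p}" for i
    proof (rule asol_if_wave_sol[where s = "\<sigma> i" and w = "w i" and w' = "w' i" and T = T])
      show "wave_sol A (\<sigma> i) T (\<lambda>t \<phi>. - (\<Sum>k\<in>coupled n i. w k t (adjoint (blinfun_apply (C i k)) \<phi>))) (w i) (w' i)"
        using d i by (auto simp: dual_sol_def)
      show "continuous_on {0..T} (\<lambda>t. - (\<Sum>k\<in>coupled n i. K i k (x k t)))"
      proof (intro continuous_on_minus continuous_on_sum)
        fix k assume k: "k \<in> coupled n i"
        then have "bounded_linear (K i k)" using rep i by (auto simp: coupling_rep_def couples_def)
        then show "continuous_on {0..T} (\<lambda>t. K i k (x k t))"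
          by (rule bounded_linear.continuous_on) (use x(1) cp[OF i] k in auto)
      qed
      fix r e assume r: "r \<in> {0..T}" and e: "e \<in> E"
      show "- (\<Sum>k\<in>coupled n i. w k r (adjoint (blinfun_apply (C i k)) e)) =
         \<mu> e powi (1 - \<sigma> i) * ((- (\<Sum>k\<in>coupled n i. K i k (x k r))) \<bullet> e)"
        using rhs[where x = x and t = r, OF i x(2)[OF _ r] sc_basis[OF e]] by simp
    qed (use T x(2) z i in auto)
    then show "\<exists>x z. asys T (n + p) (coupled n) K x z \<and>
     (\<forall>i\<in>{1..n + p}. \<forall>t\<in>{0..T}. w i t = fn (\<sigma> i) (x i t) \<and> w' i t = fn (\<sigma> i - 1) (z i t))"
      using x(2) z by (intro exI[of _ x] exI[of _ z] conjI) (auto simp: asys_def)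
  next
    assume "\<exists>x z. asys T (n + p) (coupled n) K x z \<and>
     (\<forall>i\<in>{1..n + p}. \<forall>t\<in>{0..T}. w i t = fn (\<sigma> i) (x i t) \<and> w' i t = fn (\<sigma> i - 1) (z i t))"
    then obtain x z where a: "asys T (n + p) (coupled n) K x z"
      and x: "\<And>i t. i \<in> {1..n + p} \<Longrightarrow> t \<in> {0..T} \<Longrightarrow> w i t = fn (\<sigma> i) (x i t)"
      and z: "\<And>i t. i \<in> {1..n + p} \<Longrightarrow> t \<in> {0..T} \<Longrightarrow> w' i t = fn (\<sigma> i - 1) (z i t)" by blast
    show "dual_sol A C n p \<sigma> T w w'"
      unfolding dual_sol_def
    proof
      fix i assume i: "i \<in> {1..n + p}"
      show "wave_sol A (\<sigma> i) T (\<lambda>t \<phi>. - (\<Sum>k\<in>coupled n i. w k t (adjoint (blinfun_apply (C i k)) \<phi>))) (w i) (w' i)"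
      proof (rule wave_sol_if_asol)
        show "asol T (\<lambda>t. - (\<Sum>k\<in>coupled n i. K i k (x k t))) (x i) (z i)" using a i by (auto simp: asys_def)
      qed (use rhs[where x = x, OF i x] x[OF i] z[OF i] in auto)
    qed
  qed
qed

end

section \<open>Square integrable functions with values in a Hilbert space\<close>

definition strongly_measurable :: "real \<Rightarrow> (real \<Rightarrow> 'a::real_normed_vector) \<Rightarrow> bool" where
  "strongly_measurable T f \<longleftrightarrow> (\<exists>S. (\<forall>j. simple_function (lebesgue_on {0..T}) (S j)) \<and>
          (AE t in lebesgue_on {0..T}. (\<lambda>j::nat. S j t) \<longlonglongrightarrow> f t))"

lemma L2_iff:
  "L2 T X f \<longleftrightarrow> (\<forall>t\<in>{0..T}. f t \<in> X) \<and> strongly_measurable T f \<and>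
     integrable (lebesgue_on {0..T}) (\<lambda>t. (norm (f t))\<^sup>2)"
  by (simp add: L2_def strongly_measurable_def)

text \<open>The functions are extended by zero to the whole line; there the limit agrees almost
  everywhere with a measurable function, and Lebesgue measure is complete.\<close>

lemma AE_limit_borel_measurable:
  fixes f :: "real \<Rightarrow> real"
  assumes u: "\<And>j::nat. u j \<in> borel_measurable (lebesgue_on {0..T})"
    and lim: "AE t in lebesgue_on {0..T}. (\<lambda>j. u j t) \<longlonglongrightarrow> f t"
  shows "f \<in> borel_measurable (lebesgue_on {0..T})"
proof -
  define U where "U j t = (if t \<in> {0..T} then u j t else 0)" for j t
  have "U j \<in> borel_measurable lebesgue" for j
    using u borel_measurable_if[of "{0..T}" "u j"] unfolding U_def by simp
  then have "(\<lambda>t. lim (\<lambda>j. U j t)) \<in> borel_measurable lebesgue" by (rule borel_measurable_lim_metric)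
  moreover have "AE t in lebesgue. lim (\<lambda>j. U j t) = (if t \<in> {0..T} then f t else 0)"
  proof -
    have "AE t in lebesgue. t \<in> {0..T} \<longrightarrow> (\<lambda>j. u j t) \<longlonglongrightarrow> f t"
      using lim by (simp add: AE_restrict_space_iff)
    then show ?thesis by (rule AE_mp) (auto simp: U_def intro!: AE_I2 limI)
  qed
  ultimately have "(\<lambda>t. if t \<in> {0..T} then f t else 0) \<in> borel_measurable lebesgue"
    by (rule borel_measurable_AE)
  then show ?thesis using borel_measurable_if[of "{0..T}" f] by simp
qed

text \<open>The measurability of expressions in two functions goes through their simple
  approximants, since the target spaces are not assumed second countable and pairing could destroy
  Borel measurability.\<close>

lemma strongly_measurable_compose2:
  fixes h :: "'a::real_normed_vector \<times> 'b::real_normed_vector \<Rightarrow> real"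
  assumes "strongly_measurable T f" "strongly_measurable T g" "continuous_on UNIV h"
  shows "(\<lambda>t. h (f t, g t)) \<in> borel_measurable (lebesgue_on {0..T})"
proof -
  obtain S R where S: "\<And>j. simple_function (lebesgue_on {0..T}) (S j)" "AE t in lebesgue_on {0..T}. (\<lambda>j::nat. S j t) \<longlonglongrightarrow> f t"
    and R: "\<And>j. simple_function (lebesgue_on {0..T}) (R j)" "AE t in lebesgue_on {0..T}. (\<lambda>j::nat. R j t) \<longlonglongrightarrow> g t"
    using assms by (auto simp: strongly_measurable_def)
  have "(\<lambda>t. h (S j t, R j t)) \<in> borel_measurable (lebesgue_on {0..T})" for j
    by (rule borel_measurable_simple_function) (rule simple_function_compose2[OF S(1) R(1), where h = "\<lambda>a b. h (a, b)"])
  moreover have "AE t in lebesgue_on {0..T}. (\<lambda>j. h (S j t, R j t)) \<longlonglongrightarrow> h (f t, g t)"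
    using S(2) R(2)
  proof eventually_elim
    case (elim t)
    show ?case by (rule continuous_on_tendsto_compose[OF assms(3) tendsto_Pair[OF elim]]) auto
  qed
  ultimately show ?thesis by (rule AE_limit_borel_measurable)
qed

lemma strongly_measurable_lincomb:
  assumes "strongly_measurable T f" "strongly_measurable T g"
  shows "strongly_measurable T (\<lambda>t. a *\<^sub>R f t + c *\<^sub>R g t)"
proof -
  obtain S R where S: "\<And>j. simple_function (lebesgue_on {0..T}) (S j)" "AE t in lebesgue_on {0..T}. (\<lambda>j::nat. S j t) \<longlonglongrightarrow> f t"
    and R: "\<And>j. simple_function (lebesgue_on {0..T}) (R j)" "AE t in lebesgue_on {0..T}. (\<lambda>j::nat. R j t) \<longlonglongrightarrow> g t"
    using assms by (auto simp: strongly_measurable_def)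
  show ?thesis
    unfolding strongly_measurable_def
  proof (intro exI[of _ "\<lambda>j t. a *\<^sub>R S j t + c *\<^sub>R R j t"] conjI allI)
    show "simple_function (lebesgue_on {0..T}) (\<lambda>t. a *\<^sub>R S j t + c *\<^sub>R R j t)" for j
      by (rule simple_function_compose2[OF S(1) R(1), where h = "\<lambda>x y. a *\<^sub>R x + c *\<^sub>R y"])
    show "AE t in lebesgue_on {0..T}. (\<lambda>j. a *\<^sub>R S j t + c *\<^sub>R R j t) \<longlonglongrightarrow> a *\<^sub>R f t + c *\<^sub>R g t"
      using S(2) R(2) by eventually_elim (intro tendsto_intros)
  qed
qed

lemma L2_inner_integrable:
  assumes f: "strongly_measurable T f" "integrable (lebesgue_on {0..T}) (\<lambda>t. (norm (f t))\<^sup>2)"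
    and g: "strongly_measurable T g" "integrable (lebesgue_on {0..T}) (\<lambda>t. (norm (g t))\<^sup>2)"
  shows "integrable (lebesgue_on {0..T}) (\<lambda>t. f t \<bullet> (g t :: 'a::real_inner))"
proof (rule Bochner_Integration.integrable_bound)
  show "integrable (lebesgue_on {0..T}) (\<lambda>t. (norm (f t))\<^sup>2 + (norm (g t))\<^sup>2)"
    using f(2) g(2) by (rule Bochner_Integration.integrable_add)
  have "continuous_on UNIV (\<lambda>p::'a \<times> 'a. fst p \<bullet> snd p)" by (intro continuous_intros)
  from strongly_measurable_compose2[OF f(1) g(1) this]
  show "(\<lambda>t. f t \<bullet> g t) \<in> borel_measurable (lebesgue_on {0..T})" by simp
  have "norm (x \<bullet> y) \<le> norm ((norm x)\<^sup>2 + (norm y)\<^sup>2)" for x y :: 'a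
  proof -
    have "\<bar>x \<bullet> y\<bar> \<le> norm x * norm y" by (rule Cauchy_Schwarz_ineq2)
    moreover have "2 * (norm x * norm y) \<le> (norm x)\<^sup>2 + (norm y)\<^sup>2"
      using sum_squares_bound[of "norm x" "norm y"] by simp
    moreover have "0 \<le> norm x * norm y" by simp
    ultimately show ?thesis by (simp only: real_norm_def)
  qed
  then show "AE t in lebesgue_on {0..T}. norm (f t \<bullet> g t) \<le> norm ((norm (f t))\<^sup>2 + (norm (g t))\<^sup>2)" by simp
qed

lemma norm_lincomb_sq: "(norm (a *\<^sub>R x + c *\<^sub>R y))\<^sup>2 = a\<^sup>2 * (norm x)\<^sup>2 + 2 * a * c * (x \<bullet> y) + c\<^sup>2 * (norm (y::'a::real_inner))\<^sup>2"
  unfolding power2_norm_eq_inner by (simp add: inner_add inner_commute power2_eq_square algebra_simps)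

lemma L2_lincomb:
  fixes f g :: "real \<Rightarrow> 'a::real_inner"
  assumes f: "L2 T X f" and g: "L2 T X g" and X: "subspace X"
  shows "L2 T X (\<lambda>t. a *\<^sub>R f t + c *\<^sub>R g t)"
  unfolding L2_iff
proof (intro conjI ballI)
  show "a *\<^sub>R f t + c *\<^sub>R g t \<in> X" if "t \<in> {0..T}" for t
    using f g that by (auto simp: L2_iff intro!: subspace_add[OF X] subspace_scale[OF X])
  show "strongly_measurable T (\<lambda>t. a *\<^sub>R f t + c *\<^sub>R g t)"
    using f g by (intro strongly_measurable_lincomb) (auto simp: L2_iff)
  show "integrable (lebesgue_on {0..T}) (\<lambda>t. (norm (a *\<^sub>R f t + c *\<^sub>R g t))\<^sup>2)"
    unfolding norm_lincomb_sq using f g L2_inner_integrable[of T f g]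
    by (intro Bochner_Integration.integrable_add integrable_mult_right) (auto simp: L2_iff)
qed

lemma L2_subset: "L2 T X f \<Longrightarrow> X \<subseteq> Y \<Longrightarrow> L2 T Y f"
  by (auto simp: L2_iff)

lemma L2_UNIV: "L2 T X f \<Longrightarrow> L2 T UNIV f"
  by (rule L2_subset) auto

lemma L2_cong:
  assumes "L2 T X f" "\<And>t. t \<in> {0..T} \<Longrightarrow> f t = g t"
  shows "L2 T X g"
proof -
  obtain S where S: "\<forall>j. simple_function (lebesgue_on {0..T}) (S j)" "AE t in lebesgue_on {0..T}. (\<lambda>j::nat. S j t) \<longlonglongrightarrow> f t"
    using assms(1) by (auto simp: L2_def)
  have "AE t in lebesgue_on {0..T}. (\<lambda>j::nat. S j t) \<longlonglongrightarrow> g t"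
    by (rule lebesgue_on_mono[OF S(2)]) (use assms(2) in auto)
  moreover have "integrable (lebesgue_on {0..T}) (\<lambda>t. (norm (g t))\<^sup>2)"
    using assms by (auto simp: L2_def intro: Bochner_Integration.integrable_cong[THEN iffD1, rotated -1])
  ultimately show ?thesis using assms S(1) by (auto simp: L2_def)
qed

lemma L2_sq_cong: "(\<And>t. t \<in> {0..T} \<Longrightarrow> f t = g t) \<Longrightarrow> L2_sq T f = L2_sq T g"
  by (rule Bochner_Integration.integral_cong) auto

lemma L2_sq_nonneg: "L2_sq T f \<ge> 0"
  by simp

lemma L2_sq_lincomb:
  fixes f g :: "real \<Rightarrow> 'a::real_inner"
  assumes f: "L2 T X f" and g: "L2 T Y g"
  shows "L2_sq T (\<lambda>t. a *\<^sub>R f t + c *\<^sub>R g t) =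
    a\<^sup>2 * L2_sq T f + 2 * a * c * integral\<^sup>L (lebesgue_on {0..T}) (\<lambda>t. f t \<bullet> g t) + c\<^sup>2 * L2_sq T g"
proof -
  have "integrable (lebesgue_on {0..T}) (\<lambda>t. f t \<bullet> g t)" using f g by (intro L2_inner_integrable) (auto simp: L2_iff)
  then show ?thesis using f g unfolding norm_lincomb_sq by (auto simp: L2_iff)
qed

lemma L2_sq_lincomb_le:
  fixes f g :: "real \<Rightarrow> 'a::real_inner"
  assumes f: "L2 T X f" and g: "L2 T Y g"
  shows "L2_sq T (\<lambda>t. a *\<^sub>R f t + c *\<^sub>R g t) \<le> 2 * a\<^sup>2 * L2_sq T f + 2 * c\<^sup>2 * L2_sq T g"
proof -
  have "0 \<le> a\<^sup>2 * L2_sq T f - 2 * a * c * integral\<^sup>L (lebesgue_on {0..T}) (\<lambda>t. f t \<bullet> g t) + c\<^sup>2 * L2_sq T g"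
    using L2_sq_lincomb[OF f g, of a "- c"] L2_sq_nonneg[of T "\<lambda>t. a *\<^sub>R f t + (- c) *\<^sub>R g t"] by simp
  then show ?thesis using L2_sq_lincomb[OF f g, of a c] by linarith
qed

lemma L2_cauchy_schwarz:
  fixes f g :: "real \<Rightarrow> 'a::real_inner"
  assumes f: "L2 T X f" and g: "L2 T Y g" and ab: "{a..b} \<subseteq> {0..T}"
  shows "(integral\<^sup>L (lebesgue_on {a..b}) (\<lambda>t. f t \<bullet> g t))\<^sup>2 \<le>
    integral\<^sup>L (lebesgue_on {a..b}) (\<lambda>t. (norm (f t))\<^sup>2) * integral\<^sup>L (lebesgue_on {a..b}) (\<lambda>t. (norm (g t))\<^sup>2)"
proof (rule nonneg_quadratic_discriminant)
  fix s :: real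
  have i: "integrable (lebesgue_on {a..b}) (\<lambda>t. f t \<bullet> g t)" "integrable (lebesgue_on {a..b}) (\<lambda>t. (norm (f t))\<^sup>2)"
    "integrable (lebesgue_on {a..b}) (\<lambda>t. (norm (g t))\<^sup>2)"
    using f g by (auto simp: L2_iff intro!: integrable_subinterval[OF _ ab] L2_inner_integrable)
  have "0 \<le> integral\<^sup>L (lebesgue_on {a..b}) (\<lambda>t. (norm (1 *\<^sub>R f t + s *\<^sub>R g t))\<^sup>2)" by simp
  then show "0 \<le> integral\<^sup>L (lebesgue_on {a..b}) (\<lambda>t. (norm (f t))\<^sup>2) + 2 * s * integral\<^sup>L (lebesgue_on {a..b}) (\<lambda>t. f t \<bullet> g t)
      + s\<^sup>2 * integral\<^sup>L (lebesgue_on {a..b}) (\<lambda>t. (norm (g t))\<^sup>2)"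
    unfolding norm_lincomb_sq using i by simp
qed simp

lemma lebesgue_on_integral_subinterval:
  fixes u :: "real \<Rightarrow> real"
  assumes "integrable (lebesgue_on {0..T}) u" "{a..b} \<subseteq> {0..T}" "\<And>t. t \<in> {0..T} \<Longrightarrow> u t \<ge> 0"
  shows "integral\<^sup>L (lebesgue_on {a..b}) u \<le> integral\<^sup>L (lebesgue_on {0..T}) u"
  by (rule integral_mono_lebesgue_on_AE) (use assms in auto)

lemma lebesgue_on_integral_split:
  fixes u :: "real \<Rightarrow> real"
  assumes u: "integrable (lebesgue_on {0..T}) u" and ab: "0 \<le> a" "a \<le> b" "b \<le> T"
  shows "integral\<^sup>L (lebesgue_on {0..b}) u = integral\<^sup>L (lebesgue_on {0..a}) u + integral\<^sup>L (lebesgue_on {a..b}) u"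
proof -
  have "(u has_integral integral\<^sup>L (lebesgue_on {c..d}) u) {c..d}" if "0 \<le> c" "d \<le> T" for c d
    by (rule has_integral_integral_lebesgue_on) (use integrable_subinterval[OF u, of c d] that in auto)
  from has_integral_combine[OF ab(1,2) this[of 0 a] this[of a b]] this[of 0 b]
  show ?thesis using ab by (auto dest: has_integral_unique)
qed

text \<open>Rounding times down to a grid of mesh \<open>d\<close> gives a function with finitely
  many values; uniform continuity controls the error. The grid contains 0, so the rounded time stays
  in the interval.\<close>

lemma continuous_step_approx:
  fixes f :: "real \<Rightarrow> 'a::real_normed_vector"
  assumes f: "continuous_on {0..T} f" and "\<epsilon> > 0"
  shows "\<exists>S. simple_function (lebesgue_on {0..T}) S \<and> (\<forall>t\<in>{0..T}. norm (S t - f t) < \<epsilon>)"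
proof -
  have "uniformly_continuous_on {0..T} f" using f by (rule compact_uniformly_continuous) simp
  then obtain \<delta> where \<delta>: "\<delta> > 0" "\<And>s t. s \<in> {0..T} \<Longrightarrow> t \<in> {0..T} \<Longrightarrow> dist s t < \<delta> \<Longrightarrow> dist (f s) (f t) < \<epsilon>"
    using \<open>\<epsilon> > 0\<close> unfolding uniformly_continuous_on_def by metis
  define d where "d = \<delta> / 2"
  have d: "d > 0" using \<delta> by (simp add: d_def)
  define r where "r t = d * of_int \<lfloor>t / d\<rfloor>" for t
  have r: "r t \<le> t" "t < r t + d" for t
  proof -
    have "of_int \<lfloor>t / d\<rfloor> \<le> t / d" "t / d < of_int \<lfloor>t / d\<rfloor> + 1" by linarith+
    from mult_left_mono[OF this(1), of d] mult_strict_left_mono[OF this(2), of d]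
    show "r t \<le> t" "t < r t + d" using d by (simp_all add: r_def distrib_left)
  qed
  have rin: "r t \<in> {0..T}" "dist (r t) t < \<delta>" if "t \<in> {0..T}" for t
  proof -
    have "0 \<le> \<lfloor>t / d\<rfloor>" using that d by simp
    then have "0 \<le> r t" using d by (simp add: r_def)
    then show "r t \<in> {0..T}" "dist (r t) t < \<delta>" using r[of t] that \<delta> by (auto simp: dist_real_def d_def)
  qed
  have "simple_function (lebesgue_on {0..T}) r"
  proof (rule simple_function_borel_measurable)
    have "r \<in> borel_measurable borel" unfolding r_def by measurable
    then show "r \<in> borel_measurable (lebesgue_on {0..T})"
      by (intro measurable_restrict_space1 measurable_completion) simp
    have "r ` {0..T} \<subseteq> (\<lambda>k. d * of_int k) ` {0..\<lfloor>T / d\<rfloor>}"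
      using d by (auto simp: r_def intro!: imageI floor_mono divide_right_mono)
    from finite_subset[OF this] show "finite (r ` space (lebesgue_on {0..T}))" by simp
  qed
  from simple_function_compose1[OF this, of f]
  show ?thesis using \<delta>(2) rin by (intro exI[of _ "\<lambda>t. f (r t)"]) (auto simp: dist_norm)
qed

lemma strongly_measurable_limit:
  fixes f :: "real \<Rightarrow> 'a::real_normed_vector"
  assumes c: "\<And>j::nat. continuous_on {0..T} (u j)" and lim: "AE t in lebesgue_on {0..T}. (\<lambda>j. u j t) \<longlonglongrightarrow> f t"
  shows "strongly_measurable T f"
proof -
  have "\<exists>S. \<forall>j. simple_function (lebesgue_on {0..T}) (S j) \<and> (\<forall>t\<in>{0..T}. norm (S j t - u j t) < inverse (real (Suc j)))"
    by (intro choice allI continuous_step_approx c) simp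
  then obtain S where S: "\<And>j::nat. simple_function (lebesgue_on {0..T}) (S j)"
    "\<And>j t. t \<in> {0..T} \<Longrightarrow> norm (S j t - u j t) < inverse (real (Suc j))" by blast
  have "AE t in lebesgue_on {0..T}. (\<lambda>j. S j t) \<longlonglongrightarrow> f t"
  proof (rule lebesgue_on_mono[OF lim])
    fix t assume l: "(\<lambda>j. u j t) \<longlonglongrightarrow> f t" and t: "t \<in> {0..T}"
    have "(\<lambda>j. S j t - u j t) \<longlonglongrightarrow> 0"
      by (rule Lim_null_comparison[OF _ LIMSEQ_inverse_real_of_nat]) (use S(2)[OF t] in \<open>auto intro!: always_eventually less_imp_le\<close>)
    from tendsto_add[OF this l] show "(\<lambda>j. S j t) \<longlonglongrightarrow> f t" by simp
  qed
  then show ?thesis using S(1) by (auto simp: strongly_measurable_def)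
qed

lemma strongly_measurable_continuous: "continuous_on {0..T} f \<Longrightarrow> strongly_measurable T f"
  by (rule strongly_measurable_limit[where u = "\<lambda>_. f"]) auto

lemma L2_continuous:
  assumes "continuous_on {0..T} f" "\<And>t. t \<in> {0..T} \<Longrightarrow> f t \<in> X"
  shows "L2 T X f"
  unfolding L2_iff
proof (intro conjI ballI assms strongly_measurable_continuous)
  show "integrable (lebesgue_on {0..T}) (\<lambda>t. (norm (f t))\<^sup>2)"
    by (intro continuous_imp_integrable_real continuous_intros assms)
qed

lemma L2_sq_le_bound:
  assumes "T \<ge> 0" "B \<ge> 0" "\<And>t. t \<in> {0..T} \<Longrightarrow> norm (f t) \<le> B"
  shows "L2_sq T f \<le> T * B\<^sup>2"
proof -
  have "L2_sq T f \<le> integral\<^sup>L (lebesgue_on {0..T}) (\<lambda>_. B\<^sup>2)"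
    by (rule integral_mono_AE') (use assms in \<open>auto intro!: AE_I2 power_mono continuous_imp_integrable_real\<close>)
  also have "\<dots> = T * B\<^sup>2" using assms(1) by (simp add: measure_restrict_space)
  finally show ?thesis .
qed

text \<open>The fast rate makes the increments summable in \<open>L^1\<close>, so the sequence
  itself converges almost everywhere. Fatou's lemma then turns the assumed rate into one for the
  distance to the limit.\<close>

lemma L2_complete:
  fixes g :: "nat \<Rightarrow> real \<Rightarrow> 'g::{real_inner,complete_space}"
  assumes c: "\<And>j. continuous_on {0..T} (g j)" and G: "\<And>j t. t \<in> {0..T} \<Longrightarrow> g j t \<in> G"
    and GX: "subspace G" "closed G" and T: "T \<ge> 0" and K: "K \<ge> 0"
    and cau: "\<And>i j. L2_sq T (\<lambda>t. g i t - g j t) \<le> K * ((1/2)^i + (1/2)^j)\<^sup>2"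
  shows "\<exists>f. L2 T G f \<and> (\<lambda>j. L2_sq T (\<lambda>t. g j t - f t)) \<longlonglongrightarrow> 0"
proof -
  let ?M = "lebesgue_on {0..T}"
  have cd: "continuous_on {0..T} (\<lambda>t. norm (g i t - g j t))" for i j by (intro continuous_intros c)
  have i1: "integrable ?M (\<lambda>t. norm (g i t - g j t))" for i j by (rule continuous_imp_integrable_real[OF cd])
  have i2: "integrable ?M (\<lambda>t. (norm (g i t - g j t))\<^sup>2)" for i j
    by (intro continuous_imp_integrable_real continuous_intros c)
  have m1: "(\<lambda>t. norm (g i t - g j t)) \<in> borel_measurable ?M" for i j using i1 by auto
  \<comment> \<open>The bound comes from \<open>x \<le> a / 2 + x^2 / (2 * a)\<close> with
    \<open>a = (1/2)^j\<close>: the first term integrates to \<open>T * a / 2\<close>, and the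
    assumed rate bounds the second by \<open>2 * K * a\<close>.\<close>
  define q where "q j = (1/2::real)^j * (T / 2 + 2 * K)" for j
  have q0: "q j \<ge> 0" for j using T K by (simp add: q_def)
  have L1: "integral\<^sup>L ?M (\<lambda>t. norm (g (Suc j) t - g j t)) \<le> q j" for j
  proof -
    let ?p = "(1/2::real)^j"
    have p: "?p > 0" by simp
    have "norm (g (Suc j) t - g j t) \<le> ?p / 2 + (norm (g (Suc j) t - g j t))\<^sup>2 / (2 * ?p)" for t
    proof -
      let ?x = "norm (g (Suc j) t - g j t)"
      have "0 \<le> (?p - ?x)\<^sup>2 / (2 * ?p)" using p by simp
      also have "\<dots> = ?p / 2 + ?x\<^sup>2 / (2 * ?p) - ?x" using p by (simp add: power2_diff field_simps power2_eq_square)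
      finally show ?thesis by linarith
    qed
    then have "integral\<^sup>L ?M (\<lambda>t. norm (g (Suc j) t - g j t)) \<le> integral\<^sup>L ?M (\<lambda>t. ?p / 2 + (norm (g (Suc j) t - g j t))\<^sup>2 / (2 * ?p))"
      by (intro integral_mono i1 Bochner_Integration.integrable_add integrable_divide_zero i2)
         (auto intro!: continuous_imp_integrable_real)
    also have "\<dots> = T * (?p / 2) + L2_sq T (\<lambda>t. g (Suc j) t - g j t) / (2 * ?p)"
    proof -
      have ic: "integrable ?M (\<lambda>t. ?p / 2)" by (rule continuous_imp_integrable_real) auto
      have "integral\<^sup>L ?M (\<lambda>t. ?p / 2) = T * (?p / 2)" using T by (simp add: measure_restrict_space)
      then show ?thesis using Bochner_Integration.integral_add[OF ic integrable_divide_zero[OF i2[of "Suc j" j], of "2 * ?p"]] by simp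
    qed
    also have "\<dots> \<le> T * (?p / 2) + (K * (2 * ?p)\<^sup>2) / (2 * ?p)"
    proof -
      have "K * ((1/2)^(Suc j) + ?p)\<^sup>2 \<le> K * (2 * ?p)\<^sup>2" using K by (intro mult_left_mono power_mono) auto
      then show ?thesis using cau[of "Suc j" j] p by (intro add_left_mono divide_right_mono) auto
    qed
    also have "\<dots> = q j" using p by (simp add: q_def power2_eq_square field_simps)
    finally show ?thesis .
  qed
  have "summable q" unfolding q_def by (intro summable_mult2 summable_geometric) simp
  have "(\<integral>\<^sup>+t. (\<Sum>j. ennreal (norm (g (Suc j) t - g j t))) \<partial>?M) = (\<Sum>j. \<integral>\<^sup>+t. ennreal (norm (g (Suc j) t - g j t)) \<partial>?M)"
    by (rule nn_integral_suminf) (use m1 in auto)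
  also have "\<dots> = (\<Sum>j. ennreal (integral\<^sup>L ?M (\<lambda>t. norm (g (Suc j) t - g j t))))"
    by (intro suminf_cong nn_integral_eq_integral i1) auto
  also have "\<dots> \<le> (\<Sum>j. ennreal (q j))"
    by (intro suminf_le ennreal_leI L1 summableI)
  also have "\<dots> < \<infinity>" using \<open>summable q\<close> q0 by (simp add: suminf_ennreal2)
  finally have "(\<integral>\<^sup>+t. (\<Sum>j. ennreal (norm (g (Suc j) t - g j t))) \<partial>?M) \<noteq> \<infinity>" by simp
  then have fin: "AE t in ?M. (\<Sum>j. ennreal (norm (g (Suc j) t - g j t))) \<noteq> \<infinity>"
    by (rule nn_integral_noteq_infinite[rotated]) (use m1 in measurable)
  have conv: "AE t in ?M. convergent (\<lambda>j. g j t)"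
  proof (rule lebesgue_on_mono[OF fin])
    fix t assume "(\<Sum>j. ennreal (norm (g (Suc j) t - g j t))) \<noteq> \<infinity>"
    then have sm: "summable (\<lambda>j. norm (g (Suc j) t - g j t))" by (intro summable_suminf_not_top) auto
    have tel: "norm (g n t - g m t) \<le> (\<Sum>k=m..<n. norm (g (Suc k) t - g k t))" if "m \<le> n" for m n
    proof -
      have "g n t - g m t = (\<Sum>k=m..<n. g (Suc k) t - g k t)" using sum_Suc_diff'[OF that, of "\<lambda>k. g k t"] by simp
      then show ?thesis by (simp add: norm_sum)
    qed
    have "Cauchy (\<lambda>j. g j t)"
    proof (rule CauchyI')
      fix e :: real assume "e > 0"
      then obtain N where N: "\<And>m n. m \<ge> N \<Longrightarrow> norm (\<Sum>k=m..<n. norm (g (Suc k) t - g k t)) < e"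
        using sm[unfolded summable_Cauchy] by blast
      show "\<exists>M. \<forall>m\<ge>M. \<forall>n>m. dist (g m t) (g n t) < e"
      proof (intro exI[of _ N] allI impI)
        fix m n assume mn: "N \<le> m" "m < n"
        have "norm (g m t - g n t) \<le> (\<Sum>k=m..<n. norm (g (Suc k) t - g k t))"
          using tel[of m n] mn by (simp add: norm_minus_commute)
        also have "\<dots> < e" using N[OF mn(1), of n] by simp
        finally show "dist (g m t) (g n t) < e" by (simp add: dist_norm)
      qed
    qed
    then show "convergent (\<lambda>j. g j t)" by (rule Cauchy_convergent)
  qed
  \<comment> \<open>The value 0 off the convergence set keeps \<open>f\<close> in the subspace
    \<open>G\<close> at every time.\<close>
  define f where "f t = (if t \<in> {0..T} \<and> convergent (\<lambda>j. g j t) then lim (\<lambda>j. g j t) else 0)" for t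
  have lim: "AE t in ?M. (\<lambda>j. g j t) \<longlonglongrightarrow> f t"
    by (rule lebesgue_on_mono[OF conv]) (auto simp: f_def convergent_LIMSEQ_iff)
  have fG: "f t \<in> G" if "t \<in> {0..T}" for t
  proof (cases "convergent (\<lambda>j. g j t)")
    case True
    then have "(\<lambda>j. g j t) \<longlonglongrightarrow> f t" using that by (auto simp: f_def convergent_LIMSEQ_iff)
    from closed_sequentially[OF GX(2) G[OF that] this] show ?thesis .
  qed (simp add: f_def subspace_0[OF GX(1)])
  have sf: "strongly_measurable T f" by (rule strongly_measurable_limit[OF c lim])
  have sd: "(\<lambda>t. (norm (g i t - f t))\<^sup>2) \<in> borel_measurable ?M" for i
  proof -
    have "continuous_on UNIV (\<lambda>p::'g \<times> 'g. (norm (fst p - snd p))\<^sup>2)" by (intro continuous_intros)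
    from strongly_measurable_compose2[OF strongly_measurable_continuous[OF c] sf this] show ?thesis by simp
  qed
  have fat: "(\<integral>\<^sup>+t. ennreal ((norm (g i t - f t))\<^sup>2) \<partial>?M) \<le> ennreal (4 * K * ((1/2)^i)\<^sup>2)" for i
  proof -
    have "(\<integral>\<^sup>+t. ennreal ((norm (g i t - f t))\<^sup>2) \<partial>?M) = (\<integral>\<^sup>+t. liminf (\<lambda>j. ennreal ((norm (g i t - g j t))\<^sup>2)) \<partial>?M)"
    proof (rule nn_integral_cong_AE, rule lebesgue_on_mono[OF lim])
      fix t assume "(\<lambda>j. g j t) \<longlonglongrightarrow> f t"
      then have "(\<lambda>j. ennreal ((norm (g i t - g j t))\<^sup>2)) \<longlonglongrightarrow> ennreal ((norm (g i t - f t))\<^sup>2)"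
        by (intro tendsto_ennrealI tendsto_intros)
      then show "ennreal ((norm (g i t - f t))\<^sup>2) = liminf (\<lambda>j. ennreal ((norm (g i t - g j t))\<^sup>2))"
        by (rule lim_imp_Liminf[symmetric, rotated]) simp
    qed
    also have "\<dots> \<le> liminf (\<lambda>j. \<integral>\<^sup>+t. ennreal ((norm (g i t - g j t))\<^sup>2) \<partial>?M)"
      by (rule nn_integral_liminf) (use m1 in measurable)
    also have "\<dots> \<le> ennreal (4 * K * ((1/2)^i)\<^sup>2)"
    proof (rule Liminf_le)
      show "\<forall>\<^sub>F j in sequentially. (\<integral>\<^sup>+t. ennreal ((norm (g i t - g j t))\<^sup>2) \<partial>?M) \<le> ennreal (4 * K * ((1/2)^i)\<^sup>2)"
        using eventually_ge_at_top[of i]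
      proof eventually_elim
        case (elim j)
        have "(\<integral>\<^sup>+t. ennreal ((norm (g i t - g j t))\<^sup>2) \<partial>?M) = ennreal (L2_sq T (\<lambda>t. g i t - g j t))"
          by (rule nn_integral_eq_integral[OF i2]) simp
        also have "\<dots> \<le> ennreal (4 * K * ((1/2)^i)\<^sup>2)"
        proof (rule ennreal_leI)
          have "(1/2::real)^j \<le> (1/2)^i" using elim by (intro power_decreasing) auto
          then have "K * ((1/2)^i + (1/2)^j)\<^sup>2 \<le> K * (2 * (1/2)^i)\<^sup>2" using K by (intro mult_left_mono power_mono) auto
          then show "L2_sq T (\<lambda>t. g i t - g j t) \<le> 4 * K * ((1/2)^i)\<^sup>2" using cau[of i j] by (simp add: power_mult_distrib)
        qed
        finally show ?case .
      qed
    qed simp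
    finally show ?thesis .
  qed
  have intd: "integrable ?M (\<lambda>t. (norm (g i t - f t))\<^sup>2)" for i
    by (rule integrableI_nn_integral_finite[where x = "enn2real (\<integral>\<^sup>+t. ennreal ((norm (g i t - f t))\<^sup>2) \<partial>?M)"])
       (use fat[of i] sd[of i] in \<open>auto simp: ennreal_enn2real_if top_unique\<close>)
  have L2d: "L2_sq T (\<lambda>t. g i t - f t) \<le> 4 * K * ((1/2)^i)\<^sup>2" for i
  proof -
    have "ennreal (L2_sq T (\<lambda>t. g i t - f t)) \<le> ennreal (4 * K * ((1/2)^i)\<^sup>2)"
      using fat[of i] nn_integral_eq_integral[OF intd[of i]] by simp
    then show ?thesis using K by (subst (asm) ennreal_le_iff) auto
  qed
  have gL2: "L2 T UNIV (g 0)" by (rule L2_continuous[OF c]) simp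
  have "L2 T UNIV (\<lambda>t. g 0 t - f t)"
    using strongly_measurable_lincomb[OF strongly_measurable_continuous[OF c[of 0]] sf, of 1 "-1"] intd[of 0] by (simp add: L2_iff)
  from L2_lincomb[OF gL2 this, of 1 "-1"] have "L2 T UNIV f" by simp
  then have "L2 T G f" using fG by (simp add: L2_iff)
  moreover have "(\<lambda>i. 4 * K * ((1/2::real)^i)\<^sup>2) \<longlonglongrightarrow> 4 * K * 0\<^sup>2"
    by (intro tendsto_intros LIMSEQ_power_zero) simp
  then have "(\<lambda>i. 4 * K * ((1/2::real)^i)\<^sup>2) \<longlonglongrightarrow> 0" by simp
  from tendsto_sandwich[OF _ _ tendsto_const this]
  have "(\<lambda>j. L2_sq T (\<lambda>t. g j t - f t)) \<longlonglongrightarrow> 0" using L2d by (auto intro!: always_eventually)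
  ultimately show ?thesis by blast
qed

section \<open>Observations\<close>

text \<open>An observation sees the solution only through its source and its data at time 0.\<close>

lemma observation_cong:
  assumes "observation A G \<BB> T f w w' g" "\<And>t. t \<in> {0..T} \<Longrightarrow> f t = f1 t" "w 0 = w1 0" "w' 0 = w1' 0"
  shows "observation A G \<BB> T f1 w1 w1' g"
proof -
  have "L2_sq T (\<lambda>t. F t - f t) = L2_sq T (\<lambda>t. F t - f1 t)" for F
    by (rule L2_sq_cong) (simp add: assms(2))
  then show ?thesis using assms(1) unfolding observation_def assms(3,4) by simp
qed

text \<open>The operator is evaluated only along regular approximants, whose positions lie in the
  domain of \<open>A\<close>.\<close>

lemma observation_cong_op:
  assumes "observation A G \<BB> T f w w' g" "\<And>x x'. x \<in> Hdom A 2 \<Longrightarrow> \<BB> (x, x') = \<BB>' (x, x')"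
    and Hs2: "\<And>x. pivot x \<in> Hs A 2 \<Longrightarrow> x \<in> Hdom A 2"
  shows "observation A G \<BB>' T f w w' g"
proof -
  obtain F W W' where *: "L2 T G g" "\<forall>j::nat. finite_energy_sol A T (F j) (W j) (W' j) \<and> cont_Hs A 2 T (\<lambda>t. pivot (W j t))"
    "(\<lambda>j. Hdom_norm A 1 (W j 0 - w 0)) \<longlonglongrightarrow> 0" "(\<lambda>j. norm (W' j 0 - w' 0)) \<longlonglongrightarrow> 0"
    "(\<lambda>j. L2_sq T (\<lambda>t. F j t - f t)) \<longlonglongrightarrow> 0" "(\<lambda>j. L2_sq T (\<lambda>t. \<BB> (W j t, W' j t) - g t)) \<longlonglongrightarrow> 0"
    using assms(1) unfolding observation_def by blast
  have "L2_sq T (\<lambda>t. \<BB> (W j t, W' j t) - g t) = L2_sq T (\<lambda>t. \<BB>' (W j t, W' j t) - g t)" for j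
  proof (rule L2_sq_cong)
    fix t assume "t \<in> {0..T}"
    then have "W j t \<in> Hdom A 2" using *(2) Hs2 by (auto simp: cont_Hs_def)
    then show "\<BB> (W j t, W' j t) - g t = \<BB>' (W j t, W' j t) - g t" by (simp add: assms(2))
  qed
  with * show ?thesis unfolding observation_def by auto
qed

context eigenbasis
begin

lemma pivot_Hs: "pivot x \<in> Hs A (int k) \<Longrightarrow> x \<in> Hdom A k"
  using inj_pivot by (auto simp: Hs_def dest: injD)

lemma asol_proj:
  assumes a: "asol T k x z" and F: "finite F" "F \<subseteq> E"
  shows "asol T (\<lambda>t. proj F (k t)) (\<lambda>t. proj F (x t)) (\<lambda>t. proj F (z t))"
  unfolding asol_def
proof (intro conjI ballI)
  show "continuous_on {0..T} (\<lambda>t. proj F (k t))" "continuous_on {0..T} (\<lambda>t. proj F (x t))" "continuous_on {0..T} (\<lambda>t. proj F (z t))"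
    using bounded_linear.continuous_on[OF bounded_linear_proj[OF F]] asol_D(1-3)[OF a] by blast+
  fix e t assume et: "e \<in> E" "t \<in> {0..T}"
  show "((\<lambda>t. proj F (x t) \<bullet> e) has_real_derivative \<mu> e * (proj F (z t) \<bullet> e)) (at t within {0..T})"
    using asol_D(4)[OF a et] by (simp add: proj_inner F et)
  show "((\<lambda>t. proj F (z t) \<bullet> e) has_real_derivative proj F (k t) \<bullet> e - \<mu> e * (proj F (x t) \<bullet> e)) (at t within {0..T})"
    using asol_D(5)[OF a et] by (simp add: proj_inner F et)
qed

lemma cont_Hs_pivot_iff:
  "cont_Hs A (int m) T (\<lambda>t. pivot (w t)) \<longleftrightarrow> (\<exists>x. continuous_on {0..T} x \<and> (\<forall>t\<in>{0..T}. w t = pw (- int m) (x t)))"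
  using injD[OF inj_pivot] by (auto simp: cont_Hs_iff fn_pivot)

lemma wave_sol_pivot_iff:
  "wave_sol A 1 T (\<lambda>t. pivot (f t)) (\<lambda>t. pivot (w t)) (\<lambda>t. pivot (w' t)) \<longleftrightarrow>
   (\<exists>x. continuous_on {0..T} x \<and> (\<forall>t\<in>{0..T}. w t = pw (-1) (x t))) \<and> continuous_on {0..T} w' \<and>
   (\<forall>t\<in>{0..T}. ((\<lambda>r. (1 / (r - t)) *\<^sub>R (w r - w t)) \<longlongrightarrow> w' t) (at t within {0..T})) \<and>
   (\<forall>\<phi>\<in>Hdom A 2. \<forall>t\<in>{0..T}. ((\<lambda>r. f r \<bullet> \<phi> - w r \<bullet> the (A \<phi>)) has_integral w' t \<bullet> \<phi> - w' 0 \<bullet> \<phi>) {0..t})"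
proof -
  have 1: "cont_Hs A 0 T (\<lambda>t. pivot (w' t)) \<longleftrightarrow> continuous_on {0..T} w'"
  proof -
    have "(\<exists>x. continuous_on {0..T} x \<and> (\<forall>t\<in>{0..T}. w' t = x t)) \<longleftrightarrow> continuous_on {0..T} w'"
      using continuous_on_cong by (metis (no_types, lifting))
    then show ?thesis using cont_Hs_pivot_iff[of 0 T w'] pw_eq[OF sc_0] by simp
  qed
  have 2: "Hs_norm A 0 (\<lambda>\<phi>. (pivot (w r) \<phi> - pivot (w t) \<phi>) / (r - t) - pivot (w' t) \<phi>)
    = norm ((1 / (r - t)) *\<^sub>R (w r - w t) - w' t)" for r t
    by (rule Hs_norm_eq) (auto simp: pivot_def inner_diff_left dest: sc_unique[OF sc_0])
  have 3: "((\<lambda>r. norm ((1 / (r - t)) *\<^sub>R (w r - w t) - w' t)) \<longlongrightarrow> 0) (at t within {0..T}) \<longleftrightarrow>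
    ((\<lambda>r. (1 / (r - t)) *\<^sub>R (w r - w t)) \<longlongrightarrow> w' t) (at t within {0..T})" for t
    by (simp only: tendsto_norm_zero_iff LIM_zero_iff)
  show ?thesis
    unfolding wave_sol_def using cont_Hs_pivot_iff[of 1 T w] by (simp add: 1 2 3) (simp add: pivot_def)
qed

text \<open>Argued on the solution notion itself and not on \<open>asol\<close>, because the
  approximants in \<open>observation\<close> have sources that are merely square integrable.\<close>

lemma finite_energy_sol_lin:
  assumes "finite_energy_sol A T f1 w1 w1'" "finite_energy_sol A T f2 w2 w2'"
  shows "finite_energy_sol A T (\<lambda>t. a *\<^sub>R f1 t + c *\<^sub>R f2 t) (\<lambda>t. a *\<^sub>R w1 t + c *\<^sub>R w2 t) (\<lambda>t. a *\<^sub>R w1' t + c *\<^sub>R w2' t)"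
  unfolding finite_energy_sol_def wave_sol_pivot_iff
proof (intro conjI ballI)
  have 1: "L2 T UNIV f1" "\<exists>x. continuous_on {0..T} x \<and> (\<forall>t\<in>{0..T}. w1 t = pw (-1) (x t))" "continuous_on {0..T} w1'"
     "\<And>t. t\<in>{0..T} \<Longrightarrow> ((\<lambda>r. (1 / (r - t)) *\<^sub>R (w1 r - w1 t)) \<longlongrightarrow> w1' t) (at t within {0..T})"
     "\<And>\<phi> t. \<phi>\<in>Hdom A 2 \<Longrightarrow> t\<in>{0..T} \<Longrightarrow> ((\<lambda>r. f1 r \<bullet> \<phi> - w1 r \<bullet> the (A \<phi>)) has_integral w1' t \<bullet> \<phi> - w1' 0 \<bullet> \<phi>) {0..t}"
    using assms(1) unfolding finite_energy_sol_def wave_sol_pivot_iff by blast+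
  have 2: "L2 T UNIV f2" "\<exists>x. continuous_on {0..T} x \<and> (\<forall>t\<in>{0..T}. w2 t = pw (-1) (x t))" "continuous_on {0..T} w2'"
     "\<And>t. t\<in>{0..T} \<Longrightarrow> ((\<lambda>r. (1 / (r - t)) *\<^sub>R (w2 r - w2 t)) \<longlongrightarrow> w2' t) (at t within {0..T})"
     "\<And>\<phi> t. \<phi>\<in>Hdom A 2 \<Longrightarrow> t\<in>{0..T} \<Longrightarrow> ((\<lambda>r. f2 r \<bullet> \<phi> - w2 r \<bullet> the (A \<phi>)) has_integral w2' t \<bullet> \<phi> - w2' 0 \<bullet> \<phi>) {0..t}"
    using assms(2) unfolding finite_energy_sol_def wave_sol_pivot_iff by blast+
  show "L2 T UNIV (\<lambda>t. a *\<^sub>R f1 t + c *\<^sub>R f2 t)" by (rule L2_lincomb[OF 1(1) 2(1) subspace_UNIV])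
  obtain x1 x2 where x: "continuous_on {0..T} x1" "\<forall>t\<in>{0..T}. w1 t = pw (-1) (x1 t)"
    "continuous_on {0..T} x2" "\<forall>t\<in>{0..T}. w2 t = pw (-1) (x2 t)" using 1(2) 2(2) by blast
  have pl: "linear (pw (-1))" by (intro bounded_linear.linear bounded_linear_pw) simp
  show "\<exists>x. continuous_on {0..T} x \<and> (\<forall>t\<in>{0..T}. a *\<^sub>R w1 t + c *\<^sub>R w2 t = pw (-1) (x t))"
    by (rule exI[of _ "\<lambda>t. a *\<^sub>R x1 t + c *\<^sub>R x2 t"])
       (auto simp: x linear_add[OF pl] linear_scale[OF pl] intro!: continuous_intros x)
  show "continuous_on {0..T} (\<lambda>t. a *\<^sub>R w1' t + c *\<^sub>R w2' t)" by (intro continuous_intros 1 2)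
  fix t assume t: "t \<in> {0..T}"
  have "((\<lambda>r. a *\<^sub>R ((1 / (r - t)) *\<^sub>R (w1 r - w1 t)) + c *\<^sub>R ((1 / (r - t)) *\<^sub>R (w2 r - w2 t))) \<longlongrightarrow> a *\<^sub>R w1' t + c *\<^sub>R w2' t) (at t within {0..T})"
    by (intro tendsto_intros 1(4) 2(4) t)
  moreover have "a *\<^sub>R ((1 / (r - t)) *\<^sub>R (w1 r - w1 t)) + c *\<^sub>R ((1 / (r - t)) *\<^sub>R (w2 r - w2 t))
    = (1 / (r - t)) *\<^sub>R (a *\<^sub>R w1 r + c *\<^sub>R w2 r - (a *\<^sub>R w1 t + c *\<^sub>R w2 t))" for r
    by (simp add: algebra_simps)
  ultimately show "((\<lambda>r. (1 / (r - t)) *\<^sub>R (a *\<^sub>R w1 r + c *\<^sub>R w2 r - (a *\<^sub>R w1 t + c *\<^sub>R w2 t))) \<longlongrightarrow> a *\<^sub>R w1' t + c *\<^sub>R w2' t) (at t within {0..T})"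
    by simp
  fix \<phi> assume p: "\<phi> \<in> Hdom A 2"
  have "((\<lambda>r. a * (f1 r \<bullet> \<phi> - w1 r \<bullet> the (A \<phi>)) + c * (f2 r \<bullet> \<phi> - w2 r \<bullet> the (A \<phi>))) has_integral
     a * (w1' t \<bullet> \<phi> - w1' 0 \<bullet> \<phi>) + c * (w2' t \<bullet> \<phi> - w2' 0 \<bullet> \<phi>)) {0..t}"
    by (intro has_integral_add has_integral_mult_right 1(5) 2(5) p t)
  then show "((\<lambda>r. (a *\<^sub>R f1 r + c *\<^sub>R f2 r) \<bullet> \<phi> - (a *\<^sub>R w1 r + c *\<^sub>R w2 r) \<bullet> the (A \<phi>)) has_integral
     (a *\<^sub>R w1' t + c *\<^sub>R w2' t) \<bullet> \<phi> - (a *\<^sub>R w1' 0 + c *\<^sub>R w2' 0) \<bullet> \<phi>) {0..t}"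
    by (simp add: inner_add_left algebra_simps)
qed

lemma finite_energy_if_asol:
  assumes a: "asol T k x z"
  shows "finite_energy_sol A T k (\<lambda>t. pw (-1) (x t)) z"
  unfolding finite_energy_sol_def
proof
  show "L2 T UNIV k" by (rule L2_continuous[OF asol_D(1)[OF a]]) simp
  show "wave_sol A 1 T (\<lambda>t. pivot (k t)) (\<lambda>t. pivot (pw (-1) (x t))) (\<lambda>t. pivot (z t))"
  proof (rule wave_sol_if_asol[OF a])
    show "pivot (k r) \<phi> = k r \<bullet> \<phi>'" if "sc (1 - 1) \<phi> \<phi>'" for r \<phi> \<phi>'
      using sc_unique[OF sc_0, of \<phi> \<phi>'] that by (simp add: pivot_def)
  qed (simp_all add: fn_pivot fn_0_pivot)
qed

text \<open>Composing with \<open>A^{-1}\<close> in the position makes the observation operator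
  bounded on \<open>H \<times> H\<close>, so that it preserves continuity in time along regular
  solutions.\<close>

lemma observation_op_bounded_linear:
  assumes adm: "admissibility_hyp A G \<BB>"
  shows "bounded_linear (\<lambda>p. \<BB> (pw (-2) (fst p), snd p))" and "\<BB> (pw (-2) y, z) \<in> G"
proof -
  have lin: "lin_on (Hdom A 2 \<times> UNIV) \<BB>" and img: "\<BB> ` (Hdom A 2 \<times> UNIV) \<subseteq> G" using adm by (auto simp: admissibility_hyp_def)
  obtain K where K: "\<And>w w'. w \<in> Hdom A 2 \<Longrightarrow> norm (\<BB> (w, w')) \<le> K * (Hdom_norm A 2 w + norm w')"
    using adm unfolding admissibility_hyp_def by blast
  have s: "sc 2 (pw (-2) y) y" for y using sc_sym[OF sc_pw[of "-2" y]] by simp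
  then have inH: "pw (-2) y \<in> Hdom A 2" for y by (auto simp: Hdom_iff)
  then show "\<BB> (pw (-2) y, z) \<in> G" using img by auto
  have pl: "linear (pw (-2))" by (intro bounded_linear.linear bounded_linear_pw) simp
  show "bounded_linear (\<lambda>p. \<BB> (pw (-2) (fst p), snd p))"
  proof (rule bounded_linear_intro[where K = "2 * \<bar>K\<bar>"])
    fix p q :: "'h \<times> 'h" and c :: real
    show "\<BB> (pw (-2) (fst (p + q)), snd (p + q)) = \<BB> (pw (-2) (fst p), snd p) + \<BB> (pw (-2) (fst q), snd q)"
    proof -
      have "\<BB> ((pw (-2) (fst p), snd p) + (pw (-2) (fst q), snd q)) = \<BB> (pw (-2) (fst p), snd p) + \<BB> (pw (-2) (fst q), snd q)"
        using lin inH unfolding lin_on_def by blast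
      then show ?thesis by (simp add: linear_add[OF pl])
    qed
    show "\<BB> (pw (-2) (fst (c *\<^sub>R p)), snd (c *\<^sub>R p)) = c *\<^sub>R \<BB> (pw (-2) (fst p), snd p)"
    proof -
      have "\<BB> (c *\<^sub>R (pw (-2) (fst p), snd p)) = c *\<^sub>R \<BB> (pw (-2) (fst p), snd p)"
        using lin inH unfolding lin_on_def by blast
      then show ?thesis by (simp add: linear_scale[OF pl])
    qed
    have "norm (fst p) \<le> norm p" "norm (snd p) \<le> norm p" by (metis norm_fst_le prod.collapse, metis norm_snd_le prod.collapse)
    then have "\<bar>K\<bar> * (norm (fst p) + norm (snd p)) \<le> \<bar>K\<bar> * (2 * norm p)" by (intro mult_left_mono) auto
    moreover have "K * (norm (fst p) + norm (snd p)) \<le> \<bar>K\<bar> * (norm (fst p) + norm (snd p))" by (intro mult_right_mono) auto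
    moreover have "norm (\<BB> (pw (-2) (fst p), snd p)) \<le> K * (norm (fst p) + norm (snd p))"
      using K[OF inH, of "fst p" "snd p"] Hdom_norm_sc[of 2 "pw (-2) (fst p)" "fst p"] s by simp
    ultimately have "norm (\<BB> (pw (-2) (fst p), snd p)) \<le> \<bar>K\<bar> * (2 * norm p)" by linarith
    then show "norm (\<BB> (pw (-2) (fst p), snd p)) \<le> norm p * (2 * \<bar>K\<bar>)" by (simp only: mult_ac)
  qed
qed

lemma observation_op_regular:
  assumes adm: "admissibility_hyp A G \<BB>" and W: "cont_Hs A 2 T (\<lambda>t. pivot (W t))" and W': "continuous_on {0..T} W'"
  shows "continuous_on {0..T} (\<lambda>t. \<BB> (W t, W' t))" and "t \<in> {0..T} \<Longrightarrow> \<BB> (W t, W' t) \<in> G"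
    and "L2 T G (\<lambda>t. \<BB> (W t, W' t))"
proof -
  obtain y where y: "continuous_on {0..T} y" "\<forall>t\<in>{0..T}. W t = pw (-2) (y t)"
    using W cont_Hs_pivot_iff[of 2 T W] by auto
  have "continuous_on {0..T} (\<lambda>t. (y t, W' t))" by (intro continuous_intros y W')
  from bounded_linear.continuous_on[OF observation_op_bounded_linear(1)[OF adm] this]
  show c: "continuous_on {0..T} (\<lambda>t. \<BB> (W t, W' t))"
    by (rule continuous_on_cong[THEN iffD1, rotated 2]) (use y(2) in auto)
  show G: "\<BB> (W t, W' t) \<in> G" if "t \<in> {0..T}" for t
    using observation_op_bounded_linear(2)[OF adm] y(2) that by simp
  show "L2 T G (\<lambda>t. \<BB> (W t, W' t))" by (rule L2_continuous[OF c G])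
qed

lemma observation_op_lin:
  assumes adm: "admissibility_hyp A G \<BB>" and "w \<in> Hdom A 2" "v \<in> Hdom A 2"
  shows "\<BB> (a *\<^sub>R w + c *\<^sub>R v, a *\<^sub>R w' + c *\<^sub>R v') = a *\<^sub>R \<BB> (w, w') + c *\<^sub>R \<BB> (v, v')"
proof -
  have *: "\<exists>y. u = pw (-2) y" if "u \<in> Hdom A 2" for u using that pw_eq sc_sym by (fastforce simp: Hdom_iff)
  obtain y1 y2 where y: "w = pw (-2) y1" "v = pw (-2) y2" using * assms by metis
  interpret B: bounded_linear "\<lambda>p. \<BB> (pw (-2) (fst p), snd p)" by (rule observation_op_bounded_linear(1)[OF adm])
  have pl: "linear (pw (-2))" by (intro bounded_linear.linear bounded_linear_pw) simp
  have "\<BB> (pw (-2) (fst (a *\<^sub>R (y1, w') + c *\<^sub>R (y2, v'))), snd (a *\<^sub>R (y1, w') + c *\<^sub>R (y2, v')))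
    = a *\<^sub>R \<BB> (pw (-2) y1, w') + c *\<^sub>R \<BB> (pw (-2) y2, v')"
    unfolding B.add B.scaleR by simp
  then show ?thesis by (simp add: y linear_add[OF pl] linear_scale[OF pl])
qed

lemma finite_energy_sol_cont:
  assumes "finite_energy_sol A T f w w'"
  shows "continuous_on {0..T} w'"
  using assms unfolding finite_energy_sol_def wave_sol_pivot_iff by blast

lemma tendsto_zero_lincomb_bound:
  fixes u v h :: "nat \<Rightarrow> real"
  assumes "u \<longlonglongrightarrow> 0" "v \<longlonglongrightarrow> 0" "\<And>j. 0 \<le> h j" "\<And>j. h j \<le> a * u j + c * v j"
  shows "h \<longlonglongrightarrow> 0"
proof -
  have "(\<lambda>j. a * u j + c * v j) \<longlonglongrightarrow> a * 0 + c * 0" by (intro tendsto_intros assms)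
  then have "(\<lambda>j. a * u j + c * v j) \<longlonglongrightarrow> 0" by simp
  then show ?thesis
    by (rule tendsto_sandwich[OF _ _ tendsto_const, rotated 2]) (use assms in \<open>auto intro!: always_eventually\<close>)
qed

lemma Hdom_iff_range: "v \<in> Hdom A k \<longleftrightarrow> v \<in> range (pw (- int k))"
proof
  assume "v \<in> Hdom A k"
  then obtain \<psi> where "sc (int k) v \<psi>" by (auto simp: Hdom_iff)
  then show "v \<in> range (pw (- int k))" using pw_eq[OF sc_sym] by (metis rangeI)
next
  assume "v \<in> range (pw (- int k))"
  then obtain y where "v = pw (- int k) y" by blast
  then show "v \<in> Hdom A k" using sc_sym[OF sc_pw[of "- int k" y]] by (auto simp: Hdom_iff)
qed

lemma Hdom_lin: "w \<in> Hdom A k \<Longrightarrow> v \<in> Hdom A k \<Longrightarrow> a *\<^sub>R w + c *\<^sub>R v \<in> Hdom A k"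
  using sc_lin by (fastforce simp: Hdom_iff)

lemma Hdom_norm_lin_le:
  assumes "w \<in> Hdom A k" "v \<in> Hdom A k"
  shows "Hdom_norm A k (a *\<^sub>R w + c *\<^sub>R v) \<le> \<bar>a\<bar> * Hdom_norm A k w + \<bar>c\<bar> * Hdom_norm A k v"
proof -
  obtain p q where pq: "sc (int k) w p" "sc (int k) v q" using assms by (auto simp: Hdom_iff)
  then show ?thesis using Hdom_norm_sc[OF sc_lin[OF pq]] Hdom_norm_sc pq
      norm_triangle_ineq[of "a *\<^sub>R p" "c *\<^sub>R q"] by simp
qed

text \<open>The approximating sequences of the two observations are combined; every error is
  dominated by a combination of two null sequences.\<close>

lemma observation_lin:
  assumes adm: "admissibility_hyp A G \<BB>"
    and o1: "observation A G \<BB> T f1 w1 w1' g1" and o2: "observation A G \<BB> T f2 w2 w2' g2"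
    and f: "L2 T UNIV f1" "L2 T UNIV f2" and w: "w1 0 \<in> Hdom A 1" "w2 0 \<in> Hdom A 1" and T: "T > 0"
  shows "observation A G \<BB> T (\<lambda>t. a *\<^sub>R f1 t + c *\<^sub>R f2 t) (\<lambda>t. a *\<^sub>R w1 t + c *\<^sub>R w2 t)
     (\<lambda>t. a *\<^sub>R w1' t + c *\<^sub>R w2' t) (\<lambda>t. a *\<^sub>R g1 t + c *\<^sub>R g2 t)"
proof -
  have GX: "subspace G" using adm by (simp add: admissibility_hyp_def)
  obtain F W W' where 1: "L2 T G g1" "\<And>j::nat. finite_energy_sol A T (F j) (W j) (W' j)" "\<And>j. cont_Hs A 2 T (\<lambda>t. pivot (W j t))"
    "(\<lambda>j. Hdom_norm A 1 (W j 0 - w1 0)) \<longlonglongrightarrow> 0" "(\<lambda>j. norm (W' j 0 - w1' 0)) \<longlonglongrightarrow> 0"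
    "(\<lambda>j. L2_sq T (\<lambda>t. F j t - f1 t)) \<longlonglongrightarrow> 0" "(\<lambda>j. L2_sq T (\<lambda>t. \<BB> (W j t, W' j t) - g1 t)) \<longlonglongrightarrow> 0"
    using o1 unfolding observation_def by blast
  obtain H V V' where 2: "L2 T G g2" "\<And>j::nat. finite_energy_sol A T (H j) (V j) (V' j)" "\<And>j. cont_Hs A 2 T (\<lambda>t. pivot (V j t))"
    "(\<lambda>j. Hdom_norm A 1 (V j 0 - w2 0)) \<longlonglongrightarrow> 0" "(\<lambda>j. norm (V' j 0 - w2' 0)) \<longlonglongrightarrow> 0"
    "(\<lambda>j. L2_sq T (\<lambda>t. H j t - f2 t)) \<longlonglongrightarrow> 0" "(\<lambda>j. L2_sq T (\<lambda>t. \<BB> (V j t, V' j t) - g2 t)) \<longlonglongrightarrow> 0"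
    using o2 unfolding observation_def by blast
  have t0: "0 \<in> {0..T}" using T by simp
  have H2: "W j t \<in> Hdom A 2" "V j t \<in> Hdom A 2" if "t \<in> {0..T}" for j t
    using 1(3)[of j] 2(3)[of j] that pivot_Hs[of _ 2] by (auto simp: cont_Hs_def)
  have H21: "Hdom A 2 \<subseteq> Hdom A 1" using sc_mono[of 2 _ _ 1] by (fastforce simp: Hdom_iff)
  have H1: "W j 0 - w1 0 \<in> Hdom A 1" "V j 0 - w2 0 \<in> Hdom A 1" for j
    using Hdom_lin[of "W j 0" 1 "w1 0" 1 "-1"] Hdom_lin[of "V j 0" 1 "w2 0" 1 "-1"] H2[OF t0] H21 w by auto
  let ?W = "\<lambda>j t. a *\<^sub>R W j t + c *\<^sub>R V j t" and ?W' = "\<lambda>j t. a *\<^sub>R W' j t + c *\<^sub>R V' j t" and ?F = "\<lambda>j t. a *\<^sub>R F j t + c *\<^sub>R H j t"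
  have "cont_Hs A 2 T (\<lambda>t. pivot (?W j t))" for j
  proof -
    obtain y1 y2 where y: "continuous_on {0..T} y1" "\<forall>t\<in>{0..T}. W j t = pw (-2) (y1 t)"
      "continuous_on {0..T} y2" "\<forall>t\<in>{0..T}. V j t = pw (-2) (y2 t)"
      using 1(3)[of j] 2(3)[of j] cont_Hs_pivot_iff[of 2] by auto
    have pl: "linear (pw (-2))" by (intro bounded_linear.linear bounded_linear_pw) simp
    have "\<exists>x. continuous_on {0..T} x \<and> (\<forall>t\<in>{0..T}. ?W j t = pw (-2) (x t))"
      by (rule exI[of _ "\<lambda>t. a *\<^sub>R y1 t + c *\<^sub>R y2 t"])
         (auto simp: y linear_add[OF pl] linear_scale[OF pl] intro!: continuous_intros y)
    then show ?thesis using cont_Hs_pivot_iff[of 2 T "?W j"] by simp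
  qed
  moreover have "(\<lambda>j. Hdom_norm A 1 (?W j 0 - (a *\<^sub>R w1 0 + c *\<^sub>R w2 0))) \<longlonglongrightarrow> 0"
  proof (rule tendsto_zero_lincomb_bound[OF 1(4) 2(4)])
    show "Hdom_norm A 1 (?W j 0 - (a *\<^sub>R w1 0 + c *\<^sub>R w2 0)) \<le> \<bar>a\<bar> * Hdom_norm A 1 (W j 0 - w1 0) + \<bar>c\<bar> * Hdom_norm A 1 (V j 0 - w2 0)" for j
      using Hdom_norm_lin_le[OF H1, of a j c j] by (simp add: algebra_simps)
  qed (simp add: Hdom_norm_def)
  moreover have "(\<lambda>j. norm (?W' j 0 - (a *\<^sub>R w1' 0 + c *\<^sub>R w2' 0))) \<longlonglongrightarrow> 0"
  proof (rule tendsto_zero_lincomb_bound[OF 1(5) 2(5)])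
    fix j
    have "?W' j 0 - (a *\<^sub>R w1' 0 + c *\<^sub>R w2' 0) = a *\<^sub>R (W' j 0 - w1' 0) + c *\<^sub>R (V' j 0 - w2' 0)"
      by (simp add: algebra_simps)
    then show "norm (?W' j 0 - (a *\<^sub>R w1' 0 + c *\<^sub>R w2' 0)) \<le> \<bar>a\<bar> * norm (W' j 0 - w1' 0) + \<bar>c\<bar> * norm (V' j 0 - w2' 0)"
      using norm_triangle_ineq[of "a *\<^sub>R (W' j 0 - w1' 0)" "c *\<^sub>R (V' j 0 - w2' 0)"] by simp
  qed simp
  moreover have "(\<lambda>j. L2_sq T (\<lambda>t. ?F j t - (a *\<^sub>R f1 t + c *\<^sub>R f2 t))) \<longlonglongrightarrow> 0"
  proof (rule tendsto_zero_lincomb_bound[OF 1(6) 2(6)])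
    fix j
    have "L2 T UNIV (\<lambda>t. 1 *\<^sub>R F j t + (-1) *\<^sub>R f1 t)" "L2 T UNIV (\<lambda>t. 1 *\<^sub>R H j t + (-1) *\<^sub>R f2 t)"
      using 1(2)[of j] 2(2)[of j] f by (intro L2_lincomb; simp add: finite_energy_sol_def)+
    from L2_sq_lincomb_le[OF this, of a c]
    show "L2_sq T (\<lambda>t. ?F j t - (a *\<^sub>R f1 t + c *\<^sub>R f2 t)) \<le> (2 * a\<^sup>2) * L2_sq T (\<lambda>t. F j t - f1 t) + (2 * c\<^sup>2) * L2_sq T (\<lambda>t. H j t - f2 t)"
      by (simp add: algebra_simps)
  qed simp
  moreover have "(\<lambda>j. L2_sq T (\<lambda>t. \<BB> (?W j t, ?W' j t) - (a *\<^sub>R g1 t + c *\<^sub>R g2 t))) \<longlonglongrightarrow> 0"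
  proof (rule tendsto_zero_lincomb_bound[OF 1(7) 2(7)])
    fix j
    have "L2 T G (\<lambda>t. 1 *\<^sub>R \<BB> (W j t, W' j t) + (-1) *\<^sub>R g1 t)" "L2 T G (\<lambda>t. 1 *\<^sub>R \<BB> (V j t, V' j t) + (-1) *\<^sub>R g2 t)"
      using observation_op_regular(3)[OF adm 1(3) finite_energy_sol_cont[OF 1(2)]]
        observation_op_regular(3)[OF adm 2(3) finite_energy_sol_cont[OF 2(2)]] 1(1) 2(1) GX
      by (intro L2_lincomb; simp)+
    from L2_sq_lincomb_le[OF this, of a c]
    have "L2_sq T (\<lambda>t. a *\<^sub>R (\<BB> (W j t, W' j t) - g1 t) + c *\<^sub>R (\<BB> (V j t, V' j t) - g2 t)) \<le> (2 * a\<^sup>2) * L2_sq T (\<lambda>t. \<BB> (W j t, W' j t) - g1 t) + (2 * c\<^sup>2) * L2_sq T (\<lambda>t. \<BB> (V j t, V' j t) - g2 t)"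
      by simp
    moreover have "L2_sq T (\<lambda>t. \<BB> (?W j t, ?W' j t) - (a *\<^sub>R g1 t + c *\<^sub>R g2 t)) = L2_sq T (\<lambda>t. a *\<^sub>R (\<BB> (W j t, W' j t) - g1 t) + c *\<^sub>R (\<BB> (V j t, V' j t) - g2 t))"
      by (rule L2_sq_cong) (simp add: observation_op_lin[OF adm H2] algebra_simps)
    ultimately show "L2_sq T (\<lambda>t. \<BB> (?W j t, ?W' j t) - (a *\<^sub>R g1 t + c *\<^sub>R g2 t)) \<le> (2 * a\<^sup>2) * L2_sq T (\<lambda>t. \<BB> (W j t, W' j t) - g1 t) + (2 * c\<^sup>2) * L2_sq T (\<lambda>t. \<BB> (V j t, V' j t) - g2 t)"
      by simp
  qed simp
  moreover have "L2 T G (\<lambda>t. a *\<^sub>R g1 t + c *\<^sub>R g2 t)" by (rule L2_lincomb[OF 1(1) 2(1) GX])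
  moreover have "finite_energy_sol A T (?F j) (?W j) (?W' j)" for j by (rule finite_energy_sol_lin[OF 1(2) 2(2)])
  ultimately show ?thesis
    unfolding observation_def by (intro conjI exI[of _ ?F] exI[of _ ?W] exI[of _ ?W'] allI) auto
qed

end

section \<open>Bounds for observations and their existence by truncation\<close>

context eigenbasis
begin

lemma energy_1: "energy A 1 (pivot (pw (-1) x)) (pivot z) = ((norm x)\<^sup>2 + (norm z)\<^sup>2) / 2"
  using Hs_norm_fn[of 1 x] Hs_norm_fn[of 0 z] by (simp add: energy_def fn_pivot fn_0_pivot)

lemma observation_self:
  assumes adm: "admissibility_hyp A G \<BB>" and f: "finite_energy_sol A T f w w'" and w: "cont_Hs A 2 T (\<lambda>t. pivot (w t))"
  shows "observation A G \<BB> T f w w' (\<lambda>t. \<BB> (w t, w' t))"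
proof -
  have "Hdom_norm A 1 0 = 0" using Hdom_norm_sc[of 1 0 0] by (simp add: sc_def)
  then show ?thesis
    unfolding observation_def
    using f w observation_op_regular(3)[OF adm w finite_energy_sol_cont[OF f]]
    by (intro conjI exI[of _ "\<lambda>_. f"] exI[of _ "\<lambda>_. w"] exI[of _ "\<lambda>_. w'"]) auto
qed

lemma norm_Pair_le_add: "norm (x, z) \<le> norm x + norm z"
  unfolding norm_Pair by (rule sqrt_sum_squares_le_sum) auto

text \<open>Admissibility bounds the observation by energies along the whole trajectory; the energy
  estimate reduces all of them to the data and the sup norm of the source.\<close>

lemma observation_bound:
  assumes adm: "admissibility_hyp A G \<BB>" and T: "T > 0"
  shows "\<exists>c\<ge>0. \<forall>k x z g B. asol T k x z \<longrightarrow> observation A G \<BB> T k (\<lambda>t. pw (-1) (x t)) z g \<longrightarrow>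
    (\<forall>r\<in>{0..T}. norm (k r) \<le> B) \<longrightarrow> L2_sq T g \<le> c * (norm (x 0, z 0) + B)\<^sup>2"
proof -
  let ?adm = "\<lambda>T D. D > 0 \<and> (\<forall>f w w' g. finite_energy_sol A T f w w' \<and> observation A G \<BB> T f w w' g \<longrightarrow>
        L2_sq T g \<le> D * (energy A 1 (pivot (w 0)) (pivot (w' 0)) + energy A 1 (pivot (w T)) (pivot (w' T)) +
          integral\<^sup>L (lebesgue_on {0..T}) (\<lambda>t. energy A 1 (pivot (w t)) (pivot (w' t))) + L2_sq T f))"
  have "\<forall>T>0. \<exists>D. ?adm T D" using adm unfolding admissibility_hyp_def by (elim conjE) assumption
  then have "\<exists>D. ?adm T D" using T by blast
  then obtain D where D0: "?adm T D" ..
  then have D1: "D > 0" by (rule conjunct1)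
  have D2: "L2_sq T g \<le> D * (energy A 1 (pivot (w 0)) (pivot (w' 0)) + energy A 1 (pivot (w T)) (pivot (w' T)) +
          integral\<^sup>L (lebesgue_on {0..T}) (\<lambda>t. energy A 1 (pivot (w t)) (pivot (w' t))) + L2_sq T f)"
    if "finite_energy_sol A T f w w'" "observation A G \<BB> T f w w' g" for f w w' g
    using conjunct2[OF D0, rule_format, OF conjI[OF that]] .
  show ?thesis
  proof (intro exI[of _ "D * (2 + 2 * T) * (1 + T)\<^sup>2"] conjI allI impI)
    show "0 \<le> D * (2 + 2 * T) * (1 + T)\<^sup>2" using D1 T by simp
    fix k x z g B
    assume a: "asol T k x z" and o: "observation A G \<BB> T k (\<lambda>t. pw (-1) (x t)) z g" and B: "\<forall>r\<in>{0..T}. norm (k r) \<le> B"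
    have B0: "B \<ge> 0" using B T norm_ge_zero order_trans by (meson atLeastAtMost_iff less_imp_le order_refl)
    \<comment> \<open>A common bound for the state at all times and for the source. The two end
      energies, the integrated energy and the source then contribute at most \<open>R^2\<close>,
      \<open>T * R^2 / 2\<close> and \<open>T * R^2\<close>.\<close>
    define R where "R = (1 + T) * (norm (x 0, z 0) + B)"
    have R: "norm (x 0, z 0) + B * T \<le> R" "B \<le> R" "R \<ge> 0"
    proof -
      have "R = norm (x 0, z 0) + B * T + B + T * norm (x 0, z 0)" by (simp add: R_def algebra_simps)
      moreover have "0 \<le> T * norm (x 0, z 0)" "0 \<le> B * T" "0 \<le> norm (x 0, z 0)" using T B0 by auto
      ultimately show "norm (x 0, z 0) + B * T \<le> R" "B \<le> R" "R \<ge> 0" using B0 by linarith+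
    qed
    have E: "energy A 1 (pivot (pw (-1) (x t))) (pivot (z t)) \<le> R\<^sup>2 / 2" if t: "t \<in> {0..T}" for t
    proof -
      have "norm (x t, z t) \<le> norm (x 0, z 0) + B * \<bar>t - 0\<bar>"
        by (rule asol_estimate[OF a]) (use B t T in auto)
      also have "\<dots> \<le> norm (x 0, z 0) + B * T" using t B0 by (intro add_left_mono mult_left_mono) auto
      also have "\<dots> \<le> R" by (rule R)
      finally have "(norm (x t, z t))\<^sup>2 \<le> R\<^sup>2" by (intro power_mono) auto
      then show ?thesis by (simp add: energy_1 norm_Pair)
    qed
    have I: "integral\<^sup>L (lebesgue_on {0..T}) (\<lambda>t. energy A 1 (pivot (pw (-1) (x t))) (pivot (z t))) \<le> T * (R\<^sup>2 / 2)"
    proof -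
      have "integral\<^sup>L (lebesgue_on {0..T}) (\<lambda>t. energy A 1 (pivot (pw (-1) (x t))) (pivot (z t))) \<le> integral\<^sup>L (lebesgue_on {0..T}) (\<lambda>_. R\<^sup>2 / 2)"
        by (rule integral_mono_AE') (use E in \<open>auto intro!: AE_I2 continuous_imp_integrable_real\<close>)
      also have "\<dots> = T * (R\<^sup>2 / 2)" using T by (simp add: measure_restrict_space)
      finally show ?thesis .
    qed
    have "L2_sq T k \<le> T * B\<^sup>2" by (rule L2_sq_le_bound) (use T B B0 in auto)
    also have "\<dots> \<le> T * R\<^sup>2" using T B0 R by (intro mult_left_mono power_mono) auto
    finally have K: "L2_sq T k \<le> T * R\<^sup>2" .
    have "L2_sq T g \<le> D * (energy A 1 (pivot (pw (-1) (x 0))) (pivot (z 0)) + energy A 1 (pivot (pw (-1) (x T))) (pivot (z T)) +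
          integral\<^sup>L (lebesgue_on {0..T}) (\<lambda>t. energy A 1 (pivot (pw (-1) (x t))) (pivot (z t))) + L2_sq T k)"
      by (rule D2[OF finite_energy_if_asol[OF a] o])
    also have "\<dots> \<le> D * (R\<^sup>2 / 2 + R\<^sup>2 / 2 + T * (R\<^sup>2 / 2) + T * R\<^sup>2)"
      using E[of 0] E[of T] I K D1 T by (intro mult_left_mono add_mono) auto
    also have "\<dots> \<le> D * ((2 + 2 * T) * R\<^sup>2)"
    proof -
      have "0 \<le> T * R\<^sup>2" "0 \<le> R\<^sup>2" using T by auto
      then show ?thesis using D1 by (intro mult_left_mono) (simp_all add: algebra_simps)
    qed
    finally show "L2_sq T g \<le> D * (2 + 2 * T) * (1 + T)\<^sup>2 * (norm (x 0, z 0) + B)\<^sup>2"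
      by (simp add: R_def power_mult_distrib mult_ac)
  qed
qed

lemma truncation_sequence:
  assumes c: "continuous_on {0..T} (k :: real \<Rightarrow> 'h)" "continuous_on {0..T} (x :: real \<Rightarrow> 'h)" "continuous_on {0..T} (z :: real \<Rightarrow> 'h)"
  shows "\<exists>F. \<forall>j::nat. finite (F j) \<and> F j \<subseteq> E \<and> (\<forall>r\<in>{0..T}. norm (k r - proj (F j) (k r)) < (1/2)^j \<and>
     norm (x r - proj (F j) (x r)) < (1/2)^j \<and> norm (z r - proj (F j) (z r)) < (1/2)^j)"
proof (rule choice, rule allI)
  fix j :: nat
  have "(1/2::real)^j > 0" by simp
  then obtain F1 F2 F3 where
    F: "finite F1" "F1 \<subseteq> E" "\<And>r. r \<in> {0..T} \<Longrightarrow> norm (k r - proj F1 (k r)) < (1/2)^j"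
       "finite F2" "F2 \<subseteq> E" "\<And>r. r \<in> {0..T} \<Longrightarrow> norm (x r - proj F2 (x r)) < (1/2)^j"
       "finite F3" "F3 \<subseteq> E" "\<And>r. r \<in> {0..T} \<Longrightarrow> norm (z r - proj F3 (z r)) < (1/2)^j"
    using uniform_proj_approx[OF c(1)] uniform_proj_approx[OF c(2)] uniform_proj_approx[OF c(3)] by metis
  let ?F = "F1 \<union> F2 \<union> F3"
  have m: "norm (y - proj ?F y) < (1/2)^j" if "norm (y - proj F' y) < (1/2)^j" "F' \<subseteq> ?F" for y F'
    using norm_diff_proj_mono[of ?F F' y] that F by auto
  show "\<exists>F. finite F \<and> F \<subseteq> E \<and> (\<forall>r\<in>{0..T}. norm (k r - proj F (k r)) < (1/2)^j \<and>
     norm (x r - proj F (x r)) < (1/2)^j \<and> norm (z r - proj F (z r)) < (1/2)^j)"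
    by (rule exI[of _ ?F]) (use F in \<open>auto intro!: m[OF F(3)] m[OF F(6)] m[OF F(9)]\<close>)
qed

lemma truncated_in_H2:
  assumes c: "continuous_on {0..T} x" and F: "finite F" "F \<subseteq> E"
  shows "cont_Hs A 2 T (\<lambda>t. pivot (pw (-1) (proj F (x t))))"
proof -
  \<comment> \<open>On finitely many modes a further factor \<mu> is harmless: this is
    \<open>A^{1/2}\<close> of the truncation, hence its coordinate at level 2.\<close>
  define y where "y t = (\<Sum>e\<in>F. (\<mu> e * (x t \<bullet> e)) *\<^sub>R e)" for t
  have "continuous_on {0..T} y" unfolding y_def by (intro continuous_intros c)
  moreover have "pw (-1) (proj F (x t)) = pw (-2) (y t)" for t
  proof (rule eqI)
    fix e assume e: "e \<in> E"
    show "pw (-1) (proj F (x t)) \<bullet> e = pw (-2) (y t) \<bullet> e"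
      using mu_nz[OF e] by (simp add: pw_inner e proj_inner F y_def sum_inner_basis power_int_minus power2_eq_square)
  qed
  ultimately show ?thesis using cont_Hs_pivot_iff[of 2 T "\<lambda>t. pw (-1) (proj F (x t))"] by auto
qed

text \<open>Spectral truncations are regular solutions whose source and state converge uniformly in
  time, so they supply the approximating sequence; what remains is the convergence of their
  observations.\<close>

lemma observationI:
  assumes adm: "admissibility_hyp A G \<BB>" and a: "asol T k x z" and T: "T > 0"
    and F: "\<And>j::nat. finite (F j)" "\<And>j. F j \<subseteq> E"
    and Fk: "\<And>j r. r \<in> {0..T} \<Longrightarrow> norm (k r - proj (F j) (k r)) < (1/2)^j"
    and Fx: "\<And>j r. r \<in> {0..T} \<Longrightarrow> norm (x r - proj (F j) (x r)) < (1/2)^j"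
    and Fz: "\<And>j r. r \<in> {0..T} \<Longrightarrow> norm (z r - proj (F j) (z r)) < (1/2)^j"
    and g: "L2 T G g" "(\<lambda>j. L2_sq T (\<lambda>t. \<BB> (pw (-1) (proj (F j) (x t)), proj (F j) (z t)) - g t)) \<longlonglongrightarrow> 0"
  shows "observation A G \<BB> T k (\<lambda>t. pw (-1) (x t)) z g"
proof -
  have half: "(\<lambda>j. (1/2::real)^j) \<longlonglongrightarrow> 0" by (intro LIMSEQ_power_zero) simp
  have pl: "linear (pw (-1))" by (intro bounded_linear.linear bounded_linear_pw) simp
  have "(\<lambda>j. Hdom_norm A 1 (pw (-1) (proj (F j) (x 0)) - pw (-1) (x 0))) \<longlonglongrightarrow> 0"
  proof (rule Lim_null_comparison[OF always_eventually half], rule allI)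
    fix j
    have "sc 1 (pw (-1) (proj (F j) (x 0) - x 0)) (proj (F j) (x 0) - x 0)" using sc_sym[OF sc_pw[of "-1"]] by simp
    then have "Hdom_norm A 1 (pw (-1) (proj (F j) (x 0)) - pw (-1) (x 0)) = norm (proj (F j) (x 0) - x 0)"
      using Hdom_norm_sc[of 1] by (simp add: linear_diff[OF pl])
    then show "norm (Hdom_norm A 1 (pw (-1) (proj (F j) (x 0)) - pw (-1) (x 0))) \<le> (1/2)^j"
      using Fx[of 0 j] T by (simp add: norm_minus_commute)
  qed
  moreover have "(\<lambda>j. norm (proj (F j) (z 0) - z 0)) \<longlonglongrightarrow> 0"
    by (rule Lim_null_comparison[OF always_eventually half]) (use Fz[of 0] T in \<open>auto simp: norm_minus_commute intro: less_imp_le\<close>)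
  moreover have "(\<lambda>j. L2_sq T (\<lambda>t. proj (F j) (k t) - k t)) \<longlonglongrightarrow> 0"
  proof (rule Lim_null_comparison[OF always_eventually], rule allI)
    fix j
    have "L2_sq T (\<lambda>t. proj (F j) (k t) - k t) \<le> T * ((1/2)^j)\<^sup>2"
      by (rule L2_sq_le_bound) (use T Fk in \<open>auto simp: norm_minus_commute intro: less_imp_le\<close>)
    then show "norm (L2_sq T (\<lambda>t. proj (F j) (k t) - k t)) \<le> T * ((1/2)^j)\<^sup>2" by simp
    have "(\<lambda>j. T * ((1/2::real)^j)\<^sup>2) \<longlonglongrightarrow> T * 0\<^sup>2" by (intro tendsto_intros half)
    then show "(\<lambda>j. T * ((1/2::real)^j)\<^sup>2) \<longlonglongrightarrow> 0" by simp
  qed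
  ultimately show ?thesis
    unfolding observation_def
    using g finite_energy_if_asol[OF asol_proj[OF a F]] truncated_in_H2[OF asol_D(2)[OF a] F]
    by (intro conjI exI[of _ "\<lambda>j t. proj (F j) (k t)"] exI[of _ "\<lambda>j t. pw (-1) (proj (F j) (x t))"] exI[of _ "\<lambda>j t. proj (F j) (z t)"]) auto
qed

text \<open>The difference of two truncations is again a solution, to which the admissibility bound
  applies; this gives the Cauchy rate that \<open>L2_complete\<close> asks for.\<close>

lemma observation_exists:
  fixes G :: "'g::{real_inner,complete_space} set"
  assumes adm: "admissibility_hyp A G \<BB>" and a: "asol T k x z" and T: "T > 0"
  shows "\<exists>g. observation A G \<BB> T k (\<lambda>t. pw (-1) (x t)) z g"
proof -
  obtain F where "\<forall>j::nat. finite (F j) \<and> F j \<subseteq> E \<and> (\<forall>r\<in>{0..T}. norm (k r - proj (F j) (k r)) < (1/2)^j \<and>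
     norm (x r - proj (F j) (x r)) < (1/2)^j \<and> norm (z r - proj (F j) (z r)) < (1/2)^j)"
    using truncation_sequence[OF asol_D(1-3)[OF a]] by blast
  then have F: "\<And>j::nat. finite (F j)" "\<And>j. F j \<subseteq> E"
    and Fk: "\<And>j r. r \<in> {0..T} \<Longrightarrow> norm (k r - proj (F j) (k r)) < (1/2)^j"
    and Fx: "\<And>j r. r \<in> {0..T} \<Longrightarrow> norm (x r - proj (F j) (x r)) < (1/2)^j"
    and Fz: "\<And>j r. r \<in> {0..T} \<Longrightarrow> norm (z r - proj (F j) (z r)) < (1/2)^j" by blast+
  have GX: "subspace G" "closed G" using adm by (auto simp: admissibility_hyp_def)
  obtain c where c: "c \<ge> 0" "\<And>k x z g B. asol T k x z \<Longrightarrow> observation A G \<BB> T k (\<lambda>t. pw (-1) (x t)) z g \<Longrightarrow>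
    (\<forall>r\<in>{0..T}. norm (k r) \<le> B) \<Longrightarrow> L2_sq T g \<le> c * (norm (x 0, z 0) + B)\<^sup>2"
    using observation_bound[OF adm T] by blast
  define W where "W j t = pw (-1) (proj (F j) (x t))" for j t
  define g where "g j t = \<BB> (W j t, proj (F j) (z t))" for j t
  have W: "cont_Hs A 2 T (\<lambda>t. pivot (W j t))" for j unfolding W_def by (rule truncated_in_H2[OF asol_D(2)[OF a] F])
  have aj: "asol T (\<lambda>t. proj (F j) (k t)) (\<lambda>t. proj (F j) (x t)) (\<lambda>t. proj (F j) (z t))" for j by (rule asol_proj[OF a F])
  have cg: "continuous_on {0..T} (g j)" and gG: "\<And>t. t \<in> {0..T} \<Longrightarrow> g j t \<in> G" for j
    using observation_op_regular(1,2)[OF adm W asol_D(3)[OF aj]] by (auto simp: g_def[abs_def])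
  have pl: "linear (pw (-1))" by (intro bounded_linear.linear bounded_linear_pw) simp
  have cau: "L2_sq T (\<lambda>t. g i t - g j t) \<le> (9 * c) * ((1/2)^i + (1/2)^j)\<^sup>2" for i j
  proof -
    define B where "B = (1/2::real)^i + (1/2)^j"
    have dP: "norm (1 *\<^sub>R proj (F i) y + (-1) *\<^sub>R proj (F j) y) \<le> B"
      if "norm (y - proj (F i) y) < (1/2)^i" "norm (y - proj (F j) y) < (1/2)^j" for y
      using norm_triangle_ineq4[of "y - proj (F j) y" "y - proj (F i) y"] that by (simp add: B_def)
    have ad: "asol T (\<lambda>t. 1 *\<^sub>R proj (F i) (k t) + (-1) *\<^sub>R proj (F j) (k t)) (\<lambda>t. 1 *\<^sub>R proj (F i) (x t) + (-1) *\<^sub>R proj (F j) (x t))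
      (\<lambda>t. 1 *\<^sub>R proj (F i) (z t) + (-1) *\<^sub>R proj (F j) (z t))" by (rule asol_lin[OF aj aj])
    have o: "observation A G \<BB> T (\<lambda>t. proj (F j) (k t)) (W j) (\<lambda>t. proj (F j) (z t)) (g j)" for j
      unfolding g_def[abs_def] using observation_self[OF adm _ W[of j]] finite_energy_if_asol[OF aj[of j]] by (simp add: W_def[abs_def])
    have L2k: "L2 T UNIV (\<lambda>t. proj (F j) (k t))" for j by (rule L2_continuous[OF asol_D(1)[OF aj]]) simp
    have W0: "W j 0 \<in> Hdom A 1" for j using Hdom_iff_range[of _ 1] by (simp add: W_def)
    have "observation A G \<BB> T (\<lambda>t. 1 *\<^sub>R proj (F i) (k t) + (-1) *\<^sub>R proj (F j) (k t)) (\<lambda>t. 1 *\<^sub>R W i t + (-1) *\<^sub>R W j t)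
      (\<lambda>t. 1 *\<^sub>R proj (F i) (z t) + (-1) *\<^sub>R proj (F j) (z t)) (\<lambda>t. 1 *\<^sub>R g i t + (-1) *\<^sub>R g j t)"
      by (rule observation_lin[OF adm o o L2k L2k W0 W0 T])
    moreover have "(\<lambda>t. 1 *\<^sub>R W i t + (-1) *\<^sub>R W j t) = (\<lambda>t. pw (-1) (1 *\<^sub>R proj (F i) (x t) + (-1) *\<^sub>R proj (F j) (x t)))"
      by (simp add: W_def linear_diff[OF pl])
    ultimately have "L2_sq T (\<lambda>t. 1 *\<^sub>R g i t + (-1) *\<^sub>R g j t) \<le> c * (norm (1 *\<^sub>R proj (F i) (x 0) + (-1) *\<^sub>R proj (F j) (x 0),
        1 *\<^sub>R proj (F i) (z 0) + (-1) *\<^sub>R proj (F j) (z 0)) + B)\<^sup>2"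
      using Fk by (intro c(2)[OF ad]) (auto intro!: dP[simplified])
    \<comment> \<open>Position, velocity and source each differ by at most \<open>B\<close>, whence
      the 3, and the 9 after squaring.\<close>
    also have "\<dots> \<le> c * (3 * B)\<^sup>2"
    proof (intro mult_left_mono power_mono c(1))
      show "norm (1 *\<^sub>R proj (F i) (x 0) + (-1) *\<^sub>R proj (F j) (x 0), 1 *\<^sub>R proj (F i) (z 0) + (-1) *\<^sub>R proj (F j) (z 0)) + B \<le> 3 * B"
        using norm_Pair_le_add[of "1 *\<^sub>R proj (F i) (x 0) + (-1) *\<^sub>R proj (F j) (x 0)" "1 *\<^sub>R proj (F i) (z 0) + (-1) *\<^sub>R proj (F j) (z 0)"]
          dP[OF Fx Fx, of 0] dP[OF Fz Fz, of 0] T by auto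
      show "0 \<le> norm (1 *\<^sub>R proj (F i) (x 0) + (-1) *\<^sub>R proj (F j) (x 0), 1 *\<^sub>R proj (F i) (z 0) + (-1) *\<^sub>R proj (F j) (z 0)) + B"
        by (simp add: B_def)
    qed
    also have "\<dots> = (9 * c) * B\<^sup>2" by (simp add: power_mult_distrib)
    finally show ?thesis by (simp add: B_def)
  qed
  have "\<exists>h. L2 T G h \<and> (\<lambda>j. L2_sq T (\<lambda>t. g j t - h t)) \<longlonglongrightarrow> 0"
  proof (rule L2_complete[where K = "9 * c"])
    show "continuous_on {0..T} (g j)" for j by (rule cg)
    show "g j t \<in> G" if "t \<in> {0..T}" for j t by (rule gG[OF that])
    show "L2_sq T (\<lambda>t. g i t - g j t) \<le> 9 * c * ((1/2)^i + (1/2)^j)\<^sup>2" for i j by (rule cau)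
  qed (use GX T c(1) in auto)
  then obtain h where h: "L2 T G h" "(\<lambda>j. L2_sq T (\<lambda>t. g j t - h t)) \<longlonglongrightarrow> 0" by blast
  show ?thesis by (rule exI, rule observationI[OF adm a T F Fk Fx Fz h(1) h(2)[unfolded g_def W_def]])
qed

text \<open>An operator that ignores the position is determined by its values at position 0, hence
  is a bounded operator \<open>L\<close> on \<open>H\<close>; truncated observations then converge
  uniformly in time to \<open>L z\<close>.\<close>

lemma observation_of_velocity:
  assumes adm: "admissibility_hyp A G \<BB>" and a: "asol T k x z" and T: "T > 0"
    and L: "\<And>w w'. w \<in> Hdom A 2 \<Longrightarrow> \<BB> (w, w') = L w'"
  shows "bounded_linear L" and "L v \<in> G" and "observation A G \<BB> T k (\<lambda>t. pw (-1) (x t)) z (\<lambda>t. L (z t))"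
proof -
  have p0: "pw (-2) 0 = 0" by (rule pw_eq) (simp add: sc_def)
  have H0: "0 \<in> Hdom A 2" using Hdom_iff_range[of 0 2] p0 by (auto intro: rev_image_eqI)
  have Leq: "(\<lambda>z. \<BB> (pw (-2) (fst (0 :: 'h, z)), snd (0 :: 'h, z))) = L" by (rule ext) (simp add: p0 L[OF H0])
  have "bounded_linear (\<lambda>z::'h. (0 :: 'h, z))" by (intro bounded_linear_Pair bounded_linear_zero bounded_linear_ident)
  from bounded_linear_compose[OF observation_op_bounded_linear(1)[OF adm] this]
  show bl: "bounded_linear L" unfolding Leq .
  show LG: "L v \<in> G" for v using observation_op_bounded_linear(2)[OF adm, of 0 v] by (simp add: p0 L[OF H0])
  obtain F where "\<forall>j::nat. finite (F j) \<and> F j \<subseteq> E \<and> (\<forall>r\<in>{0..T}. norm (k r - proj (F j) (k r)) < (1/2)^j \<and>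
     norm (x r - proj (F j) (x r)) < (1/2)^j \<and> norm (z r - proj (F j) (z r)) < (1/2)^j)"
    using truncation_sequence[OF asol_D(1-3)[OF a]] by blast
  then have F: "\<And>j::nat. finite (F j)" "\<And>j. F j \<subseteq> E"
    and Fk: "\<And>j r. r \<in> {0..T} \<Longrightarrow> norm (k r - proj (F j) (k r)) < (1/2)^j"
    and Fx: "\<And>j r. r \<in> {0..T} \<Longrightarrow> norm (x r - proj (F j) (x r)) < (1/2)^j"
    and Fz: "\<And>j r. r \<in> {0..T} \<Longrightarrow> norm (z r - proj (F j) (z r)) < (1/2)^j" by blast+
  show "observation A G \<BB> T k (\<lambda>t. pw (-1) (x t)) z (\<lambda>t. L (z t))"
  proof (rule observationI[OF adm a T F Fk Fx Fz])
    show "L2 T G (\<lambda>t. L (z t))"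
      by (rule L2_continuous) (auto intro: bounded_linear.continuous_on[OF bl] asol_D(3)[OF a] LG)
    show "(\<lambda>j. L2_sq T (\<lambda>t. \<BB> (pw (-1) (proj (F j) (x t)), proj (F j) (z t)) - L (z t))) \<longlonglongrightarrow> 0"
    proof (rule Lim_null_comparison[OF always_eventually], rule allI)
      fix j
      have "L2_sq T (\<lambda>t. \<BB> (pw (-1) (proj (F j) (x t)), proj (F j) (z t)) - L (z t)) \<le> T * (onorm L * (1/2)^j)\<^sup>2"
      proof (rule L2_sq_le_bound)
        show "0 \<le> onorm L * (1/2)^j" using onorm_pos_le[OF bl] by simp
        fix t assume t: "t \<in> {0..T}"
        have "pw (-1) (proj (F j) (x t)) \<in> Hdom A 2"
          using truncated_in_H2[OF asol_D(2)[OF a] F] t pivot_Hs[of _ 2] by (auto simp: cont_Hs_def)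
        then have "\<BB> (pw (-1) (proj (F j) (x t)), proj (F j) (z t)) - L (z t) = L (proj (F j) (z t) - z t)"
          by (simp add: L linear_diff[OF bounded_linear.linear[OF bl]])
        also have "norm \<dots> \<le> onorm L * norm (proj (F j) (z t) - z t)" by (rule onorm[OF bl])
        also have "\<dots> \<le> onorm L * (1/2)^j"
          using Fz[OF t, of j] by (intro mult_left_mono onorm_pos_le[OF bl]) (simp add: norm_minus_commute)
        finally show "norm (\<BB> (pw (-1) (proj (F j) (x t)), proj (F j) (z t)) - L (z t)) \<le> onorm L * (1/2)^j" .
      qed (use T in simp)
      then show "norm (L2_sq T (\<lambda>t. \<BB> (pw (-1) (proj (F j) (x t)), proj (F j) (z t)) - L (z t))) \<le> T * (onorm L * (1/2)^j)\<^sup>2" by simp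
      have "(\<lambda>j. T * (onorm L * (1/2::real)^j)\<^sup>2) \<longlonglongrightarrow> T * (onorm L * 0)\<^sup>2" by (intro tendsto_intros LIMSEQ_power_zero) simp
      then show "(\<lambda>j. T * (onorm L * (1/2::real)^j)\<^sup>2) \<longlonglongrightarrow> 0" by simp
    qed
  qed
qed

end

section \<open>The Hilbert uniqueness method\<close>

lemma integral_small_on_short_intervals:
  fixes u :: "real \<Rightarrow> real"
  assumes u: "integrable (lebesgue_on {0..T}) u" and "\<epsilon> > 0"
  shows "\<exists>\<delta>>0. \<forall>a b. 0 \<le> a \<and> a \<le> b \<and> b \<le> T \<and> b - a < \<delta> \<longrightarrow> integral\<^sup>L (lebesgue_on {a..b}) u < \<epsilon>"
proof -
  have iu: "u integrable_on {0..T}" by (rule integrable_on_lebesgue_on[OF u]) simp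
  have eq: "integral\<^sup>L (lebesgue_on {0..b}) u = integral {0..b} u" if "b \<le> T" for b
    using has_integral_integral_lebesgue_on[OF integrable_subinterval[OF u, of 0 b]] that
    by (auto simp: integral_unique)
  have "continuous_on {0..T} (\<lambda>t. integral {0..t} u)" by (rule indefinite_integral_continuous_1[OF iu])
  then have "uniformly_continuous_on {0..T} (\<lambda>t. integral {0..t} u)" by (rule compact_uniformly_continuous) simp
  then obtain \<delta> where \<delta>: "\<delta> > 0" "\<And>s t. s \<in> {0..T} \<Longrightarrow> t \<in> {0..T} \<Longrightarrow> dist s t < \<delta> \<Longrightarrow> dist (integral {0..s} u) (integral {0..t} u) < \<epsilon>"
    using \<open>\<epsilon> > 0\<close> unfolding uniformly_continuous_on_def by metis
  have "integral\<^sup>L (lebesgue_on {a..b}) u < \<epsilon>" if ab: "0 \<le> a" "a \<le> b" "b \<le> T" "b - a < \<delta>" for a b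
    using lebesgue_on_integral_split[OF u ab(1-3)] eq[of a] eq[of b] \<delta>(2)[of a b] ab by (simp add: dist_real_def)
  then show ?thesis using \<delta>(1) by blast
qed

section \<open>The space of solutions of a cascade and its forms at each time\<close>

locale cascade_system = eigenbasis E A \<mu> c\<^sub>0
  for E :: "'h::{real_inner,complete_space} set" and A \<mu> c\<^sub>0 +
  fixes N :: nat and cp :: "nat \<Rightarrow> nat set" and K :: "nat \<Rightarrow> nat \<Rightarrow> 'h \<Rightarrow> 'h" and T :: real
  assumes T: "T > 0" and cas: "cascade N cp K"
begin

abbreviation "sol \<equiv> asys T N cp K"

text \<open>The scalar product of the states at time \<open>t\<close>. On trajectories, represented
  as functions of all indices and all times, it is only semidefinite, as nothing is fixed outside
  the rows and the time interval.\<close>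

definition ip :: "real \<Rightarrow> (nat \<Rightarrow> real \<Rightarrow> 'h) \<times> (nat \<Rightarrow> real \<Rightarrow> 'h) \<Rightarrow> (nat \<Rightarrow> real \<Rightarrow> 'h) \<times> (nat \<Rightarrow> real \<Rightarrow> 'h) \<Rightarrow> real" where
  "ip t s s' = (\<Sum>i = 1..N. fst s i t \<bullet> fst s' i t + snd s i t \<bullet> snd s' i t)"

definition lc :: "real \<Rightarrow> (nat \<Rightarrow> real \<Rightarrow> 'h) \<times> (nat \<Rightarrow> real \<Rightarrow> 'h) \<Rightarrow> real \<Rightarrow> (nat \<Rightarrow> real \<Rightarrow> 'h) \<times> (nat \<Rightarrow> real \<Rightarrow> 'h)
    \<Rightarrow> (nat \<Rightarrow> real \<Rightarrow> 'h) \<times> (nat \<Rightarrow> real \<Rightarrow> 'h)" where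
  "lc a s c s' = ((\<lambda>i t. a *\<^sub>R fst s i t + c *\<^sub>R fst s' i t), (\<lambda>i t. a *\<^sub>R snd s i t + c *\<^sub>R snd s' i t))"

definition Sol where "Sol = {s. sol (fst s) (snd s)}"

lemma ip_self: "ip t s s = (\<Sum>i = 1..N. (norm (fst s i t))\<^sup>2 + (norm (snd s i t))\<^sup>2)"
  by (simp add: ip_def power2_norm_eq_inner)

lemma ip_nonneg: "ip t s s \<ge> 0"
  by (simp add: ip_self sum_nonneg)

lemma ip_lc: "ip t (lc a s c s') s'' = a * ip t s s'' + c * ip t s' s''"
  by (simp add: ip_def lc_def inner_add_left sum_distrib_left sum.distrib algebra_simps)

lemma ip_sym: "ip t s s' = ip t s' s"
  by (simp add: ip_def inner_commute)

lemma Sol_lc: "s \<in> Sol \<Longrightarrow> s' \<in> Sol \<Longrightarrow> lc a s c s' \<in> Sol"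
  using asys_lin[OF cas] by (simp add: Sol_def lc_def)

lemma Sol_data: "t \<in> {0..T} \<Longrightarrow> \<exists>s\<in>Sol. \<forall>i\<in>{1..N}. fst s i t = a i \<and> snd s i t = b i"
  using asys_exists[OF cas, of t T a b] by (fastforce simp: Sol_def)

lemma component_le_ip:
  assumes "i \<in> {1..N}"
  shows "norm (fst s i t, snd s i t) \<le> sqrt (ip t s s)"
proof -
  have "(norm (fst s i t))\<^sup>2 + (norm (snd s i t))\<^sup>2 \<le> ip t s s"
    unfolding ip_self by (rule member_le_sum[of i "{1..N}" "\<lambda>i. (norm (fst s i t))\<^sup>2 + (norm (snd s i t))\<^sup>2"]) (use assms in auto)
  then show ?thesis unfolding norm_Pair by (rule real_sqrt_le_mono)
qed

lemma component_bounds: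
  assumes "i \<in> {1..N}"
  shows "norm (fst s i t) \<le> sqrt (ip t s s)" "norm (snd s i t) \<le> sqrt (ip t s s)"
proof -
  have "norm (fst s i t) \<le> norm (fst s i t, snd s i t)" "norm (snd s i t) \<le> norm (fst s i t, snd s i t)"
    by (simp_all add: norm_Pair)
  then show "norm (fst s i t) \<le> sqrt (ip t s s)" "norm (snd s i t) \<le> sqrt (ip t s s)"
    using component_le_ip[OF assms, of s t] by linarith+
qed

lemma ip_cauchy_schwarz: "\<bar>ip t s s'\<bar> \<le> sqrt (ip t s s) * sqrt (ip t s' s')"
proof -
  have "(ip t s s')\<^sup>2 \<le> ip t s s * ip t s' s'"
  proof (rule nonneg_quadratic_discriminant)
    fix r
    have "ip t (lc 1 s r s') (lc 1 s r s') = ip t s s + 2 * r * ip t s s' + r\<^sup>2 * ip t s' s'"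
      unfolding ip_lc ip_sym[of t _ "lc 1 s r s'"] by (simp add: ip_sym[of t s' s] power2_eq_square algebra_simps)
    then show "0 \<le> ip t s s + 2 * r * ip t s s' + r\<^sup>2 * ip t s' s'" using ip_nonneg[of t "lc 1 s r s'"] by simp
  qed (rule ip_nonneg)
  then have "sqrt ((ip t s s')\<^sup>2) \<le> sqrt (ip t s s * ip t s' s')" by (rule real_sqrt_le_mono)
  then show ?thesis by (simp add: real_sqrt_mult)
qed

text \<open>All the forms \<open>ip t\<close> are uniformly equivalent on solutions, so the
  reference time may be chosen freely.\<close>

lemma ip_estimate: "\<exists>C\<ge>1. \<forall>s\<in>Sol. \<forall>r\<in>{0..T}. \<forall>t\<in>{0..T}. sqrt (ip t s s) \<le> C * sqrt (ip r s s)"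
proof -
  obtain c where c: "c \<ge> 0" "\<And>x z r t i. sol x z \<Longrightarrow> r \<in> {0..T} \<Longrightarrow> t \<in> {0..T} \<Longrightarrow> i \<in> {1..N} \<Longrightarrow>
     norm (x i t, z i t) \<le> c * (\<Sum>j = 1..N. norm (x j r, z j r))"
    using asys_estimate[OF cas] by blast
  have "sqrt (ip t s s) \<le> (1 + real N * c * real N) * sqrt (ip r s s)" if s: "s \<in> Sol" and r: "r \<in> {0..T}" and t: "t \<in> {0..T}" for s r t
  proof -
    have "sqrt (ip t s s) = L2_set (\<lambda>i. norm (fst s i t, snd s i t)) {1..N}"
      by (simp add: ip_self L2_set_def norm_Pair)
    also have "\<dots> \<le> (\<Sum>i = 1..N. norm (fst s i t, snd s i t))" by (rule L2_set_le_sum) simp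
    also have "\<dots> \<le> (\<Sum>i = 1..N. c * (\<Sum>j = 1..N. norm (fst s j r, snd s j r)))"
      by (rule sum_mono) (use c(2)[OF _ r t] s in \<open>auto simp: Sol_def\<close>)
    also have "\<dots> \<le> (\<Sum>i = 1..N. c * (\<Sum>j = 1..N. sqrt (ip r s s)))"
      by (intro sum_mono mult_left_mono component_le_ip c(1))
    also have "\<dots> = real N * c * real N * sqrt (ip r s s)" by simp
    also have "\<dots> \<le> (1 + real N * c * real N) * sqrt (ip r s s)" using ip_nonneg[of r s] by (simp add: distrib_right)
    finally show ?thesis .
  qed
  then show ?thesis using c(1) by (intro exI[of _ "1 + real N * c * real N"]) auto
qed

text \<open>The states at time \<open>t\<close> converge component by component, and the limit is
  again the state of a solution because every state at time \<open>t\<close> is attained.\<close>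

lemma Sol_complete:
  assumes t: "t \<in> {0..T}" and X: "\<And>n::nat. X n \<in> Sol"
    and cau: "\<And>e. e > 0 \<Longrightarrow> \<exists>M. \<forall>m\<ge>M. \<forall>n\<ge>M. ip t (lc 1 (X m) (-1) (X n)) (lc 1 (X m) (-1) (X n)) < e"
  shows "\<exists>s\<in>Sol. (\<lambda>n. ip t (lc 1 (X n) (-1) s) (lc 1 (X n) (-1) s)) \<longlonglongrightarrow> 0"
proof -
  have C: "convergent (\<lambda>n. fst (X n) i t) \<and> convergent (\<lambda>n. snd (X n) i t)" if i: "i \<in> {1..N}" for i
  proof -
    have "Cauchy (\<lambda>n. fst (X n) i t) \<and> Cauchy (\<lambda>n. snd (X n) i t)"
    proof (intro conjI CauchyI)
      fix e :: real assume "e > 0"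
      then obtain M where M: "\<And>m n. m \<ge> M \<Longrightarrow> n \<ge> M \<Longrightarrow> ip t (lc 1 (X m) (-1) (X n)) (lc 1 (X m) (-1) (X n)) < e\<^sup>2"
        using cau[of "e\<^sup>2"] by auto
      have lt: "sqrt (ip t (lc 1 (X m) (-1) (X n)) (lc 1 (X m) (-1) (X n))) < e" if "m \<ge> M" "n \<ge> M" for m n
        using M[OF that] \<open>e > 0\<close> by (simp add: real_less_lsqrt ip_nonneg)
      show "\<exists>M. \<forall>m\<ge>M. \<forall>n\<ge>M. norm (fst (X m) i t - fst (X n) i t) < e"
      proof (intro exI[of _ M] allI impI)
        fix m n assume "m \<ge> M" "n \<ge> M"
        from lt[OF this] component_bounds(1)[OF i, of "lc 1 (X m) (-1) (X n)" t]
        show "norm (fst (X m) i t - fst (X n) i t) < e" by (simp add: lc_def)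
      qed
      show "\<exists>M. \<forall>m\<ge>M. \<forall>n\<ge>M. norm (snd (X m) i t - snd (X n) i t) < e"
      proof (intro exI[of _ M] allI impI)
        fix m n assume "m \<ge> M" "n \<ge> M"
        from lt[OF this] component_bounds(2)[OF i, of "lc 1 (X m) (-1) (X n)" t]
        show "norm (snd (X m) i t - snd (X n) i t) < e" by (simp add: lc_def)
      qed
    qed
    then show ?thesis using Cauchy_convergent by blast
  qed
  define a where "a i = lim (\<lambda>n. fst (X n) i t)" for i
  define b where "b i = lim (\<lambda>n. snd (X n) i t)" for i
  have ab: "(\<lambda>n. fst (X n) i t) \<longlonglongrightarrow> a i" "(\<lambda>n. snd (X n) i t) \<longlonglongrightarrow> b i" if "i \<in> {1..N}" for i
    using C[OF that] by (simp_all add: a_def b_def convergent_LIMSEQ_iff)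
  obtain s where s: "s \<in> Sol" "\<And>i. i \<in> {1..N} \<Longrightarrow> fst s i t = a i \<and> snd s i t = b i" using Sol_data[OF t] by metis
  have "(\<lambda>n. \<Sum>i = 1..N. (norm (fst (X n) i t - fst s i t))\<^sup>2 + (norm (snd (X n) i t - snd s i t))\<^sup>2) \<longlonglongrightarrow>
    (\<Sum>i = 1..N. (norm (a i - fst s i t))\<^sup>2 + (norm (b i - snd s i t))\<^sup>2)"
    by (intro tendsto_sum tendsto_intros ab)
  moreover have "(\<Sum>i = 1..N. (norm (a i - fst s i t))\<^sup>2 + (norm (b i - snd s i t))\<^sup>2) = 0"
    by (rule sum.neutral) (use s(2) in auto)
  ultimately show ?thesis using s(1) by (intro bexI[of _ s]) (simp_all add: ip_self lc_def)
qed

end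

text \<open>Observations are a relation, being determined only almost everywhere. The lower bound is
  assumed for initial states with finitely many modes, since those can be carried to the level where
  the observability inequality is known; the upper bound is assumed for all solutions.\<close>

locale hum = cascade_system E A \<mu> c\<^sub>0 N cp K T
  for E :: "'h::{real_inner,complete_space} set" and A \<mu> c\<^sub>0 N cp K T +
  fixes p :: nat and G :: "nat \<Rightarrow> 'g::{real_inner,complete_space} set"
    and obs :: "(nat \<Rightarrow> real \<Rightarrow> 'h) \<Rightarrow> (nat \<Rightarrow> real \<Rightarrow> 'h) \<Rightarrow> nat \<Rightarrow> (real \<Rightarrow> 'g) \<Rightarrow> bool"
  assumes obs_ex: "\<And>x z l. sol x z \<Longrightarrow> l \<le> p \<Longrightarrow> \<exists>g. obs x z l g"
    and obs_L2: "\<And>x z l g. sol x z \<Longrightarrow> l \<le> p \<Longrightarrow> obs x z l g \<Longrightarrow> L2 T (G l) g"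
    and obs_lin: "\<And>x z x' z' l g g' a c. sol x z \<Longrightarrow> sol x' z' \<Longrightarrow> l \<le> p \<Longrightarrow>
       obs x z l g \<Longrightarrow> obs x' z' l g' \<Longrightarrow>
       obs (\<lambda>i t. a *\<^sub>R x i t + c *\<^sub>R x' i t) (\<lambda>i t. a *\<^sub>R z i t + c *\<^sub>R z' i t) l (\<lambda>t. a *\<^sub>R g t + c *\<^sub>R g' t)"
    and obs_bound: "\<exists>c\<ge>0. \<forall>s\<in>Sol. \<forall>l\<le>p. \<forall>g. obs (fst s) (snd s) l g \<longrightarrow> L2_sq T g \<le> c * ip 0 s s"
    and observability_finite: "\<exists>c\<ge>0. \<forall>s\<in>Sol. \<forall>F g. finite F \<longrightarrow> F \<subseteq> E \<longrightarrow>
       (\<forall>i\<in>{1..N}. proj F (fst s i 0) = fst s i 0 \<and> proj F (snd s i 0) = snd s i 0) \<longrightarrow>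
       (\<forall>l\<le>p. obs (fst s) (snd s) l (g l)) \<longrightarrow> ip 0 s s \<le> c * (\<Sum>l = 0..p. L2_sq T (g l))"
begin

definition ob where "ob s l = (SOME g. obs (fst s) (snd s) l g)"

lemma ob: "s \<in> Sol \<Longrightarrow> l \<le> p \<Longrightarrow> obs (fst s) (snd s) l (ob s l)"
  using someI_ex[OF obs_ex[of "fst s" "snd s" l]] by (simp add: ob_def Sol_def)

lemma ob_L2: "s \<in> Sol \<Longrightarrow> l \<le> p \<Longrightarrow> L2 T (G l) (ob s l)"
  using ob obs_L2 by (auto simp: Sol_def)

text \<open>By linearity the difference of two observations observes the difference of the solution
  with itself, and the upper bound makes it vanish.\<close>

lemma obs_unique:
  assumes s: "s \<in> Sol" and l: "l \<le> p" and g: "obs (fst s) (snd s) l g" "obs (fst s) (snd s) l g'"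
  shows "L2_sq T (\<lambda>t. g t - g' t) = 0"
proof -
  obtain c where c: "\<And>s l g. s \<in> Sol \<Longrightarrow> l \<le> p \<Longrightarrow> obs (fst s) (snd s) l g \<Longrightarrow> L2_sq T g \<le> c * ip 0 s s"
    using obs_bound by blast
  have "obs (fst (lc 1 s (-1) s)) (snd (lc 1 s (-1) s)) l (\<lambda>t. 1 *\<^sub>R g t + (-1) *\<^sub>R g' t)"
    using obs_lin[of "fst s" "snd s" "fst s" "snd s" l g g' 1 "-1"] s l g by (simp add: Sol_def lc_def)
  from c[OF Sol_lc[OF s s] l this]
  have "L2_sq T (\<lambda>t. 1 *\<^sub>R g t + (-1) *\<^sub>R g' t) \<le> c * 0"
    by (simp add: ip_self lc_def)
  then show ?thesis using L2_sq_nonneg[of T "\<lambda>t. g t - g' t"] by simp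
qed

lemma obs_integral_unique:
  assumes s: "s \<in> Sol" and l: "l \<le> p" and g: "obs (fst s) (snd s) l g" "obs (fst s) (snd s) l g'"
    and v: "L2 T X v" and t: "t \<in> {0..T}"
  shows "integral\<^sup>L (lebesgue_on {0..t}) (\<lambda>r. v r \<bullet> g r) = integral\<^sup>L (lebesgue_on {0..t}) (\<lambda>r. v r \<bullet> g' r)"
proof -
  have L: "L2 T UNIV g" "L2 T UNIV g'" "L2 T UNIV v"
    using obs_L2[OF _ l g(1)] obs_L2[OF _ l g(2)] s v by (simp_all add: Sol_def L2_UNIV[of T "G l"] L2_UNIV[of T X])
  have sub: "{0..t} \<subseteq> {0..T}" using t by auto
  have i: "integrable (lebesgue_on {0..t}) (\<lambda>r. v r \<bullet> g r)" "integrable (lebesgue_on {0..t}) (\<lambda>r. v r \<bullet> g' r)"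
    using L by (auto simp: L2_iff intro!: integrable_subinterval[OF _ sub] L2_inner_integrable)
  have Ld: "L2 T UNIV (\<lambda>r. g r - g' r)" using L2_lincomb[OF L(1,2) subspace_UNIV, of 1 "-1"] by simp
  have "integral\<^sup>L (lebesgue_on {0..t}) (\<lambda>r. (norm (g r - g' r))\<^sup>2) \<le> L2_sq T (\<lambda>r. g r - g' r)"
    by (rule lebesgue_on_integral_subinterval[OF _ sub]) (use Ld in \<open>auto simp: L2_iff\<close>)
  then have z: "integral\<^sup>L (lebesgue_on {0..t}) (\<lambda>r. (norm (g r - g' r))\<^sup>2) = 0"
    using obs_unique[OF s l g] by (intro antisym) auto
  have "(integral\<^sup>L (lebesgue_on {0..t}) (\<lambda>r. v r \<bullet> (g r - g' r)))\<^sup>2 \<le> 0"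
    using L2_cauchy_schwarz[OF L(3) Ld sub] z by simp
  then have "integral\<^sup>L (lebesgue_on {0..t}) (\<lambda>r. v r \<bullet> (g r - g' r)) = 0" by simp
  then show ?thesis using i by (simp add: inner_diff_right)
qed

text \<open>For \<open>v\<close> the observation of a solution and \<open>t = T\<close> this is the
  Gramian of the uniqueness method; for a general \<open>v\<close> it is the left-hand side of the
  transposition identity.\<close>

definition J where "J t v s = (\<Sum>l = 0..p. integral\<^sup>L (lebesgue_on {0..t}) (\<lambda>r. v l r \<bullet> ob s l r))"

lemma J_eq:
  assumes s: "s \<in> Sol" and g: "\<And>l. l \<le> p \<Longrightarrow> obs (fst s) (snd s) l (g l)"
    and v: "\<And>l. l \<le> p \<Longrightarrow> L2 T (G l) (v l)" and t: "t \<in> {0..T}"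
  shows "integral\<^sup>L (lebesgue_on {0..t}) (\<lambda>r. \<Sum>l = 0..p. v l r \<bullet> g l r) = J t v s"
proof -
  have sub: "{0..t} \<subseteq> {0..T}" using t by auto
  have i: "integrable (lebesgue_on {0..t}) (\<lambda>r. v l r \<bullet> g l r)" if "l \<le> p" for l
  proof -
    have "L2 T (G l) (g l)" using obs_L2 s g[OF that] that by (auto simp: Sol_def)
    then show ?thesis
      using v[OF that] by (auto simp: L2_iff intro!: integrable_subinterval[OF _ sub] L2_inner_integrable)
  qed
  have "integral\<^sup>L (lebesgue_on {0..t}) (\<lambda>r. \<Sum>l = 0..p. v l r \<bullet> g l r)
      = (\<Sum>l = 0..p. integral\<^sup>L (lebesgue_on {0..t}) (\<lambda>r. v l r \<bullet> g l r))"
    by (rule Bochner_Integration.integral_sum) (use i in auto)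
  also have "\<dots> = J t v s"
    unfolding J_def
    by (rule sum.cong[OF refl], rule obs_integral_unique[OF s _ g ob[OF s] v t]) auto
  finally show ?thesis .
qed

lemma J_lc:
  assumes s: "s \<in> Sol" "s' \<in> Sol" and v: "\<And>l. l \<le> p \<Longrightarrow> L2 T (G l) (v l)" and t: "t \<in> {0..T}"
  shows "J t v (lc a s c s') = a * J t v s + c * J t v s'"
proof -
  have sub: "{0..t} \<subseteq> {0..T}" using t by auto
  have "integral\<^sup>L (lebesgue_on {0..t}) (\<lambda>r. v l r \<bullet> ob (lc a s c s') l r)
    = a * integral\<^sup>L (lebesgue_on {0..t}) (\<lambda>r. v l r \<bullet> ob s l r) + c * integral\<^sup>L (lebesgue_on {0..t}) (\<lambda>r. v l r \<bullet> ob s' l r)"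
    if l: "l \<le> p" for l
  proof -
    have "obs (fst (lc a s c s')) (snd (lc a s c s')) l (\<lambda>r. a *\<^sub>R ob s l r + c *\<^sub>R ob s' l r)"
      using obs_lin[OF _ _ l ob[OF s(1) l] ob[OF s(2) l], of a c] s by (simp add: Sol_def lc_def)
    from obs_integral_unique[OF Sol_lc[OF s] l ob[OF Sol_lc[OF s] l] this v[OF l] t]
    have "integral\<^sup>L (lebesgue_on {0..t}) (\<lambda>r. v l r \<bullet> ob (lc a s c s') l r)
      = integral\<^sup>L (lebesgue_on {0..t}) (\<lambda>r. v l r \<bullet> (a *\<^sub>R ob s l r + c *\<^sub>R ob s' l r))" .
    moreover have "integrable (lebesgue_on {0..t}) (\<lambda>r. v l r \<bullet> ob s l r)" "integrable (lebesgue_on {0..t}) (\<lambda>r. v l r \<bullet> ob s' l r)"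
      using v[OF l] ob_L2[OF s(1) l] ob_L2[OF s(2) l]
      by (auto simp: L2_iff intro!: integrable_subinterval[OF _ sub] L2_inner_integrable)
    ultimately show ?thesis by (simp add: inner_add_right)
  qed
  then have "J t v (lc a s c s') = (\<Sum>l = 0..p. a * integral\<^sup>L (lebesgue_on {0..t}) (\<lambda>r. v l r \<bullet> ob s l r) + c * integral\<^sup>L (lebesgue_on {0..t}) (\<lambda>r. v l r \<bullet> ob s' l r))"
    unfolding J_def by (intro sum.cong) auto
  then show ?thesis by (simp add: J_def sum.distrib sum_distrib_left)
qed

text \<open>The Cauchy-Schwarz inequality on the interval from \<open>a\<close> to \<open>b\<close>
  leaves the norm of the control over it as a factor, which is small on short intervals. The
  reference time \<open>r\<close> is arbitrary by equivalence of the forms.\<close>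

lemma J_difference_bound:
  assumes v: "\<And>l. l \<le> p \<Longrightarrow> L2 T (G l) (v l)"
  shows "\<exists>C\<ge>0. \<forall>s\<in>Sol. \<forall>a b r. 0 \<le> a \<longrightarrow> a \<le> b \<longrightarrow> b \<le> T \<longrightarrow> r \<in> {0..T} \<longrightarrow>
    \<bar>J b v s - J a v s\<bar> \<le> C * sqrt (\<Sum>l = 0..p. integral\<^sup>L (lebesgue_on {a..b}) (\<lambda>t. (norm (v l t))\<^sup>2)) * sqrt (ip r s s)"
proof -
  obtain c where c: "c \<ge> 0" "\<And>s l g. s \<in> Sol \<Longrightarrow> l \<le> p \<Longrightarrow> obs (fst s) (snd s) l g \<Longrightarrow> L2_sq T g \<le> c * ip 0 s s"
    using obs_bound by blast
  obtain C where C: "C \<ge> 1" "\<And>s r t. s \<in> Sol \<Longrightarrow> r \<in> {0..T} \<Longrightarrow> t \<in> {0..T} \<Longrightarrow> sqrt (ip t s s) \<le> C * sqrt (ip r s s)"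
    using ip_estimate by blast
  show ?thesis
  proof (intro exI[of _ "real (Suc p) * sqrt c * C"] conjI ballI allI impI)
    show "0 \<le> real (Suc p) * sqrt c * C" using c C by simp
    fix s a b r assume s: "s \<in> Sol" and ab: "0 \<le> a" "a \<le> b" "b \<le> T" and r: "r \<in> {0..T}"
    define V where "V l = integral\<^sup>L (lebesgue_on {a..b}) (\<lambda>t. (norm (v l t))\<^sup>2)" for l
    have sub: "{a..b} \<subseteq> {0..T}" using ab by auto
    have one: "\<bar>integral\<^sup>L (lebesgue_on {a..b}) (\<lambda>t. v l t \<bullet> ob s l t)\<bar> \<le> sqrt (\<Sum>l = 0..p. V l) * (sqrt c * (C * sqrt (ip r s s)))"
      if l: "l \<le> p" for l
    proof -
      have L: "L2 T (G l) (ob s l)" by (rule ob_L2[OF s l])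
      have "(integral\<^sup>L (lebesgue_on {a..b}) (\<lambda>t. v l t \<bullet> ob s l t))\<^sup>2 \<le> V l * integral\<^sup>L (lebesgue_on {a..b}) (\<lambda>t. (norm (ob s l t))\<^sup>2)"
        unfolding V_def by (rule L2_cauchy_schwarz[OF v[OF l] L sub])
      also have "\<dots> \<le> (\<Sum>l = 0..p. V l) * (c * ip 0 s s)"
      proof (rule mult_mono)
        show "V l \<le> (\<Sum>l = 0..p. V l)" by (rule member_le_sum) (use l in \<open>auto simp: V_def\<close>)
        have "integral\<^sup>L (lebesgue_on {a..b}) (\<lambda>t. (norm (ob s l t))\<^sup>2) \<le> L2_sq T (ob s l)"
          by (rule lebesgue_on_integral_subinterval[OF _ sub]) (use L in \<open>auto simp: L2_iff\<close>)
        then show "integral\<^sup>L (lebesgue_on {a..b}) (\<lambda>t. (norm (ob s l t))\<^sup>2) \<le> c * ip 0 s s"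
          using c(2)[OF s l ob[OF s l]] by linarith
      qed (auto simp: V_def sum_nonneg)
      finally have "sqrt ((integral\<^sup>L (lebesgue_on {a..b}) (\<lambda>t. v l t \<bullet> ob s l t))\<^sup>2) \<le> sqrt ((\<Sum>l = 0..p. V l) * (c * ip 0 s s))"
        by (rule real_sqrt_le_mono)
      then have "\<bar>integral\<^sup>L (lebesgue_on {a..b}) (\<lambda>t. v l t \<bullet> ob s l t)\<bar> \<le> sqrt (\<Sum>l = 0..p. V l) * (sqrt c * sqrt (ip 0 s s))"
        by (simp add: real_sqrt_mult)
      also have "\<dots> \<le> sqrt (\<Sum>l = 0..p. V l) * (sqrt c * (C * sqrt (ip r s s)))"
        using C(2)[OF s r, of 0] T c(1) by (intro mult_left_mono) (auto simp: V_def sum_nonneg)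
      finally show ?thesis .
    qed
    have split: "integral\<^sup>L (lebesgue_on {0..b}) (\<lambda>t. v l t \<bullet> ob s l t) - integral\<^sup>L (lebesgue_on {0..a}) (\<lambda>t. v l t \<bullet> ob s l t)
        = integral\<^sup>L (lebesgue_on {a..b}) (\<lambda>t. v l t \<bullet> ob s l t)" if l: "l \<le> p" for l
    proof -
      have "integrable (lebesgue_on {0..T}) (\<lambda>t. v l t \<bullet> ob s l t)"
        using v[OF l] ob_L2[OF s l] by (auto simp: L2_iff intro!: L2_inner_integrable)
      from lebesgue_on_integral_split[OF this ab] show ?thesis by simp
    qed
    have "J b v s - J a v s = (\<Sum>l = 0..p. integral\<^sup>L (lebesgue_on {a..b}) (\<lambda>t. v l t \<bullet> ob s l t))"
      unfolding J_def sum_subtractf[symmetric] by (rule sum.cong[OF refl]) (use split in auto)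
    then have "\<bar>J b v s - J a v s\<bar> \<le> (\<Sum>l = 0..p. \<bar>integral\<^sup>L (lebesgue_on {a..b}) (\<lambda>t. v l t \<bullet> ob s l t)\<bar>)"
      by (simp add: sum_abs)
    also have "\<dots> \<le> (\<Sum>l = 0..p. sqrt (\<Sum>l = 0..p. V l) * (sqrt c * (C * sqrt (ip r s s))))"
      by (rule sum_mono) (use one in auto)
    also have "\<dots> = real (Suc p) * sqrt c * C * sqrt (\<Sum>l = 0..p. V l) * sqrt (ip r s s)" by simp
    finally show "\<bar>J b v s - J a v s\<bar> \<le> real (Suc p) * sqrt c * C * sqrt (\<Sum>l = 0..p. integral\<^sup>L (lebesgue_on {a..b}) (\<lambda>t. (norm (v l t))\<^sup>2)) * sqrt (ip r s s)"
      by (simp add: V_def)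
  qed
qed

text \<open>A solution \<open>s\<close> is compared with the solution \<open>r\<close> whose initial
  state is truncated, for which the lower bound is known. Their difference \<open>d\<close> enters
  only through \<open>ip 0 d d\<close>, which is arbitrarily small; the factor 4 collects two uses
  of \<open>|a + b|^2 \<le> 2 |a|^2 + 2 |b|^2\<close>.\<close>

lemma observability:
  "\<exists>c\<ge>0. \<forall>s\<in>Sol. ip 0 s s \<le> c * J T (ob s) s"
proof -
  obtain cb where cb: "cb \<ge> 0" "\<And>s l g. s \<in> Sol \<Longrightarrow> l \<le> p \<Longrightarrow> obs (fst s) (snd s) l g \<Longrightarrow> L2_sq T g \<le> cb * ip 0 s s"
    using obs_bound by blast
  from observability_finite obtain c where c1: "c \<ge> 0" and c2: "\<forall>s\<in>Sol. \<forall>F g. finite F \<longrightarrow> F \<subseteq> E \<longrightarrow>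
       (\<forall>i\<in>{1..N}. proj F (fst s i 0) = fst s i 0 \<and> proj F (snd s i 0) = snd s i 0) \<longrightarrow>
       (\<forall>l\<le>p. obs (fst s) (snd s) l (g l)) \<longrightarrow> ip 0 s s \<le> c * (\<Sum>l = 0..p. L2_sq T (g l))"
    by (elim exE conjE)
  have "ip 0 s s \<le> (4 * c) * J T (ob s) s" if s: "s \<in> Sol" for s
  proof (rule field_le_epsilon)
    fix \<epsilon> :: real assume e: "\<epsilon> > 0"
    \<comment> \<open>The final coefficient of \<open>ip 0 d d\<close>: the first term stems from
      the observations of \<open>d\<close>, the summand 2 from splitting the state.\<close>
    define B where "B = 4 * c * real (Suc p) * cb + 2"
    have B: "B > 0" using c1 cb(1) by (simp add: B_def add_nonneg_pos)
    \<comment> \<open>Each of the \<open>2 * N\<close> components of the truncation error is at most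
      \<delta>, so that \<open>ip 0 d d \<le> \<epsilon> / B\<close>.\<close>
    define \<delta> where "\<delta> = sqrt (\<epsilon> / B / (2 * (real N + 1)))"
    have \<delta>: "\<delta> > 0" using e B by (simp add: \<delta>_def)
    have "\<exists>F. finite F \<and> F \<subseteq> E \<and> norm (fst s i 0 - proj F (fst s i 0)) < \<delta>" for i using proj_approx[OF \<delta>] by blast
    then obtain F1 where F1: "\<And>i. finite (F1 i) \<and> F1 i \<subseteq> E \<and> norm (fst s i 0 - proj (F1 i) (fst s i 0)) < \<delta>" by metis
    have "\<exists>F. finite F \<and> F \<subseteq> E \<and> norm (snd s i 0 - proj F (snd s i 0)) < \<delta>" for i using proj_approx[OF \<delta>] by blast
    then obtain F2 where F2: "\<And>i. finite (F2 i) \<and> F2 i \<subseteq> E \<and> norm (snd s i 0 - proj (F2 i) (snd s i 0)) < \<delta>" by metis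
    define F where "F = (\<Union>i\<in>{1..N}. F1 i \<union> F2 i)"
    have F: "finite F" "F \<subseteq> E" using F1 F2 by (auto simp: F_def)
    have pF: "norm (fst s i 0 - proj F (fst s i 0)) \<le> \<delta>" "norm (snd s i 0 - proj F (snd s i 0)) \<le> \<delta>" if i: "i \<in> {1..N}" for i
    proof -
      have "F1 i \<subseteq> F" "F2 i \<subseteq> F" using i by (auto simp: F_def)
      then show "norm (fst s i 0 - proj F (fst s i 0)) \<le> \<delta>" "norm (snd s i 0 - proj F (snd s i 0)) \<le> \<delta>"
        using norm_diff_proj_mono[OF F(1) _ F(2)] F1[of i] F2[of i] by (meson less_imp_le order_trans)+
    qed
    obtain r where r: "r \<in> Sol" "\<And>i. i \<in> {1..N} \<Longrightarrow> fst r i 0 = proj F (fst s i 0) \<and> snd r i 0 = proj F (snd s i 0)"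
      using Sol_data[of 0 "\<lambda>i. proj F (fst s i 0)" "\<lambda>i. proj F (snd s i 0)"] T by auto
    have pp: "proj F (proj F y) = proj F y" for y by (rule eqI) (simp add: proj_inner F)
    define d where "d = lc 1 s (-1) r"
    have d: "d \<in> Sol" unfolding d_def by (rule Sol_lc[OF s r(1)])
    have dd: "ip 0 d d \<le> \<epsilon> / B"
    proof -
      have "ip 0 d d \<le> (\<Sum>i = 1..N. \<delta>\<^sup>2 + \<delta>\<^sup>2)"
        unfolding ip_self by (intro sum_mono add_mono power_mono) (use r(2) pF in \<open>auto simp: d_def lc_def\<close>)
      also have "\<dots> = (\<epsilon> / B) * (real N / (real N + 1))"
      proof -
        have half: "x / (2 * y) + x / (2 * y) = x / y" for x y :: real by (cases "y = 0") (simp_all add: field_simps)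
        have "\<delta>\<^sup>2 = \<epsilon> / B / (2 * (real N + 1))" using e B by (simp add: \<delta>_def)
        then show ?thesis using half[of "\<epsilon> / B" "real N + 1"] by simp
      qed
      also have "\<dots> \<le> (\<epsilon> / B) * 1" using e B by (intro mult_left_mono) auto
      finally show ?thesis by simp
    qed
    have L2r: "L2_sq T (ob r l) \<le> 2 * L2_sq T (ob s l) + 2 * (cb * ip 0 d d)" if l: "l \<le> p" for l
    proof -
      have "obs (fst d) (snd d) l (\<lambda>t. 1 *\<^sub>R ob s l t + (-1) *\<^sub>R ob r l t)"
        using obs_lin[OF _ _ l ob[OF s l] ob[OF r(1) l], of 1 "-1"] s r(1) by (simp add: Sol_def d_def lc_def)
      from obs_L2[OF _ l this] cb(2)[OF d l this] d
      have 1: "L2 T (G l) (\<lambda>t. ob s l t - ob r l t)" "L2_sq T (\<lambda>t. ob s l t - ob r l t) \<le> cb * ip 0 d d" by (simp_all add: Sol_def)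
      from L2_sq_lincomb_le[OF ob_L2[OF s l] 1(1), of 1 "-1"]
      have "L2_sq T (ob r l) \<le> 2 * L2_sq T (ob s l) + 2 * L2_sq T (\<lambda>t. ob s l t - ob r l t)" by simp
      then show ?thesis using 1(2) by linarith
    qed
    have "ip 0 r r \<le> c * (\<Sum>l = 0..p. L2_sq T (ob r l))"
      by (rule c2[rule_format, OF r(1) F]) (use r(2) pp ob[OF r(1)] in auto)
    also have "\<dots> \<le> c * (\<Sum>l = 0..p. 2 * L2_sq T (ob s l) + 2 * (cb * ip 0 d d))"
      by (intro mult_left_mono sum_mono c1) (use L2r in auto)
    also have "\<dots> = c * (2 * J T (ob s) s + 2 * real (Suc p) * cb * ip 0 d d)"
      by (simp add: J_def power2_norm_eq_inner sum.distrib sum_distrib_left[symmetric] algebra_simps)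
    finally have rr: "ip 0 r r \<le> c * (2 * J T (ob s) s + 2 * real (Suc p) * cb * ip 0 d d)" .
    have "ip 0 s s \<le> 2 * ip 0 r r + 2 * ip 0 d d"
      unfolding ip_self sum_distrib_left sum.distrib[symmetric]
    proof (rule sum_mono)
      have sq: "(norm a)\<^sup>2 \<le> 2 * (norm b)\<^sup>2 + 2 * (norm (a - b))\<^sup>2" for a b :: 'h
      proof -
        have "norm a \<le> norm b + norm (a - b)" using norm_triangle_ineq[of b "a - b"] by simp
        then have "(norm a)\<^sup>2 \<le> (norm b + norm (a - b))\<^sup>2" by (rule power_mono) simp
        also have "\<dots> \<le> 2 * (norm b)\<^sup>2 + 2 * (norm (a - b))\<^sup>2"
          using zero_le_power2[of "norm b - norm (a - b)"] by (simp add: power2_sum power2_diff)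
        finally show ?thesis .
      qed
      fix i
      show "(norm (fst s i 0))\<^sup>2 + (norm (snd s i 0))\<^sup>2 \<le> 2 * ((norm (fst r i 0))\<^sup>2 + (norm (snd r i 0))\<^sup>2) + 2 * ((norm (fst d i 0))\<^sup>2 + (norm (snd d i 0))\<^sup>2)"
        using sq[of "fst s i 0" "fst r i 0"] sq[of "snd s i 0" "snd r i 0"] by (simp add: d_def lc_def)
    qed
    also have "\<dots> \<le> 2 * (c * (2 * J T (ob s) s + 2 * real (Suc p) * cb * ip 0 d d)) + 2 * ip 0 d d" using rr by simp
    also have "\<dots> = (4 * c) * J T (ob s) s + B * ip 0 d d" by (simp add: B_def algebra_simps)
    also have "B * ip 0 d d \<le> B * (\<epsilon> / B)" using dd B by (intro mult_left_mono) auto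
    finally show "ip 0 s s \<le> (4 * c) * J T (ob s) s + \<epsilon>" using B by simp
  qed
  then show ?thesis using c1 by (intro exI[of _ "4 * c"]) auto
qed

text \<open>Observability makes the Gramian dominate \<open>ip 0\<close>, so the functional is
  bounded for it, and Cauchy sequences for the Gramian converge for \<open>ip 0\<close>; the upper
  bound carries this convergence back to the Gramian.\<close>

lemma control_exists:
  assumes "s0 \<in> Sol"
  shows "\<exists>v. (\<forall>l\<le>p. L2 T (G l) (v l)) \<and> (\<forall>s\<in>Sol. J T v s = - ip 0 s0 s)"
proof -
  obtain cb where cb: "cb \<ge> 0" "\<And>s l g. s \<in> Sol \<Longrightarrow> l \<le> p \<Longrightarrow> obs (fst s) (snd s) l g \<Longrightarrow> L2_sq T g \<le> cb * ip 0 s s"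
    using obs_bound by blast
  obtain co where co: "co \<ge> 0" "\<And>s. s \<in> Sol \<Longrightarrow> ip 0 s s \<le> co * J T (ob s) s"
    using observability by blast
  have TT: "T \<in> {0..T}" "0 \<in> {0..T}" using T by auto
  have Jsym: "J T (ob s) s' = J T (ob s') s" for s s' by (simp add: J_def inner_commute)
  have Jb: "J T (ob s) (lc a s1 c s2) = a * J T (ob s) s1 + c * J T (ob s) s2" if "s \<in> Sol" "s1 \<in> Sol" "s2 \<in> Sol" for s s1 s2 a c
    by (rule J_lc) (use that ob_L2 TT in auto)
  have "\<exists>s\<in>Sol. \<forall>s'\<in>Sol. J T (ob s) s' = - ip 0 s0 s'"
  proof (rule riesz_form[where lc = lc and K = "ip 0 s0 s0 * co"])
    show "lc a s c s' \<in> Sol" if "s \<in> Sol" "s' \<in> Sol" for a s c s' by (rule Sol_lc[OF that])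
    show "J T (ob (lc a x c y)) z = a * J T (ob x) z + c * J T (ob y) z" if "x \<in> Sol" "y \<in> Sol" "z \<in> Sol" for a x c y z
      using Jb[OF that(3,1,2)] Jsym by metis
    show "J T (ob s) s' = J T (ob s') s" for s s' by (rule Jsym)
    show "0 \<le> J T (ob s) s" for s by (auto simp: J_def power2_norm_eq_inner[symmetric] intro!: sum_nonneg)
    show "- ip 0 s0 (lc a x c y) = a * - ip 0 s0 x + c * - ip 0 s0 y" for a x c y
      unfolding ip_sym[of 0 s0] ip_lc by (simp add: algebra_simps)
    show "(- ip 0 s0 s)\<^sup>2 \<le> ip 0 s0 s0 * co * J T (ob s) s" if s: "s \<in> Sol" for s
    proof -
      have "(\<bar>ip 0 s0 s\<bar>)\<^sup>2 \<le> (sqrt (ip 0 s0 s0) * sqrt (ip 0 s s))\<^sup>2" by (rule power_mono[OF ip_cauchy_schwarz]) simp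
      also have "\<dots> = ip 0 s0 s0 * ip 0 s s" by (simp add: power_mult_distrib ip_nonneg)
      also have "\<dots> \<le> ip 0 s0 s0 * (co * J T (ob s) s)" by (rule mult_left_mono[OF co(2)[OF s] ip_nonneg])
      finally show ?thesis by (simp add: mult.assoc)
    qed
    show "Sol \<noteq> {}" using assms by auto
    fix X :: "nat \<Rightarrow> _"
    assume X: "\<And>n. X n \<in> Sol"
      and cau: "\<And>e. e > 0 \<Longrightarrow> \<exists>M. \<forall>m\<ge>M. \<forall>n\<ge>M. J T (ob (lc 1 (X m) (- 1) (X n))) (lc 1 (X m) (- 1) (X n)) < e"
    have "\<exists>s\<in>Sol. (\<lambda>n. ip 0 (lc 1 (X n) (-1) s) (lc 1 (X n) (-1) s)) \<longlonglongrightarrow> 0"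
    proof (rule Sol_complete[OF TT(2) X])
      fix e :: real assume "e > 0"
      then have "e / (co + 1) > 0" using co(1) by simp
      from cau[OF this] obtain M where M: "\<And>m n. m \<ge> M \<Longrightarrow> n \<ge> M \<Longrightarrow> J T (ob (lc 1 (X m) (- 1) (X n))) (lc 1 (X m) (- 1) (X n)) < e / (co + 1)"
        by blast
      show "\<exists>M. \<forall>m\<ge>M. \<forall>n\<ge>M. ip 0 (lc 1 (X m) (- 1) (X n)) (lc 1 (X m) (- 1) (X n)) < e"
      proof (intro exI[of _ M] allI impI)
        fix m n assume mn: "m \<ge> M" "n \<ge> M"
        have "ip 0 (lc 1 (X m) (- 1) (X n)) (lc 1 (X m) (- 1) (X n)) \<le> co * J T (ob (lc 1 (X m) (- 1) (X n))) (lc 1 (X m) (- 1) (X n))"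
          by (rule co(2)[OF Sol_lc[OF X X]])
        also have "\<dots> \<le> co * (e / (co + 1))" using M[OF mn] co(1) by (intro mult_left_mono) auto
        also have "\<dots> < e" using \<open>e > 0\<close> co(1) by (simp add: field_simps)
        finally show "ip 0 (lc 1 (X m) (- 1) (X n)) (lc 1 (X m) (- 1) (X n)) < e" .
      qed
    qed
    then obtain s where s: "s \<in> Sol" "(\<lambda>n. ip 0 (lc 1 (X n) (-1) s) (lc 1 (X n) (-1) s)) \<longlonglongrightarrow> 0" by blast
    have "(\<lambda>n. J T (ob (lc 1 (X n) (-1) s)) (lc 1 (X n) (-1) s)) \<longlonglongrightarrow> 0"
    proof (rule tendsto_sandwich[OF _ _ tendsto_const])
      have "(\<lambda>n. real (Suc p) * cb * ip 0 (lc 1 (X n) (-1) s) (lc 1 (X n) (-1) s)) \<longlonglongrightarrow> real (Suc p) * cb * 0"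
        by (intro tendsto_intros s(2))
      then show "(\<lambda>n. real (Suc p) * cb * ip 0 (lc 1 (X n) (-1) s) (lc 1 (X n) (-1) s)) \<longlonglongrightarrow> 0" by simp
      show "\<forall>\<^sub>F n in sequentially. 0 \<le> J T (ob (lc 1 (X n) (-1) s)) (lc 1 (X n) (-1) s)"
        by (auto simp: J_def power2_norm_eq_inner[symmetric] intro!: sum_nonneg always_eventually)
      have "J T (ob s') s' \<le> real (Suc p) * cb * ip 0 s' s'" if s': "s' \<in> Sol" for s'
      proof -
        have "J T (ob s') s' = (\<Sum>l = 0..p. L2_sq T (ob s' l))" by (simp add: J_def power2_norm_eq_inner)
        also have "\<dots> \<le> (\<Sum>l = 0..p. cb * ip 0 s' s')" by (rule sum_mono) (use cb(2)[OF s'] ob[OF s'] in auto)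
        finally show ?thesis by simp
      qed
      then show "\<forall>\<^sub>F n in sequentially. J T (ob (lc 1 (X n) (-1) s)) (lc 1 (X n) (-1) s) \<le> real (Suc p) * cb * ip 0 (lc 1 (X n) (-1) s) (lc 1 (X n) (-1) s)"
        using Sol_lc[OF X s(1)] by (intro always_eventually allI) blast
    qed
    then show "\<exists>s\<in>Sol. (\<lambda>n. J T (ob (lc 1 (X n) (-1) s)) (lc 1 (X n) (-1) s)) \<longlonglongrightarrow> 0" using s(1) by blast
  qed
  then obtain s where "s \<in> Sol" "\<forall>s'\<in>Sol. J T (ob s) s' = - ip 0 s0 s'" by blast
  then show ?thesis using ob_L2 by (intro exI[of _ "ob s"]) auto
qed

end

section \<open>The controlled trajectory and its continuity\<close>

context cascade_system
begin

lemma coupling_bound: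
  "\<exists>M\<ge>0. \<forall>s\<in>Sol. \<forall>r\<in>{0..T}. \<forall>t\<in>{0..T}. \<forall>i\<in>{1..N}. norm (\<Sum>k\<in>cp i. K i k (fst s k t)) \<le> M * sqrt (ip r s s)"
proof -
  obtain C where C: "C \<ge> 1" "\<And>s r t. s \<in> Sol \<Longrightarrow> r \<in> {0..T} \<Longrightarrow> t \<in> {0..T} \<Longrightarrow> sqrt (ip t s s) \<le> C * sqrt (ip r s s)"
    using ip_estimate by blast
  define m where "m i = (\<Sum>k\<in>cp i. onorm (K i k)) * C" for i
  have m0: "m i \<ge> 0" if "i \<in> {1..N}" for i
    unfolding m_def using C(1) cas that by (intro mult_nonneg_nonneg sum_nonneg onorm_pos_le) (auto simp: cascade_def)
  have "norm (\<Sum>k\<in>cp i. K i k (fst s k t)) \<le> (\<Sum>i = 1..N. m i) * sqrt (ip r s s)"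
    if s: "s \<in> Sol" and r: "r \<in> {0..T}" and t: "t \<in> {0..T}" and i: "i \<in> {1..N}" for s r t i
  proof -
    have "norm (\<Sum>k\<in>cp i. K i k (fst s k t)) \<le> (\<Sum>k\<in>cp i. norm (K i k (fst s k t)))" by (rule norm_sum)
    also have "\<dots> \<le> (\<Sum>k\<in>cp i. onorm (K i k) * (C * sqrt (ip r s s)))"
    proof (rule sum_mono)
      fix k assume k: "k \<in> cp i"
      have bl: "bounded_linear (K i k)" using cas i k by (auto simp: cascade_def)
      have "k \<in> {1..N}" using cas i k by (force simp: cascade_def)
      then have "norm (fst s k t) \<le> C * sqrt (ip r s s)" using component_bounds(1)[of k s t] C(2)[OF s r t] by linarith
      then have "onorm (K i k) * norm (fst s k t) \<le> onorm (K i k) * (C * sqrt (ip r s s))"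
        by (rule mult_left_mono) (rule onorm_pos_le[OF bl])
      then show "norm (K i k (fst s k t)) \<le> onorm (K i k) * (C * sqrt (ip r s s))"
        using onorm[OF bl, of "fst s k t"] by linarith
    qed
    also have "\<dots> = m i * sqrt (ip r s s)" by (simp add: m_def sum_distrib_right mult.assoc)
    also have "\<dots> \<le> (\<Sum>i = 1..N. m i) * sqrt (ip r s s)"
      using member_le_sum[of i "{1..N}" m] i m0 ip_nonneg by (intro mult_right_mono) auto
    finally show ?thesis .
  qed
  then show ?thesis using m0 by (intro exI[of _ "\<Sum>i = 1..N. m i"]) (auto intro: sum_nonneg)
qed

text \<open>Tested with a truncation \<open>p0\<close> of \<open>y\<close>, a solution is Lipschitz
  in time, since \<open>p0\<close> is in the domain of \<open>A^{1/2}\<close>; the remainder is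
  uniformly small. The bound is relative to the size of the solution, so one \<delta> serves all
  solutions.\<close>

lemma weak_continuity:
  assumes "\<epsilon> > 0"
  shows "\<exists>\<delta>>0. \<forall>s\<in>Sol. \<forall>r\<in>{0..T}. \<forall>t\<in>{0..T}. \<forall>i\<in>{1..N}. \<bar>t - r\<bar> < \<delta> \<longrightarrow>
    \<bar>y \<bullet> (fst s i t - fst s i r)\<bar> \<le> \<epsilon> * sqrt (ip r s s) \<and> \<bar>y \<bullet> (snd s i t - snd s i r)\<bar> \<le> \<epsilon> * sqrt (ip r s s)"
proof -
  obtain C where C: "C \<ge> 1" "\<And>s r t. s \<in> Sol \<Longrightarrow> r \<in> {0..T} \<Longrightarrow> t \<in> {0..T} \<Longrightarrow> sqrt (ip t s s) \<le> C * sqrt (ip r s s)"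
    using ip_estimate by blast
  obtain M where M: "M \<ge> 0" "\<And>s r t i. s \<in> Sol \<Longrightarrow> r \<in> {0..T} \<Longrightarrow> t \<in> {0..T} \<Longrightarrow> i \<in> {1..N} \<Longrightarrow>
      norm (\<Sum>k\<in>cp i. K i k (fst s k t)) \<le> M * sqrt (ip r s s)"
    using coupling_bound by blast
  \<comment> \<open>States have norm at most \<open>C\<close> times the size of the solution and
    their differences at most twice that, so the remainder \<open>y - p0\<close> costs half of
    \<epsilon>.\<close>
  have "\<epsilon> / (4 * C) > 0" using assms C(1) by simp
  then obtain F where F: "finite F" "F \<subseteq> E" "norm (y - proj F y) < \<epsilon> / (4 * C)" using proj_approx by blast
  define p0 where "p0 = proj F y"
  \<comment> \<open>This is \<open>A^{1/2} p0\<close>, onto which the unbounded operator is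
    shifted.\<close>
  define p1 where "p1 = (\<Sum>e\<in>F. (\<mu> e * (y \<bullet> e)) *\<^sub>R e)"
  define L where "L = (M + C) * (norm p0 + norm p1)"
  have L: "L \<ge> 0" using M C by (simp add: L_def)
  define \<delta> where "\<delta> = \<epsilon> / (2 * (L + 1))"
  have \<delta>: "\<delta> > 0" using assms L by (simp add: \<delta>_def)
  have CQ: "norm (fst s i t) \<le> C * sqrt (ip r s s)" "norm (snd s i t) \<le> C * sqrt (ip r s s)"
    if "s \<in> Sol" "r \<in> {0..T}" "t \<in> {0..T}" "i \<in> {1..N}" for s r t i
    using component_bounds[OF that(4), of s t] C(2)[OF that(1-3)] by linarith+
  have comb: "\<bar>y \<bullet> (a - b)\<bar> \<le> \<epsilon> * Q"
    if Q: "Q \<ge> 0" and a: "norm a \<le> C * Q" and b: "norm b \<le> C * Q" and lip: "\<bar>a \<bullet> p0 - b \<bullet> p0\<bar> \<le> L * Q * \<bar>t - r\<bar>"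
      and tr: "\<bar>t - r\<bar> < \<delta>" for a b Q t r
  proof -
    have "\<bar>(y - p0) \<bullet> (a - b)\<bar> \<le> norm (y - p0) * norm (a - b)" by (rule Cauchy_Schwarz_ineq2)
    also have "\<dots> \<le> (\<epsilon> / (4 * C)) * (2 * C * Q)"
    proof (rule mult_mono)
      show "norm (y - p0) \<le> \<epsilon> / (4 * C)" using F(3) by (simp add: p0_def)
      show "norm (a - b) \<le> 2 * C * Q" using norm_triangle_ineq4[of a b] a b by linarith
    qed (use assms C in auto)
    also have "\<dots> = \<epsilon> / 2 * Q" using C(1) by (simp add: field_simps)
    finally have 1: "\<bar>(y - p0) \<bullet> (a - b)\<bar> \<le> \<epsilon> / 2 * Q" .
    have "L * \<bar>t - r\<bar> \<le> L * \<delta>" using L tr by (intro mult_left_mono) auto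
    also have "\<dots> \<le> \<epsilon> / 2" using L assms by (simp add: \<delta>_def field_simps)
    finally have "(L * \<bar>t - r\<bar>) * Q \<le> \<epsilon> / 2 * Q" using Q by (rule mult_right_mono)
    then have 2: "\<bar>p0 \<bullet> (a - b)\<bar> \<le> \<epsilon> / 2 * Q" using lip by (simp add: inner_diff_right inner_commute mult_ac)
    have "y \<bullet> (a - b) = (y - p0) \<bullet> (a - b) + p0 \<bullet> (a - b)" by (simp add: inner_diff_left)
    then have "\<bar>y \<bullet> (a - b)\<bar> \<le> \<bar>(y - p0) \<bullet> (a - b)\<bar> + \<bar>p0 \<bullet> (a - b)\<bar>" by simp
    then show ?thesis using 1 2 by linarith
  qed
  have main: "\<bar>y \<bullet> (fst s i t - fst s i r)\<bar> \<le> \<epsilon> * sqrt (ip r s s) \<and> \<bar>y \<bullet> (snd s i t - snd s i r)\<bar> \<le> \<epsilon> * sqrt (ip r s s)"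
    if s: "s \<in> Sol" and r: "r \<in> {0..T}" and t: "t \<in> {0..T}" and i: "i \<in> {1..N}" and tr: "\<bar>t - r\<bar> < \<delta>" for s r t i
  proof -
    define Q where "Q = sqrt (ip r s s)"
    have Q: "Q \<ge> 0" by (simp add: Q_def ip_nonneg)
    have a: "asol T (\<lambda>t. - (\<Sum>k\<in>cp i. K i k (fst s k t))) (fst s i) (snd s i)"
      using s i by (auto simp: Sol_def asys_def)
    have dx: "((\<lambda>t. fst s i t \<bullet> p0) has_real_derivative snd s i q \<bullet> p1) (at q within {0..T})" if q: "q \<in> {0..T}" for q
    proof -
      have "((\<lambda>t. \<Sum>e\<in>F. (y \<bullet> e) * (fst s i t \<bullet> e)) has_real_derivative (\<Sum>e\<in>F. (y \<bullet> e) * (\<mu> e * (snd s i q \<bullet> e)))) (at q within {0..T})"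
        using F q by (intro DERIV_sum DERIV_cmult asol_D(4)[OF a]) auto
      then show ?thesis by (simp add: p0_def p1_def proj_def inner_sum_right mult_ac)
    qed
    have dz: "((\<lambda>t. snd s i t \<bullet> p0) has_real_derivative (- (\<Sum>k\<in>cp i. K i k (fst s k q))) \<bullet> p0 - fst s i q \<bullet> p1) (at q within {0..T})"
      if q: "q \<in> {0..T}" for q
    proof -
      have "((\<lambda>t. \<Sum>e\<in>F. (y \<bullet> e) * (snd s i t \<bullet> e)) has_real_derivative
          (\<Sum>e\<in>F. (y \<bullet> e) * ((- (\<Sum>k\<in>cp i. K i k (fst s k q))) \<bullet> e - \<mu> e * (fst s i q \<bullet> e)))) (at q within {0..T})"
        using F q by (intro DERIV_sum DERIV_cmult asol_D(5)[OF a]) auto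
      moreover have "(\<Sum>e\<in>F. (y \<bullet> e) * ((- (\<Sum>k\<in>cp i. K i k (fst s k q))) \<bullet> e - \<mu> e * (fst s i q \<bullet> e)))
          = (- (\<Sum>k\<in>cp i. K i k (fst s k q))) \<bullet> p0 - fst s i q \<bullet> p1"
        unfolding p0_def p1_def proj_def inner_sum_right inner_scaleR_right sum_subtractf[symmetric]
        by (rule sum.cong) (auto simp: algebra_simps)
      ultimately show ?thesis by (simp add: p0_def proj_def inner_sum_right)
    qed
    have 1: "norm (fst s i t \<bullet> p0 - fst s i r \<bullet> p0) \<le> (L * Q) * norm (t - r)"
    proof (rule field_differentiable_bound[OF convex_closed_interval dx])
      fix q assume q: "q \<in> {0..T}"
      have "norm (snd s i q \<bullet> p1) \<le> norm (snd s i q) * norm p1" by (simp add: Cauchy_Schwarz_ineq2)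
      also have "\<dots> \<le> (C * Q) * norm p1" using CQ(2)[OF s r q i] by (intro mult_right_mono) (auto simp: Q_def)
      also have "\<dots> \<le> L * Q"
      proof -
        have "0 \<le> M * Q * norm p0" "0 \<le> C * Q * norm p0" "0 \<le> M * Q * norm p1" using M(1) C(1) Q by auto
        then show ?thesis by (simp add: L_def algebra_simps)
      qed
      finally show "norm (snd s i q \<bullet> p1) \<le> L * Q" .
    qed (use r t in auto)
    have 2: "norm (snd s i t \<bullet> p0 - snd s i r \<bullet> p0) \<le> (L * Q) * norm (t - r)"
    proof (rule field_differentiable_bound[OF convex_closed_interval dz])
      fix q assume q: "q \<in> {0..T}"
      let ?k = "- (\<Sum>k\<in>cp i. K i k (fst s k q))"
      have "norm (?k \<bullet> p0 - fst s i q \<bullet> p1) \<le> norm ?k * norm p0 + norm (fst s i q) * norm p1"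
        using norm_triangle_ineq4[of "?k \<bullet> p0" "fst s i q \<bullet> p1"] Cauchy_Schwarz_ineq2[of ?k p0] Cauchy_Schwarz_ineq2[of "fst s i q" p1]
        by (simp only: real_norm_def)
      also have "\<dots> \<le> (M * Q) * norm p0 + (C * Q) * norm p1"
        using CQ(1)[OF s r q i] M(2)[OF s r q i] by (intro add_mono mult_right_mono) (auto simp: Q_def)
      also have "\<dots> \<le> L * Q"
      proof -
        have "0 \<le> C * Q * norm p0" "0 \<le> M * Q * norm p1" using M(1) C(1) Q by auto
        then show ?thesis by (simp add: L_def algebra_simps)
      qed
      finally show "norm (?k \<bullet> p0 - fst s i q \<bullet> p1) \<le> L * Q" .
    qed (use r t in auto)
    show ?thesis
      using comb[OF Q CQ(1)[OF s r t i, folded Q_def] CQ(1)[OF s r r i, folded Q_def] 1[unfolded real_norm_def] tr]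
        comb[OF Q CQ(2)[OF s r t i, folded Q_def] CQ(2)[OF s r r i, folded Q_def] 2[unfolded real_norm_def] tr]
      by (simp add: Q_def)
  qed
  show ?thesis using \<delta> main by blast
qed

end

context hum
begin

text \<open>The state at time \<open>t\<close> is encoded as the solution \<open>Y t\<close> that
  has it as value at that time; the values of \<open>Y t\<close> at other times are not part of the
  trajectory. Riesz representation for \<open>ip t\<close> produces it from the transposition
  identity.\<close>

lemma trajectory_exists:
  assumes s0: "s0 \<in> Sol" and v: "\<And>l. l \<le> p \<Longrightarrow> L2 T (G l) (v l)"
  shows "\<exists>Y. \<forall>t\<in>{0..T}. Y t \<in> Sol \<and> (\<forall>s\<in>Sol. ip t (Y t) s = ip 0 s0 s + J t v s)"
proof (rule bchoice, rule ballI)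
  fix t assume t: "t \<in> {0..T}"
  obtain C where C: "C \<ge> 1" "\<And>s r t. s \<in> Sol \<Longrightarrow> r \<in> {0..T} \<Longrightarrow> t \<in> {0..T} \<Longrightarrow> sqrt (ip t s s) \<le> C * sqrt (ip r s s)"
    using ip_estimate by blast
  obtain D where D: "D \<ge> 0" "\<And>s a b r. s \<in> Sol \<Longrightarrow> 0 \<le> a \<Longrightarrow> a \<le> b \<Longrightarrow> b \<le> T \<Longrightarrow> r \<in> {0..T} \<Longrightarrow>
    \<bar>J b v s - J a v s\<bar> \<le> D * sqrt (\<Sum>l = 0..p. integral\<^sup>L (lebesgue_on {a..b}) (\<lambda>t. (norm (v l t))\<^sup>2)) * sqrt (ip r s s)"
    using J_difference_bound[OF v] by blast
  have J0: "J 0 v s = 0" for s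
  proof -
    have "integral\<^sup>L (lebesgue_on {0..0::real}) u = 0" for u :: "real \<Rightarrow> real"
      by (rule integral_eq_zero_null_sets) simp
    then show ?thesis by (simp add: J_def)
  qed
  define B where "B = sqrt (ip 0 s0 s0) * C + D * sqrt (\<Sum>l = 0..p. integral\<^sup>L (lebesgue_on {0..t}) (\<lambda>t. (norm (v l t))\<^sup>2))"
  have "\<exists>z\<in>Sol. \<forall>s\<in>Sol. ip t z s = ip 0 s0 s + J t v s"
  proof (rule riesz_form[where lc = lc and K = "B\<^sup>2"])
    show "lc a s c s' \<in> Sol" if "s \<in> Sol" "s' \<in> Sol" for a s c s' by (rule Sol_lc[OF that])
    show "ip t (lc a x c y) z = a * ip t x z + c * ip t y z" for a x c y z by (rule ip_lc)
    show "ip t s s' = ip t s' s" for s s' by (rule ip_sym)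
    show "0 \<le> ip t s s" for s by (rule ip_nonneg)
    show "ip 0 s0 (lc a x c y) + J t v (lc a x c y) = a * (ip 0 s0 x + J t v x) + c * (ip 0 s0 y + J t v y)"
      if "x \<in> Sol" "y \<in> Sol" for a x c y
    proof -
      have "J t v (lc a x c y) = a * J t v x + c * J t v y" by (rule J_lc[OF that _ t]) (rule v)
      then show ?thesis unfolding ip_sym[of 0 s0] ip_lc by (simp add: algebra_simps)
    qed
    show "(ip 0 s0 s + J t v s)\<^sup>2 \<le> B\<^sup>2 * ip t s s" if s: "s \<in> Sol" for s
    proof -
      have "\<bar>ip 0 s0 s\<bar> \<le> sqrt (ip 0 s0 s0) * sqrt (ip 0 s s)" by (rule ip_cauchy_schwarz)
      also have "\<dots> \<le> sqrt (ip 0 s0 s0) * (C * sqrt (ip t s s))"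
        using C(2)[OF s t, of 0] T by (intro mult_left_mono) (auto simp: ip_nonneg)
      finally have "\<bar>ip 0 s0 s + J t v s\<bar> \<le> B * sqrt (ip t s s)"
        using D(2)[OF s _ _ _ t, of 0 t] t by (simp add: J0 B_def algebra_simps)
      then have "\<bar>ip 0 s0 s + J t v s\<bar>\<^sup>2 \<le> (B * sqrt (ip t s s))\<^sup>2" by (rule power_mono) simp
      then show ?thesis by (simp add: power_mult_distrib ip_nonneg)
    qed
    show "Sol \<noteq> {}" using s0 by auto
    fix X :: "nat \<Rightarrow> _"
    assume "\<And>n. X n \<in> Sol"
      "\<And>e. e > 0 \<Longrightarrow> \<exists>M. \<forall>m\<ge>M. \<forall>n\<ge>M. ip t (lc 1 (X m) (- 1) (X n)) (lc 1 (X m) (- 1) (X n)) < e"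
    then show "\<exists>s\<in>Sol. (\<lambda>n. ip t (lc 1 (X n) (-1) s) (lc 1 (X n) (-1) s)) \<longlonglongrightarrow> 0"
      by (rule Sol_complete[OF t])
  qed
  then show "\<exists>z. z \<in> Sol \<and> (\<forall>s\<in>Sol. ip t z s = ip 0 s0 s + J t v s)" by blast
qed

text \<open>
  No strong continuity of the adjoint group is needed: for a solution \<open>D\<close> of the dual system with
  value \<open>Y(r) - Y(t)\<close> at time \<open>r\<close> the identity gives
  \<open>|D(r)|\<^sup>2 = J r v D - J t v D + \<langle>Y(t), D(t) - D(r)\<rangle>\<close>, and here \<open>Y(t)\<close> is fixed.
\<close>

lemma trajectory_continuous:
  assumes v: "\<And>l. l \<le> p \<Longrightarrow> L2 T (G l) (v l)"
    and Y: "\<And>t s. t \<in> {0..T} \<Longrightarrow> s \<in> Sol \<Longrightarrow> ip t (Y t) s = ip 0 s0 s + J t v s"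
    and i: "i \<in> {1..N}"
  shows "continuous_on {0..T} (\<lambda>t. fst (Y t) i t)" and "continuous_on {0..T} (\<lambda>t. snd (Y t) i t)"
proof -
  obtain C where C: "C \<ge> 0" "\<And>s a b r. s \<in> Sol \<Longrightarrow> 0 \<le> a \<Longrightarrow> a \<le> b \<Longrightarrow> b \<le> T \<Longrightarrow> r \<in> {0..T} \<Longrightarrow>
    \<bar>J b v s - J a v s\<bar> \<le> C * sqrt (\<Sum>l = 0..p. integral\<^sup>L (lebesgue_on {a..b}) (\<lambda>t. (norm (v l t))\<^sup>2)) * sqrt (ip r s s)"
    using J_difference_bound[OF v] by blast
  define u where "u t = (\<Sum>l = 0..p. (norm (v l t))\<^sup>2)" for t
  have iv: "integrable (lebesgue_on {0..T}) (\<lambda>t. (norm (v l t))\<^sup>2)" if "l \<le> p" for l using v[OF that] by (simp add: L2_iff)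
  have iu: "integrable (lebesgue_on {0..T}) u" unfolding u_def by (rule Bochner_Integration.integrable_sum) (use iv in auto)
  have key: "\<exists>\<delta>>0. \<forall>r\<in>{0..T}. \<bar>t - r\<bar> < \<delta> \<longrightarrow>
      (\<forall>j\<in>{1..N}. norm (fst (Y r) j r - fst (Y t) j t) < \<epsilon> \<and> norm (snd (Y r) j r - snd (Y t) j t) < \<epsilon>)"
    if t: "t \<in> {0..T}" and e: "\<epsilon> > 0" for t \<epsilon>
  proof -
    \<comment> \<open>The \<open>2 * N\<close> terms of the remainder \<open>R\<close> then add up
      to at most \<open>\<epsilon> / 2 * Q\<close>, which leaves \<open>\<epsilon> / 4 * Q\<close>
      for the difference of the \<open>J\<close> terms.\<close>
    define \<eta> where "\<eta> = \<epsilon> / (4 * (real N + 1))"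
    have \<eta>: "\<eta> > 0" using e by (simp add: \<eta>_def)
    have "\<exists>\<delta>>0. \<forall>s\<in>Sol. \<forall>r\<in>{0..T}. \<forall>q\<in>{0..T}. \<forall>i\<in>{1..N}. \<bar>q - r\<bar> < \<delta> \<longrightarrow>
       \<bar>fst (Y t) j t \<bullet> (fst s i q - fst s i r)\<bar> \<le> \<eta> * sqrt (ip r s s)" for j
      using weak_continuity[OF \<eta>, of "fst (Y t) j t"] by meson
    then obtain d1 where d1: "\<And>j. d1 j > 0" "\<And>j s r q i. s \<in> Sol \<Longrightarrow> r \<in> {0..T} \<Longrightarrow> q \<in> {0..T} \<Longrightarrow> i \<in> {1..N} \<Longrightarrow> \<bar>q - r\<bar> < d1 j \<Longrightarrow>
       \<bar>fst (Y t) j t \<bullet> (fst s i q - fst s i r)\<bar> \<le> \<eta> * sqrt (ip r s s)" by metis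
    have "\<exists>\<delta>>0. \<forall>s\<in>Sol. \<forall>r\<in>{0..T}. \<forall>q\<in>{0..T}. \<forall>i\<in>{1..N}. \<bar>q - r\<bar> < \<delta> \<longrightarrow>
       \<bar>snd (Y t) j t \<bullet> (snd s i q - snd s i r)\<bar> \<le> \<eta> * sqrt (ip r s s)" for j
      using weak_continuity[OF \<eta>, of "snd (Y t) j t"] by meson
    then obtain d2 where d2: "\<And>j. d2 j > 0" "\<And>j s r q i. s \<in> Sol \<Longrightarrow> r \<in> {0..T} \<Longrightarrow> q \<in> {0..T} \<Longrightarrow> i \<in> {1..N} \<Longrightarrow> \<bar>q - r\<bar> < d2 j \<Longrightarrow>
       \<bar>snd (Y t) j t \<bullet> (snd s i q - snd s i r)\<bar> \<le> \<eta> * sqrt (ip r s s)" by metis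
    \<comment> \<open>Squared because the control enters the bound for \<open>J\<close> through the
      root of its square integral; \<open>C + 1\<close> avoids division by zero.\<close>
    define \<theta> where "\<theta> = (\<epsilon> / (4 * (C + 1)))\<^sup>2"
    have \<theta>: "\<theta> > 0" using e C by (simp add: \<theta>_def)
    obtain d3 where d3: "d3 > 0" "\<And>a b. 0 \<le> a \<Longrightarrow> a \<le> b \<Longrightarrow> b \<le> T \<Longrightarrow> b - a < d3 \<Longrightarrow> integral\<^sup>L (lebesgue_on {a..b}) u < \<theta>"
      using integral_small_on_short_intervals[OF iu \<theta>] by blast
    define \<delta> where "\<delta> = Min (insert d3 (d1 ` {1..N} \<union> d2 ` {1..N}))"
    have \<delta>0: "\<delta> > 0" unfolding \<delta>_def using d1(1) d2(1) d3(1) by auto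
    have \<delta>: "\<delta> \<le> d3" "\<And>j. j \<in> {1..N} \<Longrightarrow> \<delta> \<le> d1 j" "\<And>j. j \<in> {1..N} \<Longrightarrow> \<delta> \<le> d2 j"
      unfolding \<delta>_def by (rule Min_le; simp)+
    have "norm (fst (Y r) j r - fst (Y t) j t) < \<epsilon> \<and> norm (snd (Y r) j r - snd (Y t) j t) < \<epsilon>"
      if r: "r \<in> {0..T}" and tr: "\<bar>t - r\<bar> < \<delta>" and j: "j \<in> {1..N}" for r j
    proof -
      obtain D where D: "D \<in> Sol" "\<And>i. i \<in> {1..N} \<Longrightarrow> fst D i r = fst (Y r) i r - fst (Y t) i t \<and> snd D i r = snd (Y r) i r - snd (Y t) i t"
        using Sol_data[OF r, of "\<lambda>i. fst (Y r) i r - fst (Y t) i t" "\<lambda>i. snd (Y r) i r - snd (Y t) i t"] by blast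
      define Q where "Q = sqrt (ip r D D)"
      have Q0: "Q \<ge> 0" by (simp add: Q_def ip_nonneg)
      define R where "R = (\<Sum>i = 1..N. fst (Y t) i t \<bullet> (fst D i t - fst D i r) + snd (Y t) i t \<bullet> (snd D i t - snd D i r))"
      have "ip r D D = (\<Sum>i = 1..N. (fst (Y r) i r - fst (Y t) i t) \<bullet> fst D i r + (snd (Y r) i r - snd (Y t) i t) \<bullet> snd D i r)"
        unfolding ip_def by (rule sum.cong) (use D(2) in auto)
      also have "\<dots> = ip r (Y r) D - ip t (Y t) D + R"
        unfolding ip_def R_def sum_subtractf[symmetric] sum.distrib[symmetric]
        by (rule sum.cong) (auto simp: inner_diff_left inner_diff_right)
      also have "\<dots> = (J r v D - J t v D) + R" using Y[OF r D(1)] Y[OF t D(1)] by simp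
      finally have DD: "ip r D D = (J r v D - J t v D) + R" .
      have small: "C * sqrt (\<Sum>l = 0..p. integral\<^sup>L (lebesgue_on {a..b}) (\<lambda>t. (norm (v l t))\<^sup>2)) \<le> \<epsilon> / 4"
        if ab: "0 \<le> a" "a \<le> b" "b \<le> T" "b - a < d3" for a b
      proof -
        have sub: "{a..b} \<subseteq> {0..T}" using ab by auto
        have "(\<Sum>l = 0..p. integral\<^sup>L (lebesgue_on {a..b}) (\<lambda>t. (norm (v l t))\<^sup>2)) = integral\<^sup>L (lebesgue_on {a..b}) u"
          unfolding u_def by (rule Bochner_Integration.integral_sum[symmetric]) (use integrable_subinterval[OF iv sub] in auto)
        also have "\<dots> \<le> \<theta>" using d3(2)[OF ab] by simp
        finally have "sqrt (\<Sum>l = 0..p. integral\<^sup>L (lebesgue_on {a..b}) (\<lambda>t. (norm (v l t))\<^sup>2)) \<le> \<epsilon> / (4 * (C + 1))"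
          using C e by (intro real_le_lsqrt) (auto simp: \<theta>_def)
        then have "C * sqrt (\<Sum>l = 0..p. integral\<^sup>L (lebesgue_on {a..b}) (\<lambda>t. (norm (v l t))\<^sup>2)) \<le> C * (\<epsilon> / (4 * (C + 1)))"
          by (rule mult_left_mono[OF _ C(1)])
        also have "\<dots> \<le> \<epsilon> / 4" using C e by (simp add: field_simps)
        finally show ?thesis .
      qed
      have "\<bar>J r v D - J t v D\<bar> \<le> \<epsilon> / 4 * Q"
      proof (cases "t \<le> r")
        case True
        have "\<bar>J r v D - J t v D\<bar> \<le> C * sqrt (\<Sum>l = 0..p. integral\<^sup>L (lebesgue_on {t..r}) (\<lambda>t. (norm (v l t))\<^sup>2)) * Q"
          unfolding Q_def by (rule C(2)[OF D(1)]) (use t r True in auto)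
        also have "\<dots> \<le> \<epsilon> / 4 * Q" using small[of t r] True t r tr \<delta>(1) Q0 by (intro mult_right_mono) auto
        finally show ?thesis .
      next
        case False
        have "\<bar>J t v D - J r v D\<bar> \<le> C * sqrt (\<Sum>l = 0..p. integral\<^sup>L (lebesgue_on {r..t}) (\<lambda>t. (norm (v l t))\<^sup>2)) * Q"
          unfolding Q_def by (rule C(2)[OF D(1)]) (use t r False in auto)
        also have "\<dots> \<le> \<epsilon> / 4 * Q" using small[of r t] False t r tr \<delta>(1) Q0 by (intro mult_right_mono) auto
        finally show ?thesis by (subst abs_minus_commute)
      qed
      moreover have "\<bar>R\<bar> \<le> \<epsilon> / 2 * Q"
      proof -
        have "\<bar>R\<bar> \<le> (\<Sum>i = 1..N. 2 * \<eta> * Q)"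
          unfolding R_def
        proof (rule order_trans[OF sum_abs sum_mono])
          fix i assume i: "i \<in> {1..N}"
          have "\<bar>fst (Y t) i t \<bullet> (fst D i t - fst D i r)\<bar> \<le> \<eta> * Q" "\<bar>snd (Y t) i t \<bullet> (snd D i t - snd D i r)\<bar> \<le> \<eta> * Q"
            unfolding Q_def using \<delta>(2)[OF i] \<delta>(3)[OF i] tr by (auto intro!: d1(2) d2(2) D(1) r t i simp del: atLeastAtMost_iff)
          then show "\<bar>fst (Y t) i t \<bullet> (fst D i t - fst D i r) + snd (Y t) i t \<bullet> (snd D i t - snd D i r)\<bar> \<le> 2 * \<eta> * Q" by linarith
        qed
        also have "\<dots> = (2 * real N * \<eta>) * Q" by simp
        also have "\<dots> \<le> \<epsilon> / 2 * Q"
        proof (rule mult_right_mono[OF _ Q0])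
          have "2 * real N * \<eta> = \<epsilon> / 2 * (real N / (real N + 1))" by (simp add: \<eta>_def field_simps)
          also have "\<dots> \<le> \<epsilon> / 2 * 1" using e by (intro mult_left_mono) auto
          finally show "2 * real N * \<eta> \<le> \<epsilon> / 2" by simp
        qed
        finally show ?thesis .
      qed
      moreover have "Q\<^sup>2 = ip r D D" by (simp add: Q_def ip_nonneg)
      \<comment> \<open>One factor \<open>Q\<close> cancels because every bound is relative to the
        size of \<open>D\<close>; this gives a bound for \<open>D\<close> at time \<open>r\<close>
        although \<open>D\<close> itself varies with \<open>r\<close>.\<close>
      ultimately have "Q\<^sup>2 \<le> (\<epsilon> / 4 + \<epsilon> / 2) * Q" using DD unfolding distrib_right by linarith
      then have "Q \<le> \<epsilon> / 4 + \<epsilon> / 2" using Q0 e by (cases "Q = 0") (auto simp: power2_eq_square)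
      then have "Q < \<epsilon>" using e by simp
      then show ?thesis using component_bounds[OF j, of D r] D(2)[OF j] by (simp add: Q_def)
    qed
    then show ?thesis using \<delta>0 by blast
  qed
  show "continuous_on {0..T} (\<lambda>t. fst (Y t) i t)"
    unfolding continuous_on_iff dist_norm real_norm_def using key i by (metis abs_minus_commute)
  show "continuous_on {0..T} (\<lambda>t. snd (Y t) i t)"
    unfolding continuous_on_iff dist_norm real_norm_def using key i by (metis abs_minus_commute)
qed

text \<open>The pairs \<alpha>, \<beta> and \<eta>, \<zeta> stand for the coordinates of
  \<open>(y', - y)\<close> at times 0 and \<open>t\<close>: in the transposition identity
  \<open>y'\<close> is paired with \<open>w\<close>, and \<open>y\<close> with \<open>w'\<close>
  under a minus sign.\<close>

theorem hum_steering:
  "\<exists>v. (\<forall>l\<le>p. L2 T (G l) (v l)) \<and>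
    (\<exists>\<eta> \<zeta>. (\<forall>i\<in>{1..N}. continuous_on {0..T} (\<eta> i) \<and> continuous_on {0..T} (\<zeta> i)) \<and>
       (\<forall>t\<in>{0..T}. \<forall>x z g. sol x z \<longrightarrow> (\<forall>l\<le>p. obs x z l (g l)) \<longrightarrow>
          integral\<^sup>L (lebesgue_on {0..t}) (\<lambda>r. \<Sum>l = 0..p. v l r \<bullet> g l r) =
          (\<Sum>i = 1..N. \<eta> i t \<bullet> x i t + \<zeta> i t \<bullet> z i t) - (\<Sum>i = 1..N. \<alpha> i \<bullet> x i 0 + \<beta> i \<bullet> z i 0))) \<and>
    (\<forall>x z g. sol x z \<longrightarrow> (\<forall>l\<le>p. obs x z l (g l)) \<longrightarrow>
       integral\<^sup>L (lebesgue_on {0..T}) (\<lambda>r. \<Sum>l = 0..p. v l r \<bullet> g l r) = - (\<Sum>i = 1..N. \<alpha> i \<bullet> x i 0 + \<beta> i \<bullet> z i 0))"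
proof -
  obtain s0 where s0: "s0 \<in> Sol" "\<And>i. i \<in> {1..N} \<Longrightarrow> fst s0 i 0 = \<alpha> i \<and> snd s0 i 0 = \<beta> i"
    using Sol_data[of 0 \<alpha> \<beta>] T by auto
  have ip0: "ip 0 s0 s = (\<Sum>i = 1..N. \<alpha> i \<bullet> fst s i 0 + \<beta> i \<bullet> snd s i 0)" for s
    unfolding ip_def by (rule sum.cong) (use s0(2) in auto)
  obtain v where v: "\<And>l. l \<le> p \<Longrightarrow> L2 T (G l) (v l)" "\<And>s. s \<in> Sol \<Longrightarrow> J T v s = - ip 0 s0 s"
    using control_exists[OF s0(1)] by blast
  obtain Y where Y: "\<And>t s. t \<in> {0..T} \<Longrightarrow> s \<in> Sol \<Longrightarrow> ip t (Y t) s = ip 0 s0 s + J t v s"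
    using trajectory_exists[OF s0(1), of v] v(1) by blast
  have eq: "integral\<^sup>L (lebesgue_on {0..t}) (\<lambda>r. \<Sum>l = 0..p. v l r \<bullet> g l r) = J t v (x, z)"
    if "t \<in> {0..T}" "sol x z" "\<forall>l\<le>p. obs x z l (g l)" for t x z g
    by (rule J_eq) (use that v(1) in \<open>auto simp: Sol_def\<close>)
  have Y_id: "\<exists>\<eta> \<zeta>. (\<forall>i\<in>{1..N}. continuous_on {0..T} (\<eta> i) \<and> continuous_on {0..T} (\<zeta> i)) \<and>
       (\<forall>t\<in>{0..T}. \<forall>x z g. sol x z \<longrightarrow> (\<forall>l\<le>p. obs x z l (g l)) \<longrightarrow>
          integral\<^sup>L (lebesgue_on {0..t}) (\<lambda>r. \<Sum>l = 0..p. v l r \<bullet> g l r) =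
          (\<Sum>i = 1..N. \<eta> i t \<bullet> x i t + \<zeta> i t \<bullet> z i t) - (\<Sum>i = 1..N. \<alpha> i \<bullet> x i 0 + \<beta> i \<bullet> z i 0))"
  proof (rule exI[of _ "\<lambda>i t. fst (Y t) i t"], rule exI[of _ "\<lambda>i t. snd (Y t) i t"], intro conjI ballI allI impI)
    fix t x z g assume *: "t \<in> {0..T}" "sol x z" "\<forall>l\<le>p. obs x z l (g l)"
    have "(x, z) \<in> Sol" using *(2) by (simp add: Sol_def)
    from Y[OF *(1) this]
    show "integral\<^sup>L (lebesgue_on {0..t}) (\<lambda>r. \<Sum>l = 0..p. v l r \<bullet> g l r) =
          (\<Sum>i = 1..N. fst (Y t) i t \<bullet> x i t + snd (Y t) i t \<bullet> z i t) - (\<Sum>i = 1..N. \<alpha> i \<bullet> x i 0 + \<beta> i \<bullet> z i 0)"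
      using eq[OF *] ip0[of "(x, z)"] by (simp add: ip_def)
  qed (use trajectory_continuous[OF v(1) Y] in auto)
  have "integral\<^sup>L (lebesgue_on {0..T}) (\<lambda>r. \<Sum>l = 0..p. v l r \<bullet> g l r) = - (\<Sum>i = 1..N. \<alpha> i \<bullet> x i 0 + \<beta> i \<bullet> z i 0)"
    if *: "sol x z" "\<forall>l\<le>p. obs x z l (g l)" for x z g
  proof -
    have "(x, z) \<in> Sol" using *(1) by (simp add: Sol_def)
    then show ?thesis
      using eq[OF _ *, of T] v(2)[of "(x, z)"] ip0[of "(x, z)"] T by simp
  qed
  then show ?thesis using v(1) Y_id by blast
qed

end

section \<open>Change of level\<close>

context eigenbasis
begin

lemma linear_pw: "s \<le> 0 \<Longrightarrow> linear (pw s)"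
  by (intro bounded_linear.linear bounded_linear_pw)

lemma pw_0: "pw 0 y = y"
  by (rule pw_eq[OF sc_0])

lemma pw_pw: "r \<le> 0 \<Longrightarrow> s \<le> 0 \<Longrightarrow> pw r (pw s y) = pw (r + s) y"
  using sc_trans[OF sc_pw[of s y] sc_pw[of r "pw s y"]] by (intro pw_eq[symmetric]) (simp add: add.commute)

text \<open>A negative power of \<open>A\<close> need not be onto, but on finitely many modes its
  inverse is a finite sum.\<close>

lemma pw_surj_finite:
  assumes F: "finite F" "F \<subseteq> E" and y: "proj F y = y" and r: "r \<le> 0"
  shows "\<exists>a. pw r a = y"
proof
  show "pw r (\<Sum>e\<in>F. (\<mu> e powi (- r) * (y \<bullet> e)) *\<^sub>R e) = y"
  proof (rule eqI)
    fix e assume e: "e \<in> E"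
    have "y \<bullet> e = 0" if "e \<notin> F" using proj_inner[OF F e, of y] that y by simp
    then show "pw r (\<Sum>e\<in>F. (\<mu> e powi (- r) * (y \<bullet> e)) *\<^sub>R e) \<bullet> e = y \<bullet> e"
      using mu_nz[OF e] by (simp add: pw_inner r e sum_inner_basis F power_int_minus power_int_eq_0_iff)
  qed
qed

lemma asol_pw:
  assumes a: "asol T k x z" and r: "r \<le> 0"
  shows "asol T (\<lambda>t. pw r (k t)) (\<lambda>t. pw r (x t)) (\<lambda>t. pw r (z t))"
  unfolding asol_def
proof (intro conjI ballI)
  show "continuous_on {0..T} (\<lambda>t. pw r (k t))" "continuous_on {0..T} (\<lambda>t. pw r (x t))" "continuous_on {0..T} (\<lambda>t. pw r (z t))"
    using asol_D(1-3)[OF a] by (auto intro: pw_continuous_on r)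
  fix e t assume et: "e \<in> E" "t \<in> {0..T}"
  show "((\<lambda>t. pw r (x t) \<bullet> e) has_real_derivative \<mu> e * (pw r (z t) \<bullet> e)) (at t within {0..T})"
    using DERIV_cmult[OF asol_D(4)[OF a et], of "\<mu> e powi r"] by (simp add: pw_inner r et mult_ac)
  show "((\<lambda>t. pw r (z t) \<bullet> e) has_real_derivative pw r (k t) \<bullet> e - \<mu> e * (pw r (x t) \<bullet> e)) (at t within {0..T})"
    using DERIV_cmult[OF asol_D(5)[OF a et], of "\<mu> e powi r"] by (simp add: pw_inner r et algebra_simps)
qed

lemma couples_eval:
  assumes "couples r s L Q" "sc (1 - s) \<phi> \<psi>"
  shows "fn r y (L \<phi>) = Q y \<bullet> \<psi>" and "\<exists>\<xi>. sc (- r) (L \<phi>) \<xi>"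
  using assms by (auto simp: couples_def)

text \<open>At target level 1 the test vector carries no power of \<open>A\<close>, so the transpose
  of the adjoint is the operator itself.\<close>

lemma couples_one:
  assumes "couples r 1 (adjoint (blinfun_apply L)) Q" "r \<ge> 0"
  shows "Q y = blinfun_apply L (vec_of (fn r y))"
proof -
  have "Q y \<bullet> \<psi> = blinfun_apply L (vec_of (fn r y)) \<bullet> \<psi>" for \<psi>
  proof -
    have "Q y \<bullet> \<psi> = fn r y (adjoint (blinfun_apply L) \<psi>)"
      using couples_eval(1)[OF assms(1), of \<psi> \<psi> y] sc_0 by simp
    also have "\<dots> = pw (- r) y \<bullet> adjoint (blinfun_apply L) \<psi>" by (simp add: fn_pivot assms(2) pivot_def)
    also have "\<dots> = blinfun_apply L (pw (- r) y) \<bullet> \<psi>" by (rule adjoint_inner[OF blinfun.bounded_linear_right])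
    finally show ?thesis by (simp add: vec_of_fn assms(2))
  qed
  then show ?thesis using vector_eq_rdot by blast
qed

text \<open>Both operators represent the same transposed coupling at two pairs of levels. The
  negative power is moved to the test vector, where the two evaluations agree through the embedding
  of level 1 in level \<open>r\<close>.\<close>

lemma couples_intertwine:
  assumes c1: "couples 1 1 L K1" and c2: "couples r s L K2" and le: "s \<le> 1" "r \<le> 1"
  shows "pw (s - 1) (K1 y) = K2 (pw (r - 1) y)"
proof -
  have "pw (s - 1) (K1 y) \<bullet> \<psi> = K2 (pw (r - 1) y) \<bullet> \<psi>" for \<psi>
  proof -
    define \<phi> where "\<phi> = pw (s - 1) \<psi>"
    have p: "sc (s - 1) \<psi> \<phi>" unfolding \<phi>_def using le by (intro sc_pw) simp
    have p': "sc (1 - s) \<phi> \<psi>" using sc_sym[OF p] by simp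
    obtain \<xi> where x: "sc (- r) (L \<phi>) \<xi>" using couples_eval(2)[OF c2 p'] by blast
    have "pw (s - 1) (K1 y) \<bullet> \<psi> = K1 y \<bullet> \<phi>" using sc_adj[OF sc_pw p, of "K1 y"] le by simp
    also have "\<dots> = fn 1 y (L \<phi>)" using couples_eval(1)[OF c1, of \<phi> \<phi> y] sc_0 by simp
    also have "\<dots> = pw (r - 1) y \<bullet> \<xi>" using le by (intro fn_embed[OF sc_pw _ x]) auto
    also have "\<dots> = K2 (pw (r - 1) y) \<bullet> \<psi>" using couples_eval(1)[OF c2 p'] fn_eval[OF x] by simp
    finally show ?thesis .
  qed
  then show ?thesis using vector_eq_rdot by blast
qed

lemma coupling_rep_exists:
  assumes "\<And>i k. i \<in> {1..n + p} \<Longrightarrow> k \<in> coupled n i \<Longrightarrow>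
     \<sigma> i \<le> 1 \<and> \<sigma> i \<le> \<sigma> k + 1 \<and> bounded_on_Hk A (nat (1 - \<sigma> i)) (adjoint (blinfun_apply (C i k)))"
  shows "\<exists>K. coupling_rep C n p \<sigma> K"
proof -
  have "\<exists>Q. i \<in> {1..n + p} \<and> k \<in> coupled n i \<longrightarrow> couples (\<sigma> k) (\<sigma> i) (adjoint (blinfun_apply (C i k))) Q" for i k
    using couples_exists[of "nat (1 - \<sigma> i)" "adjoint (blinfun_apply (C i k))" "\<sigma> i" "\<sigma> k"] assms[of i k] by auto
  then have "\<exists>K. \<forall>i k. i \<in> {1..n + p} \<and> k \<in> coupled n i \<longrightarrow> couples (\<sigma> k) (\<sigma> i) (adjoint (blinfun_apply (C i k))) (K i k)"
    by metis
  then show ?thesis unfolding coupling_rep_def by blast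
qed

lemma coupling_repD:
  assumes "coupling_rep C n p \<sigma> K" "i \<in> {1..n + p}" "k \<in> coupled n i"
  shows "couples (\<sigma> k) (\<sigma> i) (adjoint (blinfun_apply (C i k))) (K i k)" and "bounded_linear (K i k)"
  using assms by (auto simp: coupling_rep_def couples_def)

lemma asys_change_level:
  assumes r1: "coupling_rep C n p (\<lambda>_. 1) K1" and r2: "coupling_rep C n p \<sigma> K" and le: "\<And>i. \<sigma> i \<le> 1"
    and i: "i \<in> {1..n + p}"
  shows "pw (\<sigma> i - 1) (- (\<Sum>k\<in>coupled n i. K1 i k (x k))) = - (\<Sum>k\<in>coupled n i. K i k (pw (\<sigma> k - 1) (x k)))"
proof -
  have pl: "linear (pw (\<sigma> i - 1))" using le[of i] by (intro linear_pw) simp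
  have "pw (\<sigma> i - 1) (- (\<Sum>k\<in>coupled n i. K1 i k (x k))) = - (\<Sum>k\<in>coupled n i. pw (\<sigma> i - 1) (K1 i k (x k)))"
    by (simp add: linear_neg[OF pl] linear_sum[OF pl])
  also have "(\<Sum>k\<in>coupled n i. pw (\<sigma> i - 1) (K1 i k (x k))) = (\<Sum>k\<in>coupled n i. K i k (pw (\<sigma> k - 1) (x k)))"
    by (rule sum.cong[OF refl], rule couples_intertwine[OF coupling_repD(1)[OF r1 i] coupling_repD(1)[OF r2 i]]) (use le in auto)
  finally show ?thesis .
qed

text \<open>
  The velocity \<open>w'\<close> of a solution \<open>w\<close> of the dual system is again a solution, one level lower, with
  \<open>w'' = - A w - \<Sum> C w\<close> as its velocity.
\<close>

lemma asys_velocity: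
  assumes n: "n \<ge> 2" and r1: "coupling_rep C n p (\<lambda>_. 1) K1" and r2: "coupling_rep C n p \<sigma> K" and le: "\<And>i. \<sigma> i \<le> 0"
    and a: "asys T (n + p) (coupled n) K1 x z"
  shows "asys T (n + p) (coupled n) K (\<lambda>i t. pw (\<sigma> i) (z i t))
     (\<lambda>i t. pw (\<sigma> i - 1) (- (\<Sum>k\<in>coupled n i. K1 i k (x k t))) - pw (\<sigma> i) (x i t))"
  unfolding asys_def
proof
  fix i assume i: "i \<in> {1..n + p}"
  let ?k1 = "\<lambda>t. - (\<Sum>k\<in>coupled n i. K1 i k (x k t))"
  let ?X = "\<lambda>i t. pw (\<sigma> i) (z i t)"
  have cp: "k \<in> {1..n + p}" if "k \<in> coupled n i" for k using coupled_subset[OF n, of i] that i by force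
  have ai: "asol T ?k1 (x i) (z i)" using a i by (auto simp: asys_def)
  have ak: "asol T (\<lambda>t. - (\<Sum>j\<in>coupled n k. K1 k j (x j t))) (x k) (z k)" if "k \<in> coupled n i" for k
    using a cp[OF that] by (auto simp: asys_def)
  have \<sigma>: "\<sigma> i \<le> 0" "\<sigma> i - 1 \<le> 0" using le[of i] by auto
  \<comment> \<open>At level 1 one has \<open>z = w'\<close> and \<open>x = A^{1/2} w\<close>. The
    coordinate of \<open>w'\<close> at level \<open>\<sigma> i\<close> is therefore
    \<open>A^{\<sigma> i/2} z\<close>, and that of \<open>A w\<close> one level lower is
    \<open>A^{\<sigma> i/2} x\<close>.\<close>
  show "asol T (\<lambda>t. - (\<Sum>k\<in>coupled n i. K i k (?X k t))) (?X i) (\<lambda>t. pw (\<sigma> i - 1) (?k1 t) - pw (\<sigma> i) (x i t))"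
    unfolding asol_def
  proof (intro conjI ballI)
    show "continuous_on {0..T} (\<lambda>t. - (\<Sum>k\<in>coupled n i. K i k (?X k t)))"
    proof (intro continuous_on_minus continuous_on_sum)
      fix k assume k: "k \<in> coupled n i"
      show "continuous_on {0..T} (\<lambda>t. K i k (?X k t))"
        by (intro bounded_linear.continuous_on[OF coupling_repD(2)[OF r2 i k]] pw_continuous_on le asol_D(3)[OF ak[OF k]])
    qed
    show "continuous_on {0..T} (?X i)" by (intro pw_continuous_on \<sigma> asol_D(3)[OF ai])
    show "continuous_on {0..T} (\<lambda>t. pw (\<sigma> i - 1) (?k1 t) - pw (\<sigma> i) (x i t))"
      by (intro continuous_on_diff pw_continuous_on \<sigma> asol_D[OF ai])
    fix e t assume e: "e \<in> E" and t: "t \<in> {0..T}"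
    have m1: "\<mu> e * \<mu> e powi (\<sigma> i - 1) = \<mu> e powi \<sigma> i" using mu_nz[OF e] by (simp add: power_int_diff)
    show "((\<lambda>t. ?X i t \<bullet> e) has_real_derivative \<mu> e * ((pw (\<sigma> i - 1) (?k1 t) - pw (\<sigma> i) (x i t)) \<bullet> e)) (at t within {0..T})"
    proof -
      have "((\<lambda>t. \<mu> e powi \<sigma> i * (z i t \<bullet> e)) has_real_derivative \<mu> e powi \<sigma> i * (?k1 t \<bullet> e - \<mu> e * (x i t \<bullet> e))) (at t within {0..T})"
        by (rule DERIV_cmult[OF asol_D(5)[OF ai e t]])
      moreover have "\<mu> e powi \<sigma> i * (?k1 t \<bullet> e - \<mu> e * (x i t \<bullet> e)) = \<mu> e * ((pw (\<sigma> i - 1) (?k1 t) - pw (\<sigma> i) (x i t)) \<bullet> e)"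
        unfolding inner_diff_left pw_inner[OF \<sigma>(1) e] pw_inner[OF \<sigma>(2) e] right_diff_distrib mult.assoc[symmetric] m1 by simp
      ultimately show ?thesis by (simp only: pw_inner[OF \<sigma>(1) e])
    qed
    \<comment> \<open>The forcing is differentiated through the test vector \<open>?L e\<close>: the
      position of row \<open>k\<close> has derivative \<open>z k\<close> in \<open>H\<close>, which
      is then reread at level \<open>\<sigma> k\<close> to recover the coupling
      \<open>K\<close>.\<close>
    have Kk: "((\<lambda>t. \<mu> e powi (\<sigma> i - 1) * (K1 i k (x k t) \<bullet> e)) has_real_derivative K i k (?X k t) \<bullet> e) (at t within {0..T})"
      if k: "k \<in> coupled n i" for k
    proof -
      let ?L = "adjoint (blinfun_apply (C i k))"
      have K1e: "K1 i k y \<bullet> e = pw (-1) y \<bullet> ?L e" for y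
        using couples_eval(1)[OF coupling_repD(1)[OF r1 i k], of e e y] sc_0 by (simp add: fn_pivot pivot_def)
      obtain \<xi> where xi: "sc (- \<sigma> k) (?L e) \<xi>" using couples_eval(2)[OF coupling_repD(1)[OF r2 i k] sc_basis[OF e]] by blast
      have "z k t \<bullet> ?L e = fn 0 (z k t) (?L e)" by (simp add: fn_0_pivot pivot_def)
      also have "\<dots> = ?X k t \<bullet> \<xi>" using le by (intro fn_embed[OF _ _ xi]) (auto intro: sc_pw)
      also have "\<dots> = fn (\<sigma> k) (?X k t) (?L e)" by (rule fn_eval[OF xi, symmetric])
      also have "\<dots> = \<mu> e powi (1 - \<sigma> i) * (K i k (?X k t) \<bullet> e)"
        using couples_eval(1)[OF coupling_repD(1)[OF r2 i k] sc_basis[OF e]] by simp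
      finally have "\<mu> e powi (\<sigma> i - 1) * (z k t \<bullet> ?L e) = K i k (?X k t) \<bullet> e"
        using mu_nz[OF e] by (simp add: power_int_diff)
      moreover have "((\<lambda>t. pw (-1) (x k t) \<bullet> ?L e) has_real_derivative z k t \<bullet> ?L e) (at t within {0..T})"
        by (rule inner_has_derivative[OF asol_diff_quotients(1)[OF ak[OF k] t]])
      from DERIV_cmult[OF this, of "\<mu> e powi (\<sigma> i - 1)"]
      have "((\<lambda>t. \<mu> e powi (\<sigma> i - 1) * (K1 i k (x k t) \<bullet> e)) has_real_derivative \<mu> e powi (\<sigma> i - 1) * (z k t \<bullet> ?L e)) (at t within {0..T})"
        unfolding K1e .
      ultimately show ?thesis by simp
    qed
    have "((\<lambda>t. - (\<Sum>k\<in>coupled n i. \<mu> e powi (\<sigma> i - 1) * (K1 i k (x k t) \<bullet> e)) - \<mu> e powi \<sigma> i * (x i t \<bullet> e)) has_real_derivative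
        - (\<Sum>k\<in>coupled n i. K i k (?X k t) \<bullet> e) - \<mu> e powi \<sigma> i * (\<mu> e * (z i t \<bullet> e))) (at t within {0..T})"
      by (intro DERIV_diff DERIV_minus DERIV_sum Kk DERIV_cmult asol_D(4)[OF ai e t])
    then show "((\<lambda>t. (pw (\<sigma> i - 1) (?k1 t) - pw (\<sigma> i) (x i t)) \<bullet> e) has_real_derivative
        (- (\<Sum>k\<in>coupled n i. K i k (?X k t))) \<bullet> e - \<mu> e * (?X i t \<bullet> e)) (at t within {0..T})"
      by (simp add: inner_diff_left pw_inner[OF \<sigma>(1) e] pw_inner[OF \<sigma>(2) e] inner_sum_left sum_distrib_left mult_ac)
  qed
qed

text \<open>Used to find initial positions whose second time derivative is prescribed: the coupling
  term of row \<open>i\<close> involves positions of earlier rows only.\<close>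

lemma triangular_system_solvable:
  assumes "\<And>i. i \<in> {1..N} \<Longrightarrow> cp i \<subseteq> {1..<i}"
  shows "\<exists>a :: nat \<Rightarrow> 'h. \<forall>i\<in>{1..N}. a i = f i (\<Sum>k\<in>cp i. Q i k (a k) :: 'h)"
  using assms
proof (induction N)
  case (Suc N)
  have "\<And>i. i \<in> {1..N} \<Longrightarrow> cp i \<subseteq> {1..<i}" using Suc.prems by simp
  from Suc.IH[OF this] obtain a where a: "\<forall>i\<in>{1..N}. a i = f i (\<Sum>k\<in>cp i. Q i k (a k))" by blast
  let ?a = "a(Suc N := f (Suc N) (\<Sum>k\<in>cp (Suc N). Q (Suc N) k (a k)))"
  have "(\<Sum>k\<in>cp i. Q i k (?a k)) = (\<Sum>k\<in>cp i. Q i k (a k))" if "i \<in> {1..Suc N}" for i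
  proof (rule sum.cong[OF refl])
    fix k assume "k \<in> cp i"
    then have "k \<noteq> Suc N" using Suc.prems[OF that] that by force
    then show "Q i k (?a k) = Q i k (a k)" by simp
  qed
  then show ?case using a by (intro exI[of _ ?a]) (auto simp: le_Suc_eq)
qed simp

end

lemma (in cascade_system) Sol_unique:
  assumes s: "s \<in> Sol" "s' \<in> Sol" and eq: "\<And>i. i \<in> {1..N} \<Longrightarrow> fst s i 0 = fst s' i 0 \<and> snd s i 0 = snd s' i 0"
    and t: "t \<in> {0..T}" and i: "i \<in> {1..N}"
  shows "fst s i t = fst s' i t" "snd s i t = snd s' i t"
proof -
  obtain c where c: "\<And>s r t. s \<in> Sol \<Longrightarrow> r \<in> {0..T} \<Longrightarrow> t \<in> {0..T} \<Longrightarrow> sqrt (ip t s s) \<le> c * sqrt (ip r s s)"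
    using ip_estimate by blast
  define d where "d = lc 1 s (-1) s'"
  have "ip 0 d d = 0" unfolding ip_self by (rule sum.neutral) (use eq in \<open>auto simp: d_def lc_def\<close>)
  moreover have "d \<in> Sol" unfolding d_def by (rule Sol_lc[OF s])
  ultimately have "sqrt (ip t d d) \<le> 0" using c[of d 0 t] T t by simp
  then have "norm (fst d i t) \<le> 0" "norm (snd d i t) \<le> 0"
    using component_bounds[OF i, of d t] by linarith+
  then show "fst s i t = fst s' i t" "snd s i t = snd s' i t" by (simp_all add: d_def lc_def)
qed

section \<open>The control problem\<close>

context eigenbasis
begin

text \<open>The levels of the energies in the observability inequality. The test solutions of the
  transposition identity have these levels in case (ii) and one less in case (i).\<close>

definition level :: "nat \<Rightarrow> nat \<Rightarrow> int" where
  "level n i = (if i \<le> n then 1 + int i - int n else 1)"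

lemma level_le: "level n i \<le> 1"
  by (simp add: level_def)

lemma level_eq_1: "level n (n + l) = 1"
  by (simp add: level_def)

text \<open>The given inequality in level 1 coordinates: the norm of row \<open>i\<close> in a
  weaker space of the scale is the norm of a negative power of \<open>A\<close> applied to its
  coordinate.\<close>

lemma observability_level_one:
  fixes G :: "nat \<Rightarrow> 'g::{real_inner,complete_space} set"
  assumes n: "n \<ge> 2" and ot: "observability_time A C n p G \<BB> Ts" and TTs: "T > Ts"
    and rep: "coupling_rep C n p (\<lambda>_. 1) K"
  shows "\<exists>c\<ge>0. \<forall>x z g. asys T (n + p) (coupled n) K x z \<longrightarrow>
     (\<forall>l\<le>p. observation A (G (n + l)) (\<BB> (n + l)) T (\<lambda>t. - (\<Sum>k\<in>coupled n (n + l). K (n + l) k (x k t)))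
        (\<lambda>t. pw (-1) (x (n + l) t)) (z (n + l)) (g l)) \<longrightarrow>
     (\<Sum>i = 1..n + p. (norm (pw (level n i - 1) (x i 0)))\<^sup>2 + (norm (pw (level n i - 1) (z i 0)))\<^sup>2)
       \<le> c * (\<Sum>l = 0..p. L2_sq T (g l))"
proof -
  have T: "T > 0" using ot TTs by (simp add: observability_time_def)
  let ?ot = "\<lambda>d \<rho> K T. (\<forall>i\<in>{1..n}. d i T > (0::real)) \<and> (\<forall>k\<in>{1..p}. \<rho> k T > (0::real)) \<and>
        (\<forall>i\<in>{1..n - 1}. d i T \<le> K / T ^ 3) \<and> d n T \<le> K / T \<and>
        (\<forall>w w' g. dual_sol A C n p (\<lambda>_. 1) T w w' \<and>
             (\<forall>l\<in>{0..p}. dual_observation A C n (G (n + l)) (\<BB> (n + l)) T (n + l) w w' (g l)) \<longrightarrow>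
           (\<forall>i\<in>{1..n}. energy A (1 + int i - int n) (w i 0) (w' i 0) \<le> d i T * L2_sq T (g 0)) \<and>
           (\<forall>k\<in>{1..p}. energy A 1 (w (n + k) 0) (w' (n + k) 0)
                          \<le> \<rho> k T * (\<Sum>l = 0..k. L2_sq T (g l))))"
  have "\<exists>d \<rho> K. \<forall>T>Ts. ?ot d \<rho> K T" using ot unfolding observability_time_def by (rule conjunct2)
  then obtain d0 \<rho>0 K0 where "\<forall>T>Ts. ?ot d0 \<rho>0 K0 T" by (elim exE)
  from mp[OF spec[OF this, of T] TTs] have ot': "?ot d0 \<rho>0 K0 T" .
  define d where "d i = d0 i T" for i
  define \<rho> where "\<rho> k = \<rho>0 k T" for k
  have d: "\<And>i. i \<in> {1..n} \<Longrightarrow> d i > 0" and \<rho>: "\<And>k. k \<in> {1..p} \<Longrightarrow> \<rho> k > 0"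
    using conjunct1[OF ot'] conjunct1[OF conjunct2[OF ot']] by (simp_all add: d_def \<rho>_def)
  have en: "\<forall>w w' g. dual_sol A C n p (\<lambda>_. 1) T w w' \<and>
             (\<forall>l\<in>{0..p}. dual_observation A C n (G (n + l)) (\<BB> (n + l)) T (n + l) w w' (g l)) \<longrightarrow>
           (\<forall>i\<in>{1..n}. energy A (1 + int i - int n) (w i 0) (w' i 0) \<le> d i * L2_sq T (g 0)) \<and>
           (\<forall>k\<in>{1..p}. energy A 1 (w (n + k) 0) (w' (n + k) 0)
                          \<le> \<rho> k * (\<Sum>l = 0..k. L2_sq T (g l)))"
    using ot' unfolding d_def \<rho>_def by (elim conjE) assumption
  define D where "D = (\<Sum>i = 1..n. d i) + (\<Sum>k = 1..p. \<rho> k)"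
  have D: "D \<ge> 0" "\<And>i. i \<in> {1..n} \<Longrightarrow> d i \<le> D" "\<And>k. k \<in> {1..p} \<Longrightarrow> \<rho> k \<le> D"
  proof -
    have s: "0 \<le> (\<Sum>i = 1..n. d i)" "0 \<le> (\<Sum>k = 1..p. \<rho> k)"
      by (rule sum_nonneg, use d in \<open>force intro: less_imp_le\<close>, rule sum_nonneg, use \<rho> in \<open>force intro: less_imp_le\<close>)
    then show "D \<ge> 0" by (simp add: D_def)
    show "d i \<le> D" if "i \<in> {1..n}" for i
      using member_le_sum[of i "{1..n}" d] that d s by (force simp: D_def intro: less_imp_le)
    show "\<rho> k \<le> D" if "k \<in> {1..p}" for k
      using member_le_sum[of k "{1..p}" \<rho>] that \<rho> s by (force simp: D_def intro: less_imp_le)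
  qed
  show ?thesis
  \<comment> \<open>There are \<open>n + p\<close> rows, each with a factor 2 from the half in the
    energy.\<close>
  proof (intro exI[of _ "real (n + p) * (2 * D)"] conjI allI impI)
    show "0 \<le> real (n + p) * (2 * D)" using D(1) by simp
    fix x z g
    assume a: "asys T (n + p) (coupled n) K x z"
      and o: "\<forall>l\<le>p. observation A (G (n + l)) (\<BB> (n + l)) T (\<lambda>t. - (\<Sum>k\<in>coupled n (n + l). K (n + l) k (x k t)))
        (\<lambda>t. pw (-1) (x (n + l) t)) (z (n + l)) (g l)"
    define S where "S = (\<Sum>l = 0..p. L2_sq T (g l))"
    define w where "w i t = fn 1 (x i t)" for i t
    define w' where "w' i t = fn 0 (z i t)" for i t
    have ds: "dual_sol A C n p (\<lambda>_. 1) T w w'"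
      unfolding dual_sol_iff[OF n rep T] using a by (auto simp: w_def w'_def)
    have do: "dual_observation A C n (G (n + l)) (\<BB> (n + l)) T (n + l) w w' (g l)" if l: "l \<in> {0..p}" for l
      unfolding dual_observation_def
    proof (rule observation_cong)
      show "observation A (G (n + l)) (\<BB> (n + l)) T (\<lambda>t. - (\<Sum>k\<in>coupled n (n + l). K (n + l) k (x k t)))
        (\<lambda>t. pw (-1) (x (n + l) t)) (z (n + l)) (g l)" using o l by auto
      show "- (\<Sum>k\<in>coupled n (n + l). K (n + l) k (x k t)) = - (\<Sum>k\<in>coupled n (n + l). blinfun_apply (C (n + l) k) (vec_of (w k t)))" for t
        unfolding w_def
        by (intro arg_cong[where f = uminus] sum.cong refl couples_one[OF coupling_repD(1)[OF rep]]) (use n l in auto)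
    qed (simp_all add: w_def w'_def vec_of_fn pw_0)
    have E: "(norm (pw (m - 1) (x i 0)))\<^sup>2 + (norm (pw (m - 1) (z i 0)))\<^sup>2 = 2 * energy A m (w i 0) (w' i 0)" if m: "m \<le> 1" for i m
    proof -
      have "Hs_norm A m (w i 0) = norm (pw (m - 1) (x i 0))"
        by (rule Hs_norm_eq, unfold w_def, rule fn_embed) (use m in \<open>auto intro: sc_pw\<close>)
      moreover have "Hs_norm A (m - 1) (w' i 0) = norm (pw (m - 1) (z i 0))"
        by (rule Hs_norm_eq, unfold w'_def, rule fn_embed) (use m in \<open>auto intro: sc_pw\<close>)
      ultimately show ?thesis by (simp add: energy_def)
    qed
    have en1: "\<forall>i\<in>{1..n}. energy A (1 + int i - int n) (w i 0) (w' i 0) \<le> d i * L2_sq T (g 0)"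
      and en2: "\<forall>k\<in>{1..p}. energy A 1 (w (n + k) 0) (w' (n + k) 0) \<le> \<rho> k * (\<Sum>l = 0..k. L2_sq T (g l))"
      using en[rule_format, of w w' g] ds do by auto
    have "energy A (level n i) (w i 0) (w' i 0) \<le> D * S" if i: "i \<in> {1..n + p}" for i
    proof (cases "i \<le> n")
      case True
      then have "energy A (level n i) (w i 0) (w' i 0) \<le> d i * L2_sq T (g 0)" using en1 i by (simp add: level_def)
      also have "\<dots> \<le> D * S"
        using D True i member_le_sum[of 0 "{0..p}" "\<lambda>l. L2_sq T (g l)"] by (intro mult_mono) (auto simp: S_def)
      finally show ?thesis .
    next
      case False
      define k where "k = i - n"
      have k: "i = n + k" "k \<in> {1..p}" using i False by (auto simp: k_def)
      then have "energy A (level n i) (w i 0) (w' i 0) \<le> \<rho> k * (\<Sum>l = 0..k. L2_sq T (g l))" using en2 False by (simp add: level_def)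
      also have "\<dots> \<le> D * S"
        using D k by (intro mult_mono) (auto simp: S_def sum_nonneg intro!: sum_mono2)
      finally show ?thesis .
    qed
    then have "(\<Sum>i = 1..n + p. (norm (pw (level n i - 1) (x i 0)))\<^sup>2 + (norm (pw (level n i - 1) (z i 0)))\<^sup>2) \<le> (\<Sum>i = 1..n + p. 2 * (D * S))"
      by (intro sum_mono) (simp add: E level_le)
    also have "\<dots> = real (n + p) * (2 * D) * S" by simp
    finally show "(\<Sum>i = 1..n + p. (norm (pw (level n i - 1) (x i 0)))\<^sup>2 + (norm (pw (level n i - 1) (z i 0)))\<^sup>2)
        \<le> real (n + p) * (2 * D) * (\<Sum>l = 0..p. L2_sq T (g l))" by (simp add: S_def)
  qed
qed

end

section \<open>The two kinds of observation as instances of the abstract method\<close>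

context eigenbasis
begin

text \<open>For the lower bound a truncated initial state at the levels \<open>level n\<close> is
  lifted to level 1, where the inequality is known. The lifted solution lowers to the given one by
  uniqueness, and the observed rows, being at level 1 already, keep their source, data and
  observation.\<close>

lemma hum_position_observation:
  fixes G :: "nat \<Rightarrow> 'g::{real_inner,complete_space} set"
  assumes n: "n \<ge> 2" and ot: "observability_time A C n p G \<BB> Ts" and TTs: "T > Ts"
    and adm: "\<And>l. l \<le> p \<Longrightarrow> admissibility_hyp A (G (n + l)) (\<BB> (n + l))"
    and r1: "coupling_rep C n p (\<lambda>_. 1) K1" and rep: "coupling_rep C n p (level n) K"
  shows "hum E A \<mu> c\<^sub>0 (n + p) (coupled n) K T p (\<lambda>l. G (n + l))
     (\<lambda>x z l. observation A (G (n + l)) (\<BB> (n + l)) T (\<lambda>t. - (\<Sum>k\<in>coupled n (n + l). K (n + l) k (x k t)))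
        (\<lambda>t. pw (-1) (x (n + l) t)) (z (n + l)))"
proof -
  have T: "T > 0" using ot TTs by (simp add: observability_time_def)
  interpret cascade_system E A \<mu> c\<^sub>0 "n + p" "coupled n" K T
    by unfold_locales (use T coupling_rep_cascade[OF n rep] in auto)
  let ?k = "\<lambda>x i t. - (\<Sum>k\<in>coupled n i. K i k (x k t))"
  let ?o = "\<lambda>x z l. observation A (G (n + l)) (\<BB> (n + l)) T (?k x (n + l)) (\<lambda>t. pw (-1) (x (n + l) t)) (z (n + l))"
  have as: "asol T (?k x (n + l)) (x (n + l)) (z (n + l))" if "sol x z" "l \<le> p" for x z l
    using that n by (auto simp: asys_def)
  have H1: "pw (-1) y \<in> Hdom A 1" for y using Hdom_iff_range[of "pw (-1) y" 1] by simp
  show ?thesis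
  proof unfold_locales
    fix x z l assume a: "sol x z" and l: "l \<le> p"
    show "\<exists>g. ?o x z l g" by (rule observation_exists[OF adm[OF l] as[OF a l] T])
    show "L2 T (G (n + l)) g" if "?o x z l g" for g using that by (simp add: observation_def)
  next
    fix x z x' z' l g g' and a c :: real
    assume s: "sol x z" "sol x' z'" and l: "l \<le> p" and o: "?o x z l g" "?o x' z' l g'"
    have f: "L2 T UNIV (?k x (n + l))" "L2 T UNIV (?k x' (n + l))"
      using asol_D(1)[OF as[OF s(1) l]] asol_D(1)[OF as[OF s(2) l]] by (auto intro: L2_continuous)
    have "observation A (G (n + l)) (\<BB> (n + l)) T (\<lambda>t. a *\<^sub>R ?k x (n + l) t + c *\<^sub>R ?k x' (n + l) t)
        (\<lambda>t. a *\<^sub>R pw (-1) (x (n + l) t) + c *\<^sub>R pw (-1) (x' (n + l) t)) (\<lambda>t. a *\<^sub>R z (n + l) t + c *\<^sub>R z' (n + l) t)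
        (\<lambda>t. a *\<^sub>R g t + c *\<^sub>R g' t)"
      by (rule observation_lin[OF adm[OF l] o f H1 H1 T])
    moreover have "a *\<^sub>R ?k x (n + l) t + c *\<^sub>R ?k x' (n + l) t = ?k (\<lambda>i t. a *\<^sub>R x i t + c *\<^sub>R x' i t) (n + l) t" for t
    proof -
      have "K (n + l) k (a *\<^sub>R x k t + c *\<^sub>R x' k t) = a *\<^sub>R K (n + l) k (x k t) + c *\<^sub>R K (n + l) k (x' k t)"
        if "k \<in> coupled n (n + l)" for k
        using bounded_linear.linear[OF coupling_repD(2)[OF rep _ that]] n l by (simp add: linear_add linear_scale)
      then show ?thesis by (simp add: sum.distrib scaleR_sum_right)
    qed
    moreover have "a *\<^sub>R pw (-1) (x (n + l) t) + c *\<^sub>R pw (-1) (x' (n + l) t) = pw (-1) (a *\<^sub>R x (n + l) t + c *\<^sub>R x' (n + l) t)" for t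
      by (simp add: linear_add[OF linear_pw] linear_scale[OF linear_pw])
    ultimately show "?o (\<lambda>i t. a *\<^sub>R x i t + c *\<^sub>R x' i t) (\<lambda>i t. a *\<^sub>R z i t + c *\<^sub>R z' i t) l (\<lambda>t. a *\<^sub>R g t + c *\<^sub>R g' t)" by simp
  next
    obtain M where M: "M \<ge> 0" "\<And>s r t i. s \<in> Sol \<Longrightarrow> r \<in> {0..T} \<Longrightarrow> t \<in> {0..T} \<Longrightarrow> i \<in> {1..n + p} \<Longrightarrow>
        norm (\<Sum>k\<in>coupled n i. K i k (fst s k t)) \<le> M * sqrt (ip r s s)"
      using coupling_bound by blast
    have "\<exists>c\<ge>0. \<forall>s\<in>Sol. \<forall>g. ?o (fst s) (snd s) l g \<longrightarrow> L2_sq T g \<le> c * ip 0 s s" if l: "l \<le> p" for l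
    proof -
      obtain c where c: "c \<ge> 0" "\<And>k x z g B. asol T k x z \<Longrightarrow> observation A (G (n + l)) (\<BB> (n + l)) T k (\<lambda>t. pw (-1) (x t)) z g \<Longrightarrow>
          (\<forall>r\<in>{0..T}. norm (k r) \<le> B) \<Longrightarrow> L2_sq T g \<le> c * (norm (x 0, z 0) + B)\<^sup>2"
        using observation_bound[OF adm[OF l] T] by blast
      have "L2_sq T g \<le> c * (1 + M)\<^sup>2 * ip 0 s s" if s: "s \<in> Sol" and o: "?o (fst s) (snd s) l g" for s g
      proof -
        have a: "sol (fst s) (snd s)" using s by (simp add: Sol_def)
        have i: "n + l \<in> {1..n + p}" using n l by auto
        have "L2_sq T g \<le> c * (norm (fst s (n + l) 0, snd s (n + l) 0) + M * sqrt (ip 0 s s))\<^sup>2"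
        proof (rule c(2)[OF as[OF a l] o], intro ballI)
          fix r assume "r \<in> {0..T}"
          then show "norm (?k (fst s) (n + l) r) \<le> M * sqrt (ip 0 s s)" using M(2)[OF s _ _ i, of 0 r] T by simp
        qed
        also have "\<dots> \<le> c * (sqrt (ip 0 s s) + M * sqrt (ip 0 s s))\<^sup>2"
          using component_le_ip[OF i, of s 0] M(1) ip_nonneg[of 0 s] by (intro mult_left_mono power_mono add_right_mono c(1)) auto
        also have "\<dots> = c * (1 + M)\<^sup>2 * ip 0 s s"
        proof -
          have "sqrt (ip 0 s s) + M * sqrt (ip 0 s s) = (1 + M) * sqrt (ip 0 s s)" by (simp add: distrib_right)
          then show ?thesis by (simp add: power_mult_distrib ip_nonneg)
        qed
        finally show ?thesis .
      qed
      then show ?thesis using c(1) by (intro exI[of _ "c * (1 + M)\<^sup>2"]) auto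
    qed
    then have "\<forall>l\<in>{..p}. \<exists>c\<ge>0. \<forall>s\<in>Sol. \<forall>g. ?o (fst s) (snd s) l g \<longrightarrow> L2_sq T g \<le> c * ip 0 s s" by blast
    from bchoice[OF this] obtain c where c: "\<And>l. l \<le> p \<Longrightarrow> c l \<ge> 0"
      "\<And>l s g. l \<le> p \<Longrightarrow> s \<in> Sol \<Longrightarrow> ?o (fst s) (snd s) l g \<Longrightarrow> L2_sq T g \<le> c l * ip 0 s s" by auto
    show "\<exists>c\<ge>0. \<forall>s\<in>Sol. \<forall>l\<le>p. \<forall>g. ?o (fst s) (snd s) l g \<longrightarrow> L2_sq T g \<le> c * ip 0 s s"
    proof (intro exI[of _ "\<Sum>l\<le>p. c l"] conjI ballI allI impI)
      show "0 \<le> (\<Sum>l\<le>p. c l)" using c(1) by (auto intro: sum_nonneg)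
      fix s l g assume *: "s \<in> Sol" "l \<le> p" "?o (fst s) (snd s) l g"
      have "c l * ip 0 s s \<le> (\<Sum>l\<le>p. c l) * ip 0 s s"
        by (rule mult_right_mono[OF member_le_sum ip_nonneg]) (use * c(1) in auto)
      then show "L2_sq T g \<le> (\<Sum>l\<le>p. c l) * ip 0 s s" using c(2)[OF *(2,1,3)] by linarith
    qed
  next
    obtain c where c: "c \<ge> 0" "\<And>x z g. asys T (n + p) (coupled n) K1 x z \<Longrightarrow>
       (\<forall>l\<le>p. observation A (G (n + l)) (\<BB> (n + l)) T (\<lambda>t. - (\<Sum>k\<in>coupled n (n + l). K1 (n + l) k (x k t)))
          (\<lambda>t. pw (-1) (x (n + l) t)) (z (n + l)) (g l)) \<Longrightarrow>
       (\<Sum>i = 1..n + p. (norm (pw (level n i - 1) (x i 0)))\<^sup>2 + (norm (pw (level n i - 1) (z i 0)))\<^sup>2)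
         \<le> c * (\<Sum>l = 0..p. L2_sq T (g l))"
      using observability_level_one[OF n ot TTs r1] by blast
    show "\<exists>c\<ge>0. \<forall>s\<in>Sol. \<forall>F g. finite F \<longrightarrow> F \<subseteq> E \<longrightarrow>
       (\<forall>i\<in>{1..n + p}. proj F (fst s i 0) = fst s i 0 \<and> proj F (snd s i 0) = snd s i 0) \<longrightarrow>
       (\<forall>l\<le>p. ?o (fst s) (snd s) l (g l)) \<longrightarrow> ip 0 s s \<le> c * (\<Sum>l = 0..p. L2_sq T (g l))"
    proof (intro exI[of _ c] conjI ballI allI impI c(1))
      fix s F g assume s: "s \<in> Sol" and F: "finite F" "F \<subseteq> E"
        and pF: "\<forall>i\<in>{1..n + p}. proj F (fst s i 0) = fst s i 0 \<and> proj F (snd s i 0) = snd s i 0"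
        and o: "\<forall>l\<le>p. ?o (fst s) (snd s) l (g l)"
      have le0: "level n i - 1 \<le> 0" for i using level_le[of n i] by simp
      have "\<forall>i\<in>{1..n + p}. \<exists>a. pw (level n i - 1) a = fst s i 0" using pw_surj_finite[OF F _ le0] pF by blast
      then obtain a where a: "\<forall>i\<in>{1..n + p}. pw (level n i - 1) (a i) = fst s i 0" by metis
      have "\<forall>i\<in>{1..n + p}. \<exists>b. pw (level n i - 1) b = snd s i 0" using pw_surj_finite[OF F _ le0] pF by blast
      then obtain b where b: "\<forall>i\<in>{1..n + p}. pw (level n i - 1) (b i) = snd s i 0" by metis
      obtain x z where xz: "asys T (n + p) (coupled n) K1 x z" "\<forall>i\<in>{1..n + p}. x i 0 = a i \<and> z i 0 = b i"
        using asys_exists[OF coupling_rep_cascade[OF n r1], of 0 T a b] T by auto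
      define s' where "s' = ((\<lambda>i t. pw (level n i - 1) (x i t)), (\<lambda>i t. pw (level n i - 1) (z i t)))"
      have ch: "pw (level n i - 1) (- (\<Sum>k\<in>coupled n i. K1 i k (x k t))) = ?k (fst s') i t" if i: "i \<in> {1..n + p}" for i t
        unfolding s'_def fst_conv by (rule asys_change_level[OF r1 rep level_le i, where x = "\<lambda>k. x k t"])
      have s': "s' \<in> Sol"
        unfolding Sol_def asys_def mem_Collect_eq
      proof
        fix i assume i: "i \<in> {1..n + p}"
        have "asol T (\<lambda>t. - (\<Sum>k\<in>coupled n i. K1 i k (x k t))) (x i) (z i)" using xz(1) i by (auto simp: asys_def)
        from asol_pw[OF this le0] show "asol T (?k (fst s') i) (fst s' i) (snd s' i)"
          by (rule asol_cong) (use ch[OF i] in \<open>auto simp: s'_def\<close>)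
      qed
      have eq: "fst s i t = fst s' i t" "snd s i t = snd s' i t" if "t \<in> {0..T}" "i \<in> {1..n + p}" for i t
        using Sol_unique[OF s s' _ that] a b xz(2) by (auto simp: s'_def)
      have o1: "observation A (G (n + l)) (\<BB> (n + l)) T (\<lambda>t. - (\<Sum>k\<in>coupled n (n + l). K1 (n + l) k (x k t)))
          (\<lambda>t. pw (-1) (x (n + l) t)) (z (n + l)) (g l)" if l: "l \<le> p" for l
      proof (rule observation_cong)
        show "?o (fst s) (snd s) l (g l)" using o l by blast
        have i: "n + l \<in> {1..n + p}" using n l by auto
        have T0: "0 \<in> {0..T}" using T by simp
        show "pw (-1) (fst s (n + l) 0) = pw (-1) (x (n + l) 0)" "snd s (n + l) 0 = z (n + l) 0"
          using eq[OF T0 i] by (simp_all add: s'_def level_eq_1 pw_0)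
        fix t assume t: "t \<in> {0..T}"
        have "?k (fst s) (n + l) t = ?k (fst s') (n + l) t"
          by (intro arg_cong[where f = uminus] sum.cong refl arg_cong[where f = "K (n + l) _"] eq(1)[OF t])
             (use coupled_subset[OF n, of "n + l"] l in force)
        then show "?k (fst s) (n + l) t = - (\<Sum>k\<in>coupled n (n + l). K1 (n + l) k (x k t))"
          using ch[OF i, of t] by (simp add: level_eq_1 pw_0)
      qed
      have "ip 0 s s = (\<Sum>i = 1..n + p. (norm (pw (level n i - 1) (x i 0)))\<^sup>2 + (norm (pw (level n i - 1) (z i 0)))\<^sup>2)"
        unfolding ip_self by (rule sum.cong) (use eq T in \<open>auto simp: s'_def\<close>)
      also have "\<dots> \<le> c * (\<Sum>l = 0..p. L2_sq T (g l))" by (rule c(2)[OF xz(1)]) (use o1 in blast)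
      finally show "ip 0 s s \<le> c * (\<Sum>l = 0..p. L2_sq T (g l))" .
    qed
  qed
qed

text \<open>
  The observation is \<open>B\<^sup>* w\<close> with \<open>w = u'\<close> the velocity of a finite energy solution \<open>u\<close>, so that the
  observability of \<open>u\<close> through \<open>B\<^sup>* u'\<close> applies.
\<close>

lemma hum_velocity_observation:
  fixes G :: "nat \<Rightarrow> 'g::{real_inner,complete_space} set"
  assumes n: "n \<ge> 2" and ot: "observability_time A C n p G \<BB> Ts" and TTs: "T > Ts"
    and adm: "\<And>l. l \<le> p \<Longrightarrow> admissibility_hyp A (G (n + l)) (\<BB> (n + l))"
    and L: "\<And>l w w'. l \<le> p \<Longrightarrow> w \<in> Hdom A 2 \<Longrightarrow> \<BB> (n + l) (w, w') = L l w'"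
    and r1: "coupling_rep C n p (\<lambda>_. 1) K1" and rep: "coupling_rep C n p (\<lambda>i. level n i - 1) K"
  shows "hum E A \<mu> c\<^sub>0 (n + p) (coupled n) K T p (\<lambda>l. G (n + l)) (\<lambda>x z l g. \<forall>t\<in>{0..T}. g t = L l (x (n + l) t))"
proof -
  have T: "T > 0" using ot TTs by (simp add: observability_time_def)
  have T0: "0 \<in> {0..T}" using T by simp
  interpret cascade_system E A \<mu> c\<^sub>0 "n + p" "coupled n" K T
    by unfold_locales (use T coupling_rep_cascade[OF n rep] in auto)
  \<comment> \<open>The levels of the dual space in case (i), all at most 0; the observed rows are
    at level 0, where vector and coordinate coincide.\<close>
  define \<sigma> where "\<sigma> i = level n i - 1" for i
  have \<sigma>: "\<sigma> i \<le> 0" "\<sigma> i - 1 \<le> 0" "\<sigma> (n + l) = 0" for i l using level_le[of n i] by (auto simp: \<sigma>_def level_eq_1)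
  have rep\<sigma>: "coupling_rep C n p \<sigma> K" using rep by (simp add: \<sigma>_def[abs_def])
  obtain x0 z0 where "asys T (n + p) (coupled n) K1 x0 z0"
    using asys_exists[OF coupling_rep_cascade[OF n r1] T0] by blast
  then have a0: "asol T (\<lambda>t. - (\<Sum>k\<in>coupled n (n + l). K1 (n + l) k (x0 k t))) (x0 (n + l)) (z0 (n + l))" if "l \<le> p" for l
    using that n by (auto simp: asys_def)
  have bl: "bounded_linear (L l)" and LG: "L l v \<in> G (n + l)" if l: "l \<le> p" for l v
    using observation_of_velocity(1,2)[OF adm[OF l] a0[OF l] T, of "L l"] L[OF l] by auto
  have cx: "continuous_on {0..T} (\<lambda>t. L l (x (n + l) t))" if "sol x z" "l \<le> p" for x z l
  proof -
    have "continuous_on {0..T} (x (n + l))" using that n unfolding asys_def by (auto dest!: bspec[of _ _ "n + l"] asol_D(2))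
    then show ?thesis by (rule bounded_linear.continuous_on[OF bl[OF that(2)]])
  qed
  show ?thesis
  proof unfold_locales
    fix x z l assume a: "sol x z" and l: "l \<le> p"
    show "\<exists>g. \<forall>t\<in>{0..T}. g t = L l (x (n + l) t)" by (rule exI[of _ "\<lambda>t. L l (x (n + l) t)"]) simp
    have "L2 T (G (n + l)) (\<lambda>t. L l (x (n + l) t))" by (rule L2_continuous[OF cx[OF a l] LG[OF l]])
    then show "L2 T (G (n + l)) g" if "\<forall>t\<in>{0..T}. g t = L l (x (n + l) t)" for g
      by (rule L2_cong) (use that in simp)
  next
    fix x z x' z' l g g' and a c :: real
    assume "l \<le> p" "\<forall>t\<in>{0..T}. g t = L l (x (n + l) t)" "\<forall>t\<in>{0..T}. g' t = L l (x' (n + l) t)"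
    then show "\<forall>t\<in>{0..T}. a *\<^sub>R g t + c *\<^sub>R g' t = L l (a *\<^sub>R x (n + l) t + c *\<^sub>R x' (n + l) t)"
      using bounded_linear.linear[OF bl[of l]] by (simp add: linear_add linear_scale)
  next
    obtain C where C: "C \<ge> 1" "\<And>s r t. s \<in> Sol \<Longrightarrow> r \<in> {0..T} \<Longrightarrow> t \<in> {0..T} \<Longrightarrow> sqrt (ip t s s) \<le> C * sqrt (ip r s s)"
      using ip_estimate by blast
    define m where "m = (\<Sum>l\<le>p. onorm (L l))"
    have m: "onorm (L l) \<le> m" "0 \<le> onorm (L l)" if "l \<le> p" for l
      using member_le_sum[of l "{..p}" "\<lambda>l. onorm (L l)"] that onorm_pos_le[OF bl] by (auto simp: m_def)
    have m0: "m \<ge> 0" using m[of 0] by simp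
    show "\<exists>c\<ge>0. \<forall>s\<in>Sol. \<forall>l\<le>p. \<forall>g. (\<forall>t\<in>{0..T}. g t = L l (fst s (n + l) t)) \<longrightarrow> L2_sq T g \<le> c * ip 0 s s"
    proof (intro exI[of _ "T * (m * C)\<^sup>2"] conjI ballI allI impI)
      show "0 \<le> T * (m * C)\<^sup>2" using T by simp
      fix s l g assume s: "s \<in> Sol" and l: "l \<le> p" and g: "\<forall>t\<in>{0..T}. g t = L l (fst s (n + l) t)"
      have i: "n + l \<in> {1..n + p}" using n l by auto
      have "L2_sq T g \<le> T * (m * (C * sqrt (ip 0 s s)))\<^sup>2"
      proof (rule L2_sq_le_bound)
        show "0 \<le> m * (C * sqrt (ip 0 s s))" using m0 C(1) ip_nonneg by auto
        fix t assume t: "t \<in> {0..T}"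
        have "norm (g t) \<le> onorm (L l) * norm (fst s (n + l) t)" using g t onorm[OF bl[OF l]] by simp
        also have "\<dots> \<le> m * (C * sqrt (ip 0 s s))"
          using m[OF l] m0 component_bounds(1)[OF i, of s t] C(2)[OF s T0 t] by (intro mult_mono) auto
        finally show "norm (g t) \<le> m * (C * sqrt (ip 0 s s))" .
      qed (use T in simp)
      also have "\<dots> = T * (m * C)\<^sup>2 * ip 0 s s" by (simp add: power_mult_distrib ip_nonneg)
      finally show "L2_sq T g \<le> T * (m * C)\<^sup>2 * ip 0 s s" .
    qed
  next
    obtain c where c: "c \<ge> 0" "\<And>x z g. asys T (n + p) (coupled n) K1 x z \<Longrightarrow>
       (\<forall>l\<le>p. observation A (G (n + l)) (\<BB> (n + l)) T (\<lambda>t. - (\<Sum>k\<in>coupled n (n + l). K1 (n + l) k (x k t)))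
          (\<lambda>t. pw (-1) (x (n + l) t)) (z (n + l)) (g l)) \<Longrightarrow>
       (\<Sum>i = 1..n + p. (norm (pw (\<sigma> i) (x i 0)))\<^sup>2 + (norm (pw (\<sigma> i) (z i 0)))\<^sup>2)
         \<le> c * (\<Sum>l = 0..p. L2_sq T (g l))"
      using observability_level_one[OF n ot TTs r1] unfolding \<sigma>_def by blast
    \<comment> \<open>Row constant for \<open>w''\<close>: 1 for the term \<open>A w\<close>, the
      sum for the couplings, whose arguments carry an extra \<open>A^{-1/2}\<close> of norm at most
      \<open>c\<^sub>0 powi (-1)\<close>.\<close>
    define M where "M i = 1 + (\<Sum>k\<in>coupled n i. onorm (K i k) * c\<^sub>0 powi (-1))" for i
    define D where "D = (\<Sum>i = 1..n + p. 1 + (M i)\<^sup>2)"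
    show "\<exists>c\<ge>0. \<forall>s\<in>Sol. \<forall>F g. finite F \<longrightarrow> F \<subseteq> E \<longrightarrow>
       (\<forall>i\<in>{1..n + p}. proj F (fst s i 0) = fst s i 0 \<and> proj F (snd s i 0) = snd s i 0) \<longrightarrow>
       (\<forall>l\<le>p. \<forall>t\<in>{0..T}. g l t = L l (fst s (n + l) t)) \<longrightarrow> ip 0 s s \<le> c * (\<Sum>l = 0..p. L2_sq T (g l))"
    proof (intro exI[of _ "D * c"] conjI ballI allI impI)
      show "0 \<le> D * c" using c(1) by (auto simp: D_def intro!: mult_nonneg_nonneg sum_nonneg)
      fix s F g assume s: "s \<in> Sol" and F: "finite F" "F \<subseteq> E"
        and pF: "\<forall>i\<in>{1..n + p}. proj F (fst s i 0) = fst s i 0 \<and> proj F (snd s i 0) = snd s i 0"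
        and o: "\<forall>l\<le>p. \<forall>t\<in>{0..T}. g l t = L l (fst s (n + l) t)"
      have "\<forall>i\<in>{1..n + p}. \<exists>b. pw (\<sigma> i) b = fst s i 0" using pw_surj_finite[OF F _ \<sigma>(1)] pF by blast
      then obtain b where b: "\<forall>i\<in>{1..n + p}. pw (\<sigma> i) (b i) = fst s i 0" by metis
      have "\<forall>i\<in>{1..n + p}. \<exists>d. pw (\<sigma> i) d = snd s i 0" using pw_surj_finite[OF F _ \<sigma>(1)] pF by blast
      then obtain d where d: "\<forall>i\<in>{1..n + p}. pw (\<sigma> i) (d i) = snd s i 0" by metis
      have "\<And>i. i \<in> {1..n + p} \<Longrightarrow> coupled n i \<subseteq> {1..<i}" using coupled_subset[OF n] by blast
      \<comment> \<open>The positions \<open>a\<close> solve \<open>A^{-1/2} k1 - a = d\<close>,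
        where \<open>k1\<close> is the forcing at time 0 and depends on earlier rows of
        \<open>a\<close>; this prescribes the initial \<open>w''\<close> before lowering.\<close>
      from triangular_system_solvable[OF this, of "n + p" "\<lambda>i S. pw (-1) (- S) - d i" K1]
      obtain a where a: "\<forall>i\<in>{1..n + p}. a i = pw (-1) (- (\<Sum>k\<in>coupled n i. K1 i k (a k))) - d i" by auto
      obtain x z where xz: "asys T (n + p) (coupled n) K1 x z" "\<forall>i\<in>{1..n + p}. x i 0 = a i \<and> z i 0 = b i"
        using asys_exists[OF coupling_rep_cascade[OF n r1] T0, of a b] by auto
      let ?k1 = "\<lambda>i t. - (\<Sum>k\<in>coupled n i. K1 i k (x k t))"
      define s' where "s' = ((\<lambda>i t. pw (\<sigma> i) (z i t)), (\<lambda>i t. pw (\<sigma> i - 1) (?k1 i t) - pw (\<sigma> i) (x i t)))"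
      have s': "s' \<in> Sol" using asys_velocity[OF n r1 rep\<sigma> \<sigma>(1) xz(1)] by (simp add: Sol_def s'_def)
      have cp: "k \<in> {1..n + p}" if "k \<in> coupled n i" "i \<in> {1..n + p}" for i k using coupled_subset[OF n, of i] that by force
      have ini: "fst s i 0 = fst s' i 0 \<and> snd s i 0 = snd s' i 0" if i: "i \<in> {1..n + p}" for i
      proof
        show "fst s i 0 = fst s' i 0" using b xz(2) i by (simp add: s'_def)
        have "?k1 i 0 = - (\<Sum>k\<in>coupled n i. K1 i k (a k))"
          by (intro arg_cong[where f = uminus] sum.cong refl arg_cong[where f = "K1 i _"]) (use xz(2) cp[OF _ i] in blast)
        then have "x i 0 = pw (-1) (?k1 i 0) - d i" using a xz(2) i by simp
        then have "pw (\<sigma> i) (x i 0) = pw (\<sigma> i - 1) (?k1 i 0) - snd s i 0"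
          using d i pw_pw[OF \<sigma>(1)[of i], of "-1"] by (simp add: linear_diff[OF linear_pw[OF \<sigma>(1)]])
        then show "snd s i 0 = snd s' i 0" by (simp add: s'_def)
      qed
      have eq: "fst s i t = fst s' i t" "snd s i t = snd s' i t" if "t \<in> {0..T}" "i \<in> {1..n + p}" for i t
        using Sol_unique[OF s s' ini that] by auto
      have "observation A (G (n + l)) (\<BB> (n + l)) T (?k1 (n + l)) (\<lambda>t. pw (-1) (x (n + l) t)) (z (n + l)) (\<lambda>t. L l (z (n + l) t))"
        if l: "l \<le> p" for l
        by (rule observation_of_velocity(3)[OF adm[OF l] _ T]) (use xz(1) n l L[OF l] in \<open>auto simp: asys_def\<close>)
      then have "(\<Sum>i = 1..n + p. (norm (pw (\<sigma> i) (x i 0)))\<^sup>2 + (norm (pw (\<sigma> i) (z i 0)))\<^sup>2)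
          \<le> c * (\<Sum>l = 0..p. L2_sq T (\<lambda>t. L l (z (n + l) t)))" by (intro c(2)[OF xz(1)]) blast
      also have "(\<Sum>l = 0..p. L2_sq T (\<lambda>t. L l (z (n + l) t))) = (\<Sum>l = 0..p. L2_sq T (g l))"
      proof (rule sum.cong[OF refl], rule L2_sq_cong)
        fix l t assume l: "l \<in> {0..p}" and t: "t \<in> {0..T}"
        have i: "n + l \<in> {1..n + p}" using n l by auto
        show "L l (z (n + l) t) = g l t" using o l t eq(1)[OF t i] by (simp add: s'_def \<sigma>(3) pw_0)
      qed
      finally have S: "(\<Sum>i = 1..n + p. (norm (pw (\<sigma> i) (x i 0)))\<^sup>2 + (norm (pw (\<sigma> i) (z i 0)))\<^sup>2) \<le> c * (\<Sum>l = 0..p. L2_sq T (g l))" .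
      define Q where "Q = sqrt (\<Sum>i = 1..n + p. (norm (pw (\<sigma> i) (x i 0)))\<^sup>2 + (norm (pw (\<sigma> i) (z i 0)))\<^sup>2)"
      have Q2: "Q\<^sup>2 = (\<Sum>i = 1..n + p. (norm (pw (\<sigma> i) (x i 0)))\<^sup>2 + (norm (pw (\<sigma> i) (z i 0)))\<^sup>2)"
        unfolding Q_def by (intro real_sqrt_pow2 sum_nonneg) auto
      have Q0: "Q \<ge> 0" unfolding Q_def by (intro real_sqrt_ge_zero sum_nonneg) auto
      have xQ: "norm (pw (\<sigma> i) (x i 0)) \<le> Q" and zQ: "norm (pw (\<sigma> i) (z i 0)) \<le> Q" if i: "i \<in> {1..n + p}" for i
      proof -
        have "(norm (pw (\<sigma> i) (x i 0)))\<^sup>2 + (norm (pw (\<sigma> i) (z i 0)))\<^sup>2 \<le> Q\<^sup>2"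
          unfolding Q2 by (rule member_le_sum[of i "{1..n + p}" "\<lambda>i. (norm (pw (\<sigma> i) (x i 0)))\<^sup>2 + (norm (pw (\<sigma> i) (z i 0)))\<^sup>2"]) (use i in auto)
        then have "(norm (pw (\<sigma> i) (x i 0)))\<^sup>2 \<le> Q\<^sup>2" "(norm (pw (\<sigma> i) (z i 0)))\<^sup>2 \<le> Q\<^sup>2"
          using zero_le_power2[of "norm (pw (\<sigma> i) (x i 0))"] zero_le_power2[of "norm (pw (\<sigma> i) (z i 0))"] by linarith+
        then show "norm (pw (\<sigma> i) (x i 0)) \<le> Q" "norm (pw (\<sigma> i) (z i 0)) \<le> Q" using Q0 by (auto intro: power2_le_imp_le)
      qed
      \<comment> \<open>The inequality bounds the lowered pair of \<open>x\<close> and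
        \<open>z\<close>, whereas the state of \<open>s\<close> consists of \<open>w'\<close> and
        \<open>w''\<close>; the coupling term that separates them is absorbed by
        \<open>M\<close>.\<close>
      have "ip 0 s s \<le> (\<Sum>i = 1..n + p. Q\<^sup>2 + (M i * Q)\<^sup>2)"
        unfolding ip_self
      proof (intro sum_mono add_mono power_mono norm_ge_zero)
        fix i assume i: "i \<in> {1..n + p}"
        show "norm (fst s i 0) \<le> Q" using zQ[OF i] eq(1)[OF T0 i] by (simp add: s'_def)
        have "norm (snd s i 0) \<le> norm (pw (\<sigma> i - 1) (?k1 i 0)) + norm (pw (\<sigma> i) (x i 0))"
          using eq(2)[OF T0 i] norm_triangle_ineq4 by (simp add: s'_def)
        moreover have "norm (pw (\<sigma> i - 1) (?k1 i 0)) \<le> (\<Sum>k\<in>coupled n i. onorm (K i k) * c\<^sub>0 powi (-1)) * Q"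
        proof -
          have le1: "\<sigma> i \<le> 1" for i using \<sigma>(1)[of i] by simp
          have "norm (pw (\<sigma> i - 1) (?k1 i 0)) = norm (\<Sum>k\<in>coupled n i. K i k (pw (\<sigma> k - 1) (x k 0)))"
            using asys_change_level[OF r1 rep\<sigma> le1 i, of "\<lambda>k. x k 0"] by simp
          also have "\<dots> \<le> (\<Sum>k\<in>coupled n i. norm (K i k (pw (\<sigma> k - 1) (x k 0))))" by (rule norm_sum)
          also have "\<dots> \<le> (\<Sum>k\<in>coupled n i. onorm (K i k) * (c\<^sub>0 powi (-1) * Q))"
          proof (rule sum_mono)
            fix k assume k: "k \<in> coupled n i"
            have blK: "bounded_linear (K i k)" by (rule coupling_repD(2)[OF rep i k])
            have "pw (\<sigma> k - 1) (x k 0) = pw (-1) (pw (\<sigma> k) (x k 0))" using pw_pw[of "-1" "\<sigma> k"] \<sigma>(1) by simp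
            then have "norm (pw (\<sigma> k - 1) (x k 0)) \<le> c\<^sub>0 powi (-1) * norm (pw (\<sigma> k) (x k 0))"
              using norm_pw_le[of "-1"] by simp
            also have "\<dots> \<le> c\<^sub>0 powi (-1) * Q" using xQ[OF cp[OF k i]] c0 by (intro mult_left_mono) auto
            finally have "onorm (K i k) * norm (pw (\<sigma> k - 1) (x k 0)) \<le> onorm (K i k) * (c\<^sub>0 powi (-1) * Q)"
              by (rule mult_left_mono) (rule onorm_pos_le[OF blK])
            then show "norm (K i k (pw (\<sigma> k - 1) (x k 0))) \<le> onorm (K i k) * (c\<^sub>0 powi (-1) * Q)"
              using onorm[OF blK, of "pw (\<sigma> k - 1) (x k 0)"] by linarith
          qed
          finally show ?thesis by (simp add: sum_distrib_right mult.assoc)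
        qed
        ultimately show "norm (snd s i 0) \<le> M i * Q" using xQ[OF i] by (simp add: M_def distrib_right)
      qed
      also have "\<dots> = D * Q\<^sup>2" by (simp add: D_def sum_distrib_right power_mult_distrib distrib_right)
      also have "\<dots> \<le> D * (c * (\<Sum>l = 0..p. L2_sq T (g l)))"
        using S unfolding Q2[symmetric] by (rule mult_left_mono) (auto simp: D_def intro: sum_nonneg)
      finally show "ip 0 s s \<le> D * c * (\<Sum>l = 0..p. L2_sq T (g l))" by (simp add: mult.assoc)
    qed
  qed
qed

text \<open>\<open>Ob\<close> observes a dual solution given by functionals, \<open>ob\<close> one
  given by coordinates. Existence for \<open>Ob\<close> supplies test solutions for the final time,
  and the implication from \<open>Ob\<close> to \<open>ob\<close> makes the abstract identity
  available. Every solution by transposition vanishes at \<open>T\<close>, not only the constructed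
  one.\<close>

lemma steers_to_zero_if_hum:
  fixes G :: "nat \<Rightarrow> 'g::{real_inner,complete_space} set"
  assumes n: "n \<ge> 2" and rep: "coupling_rep C n p \<sigma> K" and \<tau>: "\<And>i. \<tau> i = 1 - \<sigma> i"
    and h: "hum E A \<mu> c\<^sub>0 (n + p) (coupled n) K T p (\<lambda>l. G (n + l)) ob"
    and O_ex: "\<And>x z w w' l. asys T (n + p) (coupled n) K x z \<Longrightarrow>
       (\<forall>i\<in>{1..n + p}. \<forall>t\<in>{0..T}. w i t = fn (\<sigma> i) (x i t) \<and> w' i t = fn (\<sigma> i - 1) (z i t)) \<Longrightarrow> l \<le> p \<Longrightarrow>
       \<exists>g. Ob (n + l) w w' g"
    and O_ob: "\<And>x z w w' l g. asys T (n + p) (coupled n) K x z \<Longrightarrow>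
       (\<forall>i\<in>{1..n + p}. \<forall>t\<in>{0..T}. w i t = fn (\<sigma> i) (x i t) \<and> w' i t = fn (\<sigma> i - 1) (z i t)) \<Longrightarrow> l \<le> p \<Longrightarrow>
       Ob (n + l) w w' g \<Longrightarrow> ob x z l g"
    and Y0: "\<And>i. i \<in> {1..n + p} \<Longrightarrow> fst Y0 i \<in> Hs A (\<tau> i) \<and> snd Y0 i \<in> Hs A (\<tau> i - 1)"
  shows "\<exists>v. (\<forall>k\<in>{0..p}. L2 T (G (n + k)) (v (n + k))) \<and> steers_to_zero A C n p \<tau> Ob T v Y0"
proof -
  interpret hum E A \<mu> c\<^sub>0 "n + p" "coupled n" K T p "\<lambda>l. G (n + l)" ob by (rule h)
  have pair: "Hs_pair (\<tau> k - 1) (fn (\<tau> k - 1) a) (fn (\<sigma> k) b) = a \<bullet> b" "Hs_pair (\<tau> k) (fn (\<tau> k) a) (fn (\<sigma> k - 1) b) = a \<bullet> b" for k a b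
    using Hs_pair_fn[of "\<tau> k - 1" a b] Hs_pair_fn[of "\<tau> k" a b] by (simp_all add: \<tau>)
  have "\<forall>i\<in>{1..n + p}. \<exists>ab. fst Y0 i = fn (\<tau> i) (fst ab) \<and> snd Y0 i = fn (\<tau> i - 1) (snd ab)"
    using Y0 unfolding Hs_eq by fastforce
  from bchoice[OF this] obtain ab where ab: "\<And>i. i \<in> {1..n + p} \<Longrightarrow> fst Y0 i = fn (\<tau> i) (fst (ab i)) \<and> snd Y0 i = fn (\<tau> i - 1) (snd (ab i))"
    by blast
  define \<alpha> where "\<alpha> i = snd (ab i)" for i
  \<comment> \<open>The minus sign is that of the pairing of \<open>y\<close> with \<open>w'\<close>
    in the transposition identity.\<close>
  define \<beta> where "\<beta> i = - fst (ab i)" for i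
  have ds: "\<exists>x z. sol x z \<and> (\<forall>i\<in>{1..n + p}. \<forall>t\<in>{0..T}. w i t = fn (\<sigma> i) (x i t) \<and> w' i t = fn (\<sigma> i - 1) (z i t))"
    if "dual_sol A C n p (\<lambda>i. 1 - \<tau> i) T w w'" for w w'
  proof -
    have "(\<lambda>i. 1 - \<tau> i) = \<sigma>" by (rule ext) (simp add: \<tau>)
    then show ?thesis using that dual_sol_iff[OF n rep T, of w w'] by simp
  qed
  have bd: "(\<Sum>k = 1..n + p. Hs_pair (\<tau> k - 1) (snd Y0 k) (w k 0) - Hs_pair (\<tau> k) (fst Y0 k) (w' k 0)) = (\<Sum>i = 1..n + p. \<alpha> i \<bullet> x i 0 + \<beta> i \<bullet> z i 0)"
    if w: "\<forall>i\<in>{1..n + p}. \<forall>t\<in>{0..T}. w i t = fn (\<sigma> i) (x i t) \<and> w' i t = fn (\<sigma> i - 1) (z i t)" for w w' x z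
    by (rule sum.cong[OF refl]) (use w T ab in \<open>auto simp: pair \<alpha>_def \<beta>_def\<close>)
  obtain v \<eta> \<zeta> where v: "\<And>l. l \<le> p \<Longrightarrow> L2 T (G (n + l)) (v l)"
    and ct: "\<And>i. i \<in> {1..n + p} \<Longrightarrow> continuous_on {0..T} (\<eta> i) \<and> continuous_on {0..T} (\<zeta> i)"
    and id: "\<And>t x z g. t \<in> {0..T} \<Longrightarrow> sol x z \<Longrightarrow> \<forall>l\<le>p. ob x z l (g l) \<Longrightarrow>
          integral\<^sup>L (lebesgue_on {0..t}) (\<lambda>r. \<Sum>l = 0..p. v l r \<bullet> g l r) =
          (\<Sum>i = 1..n + p. \<eta> i t \<bullet> x i t + \<zeta> i t \<bullet> z i t) - (\<Sum>i = 1..n + p. \<alpha> i \<bullet> x i 0 + \<beta> i \<bullet> z i 0)"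
    and fin: "\<And>x z g. sol x z \<Longrightarrow> \<forall>l\<le>p. ob x z l (g l) \<Longrightarrow>
       integral\<^sup>L (lebesgue_on {0..T}) (\<lambda>r. \<Sum>l = 0..p. v l r \<bullet> g l r) = - (\<Sum>i = 1..n + p. \<alpha> i \<bullet> x i 0 + \<beta> i \<bullet> z i 0)"
    using hum_steering[of \<alpha> \<beta>] by blast
  \<comment> \<open>The abstract controls are numbered from 0, those of the control system from
    \<open>n\<close>.\<close>
  define V where "V m = v (m - n)" for m
  have Vl: "V (n + l) = v l" for l by (simp add: V_def)
  define y where "y i t = fn (\<tau> i) (- \<zeta> i t)" for i t
  define y' where "y' i t = fn (\<tau> i - 1) (\<eta> i t)" for i t
  have "transposition_sol A C n p \<tau> Ob T V Y0 y y'"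
    unfolding transposition_sol_def
  proof (intro conjI ballI allI impI)
    fix i assume "i \<in> {1..n + p}"
    then show "cont_Hs A (\<tau> i) T (y i)" "cont_Hs A (\<tau> i - 1) T (y' i)"
      using ct unfolding cont_Hs_iff y_def y'_def by (blast intro: continuous_on_minus)+
  next
    fix t w w' g assume t: "t \<in> {0..T}"
      and *: "dual_sol A C n p (\<lambda>i. 1 - \<tau> i) T w w' \<and> (\<forall>l\<in>{0..p}. Ob (n + l) w w' (g (n + l)))"
    obtain x z where xz: "sol x z" "\<forall>i\<in>{1..n + p}. \<forall>t\<in>{0..T}. w i t = fn (\<sigma> i) (x i t) \<and> w' i t = fn (\<sigma> i - 1) (z i t)"
      using ds * by blast
    have o: "\<forall>l\<le>p. ob x z l (g (n + l))" using O_ob[OF xz] * by auto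
    have "(\<Sum>k = 1..n + p. Hs_pair (\<tau> k - 1) (y' k t) (w k t) - Hs_pair (\<tau> k) (y k t) (w' k t)) = (\<Sum>i = 1..n + p. \<eta> i t \<bullet> x i t + \<zeta> i t \<bullet> z i t)"
      by (rule sum.cong[OF refl]) (use xz(2) t in \<open>auto simp: y_def y'_def pair\<close>)
    then show "integral\<^sup>L (lebesgue_on {0..t}) (\<lambda>s. \<Sum>l = 0..p. V (n + l) s \<bullet> g (n + l) s) =
          (\<Sum>k = 1..n + p. Hs_pair (\<tau> k - 1) (y' k t) (w k t) - Hs_pair (\<tau> k) (y k t) (w' k t)) -
          (\<Sum>k = 1..n + p. Hs_pair (\<tau> k - 1) (snd Y0 k) (w k 0) - Hs_pair (\<tau> k) (fst Y0 k) (w' k 0))"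
      using id[OF t xz(1) o] bd[OF xz(2)] by (simp add: Vl)
  qed
  moreover have "y i T = (\<lambda>_. 0) \<and> y' i T = (\<lambda>_. 0)"
    if ts: "transposition_sol A C n p \<tau> Ob T V Y0 y y'" and i: "i \<in> {1..n + p}" for y y' i
  proof -
    have TT: "T \<in> {0..T}" using T by simp
    have "\<forall>i\<in>{1..n + p}. \<exists>ab. y i T = fn (\<tau> i) (fst ab) \<and> y' i T = fn (\<tau> i - 1) (snd ab)"
    proof
      fix i assume "i \<in> {1..n + p}"
      then have "y i T \<in> Hs A (\<tau> i)" "y' i T \<in> Hs A (\<tau> i - 1)" using ts TT unfolding transposition_sol_def cont_Hs_def by blast+
      then obtain a b where "y i T = fn (\<tau> i) a" "y' i T = fn (\<tau> i - 1) b" unfolding Hs_eq by blast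
      then show "\<exists>ab. y i T = fn (\<tau> i) (fst ab) \<and> y' i T = fn (\<tau> i - 1) (snd ab)" by (intro exI[of _ "(a, b)"]) simp
    qed
    from bchoice[OF this] obtain d where d: "\<And>i. i \<in> {1..n + p} \<Longrightarrow> y i T = fn (\<tau> i) (fst (d i)) \<and> y' i T = fn (\<tau> i - 1) (snd (d i))" by blast
    \<comment> \<open>The dual solution whose final state is the coordinate of
      \<open>(y', - y)\<close> at \<open>T\<close>: the boundary terms at \<open>T\<close> become a
      sum of squares, while the choice of the control cancels all other terms.\<close>
    obtain x z where xz: "sol x z" "\<forall>i\<in>{1..n + p}. x i T = snd (d i) \<and> z i T = - fst (d i)"
      using asys_exists[OF cas TT, of "\<lambda>i. snd (d i)" "\<lambda>i. - fst (d i)"] by blast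
    define w where "w i t = fn (\<sigma> i) (x i t)" for i t
    define w' where "w' i t = fn (\<sigma> i - 1) (z i t)" for i t
    have w: "\<forall>i\<in>{1..n + p}. \<forall>t\<in>{0..T}. w i t = fn (\<sigma> i) (x i t) \<and> w' i t = fn (\<sigma> i - 1) (z i t)" by (simp add: w_def w'_def)
    have "\<forall>l. \<exists>g. l \<le> p \<longrightarrow> Ob (n + l) w w' g" using O_ex[OF xz(1) w] by blast
    then obtain g0 where g0: "\<And>l. l \<le> p \<Longrightarrow> Ob (n + l) w w' (g0 l)" by metis
    define g where "g m = g0 (m - n)" for m
    have g: "Ob (n + l) w w' (g (n + l))" if "l \<le> p" for l using g0[OF that] by (simp add: g_def)
    have "(\<lambda>i. 1 - \<tau> i) = \<sigma>" by (rule ext) (simp add: \<tau>)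
    then have "dual_sol A C n p (\<lambda>i. 1 - \<tau> i) T w w'" using dual_sol_iff[OF n rep T, of w w'] xz(1) w by auto
    then have "integral\<^sup>L (lebesgue_on {0..T}) (\<lambda>s. \<Sum>l = 0..p. V (n + l) s \<bullet> g (n + l) s) =
          (\<Sum>k = 1..n + p. Hs_pair (\<tau> k - 1) (y' k T) (w k T) - Hs_pair (\<tau> k) (y k T) (w' k T)) -
          (\<Sum>k = 1..n + p. Hs_pair (\<tau> k - 1) (snd Y0 k) (w k 0) - Hs_pair (\<tau> k) (fst Y0 k) (w' k 0))"
      using ts TT g unfolding transposition_sol_def by auto
    moreover have "\<forall>l\<le>p. ob x z l (g (n + l))" using O_ob[OF xz(1) w] g by blast
    from fin[OF xz(1) this] have "integral\<^sup>L (lebesgue_on {0..T}) (\<lambda>s. \<Sum>l = 0..p. V (n + l) s \<bullet> g (n + l) s) = - (\<Sum>i = 1..n + p. \<alpha> i \<bullet> x i 0 + \<beta> i \<bullet> z i 0)"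
      by (simp add: Vl)
    ultimately have "(\<Sum>k = 1..n + p. Hs_pair (\<tau> k - 1) (y' k T) (w k T) - Hs_pair (\<tau> k) (y k T) (w' k T)) = 0"
      using bd[OF w] by simp
    moreover have "(\<Sum>k = 1..n + p. Hs_pair (\<tau> k - 1) (y' k T) (w k T) - Hs_pair (\<tau> k) (y k T) (w' k T))
        = (\<Sum>k = 1..n + p. (norm (snd (d k)))\<^sup>2 + (norm (fst (d k)))\<^sup>2)"
      by (rule sum.cong[OF refl]) (use d xz(2) in \<open>auto simp: w_def w'_def pair power2_norm_eq_inner\<close>)
    ultimately have "(norm (snd (d i)))\<^sup>2 + (norm (fst (d i)))\<^sup>2 = 0" using i by (simp add: sum_nonneg_eq_0_iff)
    then have "d i = 0" by (simp add: prod_eq_iff add_nonneg_eq_0_iff)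
    then show ?thesis using d[OF i] by (simp add: fn_0)
  qed
  ultimately show ?thesis using v by (intro exI[of _ V]) (auto simp: steers_to_zero_def Vl)
qed

end

text \<open>For a row \<open>i \<le> n\<close> the bound \<open>n - i + 1\<close> is exactly the
  index \<open>1 - (level n i - 1)\<close> that case (i) requires; rows after \<open>n\<close>
  require the index 1.\<close>

lemma couplings_bounded:
  assumes n: "n \<ge> 2" and ch: "coupling_hyp A n C P"
    and cb: "\<And>i j k. i \<in> {n + 1..n + p} \<Longrightarrow> j \<in> {n - 1..i - 1} \<Longrightarrow> k \<in> {0, 1} \<Longrightarrow>
           bounded_on_Hk A k (blinfun_apply (C i j)) \<and> bounded_on_Hk A k (adjoint (blinfun_apply (C i j)))"
    and i: "i \<in> {1..n + p}" "k \<in> coupled n i" and m: "m \<le> (if i \<le> n then n - i + 1 else 1)"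
  shows "bounded_on_Hk A m (adjoint (blinfun_apply (C i k)))"
proof (cases "i \<le> n")
  case True
  then have "i \<in> {2..n}" "k = i - 1" "m \<in> {0..n - i + 1}" using i m by (auto simp: coupled_def split: if_splits)
  then show ?thesis using ch unfolding coupling_hyp_def by blast
next
  case False
  then have "i \<in> {n + 1..n + p}" "k \<in> {n - 1..i - 1}" "m \<in> {0, 1}" using i m n by (auto simp: coupled_def split: if_splits)
  then show ?thesis using cb by blast
qed

context eigenbasis
begin

text \<open>Row \<open>n + l\<close> is fed only by rows from \<open>n - 1\<close> on, whose levels
  are at least 0, so their functionals are vectors and \<open>vec_of\<close> recovers them.\<close>

lemma dual_observation_iff:
  fixes G :: "'g::{real_inner,complete_space} set"
  assumes n: "n \<ge> 2" and T: "T > 0" and rep: "coupling_rep C n p (level n) K" and l: "l \<le> p"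
    and BB: "\<And>x x'. x \<in> Hdom A 2 \<Longrightarrow> \<BB> (x, x') = \<BB>' (x, x')"
    and w: "\<forall>i\<in>{1..n + p}. \<forall>t\<in>{0..T}. w i t = fn (level n i) (x i t) \<and> w' i t = fn (level n i - 1) (z i t)"
  shows "dual_observation A C n G \<BB>' T (n + l) w w' g \<longleftrightarrow>
     observation A G \<BB> T (\<lambda>t. - (\<Sum>k\<in>coupled n (n + l). K (n + l) k (x k t))) (\<lambda>t. pw (-1) (x (n + l) t)) (z (n + l)) g"
proof -
  let ?f = "\<lambda>t. - (\<Sum>k\<in>coupled n (n + l). K (n + l) k (x k t))"
  let ?h = "\<lambda>t. - (\<Sum>k\<in>coupled n (n + l). blinfun_apply (C (n + l) k) (vec_of (w k t)))"
  have i: "n + l \<in> {1..n + p}" using n l by auto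
  have f: "?f t = ?h t" if t: "t \<in> {0..T}" for t
  proof (intro arg_cong[where f = uminus] sum.cong refl)
    fix k assume k: "k \<in> coupled n (n + l)"
    then have "k \<in> {1..n + p}" using coupled_subset[OF n, of "n + l"] l by force
    then have wk: "w k t = fn (level n k) (x k t)" using w t by blast
    have "0 \<le> level n k" using k n by (auto simp: level_def coupled_def split: if_splits)
    then show "K (n + l) k (x k t) = blinfun_apply (C (n + l) k) (vec_of (w k t))"
      using couples_one coupling_repD(1)[OF rep i k] unfolding wk level_eq_1 by blast
  qed
  have z0: "0 \<in> {0..T}" using T by simp
  have v: "vec_of (w (n + l) 0) = pw (-1) (x (n + l) 0)" "vec_of (w' (n + l) 0) = z (n + l) 0"
    using w i z0 by (simp_all add: level_eq_1 vec_of_fn pw_0)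
  have H2: "x \<in> Hdom A 2" if "pivot x \<in> Hs A 2" for x using pivot_Hs[of x 2] that by simp
  show ?thesis unfolding dual_observation_def
  proof
    assume o: "observation A G \<BB>' T ?h (\<lambda>t. vec_of (w (n + l) t)) (\<lambda>t. vec_of (w' (n + l) t)) g"
    show "observation A G \<BB> T ?f (\<lambda>t. pw (-1) (x (n + l) t)) (z (n + l)) g"
      by (rule observation_cong_op[OF observation_cong[OF o] _ H2]) (simp_all only: f v BB)
  next
    assume o: "observation A G \<BB> T ?f (\<lambda>t. pw (-1) (x (n + l) t)) (z (n + l)) g"
    show "observation A G \<BB>' T ?h (\<lambda>t. vec_of (w (n + l) t)) (\<lambda>t. vec_of (w' (n + l) t)) g"
      by (rule observation_cong_op[OF observation_cong[OF o] _ H2]) (simp_all only: f v BB)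
  qed
qed

end

theorem theorem3p5:
  fixes A :: "'h::{real_inner,complete_space} \<rightharpoonup> 'h"
    and C :: "nat \<Rightarrow> nat \<Rightarrow> 'h \<Rightarrow>\<^sub>L 'h"
    and P :: "nat \<Rightarrow> 'h \<Rightarrow>\<^sub>L 'h"
    and G :: "nat \<Rightarrow> 'g::{real_inner,complete_space} set"
    and \<BB> :: "nat \<Rightarrow> 'h \<times> 'h \<Rightarrow> 'g"
    and n p :: nat
    and Ts :: real
  assumes "n \<ge> 2" and "p \<ge> 1"
    and "abstract_setting A"
    and "coupling_hyp A n C P"
    and "coupling_observability_hyp A n P"
    and "\<And>i j k. i \<in> {n + 1..n + p} \<Longrightarrow> j \<in> {n - 1..i - 1} \<Longrightarrow> k \<in> {0, 1} \<Longrightarrow>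
           bounded_on_Hk A k (blinfun_apply (C i j)) \<and>
           bounded_on_Hk A k (adjoint (blinfun_apply (C i j)))"
    and "\<And>j. j \<in> {0..p} \<Longrightarrow> admissibility_hyp A (G (n + j)) (\<BB> (n + j))"
    and "\<And>j. j \<in> {0..p} \<Longrightarrow> observability_hyp A (G (n + j)) (\<BB> (n + j))"
    and "observability_time A C n p G \<BB> Ts"
  shows
    "(\<forall>B :: nat \<Rightarrow> 'g \<Rightarrow> 'h.
        (\<forall>k\<in>{0..p}. bounded_control_op (G (n + k)) (B (n + k)) \<and>
           (\<forall>w\<in>Hdom A 2. \<forall>w'. \<BB> (n + k) (w, w') = bounded_control_adj (G (n + k)) (B (n + k)) w')) \<longrightarrow>
        (\<forall>T>Ts. \<forall>Y0 \<in> state_space A (n + p)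
             (\<lambda>i. if i \<le> n then int n - int i + 1 else 1) (\<lambda>i. if i \<le> n then int n - int i else 0).
          \<exists>v. (\<forall>k\<in>{0..p}. L2 T (G (n + k)) (v (n + k))) \<and>
            steers_to_zero A C n p (\<lambda>i. if i \<le> n then int n - int i + 1 else 1)
              (\<lambda>m w w' g. g = (\<lambda>t. bounded_control_adj (G m) (B m) (vec_of (w m t)))) T v Y0)) \<and>
     (\<forall>B :: nat \<Rightarrow> 'g \<Rightarrow> 'h \<Rightarrow> real.
        (\<forall>k\<in>{0..p}. unbounded_control_op A (G (n + k)) (B (n + k)) \<and>
           (\<forall>w\<in>Hdom A 2. \<forall>w'. \<BB> (n + k) (w, w') = unbounded_control_adj (G (n + k)) (B (n + k)) w)) \<longrightarrow>
        (\<forall>T>Ts. \<forall>Y0 \<in> state_space A (n + p)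
             (\<lambda>i. if i \<le> n then int n - int i else 0) (\<lambda>i. if i \<le> n then int n - int i - 1 else - 1).
          \<exists>v. (\<forall>k\<in>{0..p}. L2 T (G (n + k)) (v (n + k))) \<and>
            steers_to_zero A C n p (\<lambda>i. if i \<le> n then int n - int i else 0)
              (\<lambda>m w w' g. dual_observation A C n (G m)
                 (\<lambda>(x, x'). unbounded_control_adj (G m) (B m) x) T m w w' g) T v Y0))"
proof -
  note n = assms(1) and ot = assms(9)
  have adm: "admissibility_hyp A (G (n + l)) (\<BB> (n + l))" if "l \<le> p" for l using assms(7) that by simp
  obtain E \<mu> c where "eigenbasis E A \<mu> c" using abstract_setting_eigenbasis[OF assms(3)] by blast
  then interpret eigenbasis E A \<mu> c .
  have bd: "bounded_on_Hk A m (adjoint (blinfun_apply (C i k)))"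
    if "i \<in> {1..n + p}" "k \<in> coupled n i" "m \<le> (if i \<le> n then n - i + 1 else 1)" for i k m
    by (rule couplings_bounded[OF n assms(4,6) that])
  \<comment> \<open>A solution at level \<open>s\<close> is forced in \<open>H_{s-1}\<close>, so a
    row may lie one level above the rows feeding it; consecutive rows up to \<open>n\<close> use
    this fully.\<close>
  have le: "level n i \<le> level n k + 1" if "k \<in> coupled n i" for i k
    using that n by (auto simp: level_def coupled_def split: if_splits)
  have m: "nat (1 - level n i) \<le> (if i \<le> n then n - i + 1 else 1)"
    "nat (1 - (level n i - 1)) \<le> (if i \<le> n then n - i + 1 else 1)" for i
    by (auto simp: level_def)
  \<comment> \<open>Three representations of the same couplings: at level 1, where observability is
    known, at \<open>level n\<close> for case (ii), and one level lower for case (i).\<close>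
  have "\<exists>K. coupling_rep C n p (\<lambda>_. 1) K" by (rule coupling_rep_exists) (simp add: bd)
  then obtain K1 where K1: "coupling_rep C n p (\<lambda>_. 1) K1" ..
  have "\<exists>K. coupling_rep C n p (level n) K"
    by (rule coupling_rep_exists) (simp add: level_le le bd m)
  then obtain K where K: "coupling_rep C n p (level n) K" ..
  have "\<exists>K. coupling_rep C n p (\<lambda>i. level n i - 1) K"
  proof (rule coupling_rep_exists, intro conjI)
    fix i k assume ik: "i \<in> {1..n + p}" "k \<in> coupled n i"
    show "level n i - 1 \<le> 1" "level n i - 1 \<le> level n k - 1 + 1" using level_le[of n i] le[OF ik(2)] by auto
    show "bounded_on_Hk A (nat (1 - (level n i - 1))) (adjoint (blinfun_apply (C i k)))" by (rule bd[OF ik m(2)])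
  qed
  then obtain K' where K': "coupling_rep C n p (\<lambda>i. level n i - 1) K'" ..
  show ?thesis
  proof (intro conjI allI impI ballI)
    fix B :: "nat \<Rightarrow> 'g \<Rightarrow> 'h" and T Y0
    assume B: "\<forall>k\<in>{0..p}. bounded_control_op (G (n + k)) (B (n + k)) \<and>
           (\<forall>w\<in>Hdom A 2. \<forall>w'. \<BB> (n + k) (w, w') = bounded_control_adj (G (n + k)) (B (n + k)) w')"
      and T: "T > Ts" and Y0: "Y0 \<in> state_space A (n + p)
             (\<lambda>i. if i \<le> n then int n - int i + 1 else 1) (\<lambda>i. if i \<le> n then int n - int i else 0)"
    let ?L = "\<lambda>l. bounded_control_adj (G (n + l)) (B (n + l))"
    have h: "hum E A \<mu> c (n + p) (coupled n) K' T p (\<lambda>l. G (n + l)) (\<lambda>x z l g. \<forall>t\<in>{0..T}. g t = ?L l (x (n + l) t))"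
      by (rule hum_velocity_observation[OF n ot T adm _ K1 K']) (use B in auto)
    show "\<exists>v. (\<forall>k\<in>{0..p}. L2 T (G (n + k)) (v (n + k))) \<and>
            steers_to_zero A C n p (\<lambda>i. if i \<le> n then int n - int i + 1 else 1)
              (\<lambda>m w w' g. g = (\<lambda>t. bounded_control_adj (G m) (B m) (vec_of (w m t)))) T v Y0"
    proof (rule steers_to_zero_if_hum[OF n K' _ h])
      fix x z w w' l g
      assume w: "\<forall>i\<in>{1..n + p}. \<forall>t\<in>{0..T}. w i t = fn (level n i - 1) (x i t) \<and> w' i t = fn (level n i - 1 - 1) (z i t)"
        and l: "l \<le> p" and g: "g = (\<lambda>t. ?L l (vec_of (w (n + l) t)))"
      have "n + l \<in> {1..n + p}" using n l by auto
      \<comment> \<open>In case (i) the observed rows have level 0, so the vector is its own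
        coordinate.\<close>
      then have "vec_of (w (n + l) t) = x (n + l) t" if "t \<in> {0..T}" for t
        using w that by (simp add: level_eq_1 vec_of_fn pw_0)
      then show "\<forall>t\<in>{0..T}. g t = ?L l (x (n + l) t)" by (simp add: g)
    qed (use Y0 in \<open>auto simp: level_def state_space_def split: if_splits\<close>)
  next
    fix B :: "nat \<Rightarrow> 'g \<Rightarrow> 'h \<Rightarrow> real" and T Y0
    assume B: "\<forall>k\<in>{0..p}. unbounded_control_op A (G (n + k)) (B (n + k)) \<and>
           (\<forall>w\<in>Hdom A 2. \<forall>w'. \<BB> (n + k) (w, w') = unbounded_control_adj (G (n + k)) (B (n + k)) w)"
      and T: "T > Ts" and Y0: "Y0 \<in> state_space A (n + p)
             (\<lambda>i. if i \<le> n then int n - int i else 0) (\<lambda>i. if i \<le> n then int n - int i - 1 else - 1)"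
    have T0: "T > 0" using ot T by (simp add: observability_time_def)
    let ?L = "\<lambda>l (x, x'). unbounded_control_adj (G (n + l)) (B (n + l)) x"
    have h: "hum E A \<mu> c (n + p) (coupled n) K T p (\<lambda>l. G (n + l)) (\<lambda>x z l. observation A (G (n + l)) (\<BB> (n + l)) T
        (\<lambda>t. - (\<Sum>k\<in>coupled n (n + l). K (n + l) k (x k t))) (\<lambda>t. pw (-1) (x (n + l) t)) (z (n + l)))"
      by (rule hum_position_observation[OF n ot T adm K1 K])
    show "\<exists>v. (\<forall>k\<in>{0..p}. L2 T (G (n + k)) (v (n + k))) \<and>
            steers_to_zero A C n p (\<lambda>i. if i \<le> n then int n - int i else 0)
              (\<lambda>m w w' g. dual_observation A C n (G m)
                 (\<lambda>(x, x'). unbounded_control_adj (G m) (B m) x) T m w w' g) T v Y0"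
    proof (rule steers_to_zero_if_hum[OF n K _ h])
      fix x z w w' l g
      assume a: "asys T (n + p) (coupled n) K x z"
        and w: "\<forall>i\<in>{1..n + p}. \<forall>t\<in>{0..T}. w i t = fn (level n i) (x i t) \<and> w' i t = fn (level n i - 1) (z i t)"
        and l: "l \<le> p"
      \<comment> \<open>The given observation operator and the adjoint of the control operator agree
        on the domain of \<open>A\<close>, hence define the same observations; in coordinates the
        observed vector is \<open>A^{-1/2} x\<close>.\<close>
      have oi: "dual_observation A C n (G (n + l)) (?L l) T (n + l) w w' g \<longleftrightarrow> observation A (G (n + l)) (\<BB> (n + l)) T
          (\<lambda>t. - (\<Sum>k\<in>coupled n (n + l). K (n + l) k (x k t))) (\<lambda>t. pw (-1) (x (n + l) t)) (z (n + l)) g" for g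
        by (rule dual_observation_iff[OF n T0 K l _ w]) (use B l in simp)
      have "asol T (\<lambda>t. - (\<Sum>k\<in>coupled n (n + l). K (n + l) k (x k t))) (x (n + l)) (z (n + l))"
        using a n l by (auto simp: asys_def)
      from observation_exists[OF adm[OF l] this T0]
      show "\<exists>g. dual_observation A C n (G (n + l)) (?L l) T (n + l) w w' g"
        using oi by blast
      assume "dual_observation A C n (G (n + l)) (?L l) T (n + l) w w' g"
      then show "observation A (G (n + l)) (\<BB> (n + l)) T
        (\<lambda>t. - (\<Sum>k\<in>coupled n (n + l). K (n + l) k (x k t))) (\<lambda>t. pw (-1) (x (n + l) t)) (z (n + l)) g"
        using oi by blast
    qed (use Y0 in \<open>auto simp: level_def state_space_def split: if_splits\<close>)
  qed
qed

end
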